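(* Almost surely, $$\liminf_{t\to\infty}\frac{\beta_t}{t\log\log\log t}=-\frac1{2\pi},$$ where $\beta_t$ is the renormalized self-intersection local time of planar Brownian motion started at $0$.
   Context: $X_t$ is a planar standard Brownian motion started at $0$. Let $\varphi$ be a smooth nonnegative Schwartz function on $\mathbb{R}^2$ with $\int\varphi=1$, $\varphi_\varepsilon(x)=\varepsilon^{-2}\varphi(x/\varepsilon)$, and $$\beta_t=\lim_{\varepsilon\to0}\Big[\int_0^t\int_0^s\varphi_\varepsilon(X_s-X_u)\,du\,ds-\mathbb{E}\int_0^t\int_0^s\varphi_\varepsilon(X_s-X_u)\,du\,ds\Big]$$ (the limit exists a.s. and is continuous in $t$). *)

theory Defs
  imports "HOL-Probability.Probability"
begin

type_synonym R2 = "real \<times> real"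

definition dirderiv :: "R2 \<Rightarrow> (R2 \<Rightarrow> real) \<Rightarrow> R2 \<Rightarrow> real" where
  "dirderiv v f x = frechet_derivative f (at x) v"

fun iter_dd :: "R2 list \<Rightarrow> (R2 \<Rightarrow> real) \<Rightarrow> R2 \<Rightarrow> real" where
  "iter_dd [] f = f"
| "iter_dd (v # vs) f = dirderiv v (iter_dd vs f)"

definition smooth_R2 :: "(R2 \<Rightarrow> real) \<Rightarrow> bool" where
  "smooth_R2 f \<longleftrightarrow> (\<forall>vs x. iter_dd vs f differentiable (at x))"

definition schwartz_R2 :: "(R2 \<Rightarrow> real) \<Rightarrow> bool" where
  "schwartz_R2 f \<longleftrightarrow> smooth_R2 f \<and>
     (\<forall>vs (k::nat). \<exists>C. \<forall>x. (1 + norm x) ^ k * \<bar>iter_dd vs f x\<bar> \<le> C)"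

definition gauss2 :: "real \<Rightarrow> R2 \<Rightarrow> real" where
  "gauss2 r x = exp (- (fst x ^ 2 + snd x ^ 2) / (2 * r)) / (2 * pi * r)"

definition planar_BM :: "'a measure \<Rightarrow> (real \<Rightarrow> 'a \<Rightarrow> R2) \<Rightarrow> bool" where
  "planar_BM M X \<longleftrightarrow> prob_space M \<and>
     (\<forall>t\<ge>0. X t \<in> borel_measurable M) \<and>
     (\<forall>\<omega>\<in>space M. X 0 \<omega> = 0 \<and> continuous_on {0..} (\<lambda>t. X t \<omega>)) \<and>
     (\<forall>ts::real list. sorted_wrt (<) ts \<and> (\<forall>t\<in>set ts. 0 \<le> t) \<longrightarrow>
        prob_space.indep_vars M (\<lambda>_. borel) (\<lambda>i \<omega>. X (ts ! Suc i) \<omega> - X (ts ! i) \<omega>)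
          {..<length ts - 1}) \<and>
     (\<forall>s t. 0 \<le> s \<and> s < t \<longrightarrow>
        distributed M lborel (\<lambda>\<omega>. X t \<omega> - X s \<omega>) (\<lambda>x. ennreal (gauss2 (t - s) x)))"

definition phi_eps :: "(R2 \<Rightarrow> real) \<Rightarrow> real \<Rightarrow> R2 \<Rightarrow> real" where
  "phi_eps \<phi> \<epsilon> x = \<phi> ((1 / \<epsilon>) *\<^sub>R x) / \<epsilon> ^ 2"

definition sil_eps :: "(real \<Rightarrow> 'a \<Rightarrow> R2) \<Rightarrow> (R2 \<Rightarrow> real) \<Rightarrow> real \<Rightarrow> real \<Rightarrow> 'a \<Rightarrow> real" where
  "sil_eps X \<phi> \<epsilon> t \<omega> =
     integral\<^sup>L lborel (\<lambda>s. indicator {0..t} s *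
        integral\<^sup>L lborel (\<lambda>u. indicator {0..s} u * phi_eps \<phi> \<epsilon> (X s \<omega> - X u \<omega>)))"

definition beta :: "'a measure \<Rightarrow> (real \<Rightarrow> 'a \<Rightarrow> R2) \<Rightarrow> (R2 \<Rightarrow> real) \<Rightarrow> real \<Rightarrow> 'a \<Rightarrow> real" where
  "beta M X \<phi> t \<omega> =
     Lim (at_right 0) (\<lambda>\<epsilon>. sil_eps X \<phi> \<epsilon> t \<omega> - integral\<^sup>L M (sil_eps X \<phi> \<epsilon> t))"

end

theory Submission
  imports Defs "HOL-Real_Asymp.Real_Asymp"
begin

text \<open>
  By Brownian scaling and the second moment of the self-intersection local time \<open>\<beta>\<close> at time \<open>1\<close>, everything
  reduces to the lower tail \<open>P (\<beta>\<^sub>1 \<le> - ln n / (2 pi) + O(1))\<close>, which lies between \<open>exp (- O(n))\<close> and \<open>exp (- n)\<close>;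
  with \<open>n\<close> of order \<open>ln (ln t)\<close> the two Borel-Cantelli lemmas give the constant \<open>1 / (2 pi)\<close>, and constant factors in front
  of \<open>n\<close> are invisible after the third logarithm.

  For the upper bound on the tail, cut \<open>[0, 1]\<close> into \<open>n\<close> blocks.  The interactions between the blocks are nonnegative,
  and dropping them costs their mean, \<open>ln n / (2 pi) + O(1)\<close>; what remains is an average of \<open>n\<close> independent copies
  of \<open>\<beta>\<^sub>1\<close>.  For the lower bound, a drift of size \<open>sqrt n\<close> separates the blocks, lowering the mean by
  \<open>ln n / (2 pi)\<close>, and fourth moments of the density control the change of measure.

  The existence of \<open>\<beta>\<close> and all moment bounds come from one variance estimate for double integrals of a kernel along
  the path, obtained by recursive halving of the time interval, together with chaining in time.\<close>

section \<open>The planar Gaussian kernel\<close>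

text \<open>Cutting into \<open>n\<close> blocks and rescaling turns the mollification
  \<open>\<epsilon>\<close> into \<open>\<epsilon> * sqrt n\<close>, so every moment bound must hold
  for all \<open>\<epsilon> > 0\<close> with constants that depend on \<open>\<phi>\<close> alone.
  Moreover the limit must exist for all \<open>t\<close> outside one null set, although the suprema
  over \<open>t\<close> and \<open>\<epsilon>\<close> are uncountable. Both demands are met through
  differences of two mollifiers: their integral is zero, so the Gaussian density may be replaced by
  its increment, and a Hoelder bound of order \<open>1/2\<close> gives a factor
  \<open>sqrt \<epsilon>\<close> per octave while the time singularities stay integrable. The
  variance exponent \<open>11/8\<close> exceeds \<open>1\<close>; the halving recursion and the
  dyadic chaining both live on this excess. The tail \<open>exp (- n)\<close> is bootstrapped:
  Chebyshev's inequality for \<open>n\<close> uncorrelated blocks already gives a tail like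
  \<open>exp (- 2 * pi * x)\<close>, hence a first exponential moment, and only then does the
  product over the blocks apply. The drift \<open>sqrt n\<close> displaces the path over a lag
  \<open>1 / n\<close> by as much as its fluctuation, which is why the lags in
  \<open>[1 / n, 1]\<close> are the ones suppressed.\<close>

lemma norm_R2_sq: "(norm (x::R2))\<^sup>2 = (fst x)\<^sup>2 + (snd x)\<^sup>2"
  by (simp add: norm_prod_def)

lemma gauss2_norm: "gauss2 r x = exp (- (norm x)\<^sup>2 / (2 * r)) / (2 * pi * r)"
  by (simp add: gauss2_def norm_R2_sq)

lemma gauss2_nonneg: "r > 0 \<Longrightarrow> 0 \<le> gauss2 r x"
  by (simp add: gauss2_def)

lemma gauss2_le: "r > 0 \<Longrightarrow> gauss2 r x \<le> 1 / (2 * pi * r)"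
  unfolding gauss2_norm by (intro divide_right_mono) auto

lemma gauss2_uminus: "gauss2 r (- x) = gauss2 r x"
  by (simp add: gauss2_norm)

lemma gauss2_minus_commute: "gauss2 r (x - y) = gauss2 r (y - x)"
  by (simp add: gauss2_norm norm_minus_commute)

lemma continuous_gauss2[continuous_intros]:
  "continuous_on A f \<Longrightarrow> continuous_on A (\<lambda>x. gauss2 r (f x))"
  unfolding gauss2_norm divide_inverse by (intro continuous_intros) auto

lemma borel_measurable_gauss2[measurable (raw)]:
  assumes [measurable]: "r \<in> borel_measurable M" "f \<in> borel_measurable M"
  shows "(\<lambda>x. gauss2 (r x) (f x)) \<in> borel_measurable M"
  unfolding gauss2_norm by measurable

lemma gauss2_normal:
  assumes "r > 0"
  shows "gauss2 r (x, y) = normal_density 0 (sqrt r) x * normal_density 0 (sqrt r) y"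
proof -
  have "sqrt (2 * pi * r) * sqrt (2 * pi * r) = 2 * pi * r"
    using assms by (simp add: real_sqrt_mult[symmetric])
  then show ?thesis
    using assms by (simp add: gauss2_def normal_density_def exp_add[symmetric] add_divide_distrib
        minus_add_distrib diff_divide_distrib)
qed

lemma nn_integral_gauss2:
  assumes "r > 0"
  shows "(\<integral>\<^sup>+x. ennreal (gauss2 r x) \<partial>lborel) = 1"
proof -
  interpret pn: prob_space "density lborel (normal_density 0 (sqrt r))"
    by (rule prob_space_normal_density) (use assms in simp)
  have n: "(\<integral>\<^sup>+x. ennreal (normal_density 0 (sqrt r) x) \<partial>lborel) = 1"
    using pn.emeasure_space_1 by (subst (asm) emeasure_density) auto
  have "(\<integral>\<^sup>+x. ennreal (gauss2 r x) \<partial>lborel)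
     = (\<integral>\<^sup>+x. ennreal (gauss2 r x) \<partial>(lborel \<Otimes>\<^sub>M lborel))"
    by (simp add: lborel_prod)
  also have "\<dots> = (\<integral>\<^sup>+x. \<integral>\<^sup>+y. ennreal (gauss2 r (x, y)) \<partial>lborel \<partial>lborel)"
    by (subst lborel.nn_integral_fst[symmetric]) (auto simp: lborel_prod)
  also have "\<dots> = (\<integral>\<^sup>+x. ennreal (normal_density 0 (sqrt r) x) *
      (\<integral>\<^sup>+y. ennreal (normal_density 0 (sqrt r) y) \<partial>lborel) \<partial>lborel)"
    using assms by (simp add: gauss2_normal ennreal_mult nn_integral_cmult)
  also have "\<dots> = 1" by (simp add: n)
  finally show ?thesis .
qed

lemma integrable_gauss2: "r > 0 \<Longrightarrow> integrable lborel (gauss2 r)"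
  by (rule integrableI_nonneg) (auto simp: gauss2_nonneg nn_integral_gauss2)

lemma integral_gauss2: "r > 0 \<Longrightarrow> (\<integral>x. gauss2 r x \<partial>lborel) = 1"
  by (subst integral_eq_nn_integral) (auto simp: gauss2_nonneg nn_integral_gauss2)

lemma lborel_integral_shift:
  fixes f :: "R2 \<Rightarrow> real"
  assumes [measurable]: "f \<in> borel_measurable borel"
  shows "(\<integral>x. f (x + t) \<partial>lborel) = (\<integral>x. f x \<partial>lborel)"
proof -
  have "(\<integral>x. f x \<partial>lborel) = (\<integral>x. f x \<partial>distr lborel borel ((+) t))"
    by (simp add: lborel_distr_plus)
  also have "\<dots> = (\<integral>x. f (t + x) \<partial>lborel)"
    by (rule integral_distr) auto
  finally show ?thesis by (simp add: add.commute)
qed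

lemma lborel_nn_integral_shift:
  fixes f :: "R2 \<Rightarrow> ennreal"
  assumes [measurable]: "f \<in> borel_measurable borel"
  shows "(\<integral>\<^sup>+x. f (x + t) \<partial>lborel) = (\<integral>\<^sup>+x. f x \<partial>lborel)"
proof -
  have "(\<integral>\<^sup>+x. f x \<partial>lborel) = (\<integral>\<^sup>+x. f x \<partial>distr lborel borel ((+) t))"
    by (simp add: lborel_distr_plus)
  also have "\<dots> = (\<integral>\<^sup>+x. f (t + x) \<partial>lborel)"
    by (subst nn_integral_distr) auto
  finally show ?thesis by (simp add: add.commute)
qed

section \<open>Space regularity of the Gaussian density\<close>

lemma exp_diff_bound: "\<bar>exp (- a) - exp (- b)\<bar> \<le> \<bar>a - b\<bar> * max (exp (-a)) (exp (-b))" for a b :: real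
proof (induction a b rule: linorder_wlog)
  case (le a b)
  have "1 + (a - b) \<le> exp (a - b)" by (rule exp_ge_add_one_self)
  then have "(1 - exp (a - b)) * exp (- a) \<le> (b - a) * exp (-a)"
    by (intro mult_right_mono) (linarith, simp)
  moreover have "exp (a - b) * exp (- a) = exp (-b)" by (simp add: exp_add[symmetric])
  ultimately have "exp (-a) - exp (-b) \<le> (b - a) * exp (-a)" by (simp add: algebra_simps)
  then show ?case using le by (simp add: max_def)
next
  case (sym a b)
  then show ?case by (simp add: abs_minus_commute max.commute)
qed

text \<open>Absorbs the linear factor of the gradient at the price of half the Gaussian exponent;
  this is why the majorant below contains a Gaussian of variance \<open>4 * a\<close>.\<close>

lemma half_plus_le_exp: "(1/2 + v) * exp (- (v\<^sup>2 / 4)) \<le> 4 * exp (- (v\<^sup>2 / 8))" if "0 \<le> v" for v :: real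
proof -
  have "1/2 + v \<le> 4 * (1 + v\<^sup>2 / 8)"
    using zero_le_power2[of "v - 1"] by (simp add: power2_eq_square algebra_simps)
  also have "\<dots> \<le> 4 * exp (v\<^sup>2 / 8)" by (intro mult_left_mono exp_ge_add_one_self) auto
  finally have "(1/2 + v) * exp (- (v\<^sup>2 / 4)) \<le> 4 * exp (v\<^sup>2 / 8) * exp (- (v\<^sup>2 / 4))"
    by (intro mult_right_mono) auto
  also have "\<dots> = 4 * exp (- (v\<^sup>2 / 8))" by (simp add: exp_add[symmetric])
  finally show ?thesis .
qed

text \<open>A common majorant for the increments of \<open>gauss2 a\<close> under a shift by
  \<open>x\<close>: the wide Gaussian controls short shifts, the two narrow ones control shifts
  longer than \<open>sqrt a\<close>. Its total mass is \<open>34 = 32 + 1 + 1\<close>, its supremum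
  at most \<open>10 / (2 * pi * a)\<close> with \<open>10 = 32/4 + 1 + 1\<close>.\<close>

definition gbump :: "real \<Rightarrow> R2 \<Rightarrow> R2 \<Rightarrow> real" where
  "gbump a x z = 32 * gauss2 (4 * a) z + gauss2 a z + gauss2 a (x - z)"

lemma gauss2_lipschitz_small:
  assumes "a > 0" "norm x \<le> sqrt a"
  shows "\<bar>gauss2 a (x - z) - gauss2 a z\<bar> \<le> norm x / sqrt a * (32 * gauss2 (4 * a) z)"
proof -
  define u where "u = norm x / sqrt a"
  define v where "v = norm z / sqrt a"
  have sa: "sqrt a > 0" "(sqrt a)\<^sup>2 = a" using assms by auto
  have u: "0 \<le> u" "u \<le> 1" and v: "0 \<le> v" using assms sa by (auto simp: u_def v_def)
  define A where "A = (norm (x - z))\<^sup>2 / (2 * a)"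
  define B where "B = (norm z)\<^sup>2 / (2 * a)"
  have nx: "norm x = u * sqrt a" "norm z = v * sqrt a" using sa by (auto simp: u_def v_def)
  have B: "B = v\<^sup>2 / 2" using assms by (simp add: B_def nx power_mult_distrib)
  have t1: "norm (x - z) \<le> norm x + norm z" by (rule norm_triangle_ineq4)
  have t2: "norm z \<le> norm x + norm (x - z)"
    using norm_triangle_ineq2[of z x] by (simp add: norm_minus_commute)
  define w where "w = norm (x - z) / sqrt a"
  have nw: "norm (x - z) = w * sqrt a" "0 \<le> w" using sa by (auto simp: w_def)
  have A: "A = w\<^sup>2 / 2" using assms by (simp add: A_def nw power_mult_distrib)
  have w1: "w \<le> u + v" and w2: "v \<le> u + w"
    using t1 t2 sa(1) unfolding nx nw(1) by (simp_all add: distrib_right[symmetric])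
  \<comment> \<open>The exponents differ by \<open>(w - v) * (w + v) / 2\<close>; the triangle
    inequality bounds the first factor by \<open>u\<close> and the second by
    \<open>u + 2 * v\<close>.\<close>
  have AB: "\<bar>A - B\<bar> \<le> u * (1/2 + v)"
  proof -
    have "A - B = (w - v) * (w + v) / 2"
      unfolding A B by (simp add: power2_eq_square algebra_simps diff_divide_distrib[symmetric])
    then have "\<bar>A - B\<bar> = \<bar>(w - v) * (w + v) / 2\<bar>" by (rule arg_cong)
    also have "\<dots> = \<bar>w - v\<bar> * (w + v) / 2" using v nw(2) by (simp add: abs_mult)
    finally have e: "\<bar>A - B\<bar> = \<bar>w - v\<bar> * (w + v) / 2" .
    have "\<bar>w - v\<bar> * (w + v) \<le> u * (u + 2 * v)"
      using w1 w2 u v nw(2) by (intro mult_mono) auto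
    also have "\<dots> \<le> u * (1 + 2 * v)" using u by (intro mult_left_mono) auto
    finally show ?thesis unfolding e by (simp add: algebra_simps)
  qed
  \<comment> \<open>Both exponents are at least \<open>v\<^sup>2 / 4 - 1/2\<close>, since a move by
    \<open>u \<le> 1\<close> can at most halve \<open>v\<^sup>2\<close> up to a constant.\<close>
  have mx: "max (exp (-A)) (exp (-B)) \<le> exp (1/2) * exp (- (v\<^sup>2 / 4))"
  proof -
    have "v\<^sup>2 \<le> (u + w)\<^sup>2" using w2 v by (intro power_mono) auto
    also have "\<dots> \<le> 2 * u\<^sup>2 + 2 * w\<^sup>2"
      using zero_le_power2[of "u - w"] by (simp add: power2_eq_square algebra_simps)
    also have "\<dots> \<le> 2 + 2 * w\<^sup>2" using u by (simp add: power_le_one)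
    finally have "v\<^sup>2 / 4 - 1/2 \<le> A" unfolding A by simp
    then have "exp (-A) \<le> exp (1/2 - v\<^sup>2/4)" by simp
    moreover have "exp (-B) \<le> exp (1/2 - v\<^sup>2/4)"
      unfolding B using zero_le_power2[of v] by (subst exp_le_cancel_iff) linarith
    moreover have "exp (1/2) * exp (- (v\<^sup>2 / 4)) = exp (1/2 - v\<^sup>2/4)"
      by (simp add: exp_add[symmetric])
    ultimately show ?thesis by simp
  qed
  have e2: "exp (1/2::real) \<le> 2"
  proof -
    have "exp (1/2::real) * exp (1/2) \<le> 3" using exp_le by (simp add: exp_add[symmetric])
    then have "(exp (1/2::real))\<^sup>2 \<le> 2\<^sup>2" by (simp add: power2_eq_square)
    then show ?thesis by (rule power2_le_imp_le) simp
  qed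
  have "\<bar>exp (-A) - exp (-B)\<bar> \<le> u * (1/2 + v) * (exp (1/2) * exp (- (v\<^sup>2 / 4)))"
    using u v by (intro order_trans[OF exp_diff_bound] mult_mono AB mx) (auto simp: max_def)
  also have "\<dots> = u * exp (1/2) * ((1/2 + v) * exp (- (v\<^sup>2 / 4)))" by simp
  also have "\<dots> \<le> u * 2 * (4 * exp (- (v\<^sup>2 / 8)))"
    by (rule mult_mono[OF mult_left_mono half_plus_le_exp[OF v]]) (use e2 u v in auto)
  finally have main: "\<bar>exp (-A) - exp (-B)\<bar> \<le> u * (8 * exp (- (v\<^sup>2 / 8)))" by simp
  have g4: "32 * gauss2 (4 * a) z = 8 * exp (- (v\<^sup>2 / 8)) / (2 * pi * a)"
    using assms by (simp add: gauss2_norm nx power_mult_distrib field_simps)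
  have "\<bar>gauss2 a (x - z) - gauss2 a z\<bar> = \<bar>exp (-A) - exp (-B)\<bar> / (2 * pi * a)"
    using assms by (simp add: gauss2_norm A_def B_def diff_divide_distrib[symmetric] abs_divide)
  also have "\<dots> \<le> u * (8 * exp (- (v\<^sup>2 / 8))) / (2 * pi * a)"
    using main assms by (intro divide_right_mono) auto
  finally show ?thesis unfolding g4 u_def times_divide_eq_right .
qed

lemma gauss2_lipschitz:
  assumes "a > 0"
  shows "\<bar>gauss2 a (x - z) - gauss2 a z\<bar> \<le> norm x / sqrt a * gbump a x z"
proof (cases "norm x \<le> sqrt a")
  case True
  have "norm x / sqrt a * (32 * gauss2 (4 * a) z) \<le> norm x / sqrt a * gbump a x z"
    using assms unfolding gbump_def by (intro mult_left_mono) (auto simp: gauss2_nonneg)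
  with gauss2_lipschitz_small[OF assms True, of z] show ?thesis by linarith
next
  case False
  have "\<bar>gauss2 a (x - z) - gauss2 a z\<bar> \<le> 1 * gbump a x z"
    using gauss2_nonneg[OF assms, of z] gauss2_nonneg[OF assms, of "x - z"]
      gauss2_nonneg[of "4 * a" z] assms unfolding gbump_def by auto
  also have "\<dots> \<le> norm x / sqrt a * gbump a x z"
    using False assms by (intro mult_right_mono) (auto simp: gbump_def gauss2_nonneg)
  finally show ?thesis .
qed

text \<open>Interpolates between the Lipschitz bound and the trivial bound:
  \<open>min 1 q \<le> sqrt q\<close> for \<open>q = norm x / sqrt a\<close>. Only half an order is
  spent, since a full order would cost \<open>a powr (-1/2)\<close>, which together with the
  \<open>a powr (-1/2)\<close> arising in \<open>chordI\<close> is no longer integrable at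
  zero.\<close>

lemma gauss2_hoelder:
  assumes "a > 0"
  shows "\<bar>gauss2 a (x - z) - gauss2 a z\<bar> \<le> sqrt (norm x) * a powr (-1/4) * gbump a x z"
proof -
  have eq: "sqrt (norm x) * a powr (-1/4) = sqrt (norm x / sqrt a)"
  proof -
    have "sqrt (sqrt a) = (a powr (1/2)) powr (1/2)"
      using assms by (simp only: powr_half_sqrt[of a] powr_half_sqrt[of "sqrt a"] order_less_imp_le real_sqrt_ge_zero)
    then have "sqrt (sqrt a) = a powr (1/4)" by (simp only: powr_powr) simp
    moreover have "a powr (-1/4) = inverse (a powr (1/4))"
      using powr_minus[of a "1/4"] by simp
    ultimately have "a powr (-1/4) = inverse (sqrt (sqrt a))" by (simp only:)
    then show ?thesis by (simp only: real_sqrt_divide divide_inverse real_sqrt_inverse real_sqrt_mult)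
  qed
  have gb: "0 \<le> gbump a x z" using assms by (simp add: gbump_def gauss2_nonneg)
  show ?thesis
  proof (cases "norm x \<le> sqrt a")
    case True
    define q where "q = norm x / sqrt a"
    have q: "0 \<le> q" "q \<le> 1" using True assms by (auto simp: q_def)
    have "q \<le> sqrt q"
    proof (rule real_le_rsqrt)
      show "q\<^sup>2 \<le> q" using mult_right_mono[OF q(2) q(1)] by (simp add: power2_eq_square)
    qed
    then have "q * gbump a x z \<le> sqrt q * gbump a x z" using gb by (rule mult_right_mono)
    with gauss2_lipschitz[OF assms, of x z] show ?thesis unfolding eq q_def by linarith
  next
    case False
    have "\<bar>gauss2 a (x - z) - gauss2 a z\<bar> \<le> 1 * gbump a x z"
      using gauss2_nonneg[OF assms, of z] gauss2_nonneg[OF assms, of "x - z"]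
        gauss2_nonneg[of "4 * a" z] assms unfolding gbump_def by auto
    also have "\<dots> \<le> sqrt (norm x / sqrt a) * gbump a x z"
      using False assms gb by (intro mult_right_mono) auto
    finally show ?thesis unfolding eq .
  qed
qed

lemma gbump_le: "a > 0 \<Longrightarrow> gbump a x z \<le> 10 / (2 * pi * a)"
  using gauss2_le[of "4 * a" z] gauss2_le[of a z] gauss2_le[of a "x - z"]
  by (simp add: gbump_def field_simps)

lemma gbump_nonneg: "a > 0 \<Longrightarrow> 0 \<le> gbump a x z"
  by (simp add: gbump_def gauss2_nonneg)

lemma borel_measurable_gbump[measurable (raw)]:
  assumes [measurable]: "r \<in> borel_measurable M" "f \<in> borel_measurable M" "g \<in> borel_measurable M"
  shows "(\<lambda>x. gbump (r x) (f x) (g x)) \<in> borel_measurable M"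
  unfolding gbump_def by measurable

lemma nn_integral_gbump:
  assumes "a > 0"
  shows "(\<integral>\<^sup>+z. ennreal (gbump a x z) \<partial>lborel) = 34"
proof -
  have s: "(\<integral>\<^sup>+z. ennreal (gauss2 a (x - z)) \<partial>lborel) = 1"
  proof -
    have "(\<integral>\<^sup>+z. ennreal (gauss2 a (x - z)) \<partial>lborel) = (\<integral>\<^sup>+z. ennreal (gauss2 a (z + (- x))) \<partial>lborel)"
      by (subst gauss2_minus_commute) simp
    also have "\<dots> = 1" by (subst lborel_nn_integral_shift) (auto simp: nn_integral_gauss2 assms)
    finally show ?thesis .
  qed
  have "(\<integral>\<^sup>+z. ennreal (gbump a x z) \<partial>lborel)
    = (\<integral>\<^sup>+z. 32 * ennreal (gauss2 (4 * a) z) + ennreal (gauss2 a z) + ennreal (gauss2 a (x - z)) \<partial>lborel)"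
    using assms by (intro nn_integral_cong)
      (simp add: gbump_def ennreal_plus[symmetric] gauss2_nonneg ennreal_mult''[symmetric]
        ennreal_numeral[symmetric] del: ennreal_plus ennreal_numeral)
  also have "\<dots> = 34"
    using assms by (simp add: nn_integral_add nn_integral_cmult nn_integral_gauss2 s)
  finally show ?thesis .
qed

section \<open>Gaussian convolutions\<close>

definition gaussm :: "real \<Rightarrow> R2 measure" where
  "gaussm a = density lborel (\<lambda>x. ennreal (gauss2 a x))"

lemma sets_gaussm[simp, measurable_cong]: "sets (gaussm a) = sets borel"
  by (simp add: gaussm_def)

lemma space_gaussm[simp]: "space (gaussm a) = UNIV"
  by (simp add: gaussm_def)

lemma prob_space_gaussm: "a > 0 \<Longrightarrow> prob_space (gaussm a)"
  by (rule prob_spaceI) (simp add: gaussm_def emeasure_density nn_integral_gauss2)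

lemma nn_integral_gaussm:
  assumes [measurable]: "f \<in> borel_measurable borel"
  shows "(\<integral>\<^sup>+x. f x \<partial>gaussm a) = (\<integral>\<^sup>+x. ennreal (gauss2 a x) * f x \<partial>lborel)"
  unfolding gaussm_def by (subst nn_integral_density) auto

lemma integral_gaussm:
  fixes f :: "R2 \<Rightarrow> real"
  assumes [measurable]: "f \<in> borel_measurable borel" and "a > 0"
  shows "(\<integral>x. f x \<partial>gaussm a) = (\<integral>x. gauss2 a x * f x \<partial>lborel)"
  unfolding gaussm_def by (subst integral_real_density) (auto simp: gauss2_nonneg assms)

text \<open>The moment of order \<open>1/2\<close> is what the Hoelder bound of the Gaussian density
  is integrated against; \<open>mass\<close> and \<open>hmom\<close> are the two norms that enter
  the correlation estimates.\<close>

definition kern :: "(R2 \<Rightarrow> real) \<Rightarrow> bool" where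
  "kern f \<longleftrightarrow> continuous_on UNIV f \<and> (\<exists>B. \<forall>x. \<bar>f x\<bar> \<le> B) \<and> integrable lborel f \<and>
     integrable lborel (\<lambda>x. sqrt (norm x) * f x)"

definition mass :: "(R2 \<Rightarrow> real) \<Rightarrow> real" where
  "mass f = (\<integral>x. \<bar>f x\<bar> \<partial>lborel)"

definition hmom :: "(R2 \<Rightarrow> real) \<Rightarrow> real" where
  "hmom f = (\<integral>x. sqrt (norm x) * \<bar>f x\<bar> \<partial>lborel)"

definition gconv :: "(R2 \<Rightarrow> real) \<Rightarrow> real \<Rightarrow> R2 \<Rightarrow> real" where
  "gconv f a w = (\<integral>x. f (x + w) \<partial>gaussm a)"

lemma kern_measurable: "kern f \<Longrightarrow> f \<in> borel_measurable borel"
  unfolding kern_def by (auto intro: borel_measurable_continuous_onI)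

lemma kern_bounded: "kern f \<Longrightarrow> (\<And>B. 0 \<le> B \<Longrightarrow> (\<And>x. \<bar>f x\<bar> \<le> B) \<Longrightarrow> thesis) \<Longrightarrow> thesis"
  unfolding kern_def by (meson abs_ge_zero order_trans)

lemma mass_nonneg: "0 \<le> mass f" by (simp add: mass_def)
lemma hmom_nonneg: "0 \<le> hmom f" by (simp add: hmom_def)

lemma nn_integral_mass: "kern f \<Longrightarrow> (\<integral>\<^sup>+x. ennreal \<bar>f x\<bar> \<partial>lborel) = ennreal (mass f)"
  unfolding mass_def by (rule nn_integral_eq_integral) (auto simp: kern_def)

lemma integrable_hmom:
  assumes "kern f"
  shows "integrable lborel (\<lambda>x. sqrt (norm x) * \<bar>f x\<bar>)"
proof -
  have "integrable lborel (\<lambda>x. \<bar>sqrt (norm x) * f x\<bar>)" using assms by (auto simp: kern_def)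
  then show ?thesis by (simp add: abs_mult)
qed

lemma nn_integral_hmom:
  "kern f \<Longrightarrow> (\<integral>\<^sup>+x. ennreal (sqrt (norm x) * \<bar>f x\<bar>) \<partial>lborel) = ennreal (hmom f)"
  unfolding hmom_def by (rule nn_integral_eq_integral) (auto intro: integrable_hmom)

lemma gconv_eq:
  assumes "kern f" "a > 0"
  shows "gconv f a w = (\<integral>x. f x * gauss2 a (x - w) \<partial>lborel)"
proof -
  note [measurable] = kern_measurable[OF assms(1)]
  have "gconv f a w = (\<integral>x. gauss2 a x * f (x + w) \<partial>lborel)"
    unfolding gconv_def by (rule integral_gaussm) (use assms in auto)
  also have "\<dots> = (\<integral>x. (\<lambda>x. f x * gauss2 a (x - w)) (x + w) \<partial>lborel)"
    by (simp add: mult.commute)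
  also have "\<dots> = (\<integral>x. f x * gauss2 a (x - w) \<partial>lborel)"
    by (rule lborel_integral_shift) measurable
  finally show ?thesis .
qed

lemma abs_mult_gauss2_le: "a > 0 \<Longrightarrow> \<bar>y * gauss2 a x\<bar> \<le> \<bar>y\<bar> * (1 / (2 * pi * a))"
  unfolding abs_mult using gauss2_le[of a x] gauss2_nonneg[of a x] by (intro mult_left_mono) simp_all

lemma kern_integrable_gauss2:
  assumes "kern f" "a > 0" and [measurable]: "g \<in> borel_measurable borel"
  shows "integrable lborel (\<lambda>x. f x * gauss2 a (g x - w))"
proof (rule Bochner_Integration.integrable_bound)
  note [measurable] = kern_measurable[OF assms(1)]
  show "integrable lborel (\<lambda>x. f x * (1 / (2 * pi * a)))"
    using assms by (auto simp: kern_def)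
  show "AE x in lborel. norm (f x * gauss2 a (g x - w)) \<le> norm (f x * (1 / (2 * pi * a)))"
    using abs_mult_gauss2_le[OF assms(2)] assms(2)
    by (intro AE_I2) (simp add: abs_mult)
  show "(\<lambda>x. f x * gauss2 a (g x - w)) \<in> borel_measurable lborel" by measurable
qed

lemma borel_measurable_gconv[measurable]:
  assumes "kern f" "a > 0"
  shows "gconv f a \<in> borel_measurable borel"
proof -
  note [measurable] = kern_measurable[OF assms(1)]
  have "(\<lambda>w. \<integral>x. f x * gauss2 a (x - w) \<partial>lborel) \<in> borel_measurable borel"
    by (rule lborel.borel_measurable_lebesgue_integral) measurable
  then show ?thesis using gconv_eq[OF assms] by (simp add: fun_eq_iff[symmetric] cong: measurable_cong)
qed

lemma gconv_bound:
  assumes "kern f" "a > 0"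
  shows "\<bar>gconv f a w\<bar> \<le> mass f / (2 * pi * a)"
proof -
  have "\<bar>gconv f a w\<bar> \<le> (\<integral>x. \<bar>f x\<bar> * (1 / (2 * pi * a)) \<partial>lborel)"
    unfolding gconv_eq[OF assms]
  proof (rule order_trans[OF integral_abs_bound], rule integral_mono)
    show "integrable lborel (\<lambda>x. \<bar>f x * gauss2 a (x - w)\<bar>)"
      using kern_integrable_gauss2[OF assms, of "\<lambda>x. x"] by auto
    show "integrable lborel (\<lambda>x. \<bar>f x\<bar> * (1 / (2 * pi * a)))" using assms by (auto simp: kern_def)
    show "\<bar>f x * gauss2 a (x - w)\<bar> \<le> \<bar>f x\<bar> * (1 / (2 * pi * a))" for x
      by (rule abs_mult_gauss2_le[OF assms(2)])
  qed
  then show ?thesis by (simp add: mass_def)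
qed

lemma ennreal_gconv_le:
  assumes "kern f" "a > 0"
  shows "ennreal \<bar>gconv f a w\<bar> \<le> (\<integral>\<^sup>+x. ennreal (\<bar>f x\<bar> * gauss2 a (x - w)) \<partial>lborel)"
  unfolding gconv_eq[OF assms]
  using integral_norm_bound_ennreal[OF kern_integrable_gauss2[OF assms, of "\<lambda>x. x"]]
  by (simp add: abs_mult gauss2_nonneg assms(2))

text \<open>A kernel of integral zero does not see constants, so the density may be replaced by its
  increment.\<close>

lemma gconv_centered:
  assumes "kern f" "a > 0" and z: "(\<integral>x. f x \<partial>lborel) = 0"
  shows "gconv f a w = (\<integral>x. f x * (gauss2 a (x - w) - gauss2 a w) \<partial>lborel)"
proof -
  have i1: "integrable lborel (\<lambda>x. f x * gauss2 a (x - w))"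
    using kern_integrable_gauss2[OF assms(1,2), of "\<lambda>x. x"] by simp
  have i2: "integrable lborel (\<lambda>x. f x * gauss2 a w)" using assms(1) by (auto simp: kern_def)
  show ?thesis using i1 i2 z by (simp add: gconv_eq[OF assms(1,2)] right_diff_distrib)
qed

lemma ennreal_gconv_centered_le:
  assumes f: "kern f" and a: "a > 0" and z: "(\<integral>x. f x \<partial>lborel) = 0"
  shows "ennreal \<bar>gconv f a w\<bar> \<le>
     (\<integral>\<^sup>+x. ennreal (a powr (-1/4)) * (ennreal (sqrt (norm x) * \<bar>f x\<bar>) * ennreal (gbump a x w)) \<partial>lborel)"
proof -
  note [measurable] = kern_measurable[OF f]
  have i: "integrable lborel (\<lambda>x. f x * (gauss2 a (x - w) - gauss2 a w))"
  proof -
    have i1: "integrable lborel (\<lambda>x. f x * gauss2 a (x - w))"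
      using kern_integrable_gauss2[OF f a, of "\<lambda>x. x"] by simp
    have i2: "integrable lborel (\<lambda>x. f x * gauss2 a w)" using f by (auto simp: kern_def)
    show ?thesis using i1 i2 by (simp add: right_diff_distrib)
  qed
  have "ennreal \<bar>gconv f a w\<bar> \<le> (\<integral>\<^sup>+x. ennreal \<bar>f x * (gauss2 a (x - w) - gauss2 a w)\<bar> \<partial>lborel)"
    unfolding gconv_centered[OF f a z] using integral_norm_bound_ennreal[OF i] by simp
  also have "\<dots> \<le> (\<integral>\<^sup>+x. ennreal (a powr (-1/4) * ((sqrt (norm x) * \<bar>f x\<bar>) * gbump a x w)) \<partial>lborel)"
  proof (intro nn_integral_mono ennreal_leI)
    fix x
    have "\<bar>f x\<bar> * \<bar>gauss2 a (x - w) - gauss2 a w\<bar> \<le> \<bar>f x\<bar> * (sqrt (norm x) * a powr (-1/4) * gbump a x w)"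
      by (intro mult_left_mono gauss2_hoelder a) auto
    then show "\<bar>f x * (gauss2 a (x - w) - gauss2 a w)\<bar> \<le> a powr (-1/4) * ((sqrt (norm x) * \<bar>f x\<bar>) * gbump a x w)"
      by (simp add: abs_mult mult_ac)
  qed
  finally show ?thesis using a by (simp add: ennreal_mult gbump_nonneg)
qed

text \<open>Together with \<open>nn_integral_gconv_centered\<close> this is the gain from centering:
  compared with \<open>gconv_bound\<close> and \<open>nn_integral_gconv\<close>, the factor
  \<open>mass f\<close> becomes \<open>hmom f * a powr (-1/4)\<close> up to constants, in the
  supremum norm and in the integral norm alike.\<close>

lemma gconv_centered_bound:
  assumes f: "kern f" and a: "a > 0" and z: "(\<integral>x. f x \<partial>lborel) = 0"
  shows "\<bar>gconv f a w\<bar> \<le> hmom f * a powr (-1/4) * (10 / (2 * pi * a))"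
proof -
  note [measurable] = kern_measurable[OF f]
  have "ennreal \<bar>gconv f a w\<bar> \<le>
     (\<integral>\<^sup>+x. ennreal (a powr (-1/4)) * (ennreal (sqrt (norm x) * \<bar>f x\<bar>) * ennreal (10 / (2 * pi * a))) \<partial>lborel)"
    by (rule order_trans[OF ennreal_gconv_centered_le[OF f a z]], intro nn_integral_mono mult_left_mono ennreal_leI gbump_le a) auto
  also have "\<dots> = ennreal (a powr (-1/4)) * (ennreal (hmom f) * ennreal (10 / (2 * pi * a)))"
    by (simp add: nn_integral_cmult nn_integral_multc nn_integral_hmom[OF f])
  also have "\<dots> = ennreal (hmom f * a powr (-1/4) * (10 / (2 * pi * a)))"
    using a hmom_nonneg[of f] by (simp add: ennreal_mult[symmetric] mult_ac)
  finally show ?thesis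
    using a hmom_nonneg[of f] by (subst (asm) ennreal_le_iff) auto
qed

lemma nn_integral_gconv:
  assumes f: "kern f" and a: "a > 0"
  shows "(\<integral>\<^sup>+w. ennreal \<bar>gconv f a w\<bar> \<partial>lborel) \<le> ennreal (mass f)"
proof -
  note [measurable] = kern_measurable[OF f]
  have g: "(\<integral>\<^sup>+w. ennreal (gauss2 a (x - w)) \<partial>lborel) = 1" for x
  proof -
    have "(\<integral>\<^sup>+w. ennreal (gauss2 a (x - w)) \<partial>lborel) = (\<integral>\<^sup>+w. ennreal (gauss2 a (w + (- x))) \<partial>lborel)"
      by (subst gauss2_minus_commute) simp
    also have "\<dots> = 1" by (subst lborel_nn_integral_shift) (auto simp: nn_integral_gauss2 a)
    finally show ?thesis .
  qed
  have "(\<integral>\<^sup>+w. ennreal \<bar>gconv f a w\<bar> \<partial>lborel)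
     \<le> (\<integral>\<^sup>+w. \<integral>\<^sup>+x. ennreal \<bar>f x\<bar> * ennreal (gauss2 a (x - w)) \<partial>lborel \<partial>lborel)"
    by (intro nn_integral_mono order_trans[OF ennreal_gconv_le[OF f a]]) (simp add: ennreal_mult gauss2_nonneg a)
  also have "\<dots> = (\<integral>\<^sup>+x. \<integral>\<^sup>+w. ennreal \<bar>f x\<bar> * ennreal (gauss2 a (x - w)) \<partial>lborel \<partial>lborel)"
    by (rule lborel_pair.Fubini') measurable
  also have "\<dots> = ennreal (mass f)"
    by (simp add: nn_integral_cmult g nn_integral_mass[OF f])
  finally show ?thesis .
qed

lemma nn_integral_gconv_centered:
  assumes f: "kern f" and a: "a > 0" and z: "(\<integral>x. f x \<partial>lborel) = 0"
  shows "(\<integral>\<^sup>+w. ennreal \<bar>gconv f a w\<bar> \<partial>lborel) \<le> ennreal (34 * hmom f * a powr (-1/4))"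
proof -
  note [measurable] = kern_measurable[OF f]
  have "(\<integral>\<^sup>+w. ennreal \<bar>gconv f a w\<bar> \<partial>lborel)
     \<le> (\<integral>\<^sup>+w. \<integral>\<^sup>+x. ennreal (a powr (-1/4)) * (ennreal (sqrt (norm x) * \<bar>f x\<bar>) * ennreal (gbump a x w)) \<partial>lborel \<partial>lborel)"
    by (intro nn_integral_mono ennreal_gconv_centered_le f a z)
  also have "\<dots> = (\<integral>\<^sup>+x. \<integral>\<^sup>+w. ennreal (a powr (-1/4)) * (ennreal (sqrt (norm x) * \<bar>f x\<bar>) * ennreal (gbump a x w)) \<partial>lborel \<partial>lborel)"
    by (rule lborel_pair.Fubini') measurable
  also have "\<dots> = (\<integral>\<^sup>+x. ennreal (a powr (-1/4)) * (ennreal (sqrt (norm x) * \<bar>f x\<bar>) * 34) \<partial>lborel)"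
    by (simp add: nn_integral_cmult nn_integral_gbump a)
  also have "\<dots> = ennreal (a powr (-1/4)) * (ennreal (hmom f) * 34)"
    by (simp add: nn_integral_cmult nn_integral_multc nn_integral_hmom[OF f])
  also have "\<dots> = ennreal (34 * hmom f * a powr (-1/4))"
    using hmom_nonneg[of f] by (simp add: ennreal_mult mult_ac)
  finally show ?thesis .
qed

section \<open>Increments of planar Brownian motion\<close>

text \<open>Extending the path by \<open>0\<close> to negative times makes it continuous and jointly measurable on all of
  the real line.\<close>

definition bm :: "'a measure \<Rightarrow> (real \<Rightarrow> 'a \<Rightarrow> R2) \<Rightarrow> bool" where
  "bm M X \<longleftrightarrow> planar_BM M X \<and> (\<forall>t \<omega>. t < 0 \<longrightarrow> \<omega> \<in> space M \<longrightarrow> X t \<omega> = 0)"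

lemma bm_prob_space: "bm M X \<Longrightarrow> prob_space M"
  by (simp add: bm_def planar_BM_def)

lemma bm_zero: "bm M X \<Longrightarrow> \<omega> \<in> space M \<Longrightarrow> t \<le> 0 \<Longrightarrow> X t \<omega> = 0"
  by (cases "t = 0") (auto simp: bm_def planar_BM_def)

lemma bm_measurable:
  assumes "bm M X"
  shows "X t \<in> borel_measurable M"
proof (cases "t \<ge> 0")
  case True
  then show ?thesis using assms by (simp add: bm_def planar_BM_def)
next
  case False
  have "X t \<in> borel_measurable M \<longleftrightarrow> (\<lambda>_. 0 :: R2) \<in> borel_measurable M"
    by (rule measurable_cong) (use False bm_zero[OF assms] in auto)
  then show ?thesis by simp
qed

lemma bm_continuous:
  assumes "bm M X" "\<omega> \<in> space M"
  shows "continuous_on UNIV (\<lambda>t. X t \<omega>)"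
proof -
  have 1: "continuous_on {0..} (\<lambda>t. X t \<omega>)" using assms by (auto simp: bm_def planar_BM_def)
  have 2: "continuous_on {..0} (\<lambda>t. X t \<omega>)"
    by (subst continuous_on_cong[OF refl, of _ _ "\<lambda>_. 0"]) (auto simp: bm_zero[OF assms])
  have "continuous_on ({0..} \<union> {..0}) (\<lambda>t. X t \<omega>)"
    by (intro continuous_on_closed_Un 1 2) auto
  moreover have "{0..} \<union> {..0::real} = UNIV" by auto
  ultimately show ?thesis by simp
qed

lemma floor_mesh_tendsto: "(\<lambda>n. real_of_int \<lfloor>t * real (Suc n)\<rfloor> / real (Suc n)) \<longlonglongrightarrow> t"
proof (rule LIMSEQ_I)
  fix e :: real assume "e > 0"
  then obtain N where N: "inverse (real (Suc N)) < e" using reals_Archimedean by blast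
  have "norm (real_of_int \<lfloor>t * real (Suc n)\<rfloor> / real (Suc n) - t) < e" if "n \<ge> N" for n
  proof -
    have "\<bar>real_of_int \<lfloor>t * real (Suc n)\<rfloor> / real (Suc n) - t\<bar>
        = \<bar>real_of_int \<lfloor>t * real (Suc n)\<rfloor> - t * real (Suc n)\<bar> / real (Suc n)"
      by (simp add: field_simps del: of_nat_Suc)
    also have "\<dots> \<le> 1 / real (Suc n)"
      by (intro divide_right_mono) linarith+
    also have "\<dots> \<le> inverse (real (Suc N))" using that by (simp add: field_simps)
    finally show ?thesis using N by simp
  qed
  then show "\<exists>N. \<forall>n\<ge>N. norm (real_of_int \<lfloor>t * real (Suc n)\<rfloor> / real (Suc n) - t) < e" by blast
qed

text \<open>Continuity in time makes the path the limit of its values on the grids of mesh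
  \<open>1 / Suc n\<close>, and each grid involves only countably many of the measurable maps
  \<open>X t\<close>.\<close>

lemma bm_joint_measurable:
  assumes "bm M X"
  shows "(\<lambda>(t, \<omega>). X t \<omega>) \<in> borel_measurable (borel \<Otimes>\<^sub>M M)"
proof (rule borel_measurable_LIMSEQ_metric)
  note [measurable] = bm_measurable[OF assms]
  define r where "r n t = real_of_int \<lfloor>t * real (Suc n)\<rfloor> / real (Suc n)" for n t
  show "(\<lambda>(t, \<omega>). X (r n t) \<omega>) \<in> borel_measurable (borel \<Otimes>\<^sub>M M)" for n
  proof -
    have "(\<lambda>p. (\<lambda>i p. X (real_of_int i / real (Suc n)) (snd p)) (\<lfloor>fst p * real (Suc n)\<rfloor>) p)
      \<in> borel_measurable (borel \<Otimes>\<^sub>M M)"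
      by (rule measurable_compose_countable) measurable
    then show ?thesis by (simp add: r_def case_prod_beta)
  qed
  fix p :: "real \<times> 'a" assume "p \<in> space (borel \<Otimes>\<^sub>M M)"
  then have w: "snd p \<in> space M" by (auto simp: space_pair_measure)
  have "(\<lambda>n. r n t) \<longlonglongrightarrow> t" for t unfolding r_def by (rule floor_mesh_tendsto)
  moreover have "isCont (\<lambda>t. X t (snd p)) (fst p)"
    using bm_continuous[OF assms w] by (simp add: continuous_on_eq_continuous_at)
  ultimately show "(\<lambda>n. (case p of (t, \<omega>) \<Rightarrow> X (r n t) \<omega>)) \<longlonglongrightarrow> (case p of (t, \<omega>) \<Rightarrow> X t \<omega>)"
    by (auto simp: case_prod_beta intro: isCont_tendsto_compose)
qed

lemma bm_increment_distr:
  assumes "bm M X" "0 \<le> s" "s < t"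
  shows "distr M borel (\<lambda>\<omega>. X t \<omega> - X s \<omega>) = gaussm (t - s)"
proof -
  have "distributed M lborel (\<lambda>\<omega>. X t \<omega> - X s \<omega>) (\<lambda>x. ennreal (gauss2 (t - s) x))"
    using assms by (simp add: bm_def planar_BM_def)
  then have "distr M lborel (\<lambda>\<omega>. X t \<omega> - X s \<omega>) = gaussm (t - s)"
    by (simp add: distributed_def gaussm_def)
  moreover have "distr M lborel (\<lambda>\<omega>. X t \<omega> - X s \<omega>) = distr M borel (\<lambda>\<omega>. X t \<omega> - X s \<omega>)"
    by (rule distr_cong) auto
  ultimately show ?thesis by simp
qed

lemma bm_indep:
  assumes "bm M X" "sorted_wrt (<) ts" "\<forall>t\<in>set ts. 0 \<le> t"
  shows "prob_space.indep_vars M (\<lambda>_. borel) (\<lambda>i \<omega>. X (ts ! Suc i) \<omega> - X (ts ! i) \<omega>) {..<length ts - 1}"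
  using assms by (simp add: bm_def planar_BM_def)

text \<open>The indices may come in any order because later integrations peel off the increments
  differently: the middle one first, then the outer two in the order that suits the
  configuration.\<close>

lemma bm_increments3:
  assumes X: "bm M X" and t: "0 \<le> t 0" "t 0 < t 1" "t 1 < t 2" "t 2 < (t 3 :: real)"
    and ijk: "i < 3" "j < 3" "k < (3::nat)" "i \<noteq> j" "i \<noteq> k" "j \<noteq> k"
  defines "D \<equiv> \<lambda>i \<omega>. X (t (Suc i)) \<omega> - X (t i) \<omega>"
  shows "distr M (borel \<Otimes>\<^sub>M (borel \<Otimes>\<^sub>M borel)) (\<lambda>\<omega>. (D i \<omega>, (D j \<omega>, D k \<omega>)))
     = gaussm (t (Suc i) - t i) \<Otimes>\<^sub>M (gaussm (t (Suc j) - t j) \<Otimes>\<^sub>M gaussm (t (Suc k) - t k))"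
proof -
  interpret prob_space M by (rule bm_prob_space[OF X])
  define ts where "ts = [t 0, t 1, t 2, t 3]"
  have tsn: "ts ! n = t n" if "n \<le> 3" for n
    using that by (auto simp: ts_def le_Suc_eq numeral_3_eq_3 numeral_2_eq_2)
  have "indep_vars (\<lambda>_. borel) (\<lambda>i \<omega>. X (ts ! Suc i) \<omega> - X (ts ! i) \<omega>) {..<length ts - 1}"
    by (rule bm_indep[OF X]) (use t in \<open>auto simp: ts_def\<close>)
  moreover have "length ts - 1 = 3" by (simp add: ts_def)
  ultimately have "indep_vars (\<lambda>_. borel) (\<lambda>i \<omega>. X (ts ! Suc i) \<omega> - X (ts ! i) \<omega>) {..<3}" by simp
  also have "?this \<longleftrightarrow> indep_vars (\<lambda>_. borel) D {..<3}"
    by (rule indep_vars_cong) (auto simp: D_def tsn)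
  finally have ind: "indep_vars (\<lambda>_. borel) D {..<3}" .
  have m1: "(\<lambda>f. f i) \<in> measurable (PiM {i} (\<lambda>_. borel)) (borel :: R2 measure)" for i :: nat by measurable
  have m2: "(\<lambda>f. (f i, f j)) \<in> measurable (PiM {i, j} (\<lambda>_. borel)) (borel \<Otimes>\<^sub>M (borel :: R2 measure))" for i j :: nat
    by measurable
  have rv[measurable]: "D i \<in> borel_measurable M" for i
    unfolding D_def using bm_measurable[OF X] by measurable
  \<comment> \<open>\<open>indep_var\<close> wants both variables to take values in one type, so the
    single increment is doubled to a pair; the doubling is undone when the joint law is computed on
    rectangles.\<close>
  have "indep_var (borel \<Otimes>\<^sub>M borel) ((\<lambda>f. (f i, f i)) \<circ> (\<lambda>\<omega>. restrict (\<lambda>i. D i \<omega>) {i, i})) (borel \<Otimes>\<^sub>M borel)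
    ((\<lambda>f. (f j, f k)) \<circ> (\<lambda>\<omega>. restrict (\<lambda>i. D i \<omega>) {j, k}))"
    by (intro indep_var_compose[OF indep_var_restrict[OF ind] m2 m2]) (use ijk in auto)
  then have 1: "indep_var (borel \<Otimes>\<^sub>M borel) (\<lambda>\<omega>. (D i \<omega>, D i \<omega>)) (borel \<Otimes>\<^sub>M borel) (\<lambda>\<omega>. (D j \<omega>, D k \<omega>))"
    by (simp add: comp_def)
  have "indep_var borel ((\<lambda>f. f j) \<circ> (\<lambda>\<omega>. restrict (\<lambda>i. D i \<omega>) {j})) borel
    ((\<lambda>f. f k) \<circ> (\<lambda>\<omega>. restrict (\<lambda>i. D i \<omega>) {k}))"
    by (intro indep_var_compose[OF indep_var_restrict[OF ind] m1 m1]) (use ijk in auto)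
  then have 2: "indep_var borel (D j) borel (D k)"
    by (simp add: comp_def)
  have d: "distr M borel (D i) = gaussm (t (Suc i) - t i)" if "i < 3" for i
  proof -
    have "0 \<le> t i \<and> t i < t (Suc i)" using that t
      by (auto simp: less_Suc_eq numeral_3_eq_3 numeral_2_eq_2)
    then show ?thesis unfolding D_def by (intro bm_increment_distr[OF X]) auto
  qed
  have "distr M borel (D i) \<Otimes>\<^sub>M distr M (borel \<Otimes>\<^sub>M borel) (\<lambda>\<omega>. (D j \<omega>, D k \<omega>))
    = distr M (borel \<Otimes>\<^sub>M (borel \<Otimes>\<^sub>M borel)) (\<lambda>\<omega>. (D i \<omega>, (D j \<omega>, D k \<omega>)))"
  proof (rule pair_measure_eqI)
    show "sigma_finite_measure (distr M borel (D i))"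
      "sigma_finite_measure (distr M (borel \<Otimes>\<^sub>M borel) (\<lambda>\<omega>. (D j \<omega>, D k \<omega>)))"
      by (intro prob_space_imp_sigma_finite prob_space_distr; measurable)+
    fix A B assume A: "A \<in> sets (distr M borel (D i))" and B: "B \<in> sets (distr M (borel \<Otimes>\<^sub>M borel) (\<lambda>\<omega>. (D j \<omega>, D k \<omega>)))"
    have [measurable]: "A \<in> sets borel" "B \<in> sets (borel \<Otimes>\<^sub>M borel)" using A B by auto
    have AA: "A \<times> A \<in> sets (borel \<Otimes>\<^sub>M borel)" by measurable
    have "prob ((\<lambda>\<omega>. ((D i \<omega>, D i \<omega>), (D j \<omega>, D k \<omega>))) -` ((A \<times> A) \<times> B) \<inter> space M)
      = prob ((\<lambda>\<omega>. (D i \<omega>, D i \<omega>)) -` (A \<times> A) \<inter> space M) * prob ((\<lambda>\<omega>. (D j \<omega>, D k \<omega>)) -` B \<inter> space M)"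
      by (rule indep_varD[OF 1 AA]) measurable
    moreover have "(\<lambda>\<omega>. ((D i \<omega>, D i \<omega>), (D j \<omega>, D k \<omega>))) -` ((A \<times> A) \<times> B) = (\<lambda>\<omega>. (D i \<omega>, (D j \<omega>, D k \<omega>))) -` (A \<times> B)"
      "(\<lambda>\<omega>. (D i \<omega>, D i \<omega>)) -` (A \<times> A) = D i -` A" by auto
    ultimately show "emeasure (distr M borel (D i)) A * emeasure (distr M (borel \<Otimes>\<^sub>M borel) (\<lambda>\<omega>. (D j \<omega>, D k \<omega>))) B
      = emeasure (distr M (borel \<Otimes>\<^sub>M (borel \<Otimes>\<^sub>M borel)) (\<lambda>\<omega>. (D i \<omega>, (D j \<omega>, D k \<omega>)))) (A \<times> B)"
      by (simp add: emeasure_distr emeasure_eq_measure ennreal_mult[symmetric])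
  qed simp
  then show ?thesis
    using indep_var_distribution_eq[THEN iffD1, OF 2]
      d[OF ijk(1)] d[OF ijk(2)] d[OF ijk(3)] by simp
qed

section \<open>Correlations of two chords\<close>

lemma geo_mean_bound:
  assumes "0 \<le> Q" "v \<le> Q / a" "v \<le> Q / b" "a > 0" "b > (0::real)"
  shows "v \<le> Q * a powr (-1/2) * b powr (-1/2)"
proof -
  have s: "sqrt (a * b) \<le> max a b"
    using assms by (intro real_le_lsqrt) (auto simp: power2_eq_square max_def intro: mult_mono)
  have "v \<le> Q / max a b" using assms by (auto simp: max_def)
  also have "\<dots> \<le> Q / sqrt (a * b)"
    using s assms by (intro divide_left_mono) (auto simp: max_def)
  also have "\<dots> = Q * a powr (-1/2) * b powr (-1/2)"
    using assms by (simp add: powr_minus powr_half_sqrt real_sqrt_mult field_simps)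
  finally show ?thesis .
qed

text \<open>The common bound on the correlations of two chords of a Brownian path: \<open>c\<close> is the length of the
  common time interval, \<open>a\<close> and \<open>b\<close> are the gaps between the left and the right end points.  The
  \<open>1/2\<close>-Hoelder regularity of the Gaussian density is spent on the gap \<open>a\<close> only.\<close>

definition chord :: "real \<Rightarrow> real \<Rightarrow> real \<Rightarrow> real" where
  "chord a b c = a powr (-3/4) * b powr (-1/2) / c"

lemma chordI:
  assumes "0 \<le> Q" "a > 0" "b > 0" "c > 0"
    and "v \<le> 34 * Q * a powr (-1/4) / (2 * pi * a) / (2 * pi * c)"
        "v \<le> 34 * Q * a powr (-1/4) / (2 * pi * b) / (2 * pi * c)"
  shows "v \<le> Q * chord a b c"
proof -
  define Q' where "Q' = Q * a powr (-1/4) / c"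
  have Q': "0 \<le> Q'" using assms by (simp add: Q'_def)
  \<comment> \<open>The \<open>34\<close> is the mass of \<open>gbump\<close>; it is absorbed by the
    normalising factors of the two Gaussian densities.\<close>
  have p: "34 \<le> (2 * pi) * (2 * pi)"
    using mult_mono[of 3 pi 3 pi] pi_gt3 by simp
  have *: "34 * Q * a powr (-1/4) / (2 * pi * d) / (2 * pi * c) \<le> Q' / d" if "d > 0" for d
  proof -
    have "34 * Q * a powr (-1/4) / (2 * pi * d) / (2 * pi * c) = (Q' / d) * (34 / ((2 * pi) * (2 * pi)))"
      using that assms by (simp add: Q'_def field_simps)
    also have "\<dots> \<le> (Q' / d) * 1"
      using p Q' that by (intro mult_left_mono) (auto simp: divide_le_eq)
    finally show ?thesis by simp
  qed
  have "v \<le> Q' * a powr (-1/2) * b powr (-1/2)"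
    using assms * by (intro geo_mean_bound[OF Q']) (blast intro: order_trans)+
  also have "\<dots> = Q * chord a b c"
    using assms by (simp add: Q'_def chord_def powr_add[symmetric])
  finally show ?thesis .
qed

text \<open>Given the increment \<open>z\<close> over the common interval, the two outer increments
  are independent, so the correlation is the Gaussian average of
  \<open>gconv f a z * gconv f b z\<close>. One factor is bounded by its supremum and the other by
  its integral, in both possible ways; this gives bounds with \<open>1 / a\<close> and with
  \<open>1 / b\<close>, whose geometric mean is \<open>chord\<close>. Centering is exploited in the
  factor for \<open>a\<close>.\<close>

lemma bm_interlaced:
  assumes X: "bm M X" and t: "0 \<le> t0" "t0 < t1" "t1 < t2" "t2 < t3"
    and f: "kern f" and z: "(\<integral>x. f x \<partial>lborel) = 0"
  shows "\<bar>\<integral>\<omega>. f (X t2 \<omega> - X t0 \<omega>) * f (X t3 \<omega> - X t1 \<omega>) \<partial>M\<bar>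
     \<le> mass f * hmom f * chord (t1 - t0) (t3 - t2) (t2 - t1)"
proof -
  interpret prob_space M by (rule bm_prob_space[OF X])
  note [measurable] = kern_measurable[OF f] bm_measurable[OF X]
  obtain B where B: "0 \<le> B" "\<And>x. \<bar>f x\<bar> \<le> B" using kern_bounded[OF f] by blast
  define a where "a = t1 - t0"
  define b where "b = t3 - t2"
  define c where "c = t2 - t1"
  have pos: "a > 0" "b > 0" "c > 0" using t by (auto simp: a_def b_def c_def)
  interpret A: prob_space "gaussm a" by (rule prob_space_gaussm[OF pos(1)])
  interpret Bm: prob_space "gaussm b" by (rule prob_space_gaussm[OF pos(2)])
  interpret C: prob_space "gaussm c" by (rule prob_space_gaussm[OF pos(3)])
  interpret AB: pair_prob_space "gaussm a" "gaussm b" ..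
  interpret CAB: pair_prob_space "gaussm c" "gaussm a \<Otimes>\<^sub>M gaussm b" ..
  define t where "t = (\<lambda>n::nat. [t0, t1, t2, t3] ! n)"
  have ts: "t 0 = t0" "t (Suc 0) = t1" "t 1 = t1" "t 2 = t2" "t (Suc (Suc 0)) = t2" "t (Suc 1) = t2" "t 3 = t3" "t (Suc 2) = t3"
    by (auto simp: t_def)
  define D where "D = (\<lambda>i \<omega>. X (t (Suc i)) \<omega> - X (t i) \<omega>)"
  have distr: "distr M (borel \<Otimes>\<^sub>M (borel \<Otimes>\<^sub>M borel)) (\<lambda>\<omega>. (D 1 \<omega>, (D 0 \<omega>, D 2 \<omega>)))
     = gaussm c \<Otimes>\<^sub>M (gaussm a \<Otimes>\<^sub>M gaussm b)"
    using bm_increments3[OF X, of t 1 0 2] assms(2-5)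
    by (simp add: D_def ts a_def b_def c_def)
  define F where "F = (\<lambda>(z, (x, y)). f (x + z) * f (y + z))"
  have [measurable]: "F \<in> borel_measurable (borel \<Otimes>\<^sub>M (borel \<Otimes>\<^sub>M borel))"
    unfolding F_def by measurable
  have FB: "\<bar>F p\<bar> \<le> B * B" for p
    unfolding F_def case_prod_beta abs_mult by (intro mult_mono B) (simp_all add: B(1))
  have e1: "(\<integral>\<omega>. f (X t2 \<omega> - X t0 \<omega>) * f (X t3 \<omega> - X t1 \<omega>) \<partial>M)
    = (\<integral>\<omega>. F (D 1 \<omega>, (D 0 \<omega>, D 2 \<omega>)) \<partial>M)"
    by (simp add: F_def D_def ts)
  also have "\<dots> = (\<integral>p. F p \<partial>distr M (borel \<Otimes>\<^sub>M (borel \<Otimes>\<^sub>M borel)) (\<lambda>\<omega>. (D 1 \<omega>, (D 0 \<omega>, D 2 \<omega>))))"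
    by (rule integral_distr[symmetric]) (auto simp: D_def)
  also have "\<dots> = (\<integral>p. F p \<partial>(gaussm c \<Otimes>\<^sub>M (gaussm a \<Otimes>\<^sub>M gaussm b)))"
    by (simp only: distr)
  also have "\<dots> = (\<integral>z. \<integral>q. F (z, q) \<partial>(gaussm a \<Otimes>\<^sub>M gaussm b) \<partial>gaussm c)"
    by (rule CAB.integral_fst'[symmetric], rule CAB.P.integrable_const_bound[of _ "B * B"]) (auto simp: FB)
  also have "\<dots> = (\<integral>z. gconv f a z * gconv f b z \<partial>gaussm c)"
  proof (rule Bochner_Integration.integral_cong[OF refl])
    fix z
    have "(\<integral>q. F (z, q) \<partial>(gaussm a \<Otimes>\<^sub>M gaussm b)) = (\<integral>x. \<integral>y. F (z, (x, y)) \<partial>gaussm b \<partial>gaussm a)"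
      by (rule AB.integral_fst'[symmetric], rule AB.P.integrable_const_bound[of _ "B * B"]) (auto simp: FB)
    also have "\<dots> = gconv f a z * gconv f b z"
      by (simp add: F_def gconv_def)
    finally show "(\<integral>q. F (z, q) \<partial>(gaussm a \<Otimes>\<^sub>M gaussm b)) = gconv f a z * gconv f b z" .
  qed
  finally have e: "(\<integral>\<omega>. f (X t2 \<omega> - X t0 \<omega>) * f (X t3 \<omega> - X t1 \<omega>) \<partial>M)
    = (\<integral>z. gconv f a z * gconv f b z \<partial>gaussm c)" .
  note [measurable] = borel_measurable_gconv[OF f pos(1)] borel_measurable_gconv[OF f pos(2)]
  define L where "L = (\<integral>\<^sup>+z. ennreal \<bar>gconv f a z\<bar> * ennreal \<bar>gconv f b z\<bar> \<partial>lborel)"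
  define v where "v = \<bar>\<integral>z. gconv f a z * gconv f b z \<partial>gaussm c\<bar>"
  have int: "integrable (gaussm c) (\<lambda>z. gconv f a z * gconv f b z)"
  proof (rule C.integrable_const_bound)
    show "AE z in gaussm c. norm (gconv f a z * gconv f b z) \<le> (mass f / (2 * pi * a)) * (mass f / (2 * pi * b))"
      unfolding real_norm_def abs_mult using mass_nonneg[of f] pos
      by (intro AE_I2 mult_mono gconv_bound f) simp_all
  qed auto
  have "ennreal v \<le> (\<integral>\<^sup>+z. ennreal \<bar>gconv f a z * gconv f b z\<bar> \<partial>gaussm c)"
    unfolding v_def using integral_norm_bound_ennreal[OF int] by simp
  also have "\<dots> = (\<integral>\<^sup>+z. ennreal (gauss2 c z) * ennreal \<bar>gconv f a z * gconv f b z\<bar> \<partial>lborel)"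
    by (rule nn_integral_gaussm) auto
  also have "\<dots> \<le> (\<integral>\<^sup>+z. ennreal (1 / (2 * pi * c)) * (ennreal \<bar>gconv f a z\<bar> * ennreal \<bar>gconv f b z\<bar>) \<partial>lborel)"
    by (intro nn_integral_mono) (auto simp: abs_mult ennreal_mult intro!: mult_right_mono ennreal_leI gauss2_le pos)
  also have "\<dots> = ennreal (1 / (2 * pi * c)) * L"
    unfolding L_def by (rule nn_integral_cmult) auto
  finally have vL: "ennreal v \<le> ennreal (1 / (2 * pi * c)) * L" .
  have "L \<le> (\<integral>\<^sup>+z. ennreal (hmom f * a powr (-1/4) * (10 / (2 * pi * a))) * ennreal \<bar>gconv f b z\<bar> \<partial>lborel)"
    unfolding L_def by (intro nn_integral_mono mult_right_mono ennreal_leI gconv_centered_bound f pos z) auto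
  also have "\<dots> \<le> ennreal (hmom f * a powr (-1/4) * (10 / (2 * pi * a))) * ennreal (mass f)"
    by (subst nn_integral_cmult) (auto intro!: mult_left_mono nn_integral_gconv f pos)
  finally have L1: "L \<le> ennreal (hmom f * a powr (-1/4) * (10 / (2 * pi * a)) * mass f)"
    by (simp only: ennreal_mult''[OF mass_nonneg])
  have "L \<le> (\<integral>\<^sup>+z. ennreal \<bar>gconv f a z\<bar> * ennreal (mass f / (2 * pi * b)) \<partial>lborel)"
    unfolding L_def by (intro nn_integral_mono mult_left_mono ennreal_leI gconv_bound f pos) auto
  also have "\<dots> \<le> ennreal (34 * hmom f * a powr (-1/4)) * ennreal (mass f / (2 * pi * b))"
    using nn_integral_gconv_centered[OF f pos(1) z] by (simp add: nn_integral_multc mult_right_mono)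
  also have "\<dots> = ennreal (34 * hmom f * a powr (-1/4) * (mass f / (2 * pi * b)))"
    using pos mass_nonneg[of f] by (intro ennreal_mult''[symmetric]) simp
  finally have L2: "L \<le> ennreal (34 * hmom f * a powr (-1/4) * (mass f / (2 * pi * b)))" .
  have nn: "0 \<le> mass f * hmom f" using hmom_nonneg[of f] mass_nonneg[of f] by simp
  have "v \<le> mass f * hmom f * chord a b c"
  proof (rule chordI[OF nn pos])
    have "ennreal v \<le> ennreal (1 / (2 * pi * c)) * ennreal (hmom f * a powr (-1/4) * (10 / (2 * pi * a)) * mass f)"
      by (rule order_trans[OF vL mult_left_mono[OF L1]]) simp
    then have "v \<le> 1 / (2 * pi * c) * (hmom f * a powr (-1/4) * (10 / (2 * pi * a)) * mass f)"
      using pos hmom_nonneg[of f] mass_nonneg[of f]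
      by (subst (asm) ennreal_mult[symmetric]) (auto simp: ennreal_le_iff)
    also have "\<dots> = 10 * ((mass f * hmom f) * a powr (-1/4) / (2 * pi * a) / (2 * pi * c))"
      using pos by (simp add: field_simps)
    also have "\<dots> \<le> 34 * ((mass f * hmom f) * a powr (-1/4) / (2 * pi * a) / (2 * pi * c))"
      by (intro mult_right_mono divide_nonneg_pos mult_nonneg_nonneg[OF nn] mult_pos_pos pos) auto
    finally show "v \<le> 34 * (mass f * hmom f) * a powr (-1/4) / (2 * pi * a) / (2 * pi * c)" by (simp only: times_divide_eq_right mult.assoc)
    have "ennreal v \<le> ennreal (1 / (2 * pi * c)) * ennreal (34 * hmom f * a powr (-1/4) * (mass f / (2 * pi * b)))"
      by (rule order_trans[OF vL mult_left_mono[OF L2]]) simp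
    then have "v \<le> 1 / (2 * pi * c) * (34 * hmom f * a powr (-1/4) * (mass f / (2 * pi * b)))"
      using pos hmom_nonneg[of f] mass_nonneg[of f]
      by (subst (asm) ennreal_mult[symmetric]) (auto simp: ennreal_le_iff)
    then show "v \<le> 34 * (mass f * hmom f) * a powr (-1/4) / (2 * pi * b) / (2 * pi * c)" by (simp add: mult_ac)
  qed
  then show ?thesis unfolding e v_def a_def b_def c_def .
qed

text \<open>The inner chord is the middle increment \<open>z\<close> alone, so one kernel enters as
  \<open>f z\<close>, and the outer increments act on the other kernel only, through its Gaussian
  average \<open>H\<close>. Averaging over \<open>a\<close> exploits the centering; averaging over
  \<open>b\<close> as well supplies the alternative factor \<open>1 / b\<close>.\<close>

lemma bm_nested:
  assumes X: "bm M X" and t: "0 \<le> t0" "t0 < t1" "t1 < t2" "t2 < t3"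
    and f: "kern f" and z: "(\<integral>x. f x \<partial>lborel) = 0"
  shows "\<bar>\<integral>\<omega>. f (X t2 \<omega> - X t1 \<omega>) * f (X t3 \<omega> - X t0 \<omega>) \<partial>M\<bar>
     \<le> mass f * hmom f * chord (t1 - t0) (t3 - t2) (t2 - t1)"
proof -
  interpret prob_space M by (rule bm_prob_space[OF X])
  note [measurable] = kern_measurable[OF f] bm_measurable[OF X]
  obtain B where B: "0 \<le> B" "\<And>x. \<bar>f x\<bar> \<le> B" using kern_bounded[OF f] by blast
  define a where "a = t1 - t0"
  define b where "b = t3 - t2"
  define c where "c = t2 - t1"
  have pos: "a > 0" "b > 0" "c > 0" using t by (auto simp: a_def b_def c_def)
  interpret A: prob_space "gaussm a" by (rule prob_space_gaussm[OF pos(1)])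
  interpret Bm: prob_space "gaussm b" by (rule prob_space_gaussm[OF pos(2)])
  interpret C: prob_space "gaussm c" by (rule prob_space_gaussm[OF pos(3)])
  interpret BA: pair_prob_space "gaussm b" "gaussm a" ..
  interpret CBA: pair_prob_space "gaussm c" "gaussm b \<Otimes>\<^sub>M gaussm a" ..
  define t where "t = (\<lambda>n::nat. [t0, t1, t2, t3] ! n)"
  have ts: "t 0 = t0" "t (Suc 0) = t1" "t 1 = t1" "t 2 = t2" "t (Suc (Suc 0)) = t2" "t (Suc 1) = t2" "t 3 = t3" "t (Suc 2) = t3"
    by (auto simp: t_def)
  define D where "D = (\<lambda>i \<omega>. X (t (Suc i)) \<omega> - X (t i) \<omega>)"
  have distr: "distr M (borel \<Otimes>\<^sub>M (borel \<Otimes>\<^sub>M borel)) (\<lambda>\<omega>. (D 1 \<omega>, (D 2 \<omega>, D 0 \<omega>)))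
     = gaussm c \<Otimes>\<^sub>M (gaussm b \<Otimes>\<^sub>M gaussm a)"
    using bm_increments3[OF X, of t 1 2 0] assms(2-5)
    by (simp add: D_def ts a_def b_def c_def)
  define F where "F = (\<lambda>(z, (y, x)). f z * f (x + (y + z)))"
  have [measurable]: "F \<in> borel_measurable (borel \<Otimes>\<^sub>M (borel \<Otimes>\<^sub>M borel))"
    unfolding F_def by measurable
  have FB: "\<bar>F p\<bar> \<le> B * B" for p
    unfolding F_def case_prod_beta abs_mult by (intro mult_mono B) (simp_all add: B(1))
  define H where "H z = (\<integral>y. gconv f a (y + z) \<partial>gaussm b)" for z
  have e1: "(\<integral>\<omega>. f (X t2 \<omega> - X t1 \<omega>) * f (X t3 \<omega> - X t0 \<omega>) \<partial>M)
    = (\<integral>\<omega>. F (D 1 \<omega>, (D 2 \<omega>, D 0 \<omega>)) \<partial>M)"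
    by (simp add: F_def D_def ts)
  also have "\<dots> = (\<integral>p. F p \<partial>distr M (borel \<Otimes>\<^sub>M (borel \<Otimes>\<^sub>M borel)) (\<lambda>\<omega>. (D 1 \<omega>, (D 2 \<omega>, D 0 \<omega>))))"
    by (rule integral_distr[symmetric]) (auto simp: D_def)
  also have "\<dots> = (\<integral>p. F p \<partial>(gaussm c \<Otimes>\<^sub>M (gaussm b \<Otimes>\<^sub>M gaussm a)))"
    by (simp only: distr)
  also have "\<dots> = (\<integral>z. \<integral>q. F (z, q) \<partial>(gaussm b \<Otimes>\<^sub>M gaussm a) \<partial>gaussm c)"
    by (rule CBA.integral_fst'[symmetric], rule CBA.P.integrable_const_bound[of _ "B * B"]) (auto simp: FB)
  also have "\<dots> = (\<integral>z. f z * H z \<partial>gaussm c)"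
  proof (rule Bochner_Integration.integral_cong[OF refl])
    fix z
    have "(\<integral>q. F (z, q) \<partial>(gaussm b \<Otimes>\<^sub>M gaussm a)) = (\<integral>y. \<integral>x. F (z, (y, x)) \<partial>gaussm a \<partial>gaussm b)"
      by (rule BA.integral_fst'[symmetric], rule BA.P.integrable_const_bound[of _ "B * B"]) (auto simp: FB)
    also have "\<dots> = f z * H z"
      by (simp add: F_def gconv_def H_def)
    finally show "(\<integral>q. F (z, q) \<partial>(gaussm b \<Otimes>\<^sub>M gaussm a)) = f z * H z" .
  qed
  finally have e: "(\<integral>\<omega>. f (X t2 \<omega> - X t1 \<omega>) * f (X t3 \<omega> - X t0 \<omega>) \<partial>M)
    = (\<integral>z. f z * H z \<partial>gaussm c)" .
  note [measurable] = borel_measurable_gconv[OF f pos(1)]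
  have [measurable]: "H \<in> borel_measurable borel"
    unfolding H_def by (rule Bm.borel_measurable_lebesgue_integral) measurable
  have int: "integrable (gaussm b) (\<lambda>y. gconv f a (y + z))" for z
    by (rule Bm.integrable_const_bound[of _ "mass f / (2 * pi * a)"]) (auto intro!: AE_I2 gconv_bound f pos)
  have H1: "\<bar>H z\<bar> \<le> hmom f * a powr (-1/4) * (10 / (2 * pi * a))" for z
  proof -
    have "\<bar>H z\<bar> \<le> (\<integral>y. hmom f * a powr (-1/4) * (10 / (2 * pi * a)) \<partial>gaussm b)"
      unfolding H_def using int
      by (intro order_trans[OF integral_abs_bound] integral_mono gconv_centered_bound f pos \<open>integral\<^sup>L lborel f = 0\<close>) auto
    then show ?thesis using Bm.prob_space by simp
  qed
  have H2: "\<bar>H z\<bar> \<le> 34 * hmom f * a powr (-1/4) / (2 * pi * b)" for z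
  proof -
    have "ennreal \<bar>H z\<bar> \<le> (\<integral>\<^sup>+y. ennreal \<bar>gconv f a (y + z)\<bar> \<partial>gaussm b)"
      unfolding H_def using integral_norm_bound_ennreal[OF int] by simp
    also have "\<dots> = (\<integral>\<^sup>+y. ennreal (gauss2 b y) * ennreal \<bar>gconv f a (y + z)\<bar> \<partial>lborel)"
      by (rule nn_integral_gaussm) auto
    also have "\<dots> \<le> (\<integral>\<^sup>+y. ennreal (1 / (2 * pi * b)) * ennreal \<bar>gconv f a (y + z)\<bar> \<partial>lborel)"
      by (intro nn_integral_mono mult_right_mono ennreal_leI gauss2_le pos) auto
    also have "\<dots> = ennreal (1 / (2 * pi * b)) * (\<integral>\<^sup>+y. ennreal \<bar>gconv f a (y + z)\<bar> \<partial>lborel)"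
      by (rule nn_integral_cmult) auto
    also have "(\<integral>\<^sup>+y. ennreal \<bar>gconv f a (y + z)\<bar> \<partial>lborel) = (\<integral>\<^sup>+y. ennreal \<bar>gconv f a y\<bar> \<partial>lborel)"
      by (rule lborel_nn_integral_shift) auto
    also have "ennreal (1 / (2 * pi * b)) * (\<integral>\<^sup>+y. ennreal \<bar>gconv f a y\<bar> \<partial>lborel)
      \<le> ennreal (1 / (2 * pi * b)) * ennreal (34 * hmom f * a powr (-1/4))"
      by (intro mult_left_mono nn_integral_gconv_centered f pos z \<open>integral\<^sup>L lborel f = 0\<close>) auto
    finally show ?thesis
      using pos hmom_nonneg[of f] by (subst (asm) ennreal_mult[symmetric]) (auto simp: ennreal_le_iff)
  qed
  define v where "v = \<bar>\<integral>z. f z * H z \<partial>gaussm c\<bar>"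
  have v: "v \<le> K * mass f / (2 * pi * c)" if K: "\<And>z. \<bar>H z\<bar> \<le> K" for K
  proof -
    have K0: "0 \<le> K" using K[of 0] by linarith
    have int: "integrable (gaussm c) (\<lambda>z. f z * H z)"
      by (rule C.integrable_const_bound[of _ "B * K"])
        (use B K in \<open>auto intro!: AE_I2 mult_mono simp: abs_mult\<close>)
    have "ennreal v \<le> (\<integral>\<^sup>+z. ennreal \<bar>f z * H z\<bar> \<partial>gaussm c)"
      unfolding v_def using integral_norm_bound_ennreal[OF int] by simp
    also have "\<dots> = (\<integral>\<^sup>+z. ennreal (gauss2 c z) * ennreal \<bar>f z * H z\<bar> \<partial>lborel)"
      by (rule nn_integral_gaussm) auto
    also have "\<dots> \<le> (\<integral>\<^sup>+z. ennreal (1 / (2 * pi * c)) * (ennreal \<bar>f z\<bar> * ennreal K) \<partial>lborel)"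
      using K K0 by (intro nn_integral_mono mult_mono)
        (auto simp: abs_mult ennreal_mult intro!: mult_left_mono ennreal_leI gauss2_le pos)
    also have "\<dots> = ennreal (1 / (2 * pi * c)) * (ennreal (mass f) * ennreal K)"
      by (simp add: nn_integral_cmult nn_integral_multc nn_integral_mass[OF f])
    also have "\<dots> = ennreal (1 / (2 * pi * c) * (mass f * K))"
      using pos K0 mass_nonneg[of f] by (simp add: ennreal_mult[symmetric])
    finally show ?thesis
      using pos K0 mass_nonneg[of f] by (subst (asm) ennreal_le_iff) (auto simp: mult_ac)
  qed
  have nn: "0 \<le> mass f * hmom f" using hmom_nonneg[of f] mass_nonneg[of f] by simp
  have "v \<le> mass f * hmom f * chord a b c"
  proof (rule chordI[OF nn pos])
    have "v \<le> 10 * ((mass f * hmom f) * a powr (-1/4) / (2 * pi * a) / (2 * pi * c))"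
      using v[OF H1] by (simp add: mult_ac)
    also have "\<dots> \<le> 34 * ((mass f * hmom f) * a powr (-1/4) / (2 * pi * a) / (2 * pi * c))"
      by (intro mult_right_mono divide_nonneg_pos mult_nonneg_nonneg[OF nn] mult_pos_pos pos) auto
    finally show "v \<le> 34 * (mass f * hmom f) * a powr (-1/4) / (2 * pi * a) / (2 * pi * c)" by (simp only: times_divide_eq_right mult.assoc)
    show "v \<le> 34 * (mass f * hmom f) * a powr (-1/4) / (2 * pi * b) / (2 * pi * c)"
      using v[OF H2] by (simp add: mult_ac)
  qed
  then show ?thesis unfolding e v_def a_def b_def c_def .
qed

section \<open>Double integrals along the path\<close>

definition dbl :: "R2 set \<Rightarrow> (R2 \<Rightarrow> real) \<Rightarrow> (real \<Rightarrow> R2) \<Rightarrow> real" where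
  "dbl A f x = (\<integral>p. indicator A p * f (x (fst p) - x (snd p)) \<partial>lborel)"

definition tset :: "real \<Rightarrow> R2 set" where
  "tset t = {p. 0 \<le> snd p \<and> snd p \<le> fst p \<and> fst p \<le> t}"

text \<open>Carries the interaction of the path before \<open>a\<close> with the path on
  \<open>(a, b]\<close>. The corner is left open so that \<open>s - a\<close> and
  \<open>a - u\<close> stay positive in the chord bounds.\<close>

definition rset :: "real \<Rightarrow> real \<Rightarrow> R2 set" where
  "rset a b = {p. a < fst p \<and> fst p \<le> b \<and> 0 \<le> snd p \<and> snd p < a}"

abbreviation tri :: "(R2 \<Rightarrow> real) \<Rightarrow> real \<Rightarrow> (real \<Rightarrow> R2) \<Rightarrow> real" where
  "tri f t \<equiv> dbl (tset t) f"

abbreviation rect :: "(R2 \<Rightarrow> real) \<Rightarrow> real \<Rightarrow> real \<Rightarrow> (real \<Rightarrow> R2) \<Rightarrow> real" where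
  "rect f a b \<equiv> dbl (rset a b) f"

definition bcf :: "(R2 \<Rightarrow> real) \<Rightarrow> bool" where
  "bcf f \<longleftrightarrow> continuous_on UNIV f \<and> (\<exists>B. \<forall>x. \<bar>f x\<bar> \<le> B)"

lemma kern_bcf: "kern f \<Longrightarrow> bcf f"
  by (auto simp: kern_def bcf_def)

lemma bcf_measurable: "bcf f \<Longrightarrow> f \<in> borel_measurable borel"
  unfolding bcf_def by (auto intro: borel_measurable_continuous_onI)

lemma bcf_bounded: "bcf f \<Longrightarrow> (\<And>B. 0 \<le> B \<Longrightarrow> (\<And>x. \<bar>f x\<bar> \<le> B) \<Longrightarrow> thesis) \<Longrightarrow> thesis"
  unfolding bcf_def by (meson abs_ge_zero order_trans)

lemma borel_measurable_fst_R2[measurable (raw)]: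
  fixes f :: "'b \<Rightarrow> R2"
  assumes "f \<in> borel_measurable N"
  shows "(\<lambda>x. fst (f x)) \<in> borel_measurable N"
  by (rule borel_measurable_continuous_on[OF linear_continuous_on[OF bounded_linear_fst] assms])

lemma borel_measurable_snd_R2[measurable (raw)]:
  fixes f :: "'b \<Rightarrow> R2"
  assumes "f \<in> borel_measurable N"
  shows "(\<lambda>x. snd (f x)) \<in> borel_measurable N"
  by (rule borel_measurable_continuous_on[OF linear_continuous_on[OF bounded_linear_snd] assms])

lemma measurable_fst_R2[measurable]: "fst \<in> borel_measurable (borel :: R2 measure)"
  by (rule borel_measurable_fst_R2[OF measurable_ident, unfolded id_def])

lemma measurable_snd_R2[measurable]: "snd \<in> borel_measurable (borel :: R2 measure)"
  by (rule borel_measurable_snd_R2[OF measurable_ident, unfolded id_def])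

lemma tset_measurable[measurable]: "tset t \<in> sets borel"
  unfolding tset_def by (intro borel_closed closed_Collect_conj closed_Collect_le continuous_intros)

lemma rset_eq: "rset a b = {a<..b} \<times> {0..<a}"
  by (auto simp: rset_def)

lemma rset_measurable[measurable]: "rset a b \<in> sets borel"
  unfolding rset_eq borel_prod[symmetric] by measurable

lemma tset_subset: "tset t \<subseteq> {0..t} \<times> {0..t}"
  by (auto simp: tset_def)

lemma emeasure_lborel_Times2:
  "emeasure lborel ({a..b} \<times> {c..d} :: R2 set) = ennreal (max 0 (b - a) * max 0 (d - c))"
proof -
  have "emeasure lborel ({a..b} \<times> {c..d} :: R2 set) = emeasure (lborel \<Otimes>\<^sub>M lborel) ({a..b} \<times> {c..d})"
    by (simp add: lborel_prod)
  also have "\<dots> = emeasure lborel {a..b} * emeasure lborel {c..d}"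
    by (rule lborel.emeasure_pair_measure_Times) auto
  also have "\<dots> = ennreal (max 0 (b - a) * max 0 (d - c))"
    by (auto simp: emeasure_lborel_Icc_eq ennreal_mult max_def)
  finally show ?thesis .
qed

lemma emeasure_tset: "t \<ge> 0 \<Longrightarrow> emeasure lborel (tset t) \<le> ennreal (t * t)"
  using emeasure_mono[OF tset_subset[of t], of lborel] by (simp add: emeasure_lborel_Times2 borel_closed closed_Times)

lemma rset_subset: "rset a b \<subseteq> {a..b} \<times> {0..a}"
  by (auto simp: rset_def)

lemma emeasure_rset: "0 \<le> a \<Longrightarrow> a \<le> b \<Longrightarrow> emeasure lborel (rset a b) \<le> ennreal ((b - a) * a)"
  using emeasure_mono[OF rset_subset[of a b], of lborel] by (simp add: emeasure_lborel_Times2 borel_closed closed_Times)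

lemma emeasure_tset_finite: "emeasure lborel (tset t) < \<infinity>"
  by (rule le_less_trans[OF emeasure_mono[OF tset_subset]]) (auto simp: emeasure_lborel_Times2 intro!: borel_closed closed_Times)

lemma emeasure_rset_finite: "emeasure lborel (rset a b) < \<infinity>"
  by (rule le_less_trans[OF emeasure_mono[OF rset_subset]]) (auto simp: emeasure_lborel_Times2 intro!: borel_closed closed_Times)

lemma dbl_integrable:
  assumes f: "bcf f" and x[measurable]: "x \<in> borel_measurable borel" and [measurable]: "A \<in> sets borel"
    and fin: "emeasure lborel A < \<infinity>"
  shows "integrable lborel (\<lambda>p :: R2. indicator A p * f (x (fst p) - x (snd p)))"
proof -
  note [measurable] = bcf_measurable[OF f]
  note [measurable] = measurable_compose[OF measurable_fst_R2 x] measurable_compose[OF measurable_snd_R2 x]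
  obtain B where B: "0 \<le> B" "\<And>x. \<bar>f x\<bar> \<le> B" using bcf_bounded[OF f] by blast
  show ?thesis
  proof (rule Bochner_Integration.integrable_bound)
    show "integrable lborel (\<lambda>p. indicator A p * B)" using fin by (intro integrable_mult_left integrable_real_indicator) auto
    show "AE p in lborel. norm (indicator A p * f (x (fst p) - x (snd p))) \<le> norm (indicator A p * B)"
      using B by (intro AE_I2) (simp add: abs_mult indicator_def)
    show "(\<lambda>p. indicator A p * f (x (fst p) - x (snd p))) \<in> borel_measurable lborel" by measurable
  qed
qed

lemma dbl_bound:
  assumes B: "0 \<le> B" "\<And>x. \<bar>f x\<bar> \<le> B" and f: "bcf f" and x: "x \<in> borel_measurable borel" and [measurable]: "A \<in> sets borel"
    and fin: "emeasure lborel A \<le> ennreal v" "0 \<le> v"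
  shows "\<bar>dbl A f x\<bar> \<le> B * v"
proof -
  have lt: "emeasure lborel A < \<infinity>" using fin by (auto intro: le_less_trans)
  have "\<bar>dbl A f x\<bar> \<le> (\<integral>p. indicator A p * B \<partial>lborel)"
    unfolding dbl_def
  proof (rule order_trans[OF integral_abs_bound], rule integral_mono)
    show "integrable lborel (\<lambda>p. \<bar>indicator A p * f (x (fst p) - x (snd p))\<bar>)"
      using dbl_integrable[OF f x _ lt] by auto
    show "integrable lborel (\<lambda>p. indicator A p * B)" using lt by (intro integrable_mult_left integrable_real_indicator) auto
    show "\<bar>indicator A p * f (x (fst p) - x (snd p))\<bar> \<le> indicator A p * B" for p
      using B by (simp add: abs_mult indicator_def)
  qed
  also have "\<dots> = measure lborel A * B" by simp
  also have "\<dots> \<le> v * B" using fin B by (intro mult_right_mono) (auto simp: measure_def enn2real_leI)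
  finally show ?thesis by (simp add: mult.commute)
qed

section \<open>Integrable majorants for the time singularities\<close>

text \<open>The arguments are distances to the time at which the path is split. The value on the
  diagonal is infinite because the chord bounds say nothing about chords that share an end point;
  the diagonal is a null set.\<close>

definition skern :: "real \<Rightarrow> real \<Rightarrow> real \<Rightarrow> real \<Rightarrow> ennreal" where
  "skern k t x y = (if x = y then \<infinity> else ennreal (\<bar>x - y\<bar> powr (- k) * (min x y) powr (- t)))"

lemma skern_measurable[measurable]:
  assumes [measurable]: "f \<in> borel_measurable M" "g \<in> borel_measurable M"
  shows "(\<lambda>w. skern k t (f w) (g w)) \<in> borel_measurable M"
  unfolding skern_def by measurable

lemma nn_integral_powr_0:
  assumes "t < 1" "0 \<le> h"
  shows "(\<integral>\<^sup>+x. indicator {0<..h} x * ennreal (x powr (- t)) \<partial>lborel) = ennreal (h powr (1 - t) / (1 - t))"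
proof -
  have "((\<lambda>x. x powr (- t)) has_integral (h powr (- t + 1) / (- t + 1))) {0..h}"
    by (rule has_integral_powr_from_0) (use assms in auto)
  then have "((\<lambda>x. if x \<in> {0..h} then x powr (- t) else 0) has_integral (h powr (- t + 1) / (- t + 1))) UNIV"
    by (subst has_integral_restrict_UNIV)
  moreover have "(\<lambda>x. if x \<in> {0..h} then x powr (- t) else 0) = (\<lambda>x. indicator {0<..h} x * x powr (- t))"
    by (auto simp: fun_eq_iff indicator_def)
  ultimately have "((\<lambda>x. indicator {0<..h} x * x powr (- t)) has_integral (h powr (1 - t) / (1 - t))) UNIV"
    by simp
  then have "(\<integral>\<^sup>+x. ennreal (indicator {0<..h} x * x powr (- t)) \<partial>lborel) = ennreal (h powr (1 - t) / (1 - t))"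
    by (rule nn_integral_has_integral_lborel[rotated 2]) auto
  then show ?thesis by (simp add: ennreal_mult ennreal_indicator)
qed

text \<open>On each half \<open>x < y\<close> and \<open>y < x\<close> the shift to the variable
  \<open>y - x\<close> separates the two powers; their total degree \<open>2 - k - t\<close> is the
  power of \<open>h\<close>.\<close>

lemma skern_integral:
  assumes "0 \<le> k" "k < 1" "0 \<le> t" "t < 1" "0 < h"
  shows "(\<integral>\<^sup>+x. \<integral>\<^sup>+y. indicator {0<..h} x * (indicator {0<..h} y * skern k t x y) \<partial>lborel \<partial>lborel)
    \<le> ennreal (2 / ((1 - k) * (1 - t)) * h powr (2 - k - t))"
proof -
  define L where "L x y = indicator {0<..h} x * (indicator {0<..h} y * (if x < y then ennreal ((y - x) powr (- k) * x powr (- t)) else 0))" for x y :: real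
  have [measurable]: "(\<lambda>(x, y). L x y) \<in> borel_measurable (lborel \<Otimes>\<^sub>M lborel)"
    unfolding L_def by measurable
  have [measurable]: "(\<lambda>y. L x y) \<in> borel_measurable lborel" "(\<lambda>y. L y x) \<in> borel_measurable lborel" for x
    unfolding L_def by measurable
  have Lint: "(\<integral>\<^sup>+y. L x y \<partial>lborel) \<le> indicator {0<..h} x * ennreal (x powr (- t)) * ennreal (h powr (1 - k) / (1 - k))" for x
  proof (cases "0 < x \<and> x \<le> h")
    case True
    have "(\<integral>\<^sup>+y. L x y \<partial>lborel) = (\<integral>\<^sup>+y. L x (x + 1 * y) \<partial>lborel)"
      by (subst nn_integral_real_affine[of _ 1 x]) auto
    also have "\<dots> \<le> (\<integral>\<^sup>+y. ennreal (x powr (- t)) * (indicator {0<..h} y * ennreal (y powr (- k))) \<partial>lborel)"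
      by (intro nn_integral_mono) (use True in \<open>auto simp: L_def indicator_def ennreal_mult mult_ac\<close>)
    also have "\<dots> = ennreal (x powr (- t)) * ennreal (h powr (1 - k) / (1 - k))"
      by (subst nn_integral_cmult) (use assms in \<open>auto simp: nn_integral_powr_0\<close>)
    finally show ?thesis using True by simp
  qed (auto simp: L_def)
  have "(\<integral>\<^sup>+x. \<integral>\<^sup>+y. indicator {0<..h} x * (indicator {0<..h} y * skern k t x y) \<partial>lborel \<partial>lborel)
    \<le> (\<integral>\<^sup>+x. \<integral>\<^sup>+y. L x y + L y x \<partial>lborel \<partial>lborel)"
  proof (rule nn_integral_mono, rule nn_integral_mono_AE)
    fix x :: real
    show "AE y in lborel. indicator {0<..h} x * (indicator {0<..h} y * skern k t x y) \<le> L x y + L y x"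
      using AE_lborel_singleton[of x]
      by eventually_elim (auto simp: L_def skern_def indicator_def min_def abs_if)
  qed
  also have "\<dots> = (\<integral>\<^sup>+x. \<integral>\<^sup>+y. L x y \<partial>lborel \<partial>lborel) + (\<integral>\<^sup>+x. \<integral>\<^sup>+y. L y x \<partial>lborel \<partial>lborel)"
    by (simp add: nn_integral_add)
  also have "(\<integral>\<^sup>+x. \<integral>\<^sup>+y. L y x \<partial>lborel \<partial>lborel) = (\<integral>\<^sup>+y. \<integral>\<^sup>+x. L y x \<partial>lborel \<partial>lborel)"
    by (rule lborel_pair.Fubini') (unfold L_def, measurable)
  also have "(\<integral>\<^sup>+x. \<integral>\<^sup>+y. L x y \<partial>lborel \<partial>lborel) + (\<integral>\<^sup>+y. \<integral>\<^sup>+x. L y x \<partial>lborel \<partial>lborel)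
     = 2 * (\<integral>\<^sup>+x. \<integral>\<^sup>+y. L x y \<partial>lborel \<partial>lborel)"
    by (simp add: mult_2)
  also have "\<dots> \<le> 2 * (\<integral>\<^sup>+x. indicator {0<..h} x * ennreal (x powr (- t)) * ennreal (h powr (1 - k) / (1 - k)) \<partial>lborel)"
    by (intro mult_left_mono nn_integral_mono Lint) auto
  also have "\<dots> = 2 * (ennreal (h powr (1 - t) / (1 - t)) * ennreal (h powr (1 - k) / (1 - k)))"
    by (subst nn_integral_multc) (use assms in \<open>auto simp: nn_integral_powr_0\<close>)
  also have "\<dots> = ennreal (2 / ((1 - k) * (1 - t)) * h powr (2 - k - t))"
  proof -
    have "h powr (2 - k - t) = h powr (1 - t) * h powr (1 - k)"
      by (simp add: powr_add[symmetric] algebra_simps)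
    then show ?thesis using assms
      by (simp add: ennreal_mult[symmetric] ennreal_numeral[symmetric] mult_ac del: ennreal_numeral)
  qed
  finally show ?thesis .
qed

text \<open>The factor \<open>1 / c\<close> of \<open>chord\<close> is singular at the corner where
  both chords shrink to the splitting time. The split into powers \<open>7/8\<close> and
  \<open>1/8\<close> makes it integrable in either variable and puts only \<open>1/8\<close> on the
  time after the split: the final exponent is \<open>2 - 1/2 - 1/8 = 11/8\<close>.\<close>

lemma inverse_sum_bound:
  assumes "0 < s" "0 < (u::real)"
  shows "1 / (s + u) \<le> u powr (-7/8) * s powr (-1/8)"
proof -
  define m where "m = max s u"
  have m: "0 < m" "s \<le> m" "u \<le> m" "m \<le> s + u" using assms by (auto simp: m_def)
  have "1 / (s + u) \<le> 1 / m" using m by (intro divide_left_mono) auto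
  also have "1 / m = m powr (-1)" using m by (simp add: powr_minus_divide)
  also have "\<dots> = m powr (-7/8) * m powr (-1/8)" by (subst powr_add[symmetric]) simp
  also have "\<dots> \<le> u powr (-7/8) * s powr (-1/8)"
    using m assms by (intro mult_mono powr_mono2') auto
  finally show ?thesis .
qed

lemma skern_commute: "skern k t x y = skern k t y x"
  by (simp add: skern_def abs_minus_commute min.commute)

text \<open>The chord from \<open>u\<close> to \<open>s\<close> ends first. If it also starts first,
  the chords interlace, otherwise the other one contains it; in both cases the common interval runs
  from \<open>max u u'\<close> to \<open>s\<close>.\<close>

lemma bm_chords_less:
  assumes X: "bm M X" and f: "kern f" and z: "(\<integral>x. f x \<partial>lborel) = 0" and Q: "mass f * hmom f \<le> Q"
    and p: "a < s" "0 \<le> u" "u < a" and q: "0 \<le> u'" "u' < a" "s < s'" "u \<noteq> u'"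
  shows "ennreal \<bar>\<integral>\<omega>. f (X s \<omega> - X u \<omega>) * f (X s' \<omega> - X u' \<omega>) \<partial>M\<bar>
    \<le> ennreal Q * (skern (1/2) (1/8) (s - a) (s' - a) * skern (3/4) (7/8) (a - u) (a - u'))"
proof -
  define v where "v = \<bar>\<integral>\<omega>. f (X s \<omega> - X u \<omega>) * f (X s' \<omega> - X u' \<omega>) \<partial>M\<bar>"
  define w where "w = max u u'"
  have w: "w < a" using p q by (simp add: w_def)
  have v: "v \<le> mass f * hmom f * chord \<bar>u - u'\<bar> (s' - s) (s - w)"
  proof (cases "u < u'")
    case True
    then show ?thesis
      using bm_interlaced[OF X p(2) True _ q(3) f z] p q by (simp add: v_def w_def max_def)
  next
    case False
    then have "u' < u" using q by simp
    then show ?thesis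
      using bm_nested[OF X q(1) _ _ q(3) f z, of u] p q by (simp add: v_def w_def max_def)
  qed
  define K where "K = (s' - s) powr (-1/2) * (s - a) powr (-1/8) * (\<bar>u - u'\<bar> powr (-3/4) * (a - w) powr (-7/8))"
  have Q0: "0 \<le> Q" using Q mass_nonneg[of f] hmom_nonneg[of f] by (meson mult_nonneg_nonneg order_trans)
  have c: "1 / (s - w) \<le> (a - w) powr (-7/8) * (s - a) powr (-1/8)"
    using inverse_sum_bound[of "s - a" "a - w"] p w by simp
  have "v \<le> Q * chord \<bar>u - u'\<bar> (s' - s) (s - w)"
    by (rule order_trans[OF v mult_right_mono[OF Q]]) (use w p in \<open>simp add: chord_def\<close>)
  also have "chord \<bar>u - u'\<bar> (s' - s) (s - w) = \<bar>u - u'\<bar> powr (-3/4) * (s' - s) powr (-1/2) * (1 / (s - w))"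
    by (simp add: chord_def)
  also have "Q * \<dots> \<le> Q * (\<bar>u - u'\<bar> powr (-3/4) * (s' - s) powr (-1/2) * ((a - w) powr (-7/8) * (s - a) powr (-1/8)))"
    by (intro mult_left_mono c Q0) auto
  also have "\<dots> = Q * K" by (simp add: K_def mult_ac)
  finally have "ennreal v \<le> ennreal Q * ennreal K"
    using Q0 by (simp add: ennreal_mult[symmetric] K_def)
  moreover have "min (s - a) (s' - a) = s - a" "min (a - u) (a - u') = a - w" using q by (auto simp: w_def)
  then have "ennreal K = skern (1/2) (1/8) (s - a) (s' - a) * skern (3/4) (7/8) (a - u) (a - u')"
    using q by (auto simp: skern_def K_def ennreal_mult[symmetric] abs_minus_commute)
  ultimately show ?thesis by (simp add: v_def)
qed

text \<open>Coinciding end points are covered by the infinite value of \<open>skern\<close>;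
  \<open>0 < Q\<close> and the nonvanishing of the other factor keep the product infinite.\<close>

lemma bm_chords:
  assumes X: "bm M X" and f: "kern f" and z: "(\<integral>x. f x \<partial>lborel) = 0" and Q: "mass f * hmom f \<le> Q" "0 < Q"
    and p: "a < s" "0 \<le> u" "u < a" and q: "a < s'" "0 \<le> u'" "u' < a"
  shows "ennreal \<bar>\<integral>\<omega>. f (X s \<omega> - X u \<omega>) * f (X s' \<omega> - X u' \<omega>) \<partial>M\<bar>
    \<le> ennreal Q * (skern (1/2) (1/8) (s - a) (s' - a) * skern (3/4) (7/8) (a - u) (a - u'))"
proof -
  consider "s = s' \<or> u = u'" | "s < s'" "u \<noteq> u'" | "s' < s" "u \<noteq> u'" by linarith
  then show ?thesis
  proof cases
    case 1
    have pos: "skern (1/2) (1/8) (s - a) (s' - a) \<noteq> 0" "skern (3/4) (7/8) (a - u) (a - u') \<noteq> 0"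
      using p q by (auto simp: skern_def min_def)
    have "skern (1/2) (1/8) (s - a) (s' - a) = \<infinity> \<or> skern (3/4) (7/8) (a - u) (a - u') = \<infinity>"
      using 1 by (auto simp: skern_def)
    then have "ennreal Q * (skern (1/2) (1/8) (s - a) (s' - a) * skern (3/4) (7/8) (a - u) (a - u')) = \<infinity>"
      using pos Q(2) by (auto simp: ennreal_mult_eq_top_iff)
    then show ?thesis by simp
  next
    case 2
    then show ?thesis by (intro bm_chords_less[OF X f z Q(1)]) (use p q in auto)
  next
    case 3
    have "(\<integral>\<omega>. f (X s \<omega> - X u \<omega>) * f (X s' \<omega> - X u' \<omega>) \<partial>M) = (\<integral>\<omega>. f (X s' \<omega> - X u' \<omega>) * f (X s \<omega> - X u \<omega>) \<partial>M)"
      by (simp add: mult.commute)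
    then show ?thesis
      using bm_chords_less[OF X f z Q(1), of a s' u' u s] 3 p q
      by (simp add: skern_commute)
  qed
qed

section \<open>Measurability and Fubini for double integrals\<close>

lemma bm_chord_measurable:
  assumes X: "bm M X" and f: "bcf f" and [measurable]: "A \<in> sets borel"
  shows "(\<lambda>(p, \<omega>). indicator A p * f (X (fst p) \<omega> - X (snd p) \<omega>)) \<in> borel_measurable (lborel \<Otimes>\<^sub>M M)"
proof -
  note [measurable] = bcf_measurable[OF f] bm_joint_measurable[OF X]
  have "(\<lambda>q :: R2 \<times> 'a. (\<lambda>(t, \<omega>). X t \<omega>) (fst (fst q), snd q)) \<in> borel_measurable (lborel \<Otimes>\<^sub>M M)"
    by (rule measurable_compose[OF _ bm_joint_measurable[OF X]]) measurable
  moreover have "(\<lambda>q :: R2 \<times> 'a. (\<lambda>(t, \<omega>). X t \<omega>) (snd (fst q), snd q)) \<in> borel_measurable (lborel \<Otimes>\<^sub>M M)"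
    by (rule measurable_compose[OF _ bm_joint_measurable[OF X]]) measurable
  ultimately have [measurable]: "(\<lambda>q :: R2 \<times> 'a. X (fst (fst q)) (snd q)) \<in> borel_measurable (lborel \<Otimes>\<^sub>M M)"
    "(\<lambda>q :: R2 \<times> 'a. X (snd (fst q)) (snd q)) \<in> borel_measurable (lborel \<Otimes>\<^sub>M M)" by (auto simp: case_prod_beta)
  show ?thesis unfolding case_prod_beta by measurable
qed

lemma dbl_measurable:
  assumes X: "bm M X" and f: "bcf f" and A: "A \<in> sets borel"
  shows "(\<lambda>\<omega>. dbl A f (\<lambda>s. X s \<omega>)) \<in> borel_measurable M"
proof -
  have "(\<lambda>(\<omega>, p). indicator A p * f (X (fst p) \<omega> - X (snd p) \<omega>)) \<in> borel_measurable (M \<Otimes>\<^sub>M lborel)"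
    using measurable_comp[OF measurable_pair_swap' bm_chord_measurable[OF X f A]]
    by (simp add: comp_def case_prod_beta)
  then show ?thesis unfolding dbl_def by (rule lborel.borel_measurable_lebesgue_integral)
qed

lemma bm_path_measurable: "bm M X \<Longrightarrow> \<omega> \<in> space M \<Longrightarrow> (\<lambda>s. X s \<omega>) \<in> borel_measurable borel"
  by (rule borel_measurable_continuous_onI[OF bm_continuous])

text \<open>The bounded factor \<open>Y\<close> lets the square of a double integral be expanded one
  factor at a time: first \<open>Y\<close> is the double integral itself, then the kernel at a fixed
  pair of times.\<close>

lemma expectation_dbl:
  assumes X: "bm M X" and f: "bcf f" and A: "A \<in> sets borel" and fin: "emeasure lborel A < \<infinity>"
    and Y[measurable]: "Y \<in> borel_measurable M" and YB: "\<And>\<omega>. \<omega> \<in> space M \<Longrightarrow> \<bar>Y \<omega>\<bar> \<le> C"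
  shows "(\<integral>\<omega>. Y \<omega> * dbl A f (\<lambda>s. X s \<omega>) \<partial>M)
    = (\<integral>p. indicator A p * (\<integral>\<omega>. Y \<omega> * f (X (fst p) \<omega> - X (snd p) \<omega>) \<partial>M) \<partial>lborel)" (is ?eq)
   and "integrable lborel (\<lambda>p. indicator A p * (\<integral>\<omega>. Y \<omega> * f (X (fst p) \<omega> - X (snd p) \<omega>) \<partial>M))" (is ?int)
proof -
  interpret prob_space M by (rule bm_prob_space[OF X])
  interpret P: pair_sigma_finite lborel M ..
  obtain B where B: "0 \<le> B" "\<And>x. \<bar>f x\<bar> \<le> B" using bcf_bounded[OF f] by blast
  note m = bm_chord_measurable[OF X f A]
  have C: "0 \<le> C" using YB not_empty by force
  define g where "g q = Y (snd q) * (indicator A (fst q) * f (X (fst (fst q)) (snd q) - X (snd (fst q)) (snd q)))" for q :: "R2 \<times> 'a"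
  have [measurable]: "g \<in> borel_measurable (lborel \<Otimes>\<^sub>M M)"
    using m unfolding g_def case_prod_beta by measurable
  have int: "integrable (lborel \<Otimes>\<^sub>M M) g"
  proof (rule Bochner_Integration.integrable_bound)
    have "emeasure (lborel \<Otimes>\<^sub>M M) (A \<times> space M) < \<infinity>"
      using fin A by (subst emeasure_pair_measure_Times) (auto simp: emeasure_space_1)
    then show "integrable (lborel \<Otimes>\<^sub>M M) (\<lambda>q. indicator (A \<times> space M) q * (C * B))"
      using A by (intro integrable_mult_left integrable_real_indicator) auto
    show "AE q in lborel \<Otimes>\<^sub>M M. norm (g q) \<le> norm (indicator (A \<times> space M) q * (C * B))"
    proof (rule AE_I2)
      fix q :: "R2 \<times> 'a" assume "q \<in> space (lborel \<Otimes>\<^sub>M M)"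
      then have s: "snd q \<in> space M" by (auto simp: space_pair_measure)
      then have "\<bar>Y (snd q) * f (X (fst (fst q)) (snd q) - X (snd (fst q)) (snd q))\<bar> \<le> C * B"
        unfolding abs_mult by (intro mult_mono YB B C) auto
      then show "norm (g q) \<le> norm (indicator (A \<times> space M) q * (C * B))"
        using s C B by (cases q) (auto simp: g_def indicator_def)
    qed
  qed simp
  have "(\<integral>p. \<integral>\<omega>. g (p, \<omega>) \<partial>M \<partial>lborel) = (\<integral>\<omega>. \<integral>p. g (p, \<omega>) \<partial>lborel \<partial>M)"
    using P.Fubini_integral[of "\<lambda>p \<omega>. g (p, \<omega>)"] int by (simp add: case_prod_eta)
  moreover have "(\<integral>\<omega>. g (p, \<omega>) \<partial>M) = indicator A p * (\<integral>\<omega>. Y \<omega> * f (X (fst p) \<omega> - X (snd p) \<omega>) \<partial>M)" for p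
    by (simp add: g_def mult.left_commute[of "Y _"])
  moreover have "(\<integral>p. g (p, \<omega>) \<partial>lborel) = Y \<omega> * dbl A f (\<lambda>s. X s \<omega>)" for \<omega>
    by (simp add: g_def dbl_def)
  ultimately show ?eq by simp
  have "integrable lborel (\<lambda>p. \<integral>\<omega>. g (p, \<omega>) \<partial>M)" using P.integrable_fst'[OF int] .
  then show ?int by (simp add: g_def mult.left_commute[of "Y _"])
qed

lemma expectation_dbl_sq:
  assumes X: "bm M X" and f: "bcf f" and A: "A \<in> sets borel" and fin: "emeasure lborel A < \<infinity>"
  shows "ennreal (\<integral>\<omega>. (dbl A f (\<lambda>s. X s \<omega>))\<^sup>2 \<partial>M) \<le>
    (\<integral>\<^sup>+p. indicator A p * (\<integral>\<^sup>+q. indicator A q *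
       ennreal \<bar>\<integral>\<omega>. f (X (fst p) \<omega> - X (snd p) \<omega>) * f (X (fst q) \<omega> - X (snd q) \<omega>) \<partial>M\<bar> \<partial>lborel) \<partial>lborel)"
proof -
  interpret prob_space M by (rule bm_prob_space[OF X])
  obtain B where B: "0 \<le> B" "\<And>x. \<bar>f x\<bar> \<le> B" using bcf_bounded[OF f] by blast
  note [measurable] = bm_measurable[OF X] bcf_measurable[OF f] dbl_measurable[OF X f A]
  define v where "v = enn2real (emeasure lborel A)"
  have v: "emeasure lborel A \<le> ennreal v" "0 \<le> v" using fin by (auto simp: v_def)
  let ?D = "\<lambda>\<omega>. dbl A f (\<lambda>s. X s \<omega>)"
  have bD: "\<bar>?D \<omega>\<bar> \<le> B * v" if "\<omega> \<in> space M" for \<omega>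
    by (rule dbl_bound[OF B f bm_path_measurable[OF X that] A v])
  note e1 = expectation_dbl[OF X f A fin, of ?D "B * v", OF _ bD]
  have i1: "integrable lborel (\<lambda>p. indicator A p * (\<integral>\<omega>. ?D \<omega> * f (X (fst p) \<omega> - X (snd p) \<omega>) \<partial>M))"
    by (rule e1(2)) measurable
  have "ennreal (\<integral>\<omega>. (?D \<omega>)\<^sup>2 \<partial>M) = ennreal \<bar>\<integral>\<omega>. ?D \<omega> * ?D \<omega> \<partial>M\<bar>"
    by (simp add: power2_eq_square)
  also have "(\<integral>\<omega>. ?D \<omega> * ?D \<omega> \<partial>M) = (\<integral>p. indicator A p * (\<integral>\<omega>. ?D \<omega> * f (X (fst p) \<omega> - X (snd p) \<omega>) \<partial>M) \<partial>lborel)"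
    by (rule e1(1)) measurable
  also have "ennreal \<bar>\<dots>\<bar> \<le> (\<integral>\<^sup>+p. ennreal \<bar>indicator A p * (\<integral>\<omega>. ?D \<omega> * f (X (fst p) \<omega> - X (snd p) \<omega>) \<partial>M)\<bar> \<partial>lborel)"
    using integral_norm_bound_ennreal[OF i1] by simp
  also have "\<dots> \<le> (\<integral>\<^sup>+p. indicator A p * (\<integral>\<^sup>+q. indicator A q *
       ennreal \<bar>\<integral>\<omega>. f (X (fst p) \<omega> - X (snd p) \<omega>) * f (X (fst q) \<omega> - X (snd q) \<omega>) \<partial>M\<bar> \<partial>lborel) \<partial>lborel)"
  proof (rule nn_integral_mono)
    fix p :: R2
    let ?Y = "\<lambda>\<omega>. f (X (fst p) \<omega> - X (snd p) \<omega>)"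
    note e2 = expectation_dbl[OF X f A fin, of ?Y B, OF _ B(2)]
    have i2: "integrable lborel (\<lambda>q. indicator A q * (\<integral>\<omega>. ?Y \<omega> * f (X (fst q) \<omega> - X (snd q) \<omega>) \<partial>M))"
      by (rule e2(2)) measurable
    have "ennreal \<bar>\<integral>\<omega>. ?D \<omega> * ?Y \<omega> \<partial>M\<bar> = ennreal \<bar>\<integral>\<omega>. ?Y \<omega> * ?D \<omega> \<partial>M\<bar>"
      by (simp add: mult.commute)
    also have "(\<integral>\<omega>. ?Y \<omega> * ?D \<omega> \<partial>M) = (\<integral>q. indicator A q * (\<integral>\<omega>. ?Y \<omega> * f (X (fst q) \<omega> - X (snd q) \<omega>) \<partial>M) \<partial>lborel)"
      by (rule e2(1)) measurable
    also have "ennreal \<bar>\<dots>\<bar> \<le> (\<integral>\<^sup>+q. ennreal \<bar>indicator A q * (\<integral>\<omega>. ?Y \<omega> * f (X (fst q) \<omega> - X (snd q) \<omega>) \<partial>M)\<bar> \<partial>lborel)"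
      using integral_norm_bound_ennreal[OF i2] by simp
    also have "\<dots> = (\<integral>\<^sup>+q. indicator A q * ennreal \<bar>\<integral>\<omega>. ?Y \<omega> * f (X (fst q) \<omega> - X (snd q) \<omega>) \<partial>M\<bar> \<partial>lborel)"
      by (intro nn_integral_cong) (simp add: abs_mult ennreal_mult ennreal_indicator)
    finally have "indicator A p * ennreal \<bar>\<integral>\<omega>. ?D \<omega> * ?Y \<omega> \<partial>M\<bar> \<le> indicator A p * \<dots>"
      by (rule mult_left_mono) simp
    moreover have "ennreal \<bar>indicator A p * (\<integral>\<omega>. ?D \<omega> * ?Y \<omega> \<partial>M)\<bar> = indicator A p * ennreal \<bar>\<integral>\<omega>. ?D \<omega> * ?Y \<omega> \<partial>M\<bar>"
      by (simp add: abs_mult ennreal_mult ennreal_indicator)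
    ultimately show "ennreal \<bar>indicator A p * (\<integral>\<omega>. ?D \<omega> * ?Y \<omega> \<partial>M)\<bar> \<le> indicator A p * (\<integral>\<^sup>+q. indicator A q *
       ennreal \<bar>\<integral>\<omega>. ?Y \<omega> * f (X (fst q) \<omega> - X (snd q) \<omega>) \<partial>M\<bar> \<partial>lborel)"
      by simp
  qed
  finally show ?thesis .
qed

lemma nn_integral_R2:
  fixes f :: "R2 \<Rightarrow> ennreal"
  assumes [measurable]: "f \<in> borel_measurable borel"
  shows "(\<integral>\<^sup>+p. f p \<partial>lborel) = (\<integral>\<^sup>+s. \<integral>\<^sup>+u. f (s, u) \<partial>lborel \<partial>lborel)"
  by (subst lborel_prod[symmetric], subst lborel.nn_integral_fst[symmetric]) (auto simp: lborel_prod)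

lemma nn_integral_R2_mult:
  assumes g: "g \<in> borel_measurable borel" and h: "h \<in> borel_measurable borel"
  shows "(\<integral>\<^sup>+p. g (fst p) * h (snd p) \<partial>(lborel :: R2 measure)) = (\<integral>\<^sup>+s. g s \<partial>lborel) * (\<integral>\<^sup>+u. h u \<partial>lborel)"
proof -
  note [measurable] = g h measurable_compose[OF measurable_fst_R2 g] measurable_compose[OF measurable_snd_R2 h]
  show ?thesis by (subst nn_integral_R2) (auto simp: nn_integral_cmult nn_integral_multc)
qed

text \<open>The majorant factorises into a part in the end times and a part in the start times. The
  former yields \<open>h powr (11/8)\<close>, the latter is bounded because
  \<open>a \<le> 1\<close>.\<close>

lemma rect_second_moment:
  assumes X: "bm M X" and f: "kern f" and z: "(\<integral>x. f x \<partial>lborel) = 0" and Q: "mass f * hmom f \<le> Q" "0 < Q"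
    and a: "0 < a" "a \<le> 1" and h: "0 < h"
  shows "(\<integral>\<omega>. (rect f a (a + h) (\<lambda>s. X s \<omega>))\<^sup>2 \<partial>M) \<le> 300 * Q * h powr (11/8)"
proof -
  define S where "S s s' = indicator {0<..h} (s - a) * (indicator {0<..h} (s' - a) * skern (1/2) (1/8) (s - a) (s' - a))" for s s'
  define U where "U u u' = indicator {0<..a} (a - u) * (indicator {0<..a} (a - u') * skern (3/4) (7/8) (a - u) (a - u'))" for u u'
  have [measurable]: "(\<lambda>w. S (k w) (l w)) \<in> borel_measurable N" "(\<lambda>w. U (k w) (l w)) \<in> borel_measurable N"
    if [measurable]: "k \<in> borel_measurable N" "l \<in> borel_measurable N" for k l and N :: "'b measure"
    unfolding S_def U_def by measurable
  have [measurable]: "(\<lambda>w. S (k w) (l w)) \<in> borel_measurable N" "(\<lambda>w. U (k w) (l w)) \<in> borel_measurable N"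
    if [measurable]: "k \<in> borel_measurable N" "l \<in> borel_measurable N" for k l and N :: "real measure"
    unfolding S_def U_def by measurable
  have [measurable]: "(\<lambda>w. S (k w) (l w)) \<in> borel_measurable N" "(\<lambda>w. U (k w) (l w)) \<in> borel_measurable N"
    if [measurable]: "k \<in> borel_measurable N" "l \<in> borel_measurable N" for k l and N :: "R2 measure"
    unfolding S_def U_def by measurable
  have Sint: "(\<integral>\<^sup>+s. \<integral>\<^sup>+s'. S s s' \<partial>lborel \<partial>lborel) \<le> ennreal (32/7 * h powr (11/8))"
  proof -
    have "(\<integral>\<^sup>+s. \<integral>\<^sup>+s'. S s s' \<partial>lborel \<partial>lborel) = (\<integral>\<^sup>+s. \<integral>\<^sup>+s'. S (a + s) (a + s') \<partial>lborel \<partial>lborel)"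
      using nn_integral_real_affine[of "\<lambda>s. \<integral>\<^sup>+s'. S s s' \<partial>lborel" 1 a]
        nn_integral_real_affine[of "\<lambda>s'. S (a + s) s'" 1 a for s] by simp
    also have "\<dots> \<le> ennreal (2 / ((1 - 1/2) * (1 - 1/8)) * h powr (2 - 1/2 - 1/8))"
      unfolding S_def using skern_integral[of "1/2" "1/8" h] h by simp
    finally show ?thesis by simp
  qed
  have Uint: "(\<integral>\<^sup>+u. \<integral>\<^sup>+u'. U u u' \<partial>lborel \<partial>lborel) \<le> ennreal 64"
  proof -
    have "(\<integral>\<^sup>+u. \<integral>\<^sup>+u'. U u u' \<partial>lborel \<partial>lborel) = (\<integral>\<^sup>+u. \<integral>\<^sup>+u'. U (a - u) (a - u') \<partial>lborel \<partial>lborel)"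
      using nn_integral_real_affine[of "\<lambda>u. \<integral>\<^sup>+u'. U u u' \<partial>lborel" "-1" a]
        nn_integral_real_affine[of "\<lambda>u'. U (a - u) u'" "-1" a for u] by simp
    also have "\<dots> \<le> ennreal (2 / ((1 - 3/4) * (1 - 7/8)) * a powr (2 - 3/4 - 7/8))"
      unfolding U_def using skern_integral[of "3/4" "7/8" a] a by simp
    also have "\<dots> \<le> ennreal (64 * 1)"
      using a by (intro ennreal_leI mult_mono) (auto intro: powr_le1)
    finally show ?thesis by simp
  qed
  have "ennreal (\<integral>\<omega>. (rect f a (a + h) (\<lambda>s. X s \<omega>))\<^sup>2 \<partial>M)
    \<le> (\<integral>\<^sup>+p. indicator (rset a (a + h)) p * (\<integral>\<^sup>+q. indicator (rset a (a + h)) q *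
       ennreal \<bar>\<integral>\<omega>. f (X (fst p) \<omega> - X (snd p) \<omega>) * f (X (fst q) \<omega> - X (snd q) \<omega>) \<partial>M\<bar> \<partial>lborel) \<partial>lborel)"
    by (rule expectation_dbl_sq[OF X kern_bcf[OF f] rset_measurable emeasure_rset_finite])
  also have "\<dots> \<le> (\<integral>\<^sup>+p. \<integral>\<^sup>+q. ennreal Q * (S (fst p) (fst q) * U (snd p) (snd q)) \<partial>lborel \<partial>lborel)"
  proof (intro nn_integral_mono)
    fix p :: R2
    show "indicator (rset a (a + h)) p * (\<integral>\<^sup>+q. indicator (rset a (a + h)) q *
       ennreal \<bar>\<integral>\<omega>. f (X (fst p) \<omega> - X (snd p) \<omega>) * f (X (fst q) \<omega> - X (snd q) \<omega>) \<partial>M\<bar> \<partial>lborel)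
      \<le> (\<integral>\<^sup>+q. ennreal Q * (S (fst p) (fst q) * U (snd p) (snd q)) \<partial>lborel)"
    proof (cases "p \<in> rset a (a + h)")
      case True
      have "(\<integral>\<^sup>+q. indicator (rset a (a + h)) q *
       ennreal \<bar>\<integral>\<omega>. f (X (fst p) \<omega> - X (snd p) \<omega>) * f (X (fst q) \<omega> - X (snd q) \<omega>) \<partial>M\<bar> \<partial>lborel)
      \<le> (\<integral>\<^sup>+q. ennreal Q * (S (fst p) (fst q) * U (snd p) (snd q)) \<partial>lborel)"
      proof (rule nn_integral_mono)
        fix q :: R2
        show "indicator (rset a (a + h)) q *
           ennreal \<bar>\<integral>\<omega>. f (X (fst p) \<omega> - X (snd p) \<omega>) * f (X (fst q) \<omega> - X (snd q) \<omega>) \<partial>M\<bar>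
           \<le> ennreal Q * (S (fst p) (fst q) * U (snd p) (snd q))"
        proof (cases "q \<in> rset a (a + h)")
          case q: True
          then show ?thesis using True bm_chords[OF X f z Q, of a "fst p" "snd p" "fst q" "snd q"]
            by (auto simp: rset_def S_def U_def)
        qed simp
      qed
      then show ?thesis using True by simp
    qed simp
  qed
  also have "\<dots> = (\<integral>\<^sup>+p. ennreal Q * ((\<integral>\<^sup>+s'. S (fst p) s' \<partial>lborel) * (\<integral>\<^sup>+u'. U (snd p) u' \<partial>lborel)) \<partial>lborel)"
  proof (rule nn_integral_cong)
    fix p :: R2
    have "(\<integral>\<^sup>+q. ennreal Q * (S (fst p) (fst q) * U (snd p) (snd q)) \<partial>(lborel :: R2 measure))
      = ennreal Q * (\<integral>\<^sup>+q. (S (fst p) (fst q) * U (snd p) (snd q)) \<partial>(lborel :: R2 measure))"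
      by (rule nn_integral_cmult) measurable
    also have "(\<integral>\<^sup>+q. (S (fst p) (fst q) * U (snd p) (snd q)) \<partial>(lborel :: R2 measure))
      = (\<integral>\<^sup>+s'. S (fst p) s' \<partial>lborel) * (\<integral>\<^sup>+u'. U (snd p) u' \<partial>lborel)"
      by (rule nn_integral_R2_mult) measurable
    finally show "(\<integral>\<^sup>+q. ennreal Q * (S (fst p) (fst q) * U (snd p) (snd q)) \<partial>(lborel :: R2 measure))
      = ennreal Q * ((\<integral>\<^sup>+s'. S (fst p) s' \<partial>lborel) * (\<integral>\<^sup>+u'. U (snd p) u' \<partial>lborel))" .
  qed
  also have "\<dots> = ennreal Q * (\<integral>\<^sup>+p. ((\<integral>\<^sup>+s'. S (fst p) s' \<partial>lborel) * (\<integral>\<^sup>+u'. U (snd p) u' \<partial>lborel)) \<partial>(lborel :: R2 measure))"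
    by (rule nn_integral_cmult) measurable
  also have "(\<integral>\<^sup>+p. ((\<integral>\<^sup>+s'. S (fst p) s' \<partial>lborel) * (\<integral>\<^sup>+u'. U (snd p) u' \<partial>lborel)) \<partial>(lborel :: R2 measure))
    = (\<integral>\<^sup>+s. \<integral>\<^sup>+s'. S s s' \<partial>lborel \<partial>lborel) * (\<integral>\<^sup>+u. \<integral>\<^sup>+u'. U u u' \<partial>lborel \<partial>lborel)"
    by (rule nn_integral_R2_mult[of "\<lambda>s. \<integral>\<^sup>+s'. S s s' \<partial>lborel" "\<lambda>u. \<integral>\<^sup>+u'. U u u' \<partial>lborel"]) measurable
  also have "ennreal Q * \<dots> \<le> ennreal Q * (ennreal (32/7 * h powr (11/8)) * ennreal 64)"
    by (intro mult_left_mono mult_mono Sint Uint) auto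
  also have "\<dots> = ennreal (Q * (32/7 * h powr (11/8) * 64))"
  proof -
    have "ennreal (Q * (32/7 * h powr (11/8) * 64)) = ennreal Q * ennreal (32/7 * h powr (11/8) * 64)"
      by (rule ennreal_mult) (use Q in auto)
    moreover have "ennreal (32/7 * h powr (11/8) * 64) = ennreal (32/7 * h powr (11/8)) * ennreal 64"
      by (rule ennreal_mult) auto
    ultimately show ?thesis by (simp only:)
  qed
  \<comment> \<open>\<open>32/7 * 64 < 300\<close>, where \<open>32/7\<close> and \<open>64\<close>
    are the constants of \<open>skern_integral\<close> for the two pairs of exponents.\<close>
  also have "\<dots> \<le> ennreal (300 * Q * h powr (11/8))"
    using Q by (intro ennreal_leI) simp
  finally show ?thesis
    using Q by (subst (asm) ennreal_le_iff) auto
qed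

section \<open>Scaling and independent blocks\<close>

lemma nn_integral_scale_R2:
  fixes f :: "R2 \<Rightarrow> ennreal"
  assumes [measurable]: "f \<in> borel_measurable borel" and c: "c > 0"
  shows "(\<integral>\<^sup>+x. f x \<partial>lborel) = ennreal (c\<^sup>2) * (\<integral>\<^sup>+x. f (c *\<^sub>R x) \<partial>lborel)"
proof -
  have "(\<integral>\<^sup>+x. f x \<partial>lborel) = (\<integral>\<^sup>+x. f x \<partial>density (distr lborel borel (\<lambda>x. 0 + c *\<^sub>R x)) (\<lambda>_. \<bar>c\<bar> ^ DIM(R2)))"
    using lborel_affine[of c "0 :: R2"] c by simp
  also have "\<dots> = (\<integral>\<^sup>+x. ennreal (c\<^sup>2) * f (c *\<^sub>R x) \<partial>lborel)"
    using c by (subst nn_integral_density) (auto simp: nn_integral_distr power2_eq_square)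
  finally show ?thesis by (simp add: nn_integral_cmult)
qed

lemma integral_scale_R2:
  fixes f :: "R2 \<Rightarrow> real"
  assumes [measurable]: "f \<in> borel_measurable borel" and c: "c > 0"
  shows "(\<integral>x. f x \<partial>lborel) = c\<^sup>2 * (\<integral>x. f (c *\<^sub>R x) \<partial>lborel)"
proof -
  have "(\<integral>x. f x \<partial>lborel) = (\<integral>x. f x \<partial>density (distr lborel borel (\<lambda>x. 0 + c *\<^sub>R x)) (\<lambda>_. \<bar>c\<bar> ^ DIM(R2)))"
    using lborel_affine[of c "0 :: R2"] c by simp
  also have "\<dots> = (\<integral>x. c\<^sup>2 * f (c *\<^sub>R x) \<partial>lborel)"
    using c by (subst integral_density) (auto simp: integral_distr power2_eq_square)
  finally show ?thesis by simp
qed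

lemma integrable_scale_R2:
  fixes f :: "R2 \<Rightarrow> real"
  assumes f: "integrable lborel f" and c: "c > 0"
  shows "integrable lborel (\<lambda>x. f (c *\<^sub>R x))"
proof -
  have [measurable]: "f \<in> borel_measurable borel" using f by auto
  have "(\<integral>\<^sup>+x. ennreal \<bar>f x\<bar> \<partial>lborel) < \<infinity>" using f by (simp add: integrable_iff_bounded)
  then have "ennreal (c\<^sup>2) * (\<integral>\<^sup>+x. ennreal \<bar>f (c *\<^sub>R x)\<bar> \<partial>lborel) < \<infinity>"
    by (subst (asm) nn_integral_scale_R2[OF _ c]) auto
  then have "(\<integral>\<^sup>+x. ennreal \<bar>f (c *\<^sub>R x)\<bar> \<partial>lborel) < \<infinity>"
    using c by (auto simp: ennreal_mult_less_top)
  then show ?thesis by (auto intro!: integrableI_bounded)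
qed

text \<open>The Jacobian of the dilation is \<open>c\<^sup>2\<close> in the plane and cancels the
  change of the normalising factor of the density.\<close>

lemma distr_gaussm_scale:
  assumes r: "r > 0" and c: "c > 0"
  shows "distr (gaussm r) borel (\<lambda>x. c *\<^sub>R x) = gaussm (c\<^sup>2 * r)"
proof (rule measure_eqI)
  fix A assume "A \<in> sets (distr (gaussm r) borel (\<lambda>x. c *\<^sub>R x))"
  then have [measurable]: "A \<in> sets borel" by simp
  have g: "gauss2 r x = c\<^sup>2 * gauss2 (c\<^sup>2 * r) (c *\<^sub>R x)" for x
    using c r by (simp add: gauss2_norm power_mult_distrib)
  have "emeasure (distr (gaussm r) borel (\<lambda>x. c *\<^sub>R x)) A = (\<integral>\<^sup>+x. indicator A x \<partial>distr (gaussm r) borel (\<lambda>x. c *\<^sub>R x))"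
    by simp
  also have "\<dots> = (\<integral>\<^sup>+x. indicator A (c *\<^sub>R x) \<partial>gaussm r)"
    by (rule nn_integral_distr) auto
  also have "\<dots> = (\<integral>\<^sup>+x. ennreal (gauss2 r x) * indicator A (c *\<^sub>R x) \<partial>lborel)"
    by (rule nn_integral_gaussm) measurable
  also have "\<dots> = (\<integral>\<^sup>+x. ennreal (c\<^sup>2) * (ennreal (gauss2 (c\<^sup>2 * r) (c *\<^sub>R x)) * indicator A (c *\<^sub>R x)) \<partial>lborel)"
    using r c by (intro nn_integral_cong) (simp add: g ennreal_mult gauss2_nonneg mult.assoc)
  also have "\<dots> = ennreal (c\<^sup>2) * (\<integral>\<^sup>+x. (ennreal (gauss2 (c\<^sup>2 * r) (c *\<^sub>R x)) * indicator A (c *\<^sub>R x)) \<partial>lborel)"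
    by (rule nn_integral_cmult) measurable
  also have "\<dots> = (\<integral>\<^sup>+x. (ennreal (gauss2 (c\<^sup>2 * r) x) * indicator A x) \<partial>lborel)"
    by (rule nn_integral_scale_R2[symmetric, OF _ c]) measurable
  also have "\<dots> = emeasure (gaussm (c\<^sup>2 * r)) A"
    unfolding gaussm_def by (rule emeasure_density[symmetric]) auto
  finally show "emeasure (distr (gaussm r) borel (\<lambda>x. c *\<^sub>R x)) A = emeasure (gaussm (c\<^sup>2 * r)) A" .
qed simp

text \<open>The path restarted at \<open>a\<close> and rescaled so that the interval
  \<open>[a, a + h]\<close> becomes \<open>[0, 1]\<close>. The cut at negative times restores the
  convention of \<open>bm\<close>.\<close>

definition resc :: "(real \<Rightarrow> 'a \<Rightarrow> R2) \<Rightarrow> real \<Rightarrow> real \<Rightarrow> real \<Rightarrow> 'a \<Rightarrow> R2" where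
  "resc X a h t \<omega> = (if t < 0 then 0 else (1 / sqrt h) *\<^sub>R (X (a + h * t) \<omega> - X a \<omega>))"

lemma resc_diff: "0 \<le> s \<Longrightarrow> 0 \<le> t \<Longrightarrow>
   resc X a h t \<omega> - resc X a h s \<omega> = (1 / sqrt h) *\<^sub>R (X (a + h * t) \<omega> - X (a + h * s) \<omega>)"
  by (simp add: resc_def algebra_simps)

text \<open>Increments of the rescaled path are dilated increments of \<open>X\<close> at the times
  \<open>a + h * t\<close>, so independence and law transfer directly.\<close>

lemma bm_resc:
  assumes X: "bm M X" and a: "0 \<le> a" and h: "0 < h"
  shows "bm M (resc X a h)"
proof -
  interpret prob_space M by (rule bm_prob_space[OF X])
  note [measurable] = bm_measurable[OF X]
  have m: "resc X a h t \<in> borel_measurable M" for t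
    unfolding resc_def[abs_def] by measurable
  have 1: "\<forall>\<omega>\<in>space M. resc X a h 0 \<omega> = 0 \<and> continuous_on {0..} (\<lambda>t. resc X a h t \<omega>)"
  proof
    fix \<omega> assume w: "\<omega> \<in> space M"
    have "continuous_on {0..} (\<lambda>t. (1 / sqrt h) *\<^sub>R (X (a + h * t) \<omega> - X a \<omega>))"
      by (intro continuous_intros continuous_on_compose2[OF bm_continuous[OF X w]]) auto
    then have "continuous_on {0..} (\<lambda>t. resc X a h t \<omega>)"
      by (subst continuous_on_cong[OF refl, of _ _ "\<lambda>t. (1 / sqrt h) *\<^sub>R (X (a + h * t) \<omega> - X a \<omega>)"])
        (auto simp: resc_def)
    then show "resc X a h 0 \<omega> = 0 \<and> continuous_on {0..} (\<lambda>t. resc X a h t \<omega>)" by (simp add: resc_def)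
  qed
  have 2: "indep_vars (\<lambda>_. borel) (\<lambda>i \<omega>. resc X a h (ts ! Suc i) \<omega> - resc X a h (ts ! i) \<omega>) {..<length ts - 1}"
    if ts: "sorted_wrt (<) ts" "\<forall>t\<in>set ts. 0 \<le> t" for ts
  proof -
    define us where "us = map (\<lambda>t. a + h * t) ts"
    have us: "sorted_wrt (<) us" "\<forall>t\<in>set us. 0 \<le> t"
      using ts a h by (auto simp: us_def sorted_wrt_map sorted_wrt_iff_nth_less)
    have len: "length us = length ts" by (simp add: us_def)
    have nth: "us ! i = a + h * ts ! i" if "i < length ts" for i using that by (simp add: us_def)
    have "indep_vars (\<lambda>_. borel) (\<lambda>i \<omega>. (1 / sqrt h) *\<^sub>R (X (us ! Suc i) \<omega> - X (us ! i) \<omega>)) {..<length us - 1}"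
      by (rule indep_vars_compose2[OF bm_indep[OF X us]]) measurable
    also have "?this \<longleftrightarrow> ?thesis"
    proof (rule indep_vars_cong)
      fix i assume "i \<in> {..<length us - 1}"
      then have i: "i < length ts" "Suc i < length ts" by (auto simp: len)
      then have "0 \<le> ts ! i" "0 \<le> ts ! Suc i" using ts(2) by auto
      then show "(\<lambda>\<omega>. (1 / sqrt h) *\<^sub>R (X (us ! Suc i) \<omega> - X (us ! i) \<omega>))
        = (\<lambda>\<omega>. resc X a h (ts ! Suc i) \<omega> - resc X a h (ts ! i) \<omega>)"
        by (simp only: resc_diff nth[OF i(1)] nth[OF i(2)])
    qed (auto simp: len)
    finally show ?thesis .
  qed
  have 3: "distributed M lborel (\<lambda>\<omega>. resc X a h t \<omega> - resc X a h s \<omega>) (\<lambda>x. ennreal (gauss2 (t - s) x))"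
    if st: "0 \<le> s" "s < t" for s t
  proof -
    have 0: "0 \<le> a + h * s" "a + h * s < a + h * t" using a h st by auto
    have "distr M lborel (\<lambda>\<omega>. resc X a h t \<omega> - resc X a h s \<omega>)
      = distr M borel (\<lambda>\<omega>. (1 / sqrt h) *\<^sub>R (X (a + h * t) \<omega> - X (a + h * s) \<omega>))"
      using st by (intro distr_cong) (auto simp: resc_diff)
    also have "\<dots> = distr (distr M borel (\<lambda>\<omega>. X (a + h * t) \<omega> - X (a + h * s) \<omega>)) borel (\<lambda>x. (1 / sqrt h) *\<^sub>R x)"
      by (subst distr_distr) (auto simp: comp_def)
    also have "\<dots> = distr (gaussm (h * (t - s))) borel (\<lambda>x. (1 / sqrt h) *\<^sub>R x)"
      by (subst bm_increment_distr[OF X 0]) (simp add: algebra_simps)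
    also have "\<dots> = gaussm ((1 / sqrt h)\<^sup>2 * (h * (t - s)))"
      by (rule distr_gaussm_scale) (use h st in auto)
    also have "(1 / sqrt h)\<^sup>2 * (h * (t - s)) = t - s" using h by (simp add: power_divide)
    finally have "distr M lborel (\<lambda>\<omega>. resc X a h t \<omega> - resc X a h s \<omega>) = density lborel (\<lambda>x. ennreal (gauss2 (t - s) x))"
      unfolding gaussm_def .
    then show ?thesis using m by (auto simp: distributed_def)
  qed
  have "planar_BM M (resc X a h)"
    unfolding planar_BM_def using m 1 2 3 prob_space_axioms by blast
  then show ?thesis by (simp add: bm_def resc_def)
qed

lemma tri_rescale:
  assumes f: "bcf f" and X: "bm M X" and w: "\<omega> \<in> space M" and a: "0 \<le> a" and h: "0 < h" and t: "0 \<le> t"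
  shows "tri f (h * t) (\<lambda>s. X (a + s) \<omega>) = h\<^sup>2 * tri (\<lambda>z. f (sqrt h *\<^sub>R z)) t (\<lambda>s. resc X a h s \<omega>)"
proof -
  note [measurable] = bcf_measurable[OF f]
  have xm: "(\<lambda>s. X (a + s) \<omega>) \<in> borel_measurable borel"
    by (rule measurable_compose[OF _ bm_path_measurable[OF X w]]) measurable
  note [measurable] = measurable_compose[OF measurable_fst_R2 xm] measurable_compose[OF measurable_snd_R2 xm]
  have "tri f (h * t) (\<lambda>s. X (a + s) \<omega>)
    = h\<^sup>2 * (\<integral>p. indicator (tset (h * t)) (h *\<^sub>R p) * f (X (a + fst (h *\<^sub>R p)) \<omega> - X (a + snd (h *\<^sub>R p)) \<omega>) \<partial>lborel)"
    unfolding dbl_def by (rule integral_scale_R2[OF _ h]) measurable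
  also have "(\<integral>p. indicator (tset (h * t)) (h *\<^sub>R p) * f (X (a + fst (h *\<^sub>R p)) \<omega> - X (a + snd (h *\<^sub>R p)) \<omega>) \<partial>lborel)
    = tri (\<lambda>z. f (sqrt h *\<^sub>R z)) t (\<lambda>s. resc X a h s \<omega>)"
    unfolding dbl_def
  proof (rule Bochner_Integration.integral_cong[OF refl])
    fix p :: R2
    have "indicator (tset (h * t)) (h *\<^sub>R p) = (indicator (tset t) p :: real)"
      using h by (auto simp: tset_def indicator_def zero_le_mult_iff)
    moreover have "f (X (a + fst (h *\<^sub>R p)) \<omega> - X (a + snd (h *\<^sub>R p)) \<omega>) = f (sqrt h *\<^sub>R (resc X a h (fst p) \<omega> - resc X a h (snd p) \<omega>))"
      if "p \<in> tset t"
      using that h by (subst resc_diff) (auto simp: tset_def)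
    ultimately show "indicator (tset (h * t)) (h *\<^sub>R p) * f (X (a + fst (h *\<^sub>R p)) \<omega> - X (a + snd (h *\<^sub>R p)) \<omega>)
      = indicator (tset t) p * f (sqrt h *\<^sub>R (resc X a h (fst p) \<omega> - resc X a h (snd p) \<omega>))"
      by (auto simp: indicator_def)
  qed
  finally show ?thesis .
qed

lemma dbl_shift:
  assumes f: "bcf f" and x: "x \<in> borel_measurable borel" and [measurable]: "A \<in> sets borel"
  shows "dbl A f x = dbl {p. (fst p + a, snd p + a) \<in> A} f (\<lambda>s. x (a + s))"
proof -
  note [measurable] = bcf_measurable[OF f] measurable_compose[OF measurable_fst_R2 x] measurable_compose[OF measurable_snd_R2 x]
  have "dbl A f x = (\<integral>p. indicator A (p + (a, a)) * f (x (fst (p + (a, a))) - x (snd (p + (a, a)))) \<partial>lborel)"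
    unfolding dbl_def by (rule lborel_integral_shift[symmetric]) measurable
  also have "\<dots> = dbl {p. (fst p + a, snd p + a) \<in> A} f (\<lambda>s. x (a + s))"
    unfolding dbl_def by (intro Bochner_Integration.integral_cong) (auto simp: indicator_def add.commute plus_prod_def)
  finally show ?thesis .
qed

lemma tri_split:
  assumes f: "bcf f" and x: "x \<in> borel_measurable borel" and a: "0 \<le> a" "0 \<le> h"
  shows "tri f (a + h) x = tri f a x + tri f h (\<lambda>s. x (a + s)) + rect f a (a + h) x"
proof -
  define T where "T = {p :: R2. a \<le> snd p \<and> snd p \<le> fst p \<and> fst p \<le> a + h}"
  have T[measurable]: "T \<in> sets borel"
    unfolding T_def by (intro borel_closed closed_Collect_conj closed_Collect_le continuous_intros)
  have "dbl T f x = dbl {p. (fst p + a, snd p + a) \<in> T} f (\<lambda>s. x (a + s))"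
    by (rule dbl_shift[OF f x T])
  also have "{p. (fst p + a, snd p + a) \<in> T} = tset h"
    by (auto simp: T_def tset_def)
  finally have s: "tri f h (\<lambda>s. x (a + s)) = dbl T f x" by simp
  have "T \<subseteq> tset (a + h)" using a by (auto simp: T_def tset_def)
  then have Tf: "emeasure lborel T < \<infinity>"
    by (rule le_less_trans[OF emeasure_mono emeasure_tset_finite]) simp
  note i = dbl_integrable[OF f x tset_measurable emeasure_tset_finite, of a]
    dbl_integrable[OF f x T Tf] dbl_integrable[OF f x rset_measurable emeasure_rset_finite, of a "a + h"]
  have "tri f (a + h) x = (\<integral>p. indicator (tset a) p * f (x (fst p) - x (snd p)) + indicator T p * f (x (fst p) - x (snd p))
     + indicator (rset a (a + h)) p * f (x (fst p) - x (snd p)) \<partial>lborel)"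
    unfolding dbl_def
  proof (rule integral_cong_AE)
    \<comment> \<open>The two triangles share only the corner \<open>(a, a)\<close>; everywhere else
      the three indicators add up to that of the large triangle.\<close>
    have "AE p in lborel. p \<noteq> (a, a)" by (rule AE_lborel_singleton)
    then show "AE p in lborel. indicator (tset (a + h)) p * f (x (fst p) - x (snd p)) =
      indicator (tset a) p * f (x (fst p) - x (snd p)) + indicator T p * f (x (fst p) - x (snd p))
     + indicator (rset a (a + h)) p * f (x (fst p) - x (snd p))"
    proof eventually_elim
      case (elim p)
      have "indicator (tset (a + h)) p = indicator (tset a) p + indicator T p + (indicator (rset a (a + h)) p :: real)"
        using elim a by (cases p) (auto simp: tset_def T_def rset_def indicator_def)
      then show ?case by (simp add: distrib_right)
    qed
  qed (use i dbl_integrable[OF f x tset_measurable emeasure_tset_finite, of "a + h"] in auto)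
  also have "\<dots> = tri f a x + dbl T f x + rect f a (a + h) x"
    unfolding dbl_def using i by simp
  finally show ?thesis using s by simp
qed

lemma bm_tri_split:
  assumes f: "bcf f" and X: "bm M X" and w: "\<omega> \<in> space M" and a: "0 \<le> a" and h: "0 < h"
  shows "tri f (a + h) (\<lambda>s. X s \<omega>) = tri f a (\<lambda>s. X s \<omega>)
     + h\<^sup>2 * tri (\<lambda>z. f (sqrt h *\<^sub>R z)) 1 (\<lambda>s. resc X a h s \<omega>) + rect f a (a + h) (\<lambda>s. X s \<omega>)"
  using tri_split[OF f bm_path_measurable[OF X w] a, of h] tri_rescale[OF f X w a h, of 1] h by simp

section \<open>Step paths and independence of blocks\<close>

lemma tendsto_tri_step:
  assumes f: "bcf f" and x: "continuous_on UNIV x"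
  shows "(\<lambda>n. tri f 1 (\<lambda>s. x (real_of_int \<lfloor>s * real (Suc n)\<rfloor> / real (Suc n)))) \<longlonglongrightarrow> tri f 1 x"
proof -
  obtain B where B: "0 \<le> B" "\<And>x. \<bar>f x\<bar> \<le> B" using bcf_bounded[OF f] by blast
  have [measurable]: "x \<in> borel_measurable borel" using x by (rule borel_measurable_continuous_onI)
  note [measurable] = bcf_measurable[OF f]
  show ?thesis
    unfolding dbl_def
  proof (rule integral_dominated_convergence)
    show "integrable lborel (\<lambda>p :: R2. indicator (tset 1) p * B)"
      using emeasure_tset_finite by (intro integrable_mult_left integrable_real_indicator) auto
    show "AE p in lborel. (\<lambda>n. indicator (tset 1) p * f (x (real_of_int \<lfloor>fst p * real (Suc n)\<rfloor> / real (Suc n)) -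
         x (real_of_int \<lfloor>snd p * real (Suc n)\<rfloor> / real (Suc n)))) \<longlonglongrightarrow> indicator (tset 1) p * f (x (fst p) - x (snd p))"
    proof (rule AE_I2)
      fix p :: R2
      have xc: "isCont x t" for t using x by (simp add: continuous_on_eq_continuous_at)
      have fc: "isCont f t" for t
        using f unfolding bcf_def continuous_on_eq_continuous_at[OF open_UNIV] by blast
      show "(\<lambda>n. indicator (tset 1) p * f (x (real_of_int \<lfloor>fst p * real (Suc n)\<rfloor> / real (Suc n)) -
         x (real_of_int \<lfloor>snd p * real (Suc n)\<rfloor> / real (Suc n)))) \<longlonglongrightarrow> indicator (tset 1) p * f (x (fst p) - x (snd p))"
        by (intro tendsto_intros isCont_tendsto_compose[OF fc] isCont_tendsto_compose[OF xc] floor_mesh_tendsto)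
    qed
    show "AE p in lborel. norm (indicator (tset 1) p * f (x (real_of_int \<lfloor>fst p * real (Suc n)\<rfloor> / real (Suc n)) -
         x (real_of_int \<lfloor>snd p * real (Suc n)\<rfloor> / real (Suc n)))) \<le> indicator (tset 1) p * B" for n
      using B by (intro AE_I2) (simp add: abs_mult indicator_def)
  qed measurable
qed

text \<open>The triangle integral of a step path as a function of its increments \<open>d\<close>
  over the grid of mesh \<open>1 / m\<close>: an increment counts for a pair of times when its cell
  lies between the two floors. In this form it is visibly a measurable function of finitely many
  independent variables.\<close>

definition stepf :: "nat \<Rightarrow> (R2 \<Rightarrow> real) \<Rightarrow> (nat \<Rightarrow> R2) \<Rightarrow> real" where
  "stepf m f d = (\<integral>p. indicator (tset 1) p *
     f (\<Sum>i<m. if \<lfloor>snd p * real m\<rfloor> \<le> int i \<and> int i < \<lfloor>fst p * real m\<rfloor> then d i else 0) \<partial>lborel)"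

lemma sum_telescope_window:
  fixes y :: "int \<Rightarrow> 'b::ab_group_add"
  assumes "0 \<le> a" "a \<le> b" "b \<le> int m"
  shows "(\<Sum>i<m. if a \<le> int i \<and> int i < b then y (int i + 1) - y (int i) else 0) = y b - y a"
  using assms
proof (induction m arbitrary: b)
  case 0
  then have "a = b" by simp
  then show ?case by simp
next
  case (Suc m)
  show ?case
  proof (cases "b \<le> int m")
    case True
    then show ?thesis using Suc.IH[OF Suc.prems(1,2) True] by simp
  next
    case False
    then have b: "b = int m + 1" using Suc.prems by simp
    show ?thesis
    proof (cases "a = b")
      case True
      then show ?thesis by (auto intro!: sum.neutral)
    next
      case False
      then have "a \<le> int m" using b Suc.prems by simp
      moreover have "(\<Sum>i<m. if a \<le> int i \<and> int i < b then y (int i + 1) - y (int i) else 0)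
        = (\<Sum>i<m. if a \<le> int i \<and> int i < int m then y (int i + 1) - y (int i) else 0)"
        by (rule sum.cong) (auto simp: b)
      ultimately show ?thesis using Suc.IH[OF Suc.prems(1), of "int m"] by (simp add: b)
    qed
  qed
qed

lemma tri_step_eq_stepf:
  assumes "m > 0"
  shows "tri f 1 (\<lambda>s. x (real_of_int \<lfloor>s * real m\<rfloor> / real m))
     = stepf m f (\<lambda>i. x (real (Suc i) / real m) - x (real i / real m))"
  unfolding dbl_def stepf_def
proof (rule Bochner_Integration.integral_cong[OF refl])
  fix p :: R2
  show "indicator (tset 1) p * f (x (real_of_int \<lfloor>fst p * real m\<rfloor> / real m) - x (real_of_int \<lfloor>snd p * real m\<rfloor> / real m))
   = indicator (tset 1) p * f (\<Sum>i<m. if \<lfloor>snd p * real m\<rfloor> \<le> int i \<and> int i < \<lfloor>fst p * real m\<rfloor>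
        then x (real (Suc i) / real m) - x (real i / real m) else 0)"
  proof (cases "p \<in> tset 1")
    case True
    then have *: "0 \<le> snd p" "snd p \<le> fst p" "fst p \<le> 1" by (auto simp: tset_def)
    have "0 \<le> \<lfloor>snd p * real m\<rfloor>" "\<lfloor>snd p * real m\<rfloor> \<le> \<lfloor>fst p * real m\<rfloor>"
      using * by (auto intro!: floor_mono mult_right_mono)
    moreover have "\<lfloor>fst p * real m\<rfloor> \<le> int m"
      using mult_right_mono[OF *(3), of "real m"] by (simp add: floor_le_iff)
    ultimately have "(\<Sum>i<m. if \<lfloor>snd p * real m\<rfloor> \<le> int i \<and> int i < \<lfloor>fst p * real m\<rfloor>
        then x (real_of_int (int i + 1) / real m) - x (real_of_int (int i) / real m) else 0)
      = x (real_of_int \<lfloor>fst p * real m\<rfloor> / real m) - x (real_of_int \<lfloor>snd p * real m\<rfloor> / real m)"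
      by (rule sum_telescope_window[of _ _ _ "\<lambda>j. x (real_of_int j / real m)"])
    moreover have "real_of_int (int i + 1) = real (Suc i)" "real_of_int (int i) = real i" for i by simp_all
    ultimately show ?thesis by (simp only:)
  qed simp
qed

lemma stepf_measurable:
  assumes f: "bcf f" and [measurable]: "\<And>i. i < m \<Longrightarrow> (\<lambda>d. D d i) \<in> borel_measurable N"
  shows "(\<lambda>d. stepf m f (D d)) \<in> borel_measurable N"
  unfolding stepf_def
proof (rule lborel.borel_measurable_lebesgue_integral)
  note [measurable] = bcf_measurable[OF f]
  have [measurable]: "(\<lambda>q :: 'a \<times> R2. \<Sum>i<m. if \<lfloor>snd (snd q) * real m\<rfloor> \<le> int i \<and> int i < \<lfloor>fst (snd q) * real m\<rfloor> then D (fst q) i else 0)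
    \<in> borel_measurable (N \<Otimes>\<^sub>M lborel)"
    by (rule borel_measurable_sum) simp
  show "(\<lambda>(d, p). indicator (tset 1) p * f (\<Sum>i<m. if \<lfloor>snd p * real m\<rfloor> \<le> int i \<and> int i < \<lfloor>fst p * real m\<rfloor> then D d i else 0))
    \<in> borel_measurable (N \<Otimes>\<^sub>M lborel)"
    unfolding case_prod_beta by measurable
qed

text \<open>All blocks are cut into \<open>m\<close> cells each, and \<open>\<tau>\<close> lists the
  resulting grid: \<open>j div m\<close> is the block, \<open>j mod m\<close> the cell. The
  increments over this grid are independent, and each block functional depends only on its own group
  of them.\<close>

lemma indep_blocks_step:
  assumes X: "bm M X" and h: "\<And>k. k < n \<Longrightarrow> 0 < h k" and a: "0 \<le> a 0" "\<And>k. k < n \<Longrightarrow> a (Suc k) = a k + h k"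
    and f: "\<And>k. k < n \<Longrightarrow> bcf (f k)" and g: "\<And>k. k < n \<Longrightarrow> g k \<in> borel_measurable borel" and m: "m > 0"
  shows "prob_space.indep_vars M (\<lambda>_. borel) (\<lambda>k \<omega>. g k (tri (f k) 1 (\<lambda>s. resc X (a k) (h k) (real_of_int \<lfloor>s * real m\<rfloor> / real m) \<omega>)) :: real) {..<n}"
proof -
  interpret prob_space M by (rule bm_prob_space[OF X])
  define \<tau> where "\<tau> j = a (j div m) + h (j div m) * (real (j mod m) / real m)" for j
  have step: "\<tau> (Suc j) = \<tau> j + h (j div m) / real m" if "j < n * m" for j
  proof -
    have k: "j div m < n" using that by (simp add: less_mult_imp_div_less)
    show ?thesis
    proof (cases "Suc (j mod m) = m")
      \<comment> \<open>Last cell of a block: the next grid point is the start of the following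
        block, where the cell length may change.\<close>
      case True
      then have "Suc j div m = Suc (j div m)" "Suc j mod m = 0"
        using m by (auto simp: div_Suc mod_Suc)
      moreover have "real (j mod m) = real m - 1" using True by (simp flip: of_nat_Suc add: of_nat_diff)
      moreover have "h (j div m) = h (j div m) * ((real (j mod m) + 1) / real m)"
        using m calculation(3) by simp
      then have "h (j div m) = h (j div m) * (real (j mod m) / real m) + h (j div m) / real m"
        by (simp add: add_divide_distrib distrib_left)
      ultimately show ?thesis using m a(2)[OF k] by (simp add: \<tau>_def)
    next
      case False
      then have "Suc j div m = j div m" "Suc j mod m = Suc (j mod m)"
        using m by (auto simp: div_Suc mod_Suc)
      then show ?thesis using m by (simp add: \<tau>_def field_simps)
    qed
  qed
  have mono: "\<tau> j < \<tau> (Suc j)" if "j < n * m" for j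
    using step[OF that] h[of "j div m"] that m by (simp add: less_mult_imp_div_less)
  have mono': "\<tau> i < \<tau> j" if "i < j" "j \<le> n * m" for i j
    using that
  proof (induction j)
    case (Suc j)
    then show ?case using mono[of j] by (cases "i = j") (auto intro: less_trans)
  qed simp
  define ts where "ts = map \<tau> [0..<Suc (n * m)]"
  have nth: "ts ! i = \<tau> i" if "i \<le> n * m" for i using that unfolding ts_def
    by (subst nth_map) (auto simp del: upt_Suc)
  have len: "length ts = Suc (n * m)" by (simp add: ts_def)
  have 0: "0 \<le> \<tau> i" if "i \<le> n * m" for i
  proof -
    have "\<tau> 0 = a 0" by (simp add: \<tau>_def)
    then show ?thesis using mono'[of 0 i] that a(1) by (cases "i = 0") auto
  qed
  have srt: "sorted_wrt (<) ts"
    unfolding sorted_wrt_iff_nth_less len using mono' nth by auto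
  have nn: "\<forall>t\<in>set ts. 0 \<le> t" unfolding ts_def using 0 by (auto simp del: upt_Suc)
  have "indep_vars (\<lambda>_. borel) (\<lambda>i \<omega>. X (ts ! Suc i) \<omega> - X (ts ! i) \<omega>) {..<length ts - 1}"
    by (rule bm_indep[OF X srt nn])
  also have "?this \<longleftrightarrow> indep_vars (\<lambda>_. borel) (\<lambda>i \<omega>. X (\<tau> (Suc i)) \<omega> - X (\<tau> i) \<omega>) {..<n * m}"
    by (rule indep_vars_cong) (auto simp: len nth)
  finally have ind: "indep_vars (\<lambda>_. borel) (\<lambda>i \<omega>. X (\<tau> (Suc i)) \<omega> - X (\<tau> i) \<omega>) {..<n * m}" .
  define K where "K k = {k * m..<Suc k * m}" for k
  have K: "K k \<subseteq> {..<n * m}" if "k < n" for k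
    using that mult_le_mono1[of "Suc k" n m] by (auto simp: K_def)
  have disj: "disjoint_family_on K {..<n}"
  proof -
    have "i = j" if "x \<in> K i" "x \<in> K j" for x i j
    proof -
      have "x div m = i" if "x \<in> K i" for i
        using that m by (intro div_nat_eqI) (auto simp: K_def mult.commute)
      then show ?thesis using that by auto
    qed
    then show ?thesis unfolding disjoint_family_on_def by blast
  qed
  have ind2: "indep_vars (\<lambda>k. PiM (K k) (\<lambda>_. borel)) (\<lambda>k \<omega>. restrict (\<lambda>i. X (\<tau> (Suc i)) \<omega> - X (\<tau> i) \<omega>) (K k)) {..<n}"
    by (rule indep_vars_restrict[OF ind]) (use K disj in auto)
  define Y where "Y k d = g k (stepf m (f k) (\<lambda>i. (1 / sqrt (h k)) *\<^sub>R d (k * m + i)))" for k and d :: "nat \<Rightarrow> R2"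
  have ind3: "indep_vars (\<lambda>_. borel) (\<lambda>k \<omega>. Y k (restrict (\<lambda>i. X (\<tau> (Suc i)) \<omega> - X (\<tau> i) \<omega>) (K k))) {..<n}"
  proof (rule indep_vars_compose2[OF ind2])
    fix k assume "k \<in> {..<n}"
    then have k: "k < n" by simp
    have "(\<lambda>d. stepf m (f k) (\<lambda>i. (1 / sqrt (h k)) *\<^sub>R d (k * m + i))) \<in> borel_measurable (PiM (K k) (\<lambda>_. borel))"
    proof (rule stepf_measurable[OF f[OF k]])
      fix i assume "i < m"
      then have "k * m + i \<in> K k" by (auto simp: K_def)
      then have mi: "(\<lambda>d. d (k * m + i)) \<in> measurable (PiM (K k) (\<lambda>_. borel)) (borel :: R2 measure)"
        by (rule measurable_component_singleton)
      show "(\<lambda>d. (1 / sqrt (h k)) *\<^sub>R (d (k * m + i) :: R2)) \<in> borel_measurable (PiM (K k) (\<lambda>_. borel))"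
        by (rule measurable_compose[OF mi]) measurable
    qed
    then show "Y k \<in> borel_measurable (PiM (K k) (\<lambda>_. borel))"
      unfolding Y_def by (rule measurable_compose[OF _ g[OF k]])
  qed
  also have "?this \<longleftrightarrow> ?thesis"
  proof (rule indep_vars_cong)
    fix k assume "k \<in> {..<n}"
    then have k: "k < n" by simp
    have "stepf m (f k) (\<lambda>i. (1 / sqrt (h k)) *\<^sub>R restrict (\<lambda>i. X (\<tau> (Suc i)) \<omega> - X (\<tau> i) \<omega>) (K k) (k * m + i))
      = stepf m (f k) (\<lambda>i. resc X (a k) (h k) (real (Suc i) / real m) \<omega> - resc X (a k) (h k) (real i / real m) \<omega>)" for \<omega>
      unfolding stepf_def
    proof (intro Bochner_Integration.integral_cong[OF refl] arg_cong2[where f = "(*)"] arg_cong[where f = "f k"] sum.cong if_cong refl)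
      fix p :: R2 and i assume "i \<in> {..<m}"
      then have i: "i < m" by simp
      have "k * m + i \<in> K k" using i by (auto simp: K_def)
      moreover have "k * m + i < n * m" using K[OF k] calculation by auto
      moreover have "\<tau> (k * m + i) = a k + h k * (real i / real m)" using i by (simp add: \<tau>_def)
      ultimately show "(1 / sqrt (h k)) *\<^sub>R restrict (\<lambda>i. X (\<tau> (Suc i)) \<omega> - X (\<tau> i) \<omega>) (K k) (k * m + i)
        = resc X (a k) (h k) (real (Suc i) / real m) \<omega> - resc X (a k) (h k) (real i / real m) \<omega>"
        using i step[of "k * m + i"] by (simp add: resc_diff add_divide_distrib distrib_left ac_simps)
    qed
    then show "(\<lambda>\<omega>. Y k (restrict (\<lambda>i. X (\<tau> (Suc i)) \<omega> - X (\<tau> i) \<omega>) (K k)))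
      = (\<lambda>\<omega>. g k (tri (f k) 1 (\<lambda>s. resc X (a k) (h k) (real_of_int \<lfloor>s * real m\<rfloor> / real m) \<omega>)))"
      unfolding Y_def by (simp add: tri_step_eq_stepf[OF m, where x = "\<lambda>s. resc X (a k) (h k) s _"])
  qed auto
  finally show ?thesis .
qed

text \<open>The step paths are refined and dominated convergence is applied to both sides. The
  product formula for continuous functions that survives the limit is the only form of independence
  between blocks used later.\<close>

lemma indep_blocks:
  assumes X: "bm M X" and h: "\<And>k. k < n \<Longrightarrow> 0 < h k" and a: "0 \<le> a 0" "\<And>k. k < n \<Longrightarrow> a (Suc k) = a k + h k"
    and f: "\<And>k. k < n \<Longrightarrow> bcf (f k)" and g: "\<And>k. k < n \<Longrightarrow> continuous_on UNIV (g k :: real \<Rightarrow> real)"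
  shows "(\<integral>\<omega>. (\<Prod>k<n. g k (tri (f k) 1 (\<lambda>s. resc X (a k) (h k) s \<omega>))) \<partial>M)
    = (\<Prod>k<n. \<integral>\<omega>. g k (tri (f k) 1 (\<lambda>s. resc X (a k) (h k) s \<omega>)) \<partial>M)"
proof -
  interpret prob_space M by (rule bm_prob_space[OF X])
  have a0: "0 \<le> a k" if "k \<le> n" for k
    using that
  proof (induction k)
    case (Suc k)
    then show ?case using a(2)[of k] h[of k] by simp
  qed (use a in simp)
  have bk: "bm M (resc X (a k) (h k))" if "k < n" for k using bm_resc[OF X a0 h] that by simp
  have gm[measurable]: "g k \<in> borel_measurable borel" if "k < n" for k
    using g[OF that] by (rule borel_measurable_continuous_onI)
  have "\<exists>C. 0 \<le> C \<and> (\<forall>x. x \<in> borel_measurable borel \<longrightarrow> \<bar>g k (tri (f k) 1 x)\<bar> \<le> C)" if k: "k < n" for k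
  proof -
    obtain B where B: "0 \<le> B" "\<And>x. \<bar>f k x\<bar> \<le> B" using bcf_bounded[OF f[OF k]] by blast
    have "compact (g k ` {-B..B})"
      by (intro compact_continuous_image continuous_on_subset[OF g[OF k]]) auto
    then obtain C where C: "\<forall>y\<in>g k ` {-B..B}. norm y \<le> C" using compact_imp_bounded bounded_iff by metis
    have C0: "0 \<le> C" using C B(1) by (force intro: order_trans[OF norm_ge_zero])
    have "\<bar>g k (tri (f k) 1 x)\<bar> \<le> C" if "x \<in> borel_measurable borel" for x
    proof -
      have "\<bar>tri (f k) 1 x\<bar> \<le> B * 1"
        by (rule dbl_bound[OF B f[OF k] that]) (use emeasure_tset[of 1] in auto)
      then have "tri (f k) 1 x \<in> {-B..B}" by auto
      then show ?thesis using C by (metis imageI real_norm_def)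
    qed
    then show ?thesis using C0 by blast
  qed
  then obtain C where C: "\<And>k. k < n \<Longrightarrow> 0 \<le> C k" "\<And>k x. k < n \<Longrightarrow> x \<in> borel_measurable borel \<Longrightarrow> \<bar>g k (tri (f k) 1 x)\<bar> \<le> C k"
    by metis
  define s where "s m k \<omega> = g k (tri (f k) 1 (\<lambda>s. resc X (a k) (h k) (real_of_int \<lfloor>s * real (Suc m)\<rfloor> / real (Suc m)) \<omega>))" for m k \<omega>
  define l where "l k \<omega> = g k (tri (f k) 1 (\<lambda>s. resc X (a k) (h k) s \<omega>))" for k \<omega>
  have ind: "indep_vars (\<lambda>_. borel) (s m) {..<n}" for m
    unfolding s_def by (rule indep_blocks_step[OF X h a f gm]) auto
  have sm[measurable]: "s m k \<in> borel_measurable M" if "k < n" for m k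
    using ind[of m] that by (auto simp: indep_vars_def)
  have lm[measurable]: "l k \<in> borel_measurable M" if "k < n" for k
    unfolding l_def by (rule measurable_compose[OF dbl_measurable[OF bk[OF that] f[OF that] tset_measurable] gm[OF that]])
  have sC: "\<bar>s m k \<omega>\<bar> \<le> C k" if "\<omega> \<in> space M" "k < n" for m k \<omega>
    unfolding s_def by (intro C that(2) measurable_compose[OF _ bm_path_measurable[OF bk[OF that(2)] that(1)]]) measurable
  have sl: "(\<lambda>m. s m k \<omega>) \<longlonglongrightarrow> l k \<omega>" if "\<omega> \<in> space M" "k < n" for k \<omega>
    unfolding s_def l_def
    by (rule isCont_tendsto_compose[OF _ tendsto_tri_step[OF f[OF that(2)] bm_continuous[OF bk[OF that(2)] that(1)]]])
      (use g[OF that(2)] in \<open>simp add: continuous_on_eq_continuous_at\<close>)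
  have 1: "(\<integral>\<omega>. (\<Prod>k<n. s m k \<omega>) \<partial>M) = (\<Prod>k<n. \<integral>\<omega>. s m k \<omega> \<partial>M)" for m
  proof (rule indep_vars_lebesgue_integral[OF _ ind])
    fix i assume "i \<in> {..<n}"
    then show "integrable M (s m i)" by (intro integrable_const_bound[of _ "C i"]) (auto intro!: AE_I2 sC)
  qed simp
  have 2: "(\<lambda>m. \<integral>\<omega>. (\<Prod>k<n. s m k \<omega>) \<partial>M) \<longlonglongrightarrow> (\<integral>\<omega>. (\<Prod>k<n. l k \<omega>) \<partial>M)"
  proof (rule integral_dominated_convergence[where w = "\<lambda>_. \<Prod>k<n. C k"])
    show "AE \<omega> in M. (\<lambda>m. \<Prod>k<n. s m k \<omega>) \<longlonglongrightarrow> (\<Prod>k<n. l k \<omega>)"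
      by (intro AE_I2 tendsto_prod sl) auto
    show "AE \<omega> in M. norm (\<Prod>k<n. s m k \<omega>) \<le> (\<Prod>k<n. C k)" for m
      unfolding prod_norm[symmetric] by (intro AE_I2 prod_mono) (auto simp: sC)
  qed (auto intro!: borel_measurable_prod)
  have 3: "(\<lambda>m. \<integral>\<omega>. s m k \<omega> \<partial>M) \<longlonglongrightarrow> (\<integral>\<omega>. l k \<omega> \<partial>M)" if "k < n" for k
    by (rule integral_dominated_convergence[where w = "\<lambda>_. C k"]) (use that in \<open>auto intro!: AE_I2 sl sC\<close>)
  have "(\<lambda>m. \<integral>\<omega>. (\<Prod>k<n. s m k \<omega>) \<partial>M) \<longlonglongrightarrow> (\<Prod>k<n. \<integral>\<omega>. l k \<omega> \<partial>M)"
    unfolding 1 by (intro tendsto_prod 3) auto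
  then show ?thesis using 2 unfolding l_def by (rule LIMSEQ_unique[rotated])
qed

section \<open>Variance of double integrals\<close>

text \<open>Eighth powers make both sides rational. That \<open>2 powr (11/8)\<close> exceeds
  \<open>2\<close> by a margin lets the halving recursion contract and the chaining sums
  converge.\<close>

lemma two_powr_bound: "128 / 50 \<le> (2::real) powr (11/8)"
proof -
  have "((2::real) powr (11/8)) ^ 8 = 2 powr (11/8 * real 8)"
    by (subst powr_realpow[symmetric]) (simp_all add: powr_powr)
  also have "\<dots> = 2 powr (real 11)" by simp
  also have "\<dots> = 2 ^ 11" by (subst powr_realpow) simp_all
  also have "(2 :: real) ^ 11 \<ge> (128 / 50) ^ 8" by (simp add: power_divide)
  finally have "(128 / 50 :: real) ^ 8 \<le> (2 powr (11/8)) ^ 8" .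
  then show ?thesis
    by (rule contrapos_pp) (use power_strict_mono[of "2 powr (11/8)" "128 / 50 :: real" 8] in auto)
qed

lemma half_powr_bound:
  assumes "0 \<le> t"
  shows "(t / 2) powr (11/8) \<le> 25 / 64 * (t::real) powr (11/8)"
proof -
  have "t powr (11/8) * (128 / 50) \<le> t powr (11/8) * 2 powr (11/8)"
    by (intro mult_left_mono two_powr_bound) simp
  then show ?thesis using assms by (simp add: powr_divide divide_le_eq)
qed

definition cvar :: "'a measure \<Rightarrow> ('a \<Rightarrow> real) \<Rightarrow> real" where
  "cvar M Y = (\<integral>\<omega>. (Y \<omega> - (\<integral>\<omega>. Y \<omega> \<partial>M))\<^sup>2 \<partial>M)"

lemma (in prob_space) integrable_bounded_measurable:
  fixes Y :: "'a \<Rightarrow> real"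
  assumes "Y \<in> borel_measurable M" "\<And>\<omega>. \<omega> \<in> space M \<Longrightarrow> \<bar>Y \<omega>\<bar> \<le> B"
  shows "integrable M Y"
  by (rule integrable_const_bound[of _ B]) (use assms in \<open>auto intro!: AE_I2\<close>)

lemma (in prob_space) cvar_le_second_moment:
  assumes "integrable M Y" "integrable M (\<lambda>\<omega>. (Y \<omega>)\<^sup>2)"
  shows "cvar M Y \<le> (\<integral>\<omega>. (Y \<omega>)\<^sup>2 \<partial>M)"
proof -
  have "cvar M Y = (\<integral>\<omega>. (Y \<omega>)\<^sup>2 \<partial>M) - (\<integral>\<omega>. Y \<omega> \<partial>M)\<^sup>2"
    unfolding cvar_def using variance_eq[OF assms] .
  then show ?thesis by simp
qed

text \<open>The variances of the uncorrelated parts add up; the remainder \<open>c\<close> is split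
  off with a weight close to one, because \<open>11/10\<close> is multiplied by
  \<open>2 * 25/64\<close> at each halving and the result \<open>55/64\<close> has to stay below
  one.\<close>

lemma (in prob_space) cvar_sum3:
  fixes a b c :: "'a \<Rightarrow> real"
  assumes [measurable]: "a \<in> borel_measurable M" "b \<in> borel_measurable M" "c \<in> borel_measurable M"
    and B: "\<And>\<omega>. \<omega> \<in> space M \<Longrightarrow> \<bar>a \<omega>\<bar> \<le> B" "\<And>\<omega>. \<omega> \<in> space M \<Longrightarrow> \<bar>b \<omega>\<bar> \<le> B" "\<And>\<omega>. \<omega> \<in> space M \<Longrightarrow> \<bar>c \<omega>\<bar> \<le> B"
    and ind: "(\<integral>\<omega>. a \<omega> * b \<omega> \<partial>M) = (\<integral>\<omega>. a \<omega> \<partial>M) * (\<integral>\<omega>. b \<omega> \<partial>M)"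
  shows "cvar M (\<lambda>\<omega>. a \<omega> + b \<omega> + c \<omega>) \<le> 11/10 * (cvar M a + cvar M b) + 11 * (\<integral>\<omega>. (c \<omega>)\<^sup>2 \<partial>M)"
proof -
  have B0: "0 \<le> B" using B(1) not_empty by force
  have prod_bound: "\<bar>u \<omega> * v \<omega>\<bar> \<le> B * B" if "\<omega> \<in> space M" "\<bar>u \<omega>\<bar> \<le> B" "\<bar>v \<omega>\<bar> \<le> B" for u v :: "'a \<Rightarrow> real" and \<omega>
    unfolding abs_mult using that B0 by (intro mult_mono) auto
  have i[simp]: "integrable M a" "integrable M b" "integrable M c"
    by (intro integrable_bounded_measurable[of _ B]; simp add: B)+
  have i2[simp]: "integrable M (\<lambda>\<omega>. a \<omega> * b \<omega>)" "integrable M (\<lambda>\<omega>. a \<omega> * a \<omega>)" "integrable M (\<lambda>\<omega>. b \<omega> * b \<omega>)" "integrable M (\<lambda>\<omega>. c \<omega> * c \<omega>)"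
    by (intro integrable_bounded_measurable[of _ "B * B"] prod_bound; simp add: B)+
  define ea eb ec where e: "ea = (\<integral>\<omega>. a \<omega> \<partial>M)" "eb = (\<integral>\<omega>. b \<omega> \<partial>M)" "ec = (\<integral>\<omega>. c \<omega> \<partial>M)"
  have sq: "(x + y)\<^sup>2 \<le> 11/10 * x\<^sup>2 + 11 * y\<^sup>2" for x y :: real
    using zero_le_power2[of "x - 10 * y"] by (simp add: power2_eq_square algebra_simps)
  have ii: "integrable M (\<lambda>\<omega>. (a \<omega> - ea)\<^sup>2)" "integrable M (\<lambda>\<omega>. (b \<omega> - eb)\<^sup>2)" "integrable M (\<lambda>\<omega>. (c \<omega> - ec)\<^sup>2)"
    "integrable M (\<lambda>\<omega>. (a \<omega> - ea) * (b \<omega> - eb))"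
    by (simp_all add: power2_eq_square algebra_simps)
  have cov: "(\<integral>\<omega>. (a \<omega> - ea) * (b \<omega> - eb) \<partial>M) = 0"
    by (simp add: algebra_simps ind prob_space e)
  have "cvar M (\<lambda>\<omega>. a \<omega> + b \<omega> + c \<omega>) = (\<integral>\<omega>. (((a \<omega> - ea) + (b \<omega> - eb)) + (c \<omega> - ec))\<^sup>2 \<partial>M)"
    unfolding cvar_def e by (simp add: algebra_simps)
  also have "\<dots> \<le> (\<integral>\<omega>. 11/10 * ((a \<omega> - ea)\<^sup>2 + (b \<omega> - eb)\<^sup>2 + 2 * ((a \<omega> - ea) * (b \<omega> - eb))) + 11 * (c \<omega> - ec)\<^sup>2 \<partial>M)"
  proof (rule integral_mono)
    have "integrable M (\<lambda>\<omega>. (a \<omega> + b \<omega> + c \<omega> - (ea + eb + ec))\<^sup>2)"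
    proof (rule integrable_bounded_measurable)
      fix \<omega> assume w: "\<omega> \<in> space M"
      have "\<bar>a \<omega> + b \<omega> + c \<omega> - (ea + eb + ec)\<bar> \<le> 3 * B + \<bar>ea + eb + ec\<bar>" using B[OF w] by linarith
      then have "\<bar>a \<omega> + b \<omega> + c \<omega> - (ea + eb + ec)\<bar>\<^sup>2 \<le> (3 * B + \<bar>ea + eb + ec\<bar>)\<^sup>2" by (intro power_mono) auto
      then show "\<bar>(a \<omega> + b \<omega> + c \<omega> - (ea + eb + ec))\<^sup>2\<bar> \<le> (3 * B + \<bar>ea + eb + ec\<bar>)\<^sup>2" by simp
    qed measurable
    then show "integrable M (\<lambda>\<omega>. (((a \<omega> - ea) + (b \<omega> - eb)) + (c \<omega> - ec))\<^sup>2)" by (simp add: algebra_simps)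
    show "integrable M (\<lambda>\<omega>. 11/10 * ((a \<omega> - ea)\<^sup>2 + (b \<omega> - eb)\<^sup>2 + 2 * ((a \<omega> - ea) * (b \<omega> - eb))) + 11 * (c \<omega> - ec)\<^sup>2)"
      using ii by (intro Bochner_Integration.integrable_add integrable_mult_right)
    show "(((a \<omega> - ea) + (b \<omega> - eb)) + (c \<omega> - ec))\<^sup>2 \<le> 11/10 * ((a \<omega> - ea)\<^sup>2 + (b \<omega> - eb)\<^sup>2 + 2 * ((a \<omega> - ea) * (b \<omega> - eb))) + 11 * (c \<omega> - ec)\<^sup>2" for \<omega>
      using sq[of "(a \<omega> - ea) + (b \<omega> - eb)" "c \<omega> - ec"]
      unfolding power2_sum[of "a \<omega> - ea" "b \<omega> - eb"] by (simp only: mult.assoc)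
  qed
  also have "\<dots> = 11/10 * (cvar M a + cvar M b) + 11 * cvar M c"
    using ii cov by (simp add: cvar_def e)
  also have "cvar M c \<le> (\<integral>\<omega>. (c \<omega>)\<^sup>2 \<partial>M)"
    by (rule cvar_le_second_moment) (simp_all add: power2_eq_square)
  finally show ?thesis by simp
qed

lemma tri_bound:
  assumes B: "0 \<le> B" "\<And>x. \<bar>f x\<bar> \<le> B" and f: "bcf f" and x: "x \<in> borel_measurable borel" and t: "0 \<le> t"
  shows "\<bar>tri f t x\<bar> \<le> B * t\<^sup>2"
  by (rule dbl_bound[OF B f x]) (use emeasure_tset[OF t] t in \<open>auto simp: power2_eq_square\<close>)

lemma rect_bound:
  assumes B: "0 \<le> B" "\<And>x. \<bar>f x\<bar> \<le> B" and f: "bcf f" and x: "x \<in> borel_measurable borel" and t: "0 \<le> a" "0 \<le> h"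
  shows "\<bar>rect f a (a + h) x\<bar> \<le> B * (h * a)"
  by (rule dbl_bound[OF B f x]) (use emeasure_rset[of a "a + h"] t in auto)

lemma tri_shift:
  assumes f: "bcf f" and X: "bm M X" and w: "\<omega> \<in> space M" and a: "0 \<le> a" and t: "0 \<le> t"
  shows "tri f t (\<lambda>s. X (a + s) \<omega>) = tri f t (\<lambda>s. resc X a 1 s \<omega>)"
  using tri_rescale[OF f X w a, of 1 t] t by simp

lemma bcf_scale: "bcf f \<Longrightarrow> bcf (\<lambda>z. f (c *\<^sub>R z))"
  unfolding bcf_def by (auto intro!: continuous_on_compose2[of UNIV f] continuous_intros)

text \<open>Two blocks of equal length, both brought to unit time with kernel
  \<open>f (sqrt h z)\<close> so that \<open>indep_blocks\<close> applies.\<close>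

lemma tri_two_blocks_uncorrelated:
  assumes X: "bm M X" and f: "bcf f" and h: "0 < h"
  shows "(\<integral>\<omega>. tri f h (\<lambda>s. X s \<omega>) * tri f h (\<lambda>s. resc X h 1 s \<omega>) \<partial>M)
    = (\<integral>\<omega>. tri f h (\<lambda>s. X s \<omega>) \<partial>M) * (\<integral>\<omega>. tri f h (\<lambda>s. resc X h 1 s \<omega>) \<partial>M)"
proof -
  let ?f = "\<lambda>z. f (sqrt h *\<^sub>R z)"
  have "(\<integral>\<omega>. (\<Prod>k<2::nat. (h\<^sup>2 * tri ?f 1 (\<lambda>s. resc X (real k * h) h s \<omega>))) \<partial>M)
    = (\<Prod>k<2. \<integral>\<omega>. (h\<^sup>2 * tri ?f 1 (\<lambda>s. resc X (real k * h) h s \<omega>)) \<partial>M)"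
    by (rule indep_blocks[OF X, where g = "\<lambda>k y. h\<^sup>2 * y"])
      (use h in \<open>auto simp: algebra_simps intro!: bcf_scale f continuous_intros\<close>)
  moreover have "tri f h (\<lambda>s. X s \<omega>) = h\<^sup>2 * tri ?f 1 (\<lambda>s. resc X 0 h s \<omega>)"
    "tri f h (\<lambda>s. resc X h 1 s \<omega>) = h\<^sup>2 * tri ?f 1 (\<lambda>s. resc X h h s \<omega>)" if w: "\<omega> \<in> space M" for \<omega>
    using tri_rescale[OF f X w, of 0 h 1] tri_rescale[OF f X w, of h h 1] tri_shift[OF f X w, of h h] h by auto
  ultimately show ?thesis
    by (simp add: lessThan_Suc numeral_2_eq_2 mult_ac cong: Bochner_Integration.integral_cong)
qed

lemma cvar_cong: "(\<And>\<omega>. \<omega> \<in> space M \<Longrightarrow> Y \<omega> = Z \<omega>) \<Longrightarrow> cvar M Y = cvar M Z"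
  unfolding cvar_def by (simp cong: Bochner_Integration.integral_cong)

lemma (in prob_space) cvar_bounded:
  fixes Y :: "'a \<Rightarrow> real"
  assumes [measurable]: "Y \<in> borel_measurable M" and B: "\<And>\<omega>. \<omega> \<in> space M \<Longrightarrow> \<bar>Y \<omega>\<bar> \<le> B"
  shows "cvar M Y \<le> B\<^sup>2"
proof -
  have sq: "(Y \<omega>)\<^sup>2 \<le> B\<^sup>2" if "\<omega> \<in> space M" for \<omega>
    using power_mono[OF B[OF that], of 2] by simp
  have i: "integrable M Y" by (rule integrable_bounded_measurable[OF _ B]) auto
  have i2: "integrable M (\<lambda>\<omega>. (Y \<omega>)\<^sup>2)" by (rule integrable_bounded_measurable[of _ "B\<^sup>2"]) (auto simp: sq)
  have "cvar M Y \<le> (\<integral>\<omega>. (Y \<omega>)\<^sup>2 \<partial>M)" by (rule cvar_le_second_moment[OF i i2])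
  also have "\<dots> \<le> (\<integral>\<omega>. B\<^sup>2 \<partial>M)" by (rule integral_mono_AE[OF i2]) (auto intro!: AE_I2 sq)
  finally show ?thesis by (simp add: prob_space)
qed

text \<open>Halving the time interval: the two halves are independent and the interaction between them is
  controlled by the rectangle bound; the recursion contracts because \<open>2 < 2 powr (11/8)\<close>.\<close>

lemma tri_variance_step:
  assumes f: "kern f" and z: "(\<integral>x. f x \<partial>lborel) = 0" and Q: "mass f * hmom f \<le> Q" "0 < Q"
    and B: "0 \<le> B" "\<And>x. \<bar>f x\<bar> \<le> B"
  shows "bm M X \<Longrightarrow> 0 \<le> t \<Longrightarrow> t \<le> 1 \<Longrightarrow>
    cvar M (\<lambda>\<omega>. tri f t (\<lambda>s. X s \<omega>)) \<le> 10000 * Q * t powr (11/8) + (1/4) ^ N * (B * t\<^sup>2)\<^sup>2"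
proof (induction N arbitrary: X t)
  case 0
  then interpret prob_space M by (intro bm_prob_space)
  have "cvar M (\<lambda>\<omega>. tri f t (\<lambda>s. X s \<omega>)) \<le> (B * t\<^sup>2)\<^sup>2"
    by (rule cvar_bounded[OF dbl_measurable[OF 0(1) kern_bcf[OF f] tset_measurable]])
      (intro tri_bound[OF B kern_bcf[OF f] bm_path_measurable[OF 0(1)] 0(2)])
  then show ?case using Q by (simp add: add_increasing)
next
  case (Suc N)
  note X = Suc.prems(1) and t = Suc.prems(2,3)
  interpret prob_space M by (rule bm_prob_space[OF X])
  note bf = kern_bcf[OF f]
  show ?case
  proof (cases "t = 0")
    case True
    have "cvar M (\<lambda>\<omega>. tri f t (\<lambda>s. X s \<omega>)) \<le> (B * t\<^sup>2)\<^sup>2"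
      by (rule cvar_bounded[OF dbl_measurable[OF X bf tset_measurable]])
        (intro tri_bound[OF B bf bm_path_measurable[OF X] t(1)])
    then show ?thesis using True by simp
  next
    case False
    define h where "h = t / 2"
    have h: "0 < h" "h \<le> 1" "t = h + h" using False t by (auto simp: h_def)
    define X2 where "X2 = resc X h 1"
    have X2: "bm M X2" unfolding X2_def by (rule bm_resc[OF X]) (use h in auto)
    define a where "a = (\<lambda>\<omega>. tri f h (\<lambda>s. X s \<omega>))"
    define b where "b = (\<lambda>\<omega>. tri f h (\<lambda>s. X2 s \<omega>))"
    define c where "c = (\<lambda>\<omega>. rect f h (h + h) (\<lambda>s. X s \<omega>))"
    have [measurable]: "a \<in> borel_measurable M" "b \<in> borel_measurable M" "c \<in> borel_measurable M"
      unfolding a_def b_def c_def by (intro dbl_measurable X X2 bf; simp)+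
    have "cvar M (\<lambda>\<omega>. tri f t (\<lambda>s. X s \<omega>)) = cvar M (\<lambda>\<omega>. a \<omega> + b \<omega> + c \<omega>)"
      using h tri_split[OF bf bm_path_measurable[OF X], of _ h h] tri_shift[OF bf X, of _ h h]
      by (intro cvar_cong) (simp add: a_def b_def c_def X2_def)
    also have "\<dots> \<le> 11/10 * (cvar M a + cvar M b) + 11 * (\<integral>\<omega>. (c \<omega>)\<^sup>2 \<partial>M)"
    proof (rule cvar_sum3)
      have h2: "B * h\<^sup>2 \<le> B" using h B by (simp add: mult_left_le power_le_one)
      have h3: "B * (h * h) \<le> B" using h2 by (simp add: power2_eq_square)
      show "\<bar>a \<omega>\<bar> \<le> B" "\<bar>b \<omega>\<bar> \<le> B" "\<bar>c \<omega>\<bar> \<le> B" if "\<omega> \<in> space M" for \<omega>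
        unfolding a_def b_def c_def
        using h2 h3 tri_bound[OF B bf bm_path_measurable[OF X that], of h] tri_bound[OF B bf bm_path_measurable[OF X2 that], of h]
          rect_bound[OF B bf bm_path_measurable[OF X that], of h h] h by linarith+
      show "(\<integral>\<omega>. a \<omega> * b \<omega> \<partial>M) = (\<integral>\<omega>. a \<omega> \<partial>M) * (\<integral>\<omega>. b \<omega> \<partial>M)"
        unfolding a_def b_def X2_def by (rule tri_two_blocks_uncorrelated[OF X bf h(1)])
    qed measurable
    also have "\<dots> \<le> 11/10 * ((10000 * Q * h powr (11/8) + (1/4) ^ N * (B * h\<^sup>2)\<^sup>2) + (10000 * Q * h powr (11/8) + (1/4) ^ N * (B * h\<^sup>2)\<^sup>2))
        + 11 * (300 * Q * h powr (11/8))"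
      unfolding a_def b_def c_def
      by (intro add_mono mult_left_mono Suc.IH X X2 rect_second_moment[OF X f z Q]) (use h in auto)
    also have "\<dots> = 25300 * Q * h powr (11/8) + 11/5 * ((1/4) ^ N * (B * h\<^sup>2)\<^sup>2)"
      by (simp add: algebra_simps)
    \<comment> \<open>\<open>25300 = 2 * 11/10 * 10000 + 11 * 300\<close>, and \<open>25/64\<close>
      of it is below \<open>10000\<close>. The crude error is homogeneous of degree four in the
      time, so it shrinks by \<open>11/5 / 16 < 1/4\<close>.\<close>
    also have "\<dots> \<le> 25300 * Q * (25 / 64 * t powr (11/8)) + (1/4) ^ Suc N * (B * t\<^sup>2)\<^sup>2"
    proof (rule add_mono)
      show "25300 * Q * h powr (11/8) \<le> 25300 * Q * (25 / 64 * t powr (11/8))"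
        unfolding h_def using Q t half_powr_bound[of t] by (intro mult_left_mono) auto
      have "(1/4) ^ N * (B * h\<^sup>2)\<^sup>2 = (1/16) * ((1/4) ^ N * (B * t\<^sup>2)\<^sup>2)"
        by (simp add: h_def power_divide power_mult_distrib)
      moreover have "0 \<le> (1/4) ^ N * (B * t\<^sup>2)\<^sup>2" by simp
      moreover have "(1/4) ^ Suc N * (B * t\<^sup>2)\<^sup>2 = (1/4) * ((1/4) ^ N * (B * t\<^sup>2)\<^sup>2)" by simp
      ultimately show "11/5 * ((1/4) ^ N * (B * h\<^sup>2)\<^sup>2) \<le> (1/4) ^ Suc N * (B * t\<^sup>2)\<^sup>2"
        by linarith
    qed
    also have "25300 * Q * (25 / 64 * t powr (11/8)) \<le> 10000 * Q * t powr (11/8)"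
      using Q by simp
    finally show ?thesis by simp
  qed
qed

text \<open>The second term of \<open>tri_variance_step\<close> carries the supremum of
  \<open>f\<close> and vanishes as the recursion depth grows; what remains knows \<open>f\<close>
  only through \<open>mass\<close> and \<open>hmom\<close>.\<close>

lemma tri_variance:
  assumes f: "kern f" and z: "(\<integral>x. f x \<partial>lborel) = 0" and Q: "mass f * hmom f \<le> Q" "0 < Q"
    and X: "bm M X" and t: "0 \<le> t" "t \<le> 1"
  shows "cvar M (\<lambda>\<omega>. tri f t (\<lambda>s. X s \<omega>)) \<le> 10000 * Q * t powr (11/8)"
proof -
  obtain B where B: "0 \<le> B" "\<And>x. \<bar>f x\<bar> \<le> B" using kern_bounded[OF f] by blast
  have "(\<lambda>N. 10000 * Q * t powr (11/8) + (1/4) ^ N * (B * t\<^sup>2)\<^sup>2) \<longlonglongrightarrow> 10000 * Q * t powr (11/8) + 0 * (B * t\<^sup>2)\<^sup>2"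
    by (intro tendsto_intros LIMSEQ_realpow_zero) auto
  then show ?thesis
    using LIMSEQ_le_const[of _ _ "cvar M (\<lambda>\<omega>. tri f t (\<lambda>s. X s \<omega>))"] tri_variance_step[OF f z Q B X t] by simp
qed

section \<open>Centered double integrals and their increments\<close>

definition ctri :: "'a measure \<Rightarrow> (R2 \<Rightarrow> real) \<Rightarrow> real \<Rightarrow> (real \<Rightarrow> 'a \<Rightarrow> R2) \<Rightarrow> 'a \<Rightarrow> real" where
  "ctri M f t X \<omega> = tri f t (\<lambda>s. X s \<omega>) - (\<integral>\<omega>. tri f t (\<lambda>s. X s \<omega>) \<partial>M)"

lemma ctri_measurable: "bm M X \<Longrightarrow> bcf f \<Longrightarrow> ctri M f t X \<in> borel_measurable M"
  unfolding ctri_def[abs_def] by (intro borel_measurable_diff dbl_measurable) auto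

lemma integrable_tri:
  assumes X: "bm M X" and f: "bcf f" and t: "0 \<le> t"
  shows "integrable M (\<lambda>\<omega>. tri f t (\<lambda>s. X s \<omega>))"
proof -
  interpret prob_space M by (rule bm_prob_space[OF X])
  obtain B where B: "0 \<le> B" "\<And>x. \<bar>f x\<bar> \<le> B" using bcf_bounded[OF f] by blast
  show ?thesis
    by (rule integrable_bounded_measurable[OF dbl_measurable[OF X f tset_measurable] tri_bound[OF B f bm_path_measurable[OF X] t]])
qed

text \<open>The increment is the triangle over \<open>[s, t]\<close> plus the rectangle between
  \<open>[0, s]\<close> and \<open>[s, t]\<close>; both have variance of order
  \<open>(t - s) powr (11/8)\<close>, and \<open>2 * (10000 + 300) \<le> 21000\<close>.\<close>

lemma ctri_increment:
  assumes f: "kern f" and z: "(\<integral>x. f x \<partial>lborel) = 0" and Q: "mass f * hmom f \<le> Q" "0 < Q"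
    and X: "bm M X" and s: "0 \<le> s" "s < t" "t \<le> 1"
  shows "(\<integral>\<omega>. (ctri M f t X \<omega> - ctri M f s X \<omega>)\<^sup>2 \<partial>M) \<le> 21000 * Q * (t - s) powr (11/8)"
proof -
  interpret prob_space M by (rule bm_prob_space[OF X])
  obtain B where B: "0 \<le> B" "\<And>x. \<bar>f x\<bar> \<le> B" using kern_bounded[OF f] by blast
  note bf = kern_bcf[OF f]
  define h where "h = t - s"
  have h: "0 < h" "h \<le> 1" "t = s + h" using s by (auto simp: h_def)
  define X2 where "X2 = resc X s 1"
  have X2: "bm M X2" unfolding X2_def by (rule bm_resc[OF X]) (use s in auto)
  define b where "b = (\<lambda>\<omega>. tri f h (\<lambda>s. X2 s \<omega>))"
  define c where "c = (\<lambda>\<omega>. rect f s (s + h) (\<lambda>s. X s \<omega>))"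
  have [measurable]: "b \<in> borel_measurable M" "c \<in> borel_measurable M"
    unfolding b_def c_def by (intro dbl_measurable X X2 bf; simp)+
  have cB: "\<bar>c \<omega>\<bar> \<le> B * (h * s)" if "\<omega> \<in> space M" for \<omega>
    unfolding c_def by (rule rect_bound[OF B bf bm_path_measurable[OF X that]]) (use s h in auto)
  have bB: "\<bar>b \<omega>\<bar> \<le> B * h\<^sup>2" if "\<omega> \<in> space M" for \<omega>
    unfolding b_def by (rule tri_bound[OF B bf bm_path_measurable[OF X2 that]]) (use s h in auto)
  have ib: "integrable M b" and ic: "integrable M c"
    by (rule integrable_bounded_measurable[OF _ bB], simp, simp, rule integrable_bounded_measurable[OF _ cB], simp, simp)
  have split: "tri f t (\<lambda>s. X s \<omega>) = tri f s (\<lambda>s. X s \<omega>) + b \<omega> + c \<omega>" if "\<omega> \<in> space M" for \<omega>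
    using h s tri_split[OF bf bm_path_measurable[OF X that], of s h] tri_shift[OF bf X that, of s h]
    by (simp add: b_def c_def X2_def)
  have "(\<integral>\<omega>. tri f t (\<lambda>s. X s \<omega>) \<partial>M) = (\<integral>\<omega>. tri f s (\<lambda>s. X s \<omega>) + b \<omega> + c \<omega> \<partial>M)"
    by (rule Bochner_Integration.integral_cong) (auto simp: split)
  also have "\<dots> = (\<integral>\<omega>. tri f s (\<lambda>s. X s \<omega>) \<partial>M) + (\<integral>\<omega>. b \<omega> \<partial>M) + (\<integral>\<omega>. c \<omega> \<partial>M)"
    using ib ic integrable_tri[OF X bf s(1)] by simp
  finally have e: "ctri M f t X \<omega> - ctri M f s X \<omega> = (b \<omega> - (\<integral>\<omega>. b \<omega> \<partial>M)) + (c \<omega> - (\<integral>\<omega>. c \<omega> \<partial>M))"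
    if "\<omega> \<in> space M" for \<omega>
    unfolding ctri_def using split[OF that] by simp
  have sqi: "integrable M (\<lambda>\<omega>. (u \<omega> - k)\<^sup>2)" if [measurable]: "u \<in> borel_measurable M" and "\<And>\<omega>. \<omega> \<in> space M \<Longrightarrow> \<bar>u \<omega>\<bar> \<le> K" for u :: "'a \<Rightarrow> real" and k K
  proof (rule integrable_bounded_measurable)
    fix \<omega> assume "\<omega> \<in> space M"
    then have "\<bar>u \<omega> - k\<bar> \<le> K + \<bar>k\<bar>" using that(2)[of \<omega>] by linarith
    then have "\<bar>u \<omega> - k\<bar>\<^sup>2 \<le> (K + \<bar>k\<bar>)\<^sup>2" by (intro power_mono) auto
    then show "\<bar>(u \<omega> - k)\<^sup>2\<bar> \<le> (K + \<bar>k\<bar>)\<^sup>2" by simp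
  qed measurable
  have ib2: "integrable M (\<lambda>\<omega>. (b \<omega> - (\<integral>\<omega>. b \<omega> \<partial>M))\<^sup>2)" by (rule sqi[OF _ bB]) auto
  have ic2: "integrable M (\<lambda>\<omega>. (c \<omega> - (\<integral>\<omega>. c \<omega> \<partial>M))\<^sup>2)" by (rule sqi[OF _ cB]) auto
  have ic3: "integrable M (\<lambda>\<omega>. (c \<omega>)\<^sup>2)"
  proof (rule integrable_bounded_measurable[of _ "(B * (h * s))\<^sup>2"])
    show "\<bar>(c \<omega>)\<^sup>2\<bar> \<le> (B * (h * s))\<^sup>2" if "\<omega> \<in> space M" for \<omega>
      using power_mono[OF cB[OF that], of 2] by simp
  qed measurable
  have "(\<integral>\<omega>. (ctri M f t X \<omega> - ctri M f s X \<omega>)\<^sup>2 \<partial>M)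
    \<le> (\<integral>\<omega>. 2 * (b \<omega> - (\<integral>\<omega>. b \<omega> \<partial>M))\<^sup>2 + 2 * (c \<omega> - (\<integral>\<omega>. c \<omega> \<partial>M))\<^sup>2 \<partial>M)"
  proof (rule integral_mono')
    show "integrable M (\<lambda>\<omega>. 2 * (b \<omega> - (\<integral>\<omega>. b \<omega> \<partial>M))\<^sup>2 + 2 * (c \<omega> - (\<integral>\<omega>. c \<omega> \<partial>M))\<^sup>2)"
      using ib2 ic2 by simp
    fix \<omega> assume w: "\<omega> \<in> space M"
    have "(x + y)\<^sup>2 \<le> 2 * x\<^sup>2 + 2 * y\<^sup>2" for x y :: real
      using zero_le_power2[of "x - y"] by (simp add: power2_eq_square algebra_simps)
    then show "(ctri M f t X \<omega> - ctri M f s X \<omega>)\<^sup>2 \<le> 2 * (b \<omega> - (\<integral>\<omega>. b \<omega> \<partial>M))\<^sup>2 + 2 * (c \<omega> - (\<integral>\<omega>. c \<omega> \<partial>M))\<^sup>2"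
      unfolding e[OF w] .
  qed simp
  also have "\<dots> = 2 * cvar M b + 2 * cvar M c"
    unfolding cvar_def using ib2 ic2 by simp
  also have "cvar M b \<le> 10000 * Q * h powr (11/8)"
    unfolding b_def by (rule tri_variance[OF f z Q X2]) (use h in auto)
  also have "cvar M c \<le> 300 * Q * h powr (11/8)"
  proof (cases "s = 0")
    \<comment> \<open>The rectangle bound needs a positive splitting time; at \<open>s = 0\<close>
      the rectangle has measure zero.\<close>
    case True
    have "cvar M c \<le> (B * (h * s))\<^sup>2" by (rule cvar_bounded[OF _ cB]) auto
    then show ?thesis using True Q by (simp add: order_trans[of _ 0])
  next
    case False
    have "cvar M c \<le> (\<integral>\<omega>. (c \<omega>)\<^sup>2 \<partial>M)" by (rule cvar_le_second_moment[OF ic ic3])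
    also have "\<dots> \<le> 300 * Q * h powr (11/8)"
      unfolding c_def by (rule rect_second_moment[OF X f z Q]) (use False s h in auto)
    finally show ?thesis .
  qed
  finally have "(\<integral>\<omega>. (ctri M f t X \<omega> - ctri M f s X \<omega>)\<^sup>2 \<partial>M) \<le> 20600 * (Q * h powr (11/8))" by simp
  also have "\<dots> \<le> 21000 * (Q * h powr (11/8))" using Q by (intro mult_right_mono) auto
  finally show ?thesis by (simp add: h_def)
qed

section \<open>Chaining\<close>

text \<open>\<open>ubd M F K\<close> says that the upper integral of \<open>F\<close> is at most \<open>K\<close>; it lets us treat suprema over
  uncountable families without discussing their measurability.\<close>

definition ubd :: "'a measure \<Rightarrow> ('a \<Rightarrow> ennreal) \<Rightarrow> ennreal \<Rightarrow> bool" where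
  "ubd M F K \<longleftrightarrow> (\<exists>S\<in>borel_measurable M. (\<forall>\<omega>\<in>space M. F \<omega> \<le> S \<omega>) \<and> (\<integral>\<^sup>+\<omega>. S \<omega> \<partial>M) \<le> K)"

lemma ubdI: "S \<in> borel_measurable M \<Longrightarrow> (\<And>\<omega>. \<omega> \<in> space M \<Longrightarrow> F \<omega> \<le> S \<omega>) \<Longrightarrow> (\<integral>\<^sup>+\<omega>. S \<omega> \<partial>M) \<le> K \<Longrightarrow> ubd M F K"
  unfolding ubd_def by blast

lemma ubdE:
  assumes "ubd M F K"
  obtains S where "S \<in> borel_measurable M" "\<And>\<omega>. \<omega> \<in> space M \<Longrightarrow> F \<omega> \<le> S \<omega>" "(\<integral>\<^sup>+\<omega>. S \<omega> \<partial>M) \<le> K"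
  using assms unfolding ubd_def by blast

lemma ubd_mono:
  assumes "ubd M F K" "\<And>\<omega>. \<omega> \<in> space M \<Longrightarrow> G \<omega> \<le> F \<omega>" "K \<le> L"
  shows "ubd M G L"
  using assms unfolding ubd_def by (meson order_trans)

text \<open>Iterates \<open>(a + b)\<^sup>2 \<le> 8 * a\<^sup>2 + (8/7) * b\<^sup>2\<close>, so that
  the weight \<open>8/7\<close> is paid once per step. It has to be small enough to be beaten by the
  decay \<open>25/32\<close> of the chaining levels.\<close>

lemma sum_square_weighted:
  fixes x :: "nat \<Rightarrow> real"
  shows "(\<Sum>j\<le>J. x j)\<^sup>2 \<le> 8 * (\<Sum>j\<le>J. (8/7) ^ j * (x j)\<^sup>2)"
proof (induction J arbitrary: x)
  case 0
  then show ?case by simp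
next
  case (Suc J)
  have sq: "(a + b)\<^sup>2 \<le> 8 * a\<^sup>2 + (8/7) * b\<^sup>2" for a b :: real
    using zero_le_power2[of "7 * a - b"] by (simp add: power2_eq_square algebra_simps)
  have "(\<Sum>j\<le>Suc J. x j)\<^sup>2 = (x 0 + (\<Sum>j\<le>J. x (Suc j)))\<^sup>2"
    by (simp only: sum.atMost_Suc_shift)
  also have "\<dots> \<le> 8 * (x 0)\<^sup>2 + (8/7) * (\<Sum>j\<le>J. x (Suc j))\<^sup>2" by (rule sq)
  also have "\<dots> \<le> 8 * (x 0)\<^sup>2 + (8/7) * (8 * (\<Sum>j\<le>J. (8/7) ^ j * (x (Suc j))\<^sup>2))"
    using Suc.IH[of "\<lambda>j. x (Suc j)"] by simp
  also have "\<dots> = 8 * (\<Sum>j\<le>Suc J. (8/7) ^ j * (x j)\<^sup>2)"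
    by (simp only: sum.atMost_Suc_shift) (simp add: sum_distrib_left algebra_simps)
  finally show ?case .
qed

lemma ennreal_sum_square_weighted:
  fixes x :: "nat \<Rightarrow> real" and W :: "nat \<Rightarrow> ennreal"
  assumes "\<And>j. ennreal ((x j)\<^sup>2) \<le> W j"
  shows "ennreal ((\<Sum>j\<le>J. x j)\<^sup>2) \<le> 8 * (\<Sum>j. ennreal ((8/7) ^ j) * W j)"
proof -
  have "ennreal ((\<Sum>j\<le>J. x j)\<^sup>2) \<le> ennreal (8 * (\<Sum>j\<le>J. (8/7) ^ j * (x j)\<^sup>2))"
    by (intro ennreal_leI sum_square_weighted)
  also have "\<dots> = 8 * (\<Sum>j\<le>J. ennreal ((8/7) ^ j) * ennreal ((x j)\<^sup>2))"
    by (simp add: ennreal_mult sum_nonneg sum_ennreal[symmetric] del: sum_ennreal)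
  also have "\<dots> \<le> 8 * (\<Sum>j\<le>J. ennreal ((8/7) ^ j) * W j)"
    by (intro mult_left_mono sum_mono assms) auto
  also have "\<dots> \<le> 8 * (\<Sum>j. ennreal ((8/7) ^ j) * W j)"
    by (intro mult_left_mono sum_le_suminf) auto
  finally show ?thesis .
qed

text \<open>The series has ratio at most \<open>8/7 * 25/32 = 25/28\<close>, hence sum
  \<open>28/3\<close>, and \<open>8 * 28/3 < 75\<close>.\<close>

lemma ubd_weighted_sum:
  assumes "\<And>j. ubd M (F j) (ennreal (K * q ^ j))" "0 \<le> K" "0 \<le> q" "q \<le> 25/32"
  shows "ubd M (\<lambda>\<omega>. 8 * (\<Sum>j. ennreal ((8/7) ^ j) * F j \<omega>)) (ennreal (75 * K))"
proof -
  have "\<forall>j. \<exists>S\<in>borel_measurable M. (\<forall>\<omega>\<in>space M. F j \<omega> \<le> S \<omega>) \<and> (\<integral>\<^sup>+\<omega>. S \<omega> \<partial>M) \<le> ennreal (K * q ^ j)"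
    using assms(1) unfolding ubd_def by blast
  then obtain S where S[measurable]: "\<And>j. S j \<in> borel_measurable M" and le: "\<And>j \<omega>. \<omega> \<in> space M \<Longrightarrow> F j \<omega> \<le> S j \<omega>"
    and int: "\<And>j. (\<integral>\<^sup>+\<omega>. S j \<omega> \<partial>M) \<le> ennreal (K * q ^ j)" by metis
  show ?thesis
  proof (rule ubdI[of "\<lambda>\<omega>. 8 * (\<Sum>j. ennreal ((8/7) ^ j) * S j \<omega>)"])
    show "8 * (\<Sum>j. ennreal ((8/7) ^ j) * F j \<omega>) \<le> 8 * (\<Sum>j. ennreal ((8/7) ^ j) * S j \<omega>)" if "\<omega> \<in> space M" for \<omega>
      using le[OF that] by (intro mult_left_mono suminf_le) auto
    have "(\<integral>\<^sup>+\<omega>. 8 * (\<Sum>j. ennreal ((8/7) ^ j) * S j \<omega>) \<partial>M) = 8 * (\<Sum>j. ennreal ((8/7) ^ j) * (\<integral>\<^sup>+\<omega>. S j \<omega> \<partial>M))"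
      by (simp add: nn_integral_cmult nn_integral_suminf)
    also have "\<dots> \<le> 8 * (\<Sum>j. ennreal (K * (25/28) ^ j))"
    proof (intro mult_left_mono suminf_le)
      fix j
      have "ennreal ((8/7) ^ j) * (\<integral>\<^sup>+\<omega>. S j \<omega> \<partial>M) \<le> ennreal ((8/7) ^ j) * ennreal (K * q ^ j)"
        by (intro mult_left_mono int) auto
      also have "\<dots> = ennreal (K * ((8/7) * q) ^ j)"
      proof -
        have "(8/7) ^ j * (K * q ^ j) = K * ((8/7) * q) ^ j" by (simp only: power_mult_distrib mult_ac)
        then show ?thesis using assms by (subst ennreal_mult[symmetric]) auto
      qed
      also have "\<dots> \<le> ennreal (K * (25/28) ^ j)"
        using assms by (intro ennreal_leI mult_left_mono power_mono) auto
      finally show "ennreal ((8/7) ^ j) * (\<integral>\<^sup>+\<omega>. S j \<omega> \<partial>M) \<le> ennreal (K * (25/28) ^ j)" .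
    qed auto
    also have "(\<Sum>j. ennreal (K * (25/28) ^ j)) = ennreal (K * (28/3))"
    proof (rule suminf_ennreal_eq)
      show "(\<lambda>j. K * (25/28) ^ j) sums (K * (28/3))"
        using geometric_sums[of "25/28 :: real"] by (intro sums_mult) simp
    qed (use assms in auto)
    also have "8 * ennreal (K * (28/3)) = ennreal (8 * (K * (28/3)))"
      by (subst ennreal_mult) (use assms in auto)
    also have "\<dots> \<le> ennreal (75 * K)" using assms by (intro ennreal_leI) simp
    finally show "(\<integral>\<^sup>+\<omega>. 8 * (\<Sum>j. ennreal ((8/7) ^ j) * S j \<omega>) \<partial>M) \<le> ennreal (75 * K)" .
  qed measurable
qed

lemma ubd_sum:
  assumes "finite I" "\<And>i. i \<in> I \<Longrightarrow> ubd M (F i) (K i)"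
  shows "ubd M (\<lambda>\<omega>. \<Sum>i\<in>I. F i \<omega>) (\<Sum>i\<in>I. K i)"
proof -
  have "\<forall>i\<in>I. \<exists>S\<in>borel_measurable M. (\<forall>\<omega>\<in>space M. F i \<omega> \<le> S \<omega>) \<and> (\<integral>\<^sup>+\<omega>. S \<omega> \<partial>M) \<le> K i"
    using assms(2) unfolding ubd_def by blast
  then obtain S where S[measurable]: "\<And>i. i \<in> I \<Longrightarrow> S i \<in> borel_measurable M" and le: "\<And>i \<omega>. i \<in> I \<Longrightarrow> \<omega> \<in> space M \<Longrightarrow> F i \<omega> \<le> S i \<omega>"
    and int: "\<And>i. i \<in> I \<Longrightarrow> (\<integral>\<^sup>+\<omega>. S i \<omega> \<partial>M) \<le> K i" by metis
  show ?thesis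
    by (rule ubdI[of "\<lambda>\<omega>. \<Sum>i\<in>I. S i \<omega>"]) (auto simp: nn_integral_sum intro!: sum_mono le int)
qed

section \<open>Dyadic chaining\<close>

lemma dyadic_tendsto: "(\<lambda>j. real_of_int \<lfloor>2 ^ j * t\<rfloor> / 2 ^ j) \<longlonglongrightarrow> t" for t :: real
proof (rule tendsto_sandwich)
  show "(\<lambda>j. t - 1 / 2 ^ j) \<longlonglongrightarrow> t"
    using LIMSEQ_divide_realpow_zero[of 2 1] tendsto_diff[OF tendsto_const, of _ 0 sequentially t] by force
  show "\<forall>\<^sub>F j in sequentially. t - 1 / 2 ^ j \<le> real_of_int \<lfloor>2 ^ j * t\<rfloor> / 2 ^ j"
  proof (intro always_eventually allI)
    fix j
    have "2 ^ j * t - 1 \<le> real_of_int \<lfloor>2 ^ j * t\<rfloor>" by linarith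
    then have "(2 ^ j * t - 1) / 2 ^ j \<le> real_of_int \<lfloor>2 ^ j * t\<rfloor> / 2 ^ j" by (intro divide_right_mono) auto
    then show "t - 1 / 2 ^ j \<le> real_of_int \<lfloor>2 ^ j * t\<rfloor> / 2 ^ j" by (simp add: diff_divide_distrib)
  qed
  show "\<forall>\<^sub>F j in sequentially. real_of_int \<lfloor>2 ^ j * t\<rfloor> / 2 ^ j \<le> t"
    by (intro always_eventually allI) (simp add: divide_le_eq mult.commute)
qed simp

text \<open>The alternative is the next binary digit of \<open>t\<close>; the cell index stays in
  range because \<open>t \<le> 1\<close>.\<close>

lemma dyadic_succ:
  fixes t :: real
  defines "d \<equiv> \<lambda>j. real_of_int \<lfloor>2 ^ j * t\<rfloor> / 2 ^ j"
  assumes t: "0 \<le> t" "t \<le> 1"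
  shows "d (Suc j) = d j \<or> (\<exists>i<2 ^ Suc j. d j = real i / 2 ^ Suc j \<and> d (Suc j) = real (Suc i) / 2 ^ Suc j)"
proof -
  define y where "y = 2 ^ j * t"
  define i where "i = nat \<lfloor>y\<rfloor>"
  have y: "0 \<le> y" using t by (simp add: y_def)
  have i: "real_of_int \<lfloor>y\<rfloor> = real i" using y by (simp add: i_def)
  have dj: "d j = real (2 * i) / 2 ^ Suc j" by (simp add: d_def y_def[symmetric] i)
  have dis: "\<lfloor>2 * y\<rfloor> = 2 * \<lfloor>y\<rfloor> \<or> \<lfloor>2 * y\<rfloor> = 2 * \<lfloor>y\<rfloor> + 1" by linarith
  have ds: "d (Suc j) = real_of_int \<lfloor>2 * y\<rfloor> / 2 ^ Suc j" by (simp add: d_def y_def mult.assoc)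
  have lt: "2 * i < 2 ^ Suc j" if "\<lfloor>2 * y\<rfloor> = 2 * \<lfloor>y\<rfloor> + 1"
  proof -
    have "2 * y \<le> 2 ^ Suc j" using t by (simp add: y_def)
    then have "real (2 * i) + 1 \<le> 2 ^ Suc j" using that i by linarith
    then have "2 * real i + 1 \<le> 2 * 2 ^ j" by simp
    then have "real i < 2 ^ j" by linarith
    moreover have "real (2 ^ j) = (2 :: real) ^ j" by simp
    ultimately have "real i < real (2 ^ j)" by linarith
    then have "i < 2 ^ j" by (simp only: of_nat_less_iff)
    then show ?thesis by simp
  qed
  from dis show ?thesis
  proof
    assume "\<lfloor>2 * y\<rfloor> = 2 * \<lfloor>y\<rfloor>"
    then have "real_of_int \<lfloor>2 * y\<rfloor> = real (2 * i)" using i by simp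
    then have "d (Suc j) = d j" unfolding ds dj by (simp only:)
    then show ?thesis by simp
  next
    assume B: "\<lfloor>2 * y\<rfloor> = 2 * \<lfloor>y\<rfloor> + 1"
    then have "real_of_int \<lfloor>2 * y\<rfloor> = real (Suc (2 * i))" using i by simp
    then have "d (Suc j) = real (Suc (2 * i)) / 2 ^ Suc j" unfolding ds by (simp only:)
    then show ?thesis using dj lt[OF B] by blast
  qed
qed

text \<open>Kolmogorov's argument for a random pseudodistance. The \<open>2 ^ j\<close> cells of
  level \<open>j\<close> contribute \<open>2 ^ j * (1 / 2 ^ j) powr (11/8) = q ^ j\<close> with
  \<open>q = 2 powr (-3/8)\<close>, and \<open>cont\<close> only closes the gap between the dyadic
  approximations and \<open>t\<close>. The distance is abstract since the lemma is applied twice, to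
  time and to the mollification parameter.\<close>

lemma chaining:
  fixes D :: "real \<Rightarrow> real \<Rightarrow> 'a \<Rightarrow> real"
  assumes D0: "\<And>s t \<omega>. \<omega> \<in> space M \<Longrightarrow> 0 \<le> D s t \<omega>" "\<And>t \<omega>. \<omega> \<in> space M \<Longrightarrow> D t t \<omega> = 0"
    and tri: "\<And>r s t \<omega>. \<omega> \<in> space M \<Longrightarrow> D r t \<omega> \<le> D r s \<omega> + D s t \<omega>"
    and cont: "\<And>\<omega> u t. \<omega> \<in> space M \<Longrightarrow> u \<longlonglongrightarrow> t \<Longrightarrow> (\<And>j. 0 \<le> u j \<and> u j \<le> 1) \<Longrightarrow> 0 \<le> t \<Longrightarrow> t \<le> 1 \<Longrightarrow> (\<lambda>j. D (u j) t \<omega>) \<longlonglongrightarrow> 0"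
    and bd: "\<And>s t. 0 \<le> s \<Longrightarrow> s < t \<Longrightarrow> t \<le> 1 \<Longrightarrow> ubd M (\<lambda>\<omega>. ennreal ((D s t \<omega>)\<^sup>2)) (ennreal (K * (t - s) powr (11/8)))"
    and K: "0 \<le> K"
  shows "ubd M (\<lambda>\<omega>. SUP t\<in>{0..1}. ennreal ((D 0 t \<omega>)\<^sup>2)) (ennreal (75 * K))"
proof -
  define W where "W j \<omega> = (\<Sum>i<(2::nat) ^ j. ennreal ((D (real i / 2 ^ j) (real (Suc i) / 2 ^ j) \<omega>)\<^sup>2))" for j \<omega>
  define q where "q = (2::real) powr (-3/8)"
  have q: "q \<le> 25/32"
  proof -
    have "q = 2 / 2 powr (11/8)" unfolding q_def using powr_diff[of 2 1 "11/8::real"] by simp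
    also have "\<dots> \<le> 2 / (128/50)" by (intro divide_left_mono two_powr_bound) auto
    finally show ?thesis by simp
  qed
  have Wbd: "ubd M (W j) (ennreal (K * q ^ j))" for j
  proof -
    have "ubd M (W j) (\<Sum>i<(2::nat) ^ j. ennreal (K * (1 / 2 ^ j) powr (11/8)))"
      unfolding W_def
    proof (rule ubd_sum)
      fix i :: nat assume "i \<in> {..<2 ^ j}"
      then have "Suc i \<le> 2 ^ j" by simp
      then have "real (Suc i) \<le> 2 ^ j" by (metis of_nat_le_iff of_nat_numeral of_nat_power)
      then have "real (Suc i) / 2 ^ j \<le> 1" by simp
      moreover have "real (Suc i) / 2 ^ j - real i / 2 ^ j = 1 / 2 ^ j" by (simp add: diff_divide_distrib[symmetric])
      ultimately show "ubd M (\<lambda>\<omega>. ennreal ((D (real i / 2 ^ j) (real (Suc i) / 2 ^ j) \<omega>)\<^sup>2)) (ennreal (K * (1 / 2 ^ j) powr (11/8)))"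
        using bd[of "real i / 2 ^ j" "real (Suc i) / 2 ^ j"] by (simp add: divide_strict_right_mono)
    qed simp
    moreover have "(\<Sum>i<(2::nat) ^ j. ennreal (K * (1 / 2 ^ j) powr (11/8))) = ennreal (K * q ^ j)"
    proof -
      have "2 ^ j * (1 / 2 ^ j) powr (11/8) = q ^ j"
      proof -
        have p: "(2::real) ^ j = 2 powr (real j)" by (simp add: powr_realpow)
        have "(1 / (2::real) ^ j) = 2 powr (- real j)" by (simp add: powr_minus_divide powr_realpow)
        then have "2 ^ j * (1 / 2 ^ j) powr (11/8) = 2 powr (real j) * 2 powr (- real j * (11/8))"
          unfolding p by (simp add: powr_powr)
        also have "\<dots> = 2 powr (- (3/8) * real j)" by (simp add: powr_add[symmetric] algebra_simps)
        also have "\<dots> = q powr (real j)" by (simp add: q_def powr_powr)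
        also have "\<dots> = q ^ j" by (simp add: q_def powr_realpow)
        finally show ?thesis .
      qed
      then show ?thesis using K by (simp add: ennreal_of_nat_eq_real_of_nat ennreal_mult[symmetric] mult.left_commute)
    qed
    ultimately show ?thesis by simp
  qed
  have "ubd M (\<lambda>\<omega>. 8 * (\<Sum>j. ennreal ((8/7) ^ j) * W j \<omega>)) (ennreal (75 * K))"
    by (rule ubd_weighted_sum[OF Wbd K _ q]) (simp add: q_def)
  then show ?thesis
  proof (rule ubd_mono)
    fix \<omega> assume w: "\<omega> \<in> space M"
    show "(SUP t\<in>{0..1}. ennreal ((D 0 t \<omega>)\<^sup>2)) \<le> 8 * (\<Sum>j. ennreal ((8/7) ^ j) * W j \<omega>)"
    proof (rule SUP_least)
      fix t :: real assume "t \<in> {0..1}"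
      then have t: "0 \<le> t" "t \<le> 1" by auto
      define d where "d j = real_of_int \<lfloor>2 ^ j * t\<rfloor> / 2 ^ j" for j :: nat
      \<comment> \<open>Index \<open>0\<close> is the jump from \<open>0\<close> to the integer part
        of \<open>t\<close>, which can be nonzero only for \<open>t = 1\<close>; the other entries
        are the dyadic refinements.\<close>
      define x where "x j = (case j of 0 \<Rightarrow> D 0 (d 0) \<omega> | Suc j \<Rightarrow> D (d j) (d (Suc j)) \<omega>)" for j
      have single: "ennreal ((D (real i / 2 ^ j) (real (Suc i) / 2 ^ j) \<omega>)\<^sup>2) \<le> W j \<omega>" if "i < 2 ^ j" for i j
        unfolding W_def using that by (intro member_le_sum[of i]) auto
      have xW: "ennreal ((x j)\<^sup>2) \<le> W j \<omega>" for j
      proof (cases j)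
        case 0
        have "\<lfloor>t\<rfloor> = 0 \<or> \<lfloor>t\<rfloor> = 1" using t by linarith
        then have "d 0 = 0 \<or> d 0 = 1" by (auto simp: d_def)
        then show ?thesis using single[of 0 0] by (auto simp: 0 x_def D0[OF w])
      next
        case (Suc k)
        show ?thesis
          using dyadic_succ[OF t, of k] single[of _ "Suc k"] unfolding d_def[symmetric] Suc x_def
          by (auto simp: D0[OF w] simp del: power_Suc)
      qed
      have chain: "D 0 t \<omega> \<le> (\<Sum>j\<le>J. x j) + D (d J) t \<omega>" for J
      proof (induction J)
        case 0
        then show ?case using tri[OF w, of 0 t "d 0"] by (simp add: x_def)
      next
        case (Suc J)
        then show ?case using tri[OF w, of "d J" t "d (Suc J)"] by (simp add: x_def)
      qed
      define U where "U = 8 * (\<Sum>j. ennreal ((8/7) ^ j) * W j \<omega>)"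
      show "ennreal ((D 0 t \<omega>)\<^sup>2) \<le> 8 * (\<Sum>j. ennreal ((8/7) ^ j) * W j \<omega>)"
      proof (cases "U = \<infinity>")
        case True
        then show ?thesis by (simp add: U_def)
      next
        case False
        then obtain u where u: "U = ennreal u" "0 \<le> u" by (cases U) auto
        have "(\<Sum>j\<le>J. x j)\<^sup>2 \<le> u" for J
          using ennreal_sum_square_weighted[of x "\<lambda>j. W j \<omega>" J, OF xW] u unfolding U_def[symmetric] by simp
        then have sx: "(\<Sum>j\<le>J. x j) \<le> sqrt u" for J by (meson real_le_rsqrt)
        have "(\<lambda>J. D (d J) t \<omega>) \<longlonglongrightarrow> 0"
        proof (rule cont[OF w])
          show "d \<longlonglongrightarrow> t" unfolding d_def by (rule dyadic_tendsto)
          show "0 \<le> d j \<and> d j \<le> 1" for j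
          proof -
            have "real_of_int \<lfloor>2 ^ j * t\<rfloor> \<le> 2 ^ j * t" by linarith
            also have "\<dots> \<le> 2 ^ j" using t by simp
            finally show ?thesis using t by (simp add: d_def)
          qed
        qed (use t in auto)
        then have "(\<lambda>J. sqrt u + D (d J) t \<omega>) \<longlonglongrightarrow> sqrt u + 0" by (intro tendsto_intros)
        moreover have "D 0 t \<omega> \<le> sqrt u + D (d J) t \<omega>" for J using chain[of J] sx[of J] by simp
        ultimately have "D 0 t \<omega> \<le> sqrt u + 0" by (intro LIMSEQ_le_const) auto
        then have "(D 0 t \<omega>)\<^sup>2 \<le> (sqrt u)\<^sup>2" using D0(1)[OF w] by (intro power_mono) auto
        then show ?thesis using u unfolding U_def[symmetric] by (simp add: ennreal_leI)
      qed
    qed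
  qed simp
qed

section \<open>Mollifiers\<close>

lemma integrable_inverse_square: "integrable lborel (\<lambda>x::real. 1 / (1 + x\<^sup>2))"
  using integrable_inverse_1_plus_square unfolding set_integrable_def
  by (simp add: einterval_def inverse_eq_divide)

definition decay :: "R2 \<Rightarrow> real" where
  "decay x = 1 / (1 + norm x) ^ 4"

lemma decay_measurable[measurable]: "decay \<in> borel_measurable borel"
  unfolding decay_def[abs_def] by measurable

lemma decay_nonneg: "0 \<le> decay x"
  by (simp add: decay_def)

text \<open>Both \<open>1 + x\<^sup>2\<close> and \<open>1 + y\<^sup>2\<close> are at most the
  square of \<open>1 + norm (x, y)\<close>, which reduces the plane to a product of two
  one-dimensional integrals.\<close>

lemma integrable_decay: "integrable lborel decay"
proof (rule integrableI_nonneg)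
  have le: "ennreal (decay (x, y)) \<le> ennreal (1 / (1 + x\<^sup>2)) * ennreal (1 / (1 + y\<^sup>2))" for x y
  proof -
    have "1 + x\<^sup>2 \<le> (1 + norm (x, y))\<^sup>2" "1 + y\<^sup>2 \<le> (1 + norm (x, y))\<^sup>2"
      using norm_R2_sq[of "(x, y)"] by (auto simp: power2_sum add_increasing2)
    then have "(1 + x\<^sup>2) * (1 + y\<^sup>2) \<le> (1 + norm (x, y))\<^sup>2 * (1 + norm (x, y))\<^sup>2"
      by (intro mult_mono) auto
    also have "\<dots> = (1 + norm (x, y)) ^ 4" by (simp add: power2_eq_square numeral_eq_Suc)
    finally have "decay (x, y) \<le> 1 / ((1 + x\<^sup>2) * (1 + y\<^sup>2))"
      unfolding decay_def by (intro divide_left_mono mult_pos_pos zero_less_power) (auto simp: add_pos_nonneg)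
    then show ?thesis by (subst ennreal_mult[symmetric]) (auto intro: ennreal_leI)
  qed
  have fin: "(\<integral>\<^sup>+x. ennreal (1 / (1 + x\<^sup>2)) \<partial>(lborel :: real measure)) < \<infinity>"
    using integrable_inverse_square by (subst nn_integral_eq_integral) auto
  have "(\<integral>\<^sup>+x. ennreal (decay x) \<partial>lborel) = (\<integral>\<^sup>+x. \<integral>\<^sup>+y. ennreal (decay (x, y)) \<partial>lborel \<partial>lborel)"
    by (rule nn_integral_R2) measurable
  also have "\<dots> \<le> (\<integral>\<^sup>+x. \<integral>\<^sup>+y. ennreal (1 / (1 + x\<^sup>2)) * ennreal (1 / (1 + y\<^sup>2)) \<partial>lborel \<partial>lborel)"
    by (intro nn_integral_mono le)
  also have "\<dots> = (\<integral>\<^sup>+x. ennreal (1 / (1 + x\<^sup>2)) \<partial>(lborel :: real measure)) * (\<integral>\<^sup>+x. ennreal (1 / (1 + x\<^sup>2)) \<partial>(lborel :: real measure))"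
    by (simp add: nn_integral_cmult nn_integral_multc)
  also have "\<dots> < \<infinity>" using fin by (simp add: ennreal_mult_less_top)
  finally show "(\<integral>\<^sup>+x. ennreal (decay x) \<partial>lborel) < \<infinity>" .
qed (auto simp: decay_nonneg)

definition dmass :: real where "dmass = (\<integral>x. decay x \<partial>lborel)"

lemma inv_pow_le_1: "1 / (1 + norm x) ^ k \<le> 1"
  by (simp add: divide_le_eq add_pos_nonneg one_le_power)

lemma decay5_le: "1 / (1 + norm x) ^ 5 \<le> decay x" "sqrt (norm x) * (1 / (1 + norm x) ^ 5) \<le> decay x"
proof -
  have 1: "1 / (1 + norm x) ^ 5 = (1 / (1 + norm x)) * decay x"
    by (simp add: decay_def numeral_eq_Suc)
  have "1 / (1 + norm x) \<le> 1" using inv_pow_le_1[of x 1] by simp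
  then show "1 / (1 + norm x) ^ 5 \<le> decay x" unfolding 1
    using mult_right_mono[of "1 / (1 + norm x)" 1 "decay x"] decay_nonneg by simp
  have "sqrt (norm x) \<le> 1 + norm x"
    by (rule real_le_lsqrt) (auto simp: power2_eq_square algebra_simps)
  moreover have "0 < 1 + norm x" by (simp add: add_pos_nonneg)
  ultimately have "sqrt (norm x) * (1 / (1 + norm x)) \<le> 1" by (simp add: divide_le_eq)
  then show "sqrt (norm x) * (1 / (1 + norm x) ^ 5) \<le> decay x" unfolding 1
    using mult_right_mono[of "sqrt (norm x) * (1 / (1 + norm x))" 1 "decay x"] decay_nonneg by (simp add: mult.assoc)
qed

text \<open>Four of the five powers make the function integrable in the plane; the fifth pays for
  the weight \<open>sqrt (norm x)\<close>.\<close>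

lemma kern_decay:
  assumes c: "continuous_on UNIV f" and K: "0 \<le> K" "\<And>x. \<bar>f x\<bar> \<le> K * (1 / (1 + norm x) ^ 5)"
  shows "kern f" "mass f \<le> K * dmass" "hmom f \<le> K * dmass"
proof -
  have [measurable]: "f \<in> borel_measurable borel" using c by (rule borel_measurable_continuous_onI)
  have b1: "\<bar>f x\<bar> \<le> K * decay x" for x
    using K(2)[of x] mult_left_mono[OF decay5_le(1) K(1), of x] by linarith
  have b2: "sqrt (norm x) * \<bar>f x\<bar> \<le> K * decay x" for x
  proof -
    have "sqrt (norm x) * \<bar>f x\<bar> \<le> sqrt (norm x) * (K * (1 / (1 + norm x) ^ 5))"
      by (intro mult_left_mono K) auto
    also have "\<dots> = K * (sqrt (norm x) * (1 / (1 + norm x) ^ 5))" by simp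
    also have "\<dots> \<le> K * decay x" by (intro mult_left_mono decay5_le K)
    finally show ?thesis .
  qed
  have i: "integrable lborel (\<lambda>x. K * decay x)" using integrable_decay by simp
  have Kd: "norm (K * decay x) = K * decay x" for x using K(1) decay_nonneg[of x] by simp
  have i1: "integrable lborel f"
    by (rule Bochner_Integration.integrable_bound[OF i]) (simp, intro AE_I2, unfold Kd, simp only: real_norm_def b1)
  have i2: "integrable lborel (\<lambda>x. sqrt (norm x) * f x)"
    by (rule Bochner_Integration.integrable_bound[OF i])
      (measurable, intro AE_I2, unfold Kd, simp add: abs_mult b2)
  have "\<bar>f x\<bar> \<le> K" for x
  proof -
    have "K * decay x \<le> K * 1" unfolding decay_def by (intro mult_left_mono inv_pow_le_1 K(1))
    then show ?thesis using b1[of x] by simp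
  qed
  then show kf: "kern f" using c i1 i2 by (auto simp: kern_def)
  have e: "K * dmass = (\<integral>x. K * decay x \<partial>lborel)" by (simp add: dmass_def)
  have i1': "integrable lborel (\<lambda>x. \<bar>f x\<bar>)" using i1 by auto
  show "mass f \<le> K * dmass" unfolding mass_def e by (rule integral_mono[OF i1' i b1])
  show "hmom f \<le> K * dmass" unfolding hmom_def e by (rule integral_mono[OF integrable_hmom[OF kf] i b2])
qed

locale mollifier =
  fixes \<phi> :: "R2 \<Rightarrow> real" and M :: "'a measure"
  assumes schwartz: "schwartz_R2 \<phi>" and nonneg: "\<And>x. 0 \<le> \<phi> x" and total: "integral\<^sup>L lborel \<phi> = 1"
begin

lemma phi_differentiable: "\<phi> differentiable (at x)"
  using schwartz unfolding schwartz_R2_def smooth_R2_def by (metis iter_dd.simps(1))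

lemma phi_continuous: "continuous_on UNIV \<phi>"
  by (intro continuous_at_imp_continuous_on ballI differentiable_imp_continuous_within phi_differentiable)

text \<open>The derivative is asked to decay one power faster because a radial derivative brings a
  factor \<open>norm y\<close>. The two coordinate directions suffice by linearity.\<close>

lemma ex_decay_const: "\<exists>C>0. (\<forall>x. \<bar>\<phi> x\<bar> \<le> C * (1 / (1 + norm x) ^ 5)) \<and>
   (\<forall>x y. \<bar>frechet_derivative \<phi> (at x) y\<bar> \<le> norm y * (2 * C * (1 / (1 + norm x) ^ 6)))"
proof -
  have "\<exists>C. \<forall>x. (1 + norm x) ^ k * \<bar>iter_dd vs \<phi> x\<bar> \<le> C" for k vs
    using schwartz unfolding schwartz_R2_def by blast
  then obtain C where C: "\<And>k vs x. (1 + norm x) ^ k * \<bar>iter_dd vs \<phi> x\<bar> \<le> C k vs" by metis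
  define K where "K = Max {1, C 5 [], C 6 [(1, 0)], C 6 [(0, 1)]}"
  have K: "1 \<le> K" "C 5 [] \<le> K" "C 6 [(1, 0)] \<le> K" "C 6 [(0, 1)] \<le> K" by (auto simp: K_def)
  have b: "\<bar>iter_dd vs \<phi> x\<bar> \<le> K * (1 / (1 + norm x) ^ k)" if "C k vs \<le> K" for k vs x
  proof -
    have "\<bar>iter_dd vs \<phi> x\<bar> * (1 + norm x) ^ k \<le> K" using C[of x k vs] that by (simp add: mult.commute)
    then show ?thesis by (simp add: pos_le_divide_eq add_pos_nonneg)
  qed
  have "\<bar>\<phi> x\<bar> \<le> K * (1 / (1 + norm x) ^ 5)" for x
    using b[OF K(2), of x] by simp
  moreover have "\<bar>frechet_derivative \<phi> (at x) y\<bar> \<le> norm y * (2 * K * (1 / (1 + norm x) ^ 6))" for x y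
  proof -
    have lin: "linear (frechet_derivative \<phi> (at x))"
      by (rule linear_frechet_derivative[OF phi_differentiable])
    have "y = fst y *\<^sub>R (1, 0) + snd y *\<^sub>R (0, 1)" by (simp add: prod_eq_iff)
    then have "frechet_derivative \<phi> (at x) y = fst y * iter_dd [(1, 0)] \<phi> x + snd y * iter_dd [(0, 1)] \<phi> x"
      using linear_add[OF lin, of "fst y *\<^sub>R (1, 0)" "snd y *\<^sub>R (0, 1)"]
        linear_scale[OF lin, of "fst y" "(1, 0)"] linear_scale[OF lin, of "snd y" "(0, 1)"]
      by (simp add: dirderiv_def)
    also have "\<bar>\<dots>\<bar> \<le> \<bar>fst y\<bar> * \<bar>iter_dd [(1, 0)] \<phi> x\<bar> + \<bar>snd y\<bar> * \<bar>iter_dd [(0, 1)] \<phi> x\<bar>"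
      by (rule order_trans[OF abs_triangle_ineq]) (simp add: abs_mult)
    also have "\<dots> \<le> norm y * (K * (1 / (1 + norm x) ^ 6)) + norm y * (K * (1 / (1 + norm x) ^ 6))"
      using norm_fst_le[of "fst y" "snd y"] norm_snd_le[of "snd y" "fst y"]
      by (intro add_mono mult_mono b K) auto
    also have "\<dots> = norm y * (2 * K * (1 / (1 + norm x) ^ 6))" by (simp add: algebra_simps)
    finally show ?thesis .
  qed
  ultimately show ?thesis using K(1) by (intro exI[of _ K]) auto
qed

definition dconst :: real where
  "dconst = (SOME C. C > 0 \<and> (\<forall>x. \<bar>\<phi> x\<bar> \<le> C * (1 / (1 + norm x) ^ 5)) \<and>
   (\<forall>x y. \<bar>frechet_derivative \<phi> (at x) y\<bar> \<le> norm y * (2 * C * (1 / (1 + norm x) ^ 6))))"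

lemma dconst: "dconst > 0" "\<bar>\<phi> x\<bar> \<le> dconst * (1 / (1 + norm x) ^ 5)"
   "\<bar>frechet_derivative \<phi> (at x) y\<bar> \<le> norm y * (2 * dconst * (1 / (1 + norm x) ^ 6))"
  using someI_ex[OF ex_decay_const] unfolding dconst_def by blast+

section \<open>Differences of mollifiers\<close>

definition gdiff :: "real \<Rightarrow> R2 \<Rightarrow> real" where
  "gdiff l y = \<phi> y - l\<^sup>2 * \<phi> (l *\<^sub>R y)"

text \<open>After scaling, \<open>gdiff l\<close> is the difference of the mollifiers at two scales
  of ratio \<open>l\<close>. It is minus the increment of \<open>s\<^sup>2 * \<phi> (s y)\<close>
  from \<open>s = 1\<close> to \<open>s = l\<close>, so the mean value theorem produces the factor
  \<open>l - 1\<close>; the intermediate point is at least as far out as \<open>y\<close>, where the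
  decay is no worse.\<close>

lemma gdiff_bound:
  assumes l: "1 \<le> l" "l \<le> 2"
  shows "\<bar>gdiff l y\<bar> \<le> (12 * dconst * (l - 1)) * (1 / (1 + norm y) ^ 5)"
proof (cases "l = 1")
  case True
  then show ?thesis by (simp add: gdiff_def)
next
  case False
  then have l1: "1 < l" using l by simp
  define h where "h s = s\<^sup>2 * \<phi> (s *\<^sub>R y)" for s
  define h' where "h' s = 2 * s * \<phi> (s *\<^sub>R y) + s\<^sup>2 * frechet_derivative \<phi> (at (s *\<^sub>R y)) y" for s
  have der: "(h has_real_derivative h' s) (at s)" for s
  proof -
    have f: "(\<phi> has_derivative frechet_derivative \<phi> (at (s *\<^sub>R y))) (at (s *\<^sub>R y))"
      using phi_differentiable by (simp add: frechet_derivative_works[symmetric])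
    have "((\<lambda>s. s *\<^sub>R y) has_derivative (\<lambda>t. t *\<^sub>R y)) (at s)" by (auto intro!: derivative_eq_intros)
    from has_derivative_compose[OF this f]
    have "((\<lambda>s. \<phi> (s *\<^sub>R y)) has_derivative (\<lambda>t. frechet_derivative \<phi> (at (s *\<^sub>R y)) (t *\<^sub>R y))) (at s)" .
    moreover have "frechet_derivative \<phi> (at (s *\<^sub>R y)) (t *\<^sub>R y) = frechet_derivative \<phi> (at (s *\<^sub>R y)) y * t" for t
      using linear_scale[OF linear_frechet_derivative[OF phi_differentiable], of "s *\<^sub>R y" t y] by simp
    ultimately have "((\<lambda>s. \<phi> (s *\<^sub>R y)) has_real_derivative frechet_derivative \<phi> (at (s *\<^sub>R y)) y) (at s)"
      by (simp add: has_field_derivative_def)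
    then show ?thesis unfolding h_def h'_def
      by (auto intro!: derivative_eq_intros)
  qed
  obtain z where z: "1 < z" "z < l" "h l - h 1 = (l - 1) * h' z"
    using MVT2[OF l1, of h h'] der by auto
  have zy: "norm y \<le> norm (z *\<^sub>R y)" using z by (simp add: mult_left_le_one_le mult_right_mono[of 1 z "norm y", simplified])
  have p: "1 / (1 + norm (z *\<^sub>R y)) ^ k \<le> 1 / (1 + norm y) ^ k" for k
    using zy by (intro divide_left_mono power_mono mult_pos_pos zero_less_power) (auto simp: add_pos_nonneg)
  define w where "w = 1 / (1 + norm y) ^ 5"
  have w0: "0 \<le> w" by (simp add: w_def)
  have b1: "\<bar>\<phi> (z *\<^sub>R y)\<bar> \<le> dconst * w"
    unfolding w_def by (rule order_trans[OF dconst(2) mult_left_mono[OF p]]) (use dconst(1) in simp)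
  have b2: "\<bar>frechet_derivative \<phi> (at (z *\<^sub>R y)) y\<bar> \<le> 2 * dconst * w"
  proof -
    have "\<bar>frechet_derivative \<phi> (at (z *\<^sub>R y)) y\<bar> \<le> norm y * (2 * dconst * (1 / (1 + norm y) ^ 6))"
      by (rule order_trans[OF dconst(3) mult_left_mono[OF mult_left_mono[OF p]]]) (use dconst(1) in simp_all)
    also have "\<dots> = (norm y / (1 + norm y)) * (2 * dconst * w)"
      by (simp add: w_def numeral_eq_Suc)
    also have "\<dots> \<le> 1 * (2 * dconst * w)"
      using dconst(1) w0 by (intro mult_right_mono) (auto simp: divide_le_eq add_pos_nonneg)
    finally show ?thesis by simp
  qed
  have "\<bar>h' z\<bar> \<le> \<bar>2 * z * \<phi> (z *\<^sub>R y)\<bar> + \<bar>z\<^sup>2 * frechet_derivative \<phi> (at (z *\<^sub>R y)) y\<bar>"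
    unfolding h'_def by (rule abs_triangle_ineq)
  also have "\<dots> \<le> (2 * z) * (dconst * w) + z\<^sup>2 * (2 * dconst * w)"
    using z b1 b2 by (auto simp: abs_mult intro!: add_mono mult_left_mono)
  \<comment> \<open>Here \<open>1 < z < 2\<close>, and the two summands give
    \<open>4 + 8 = 12\<close>.\<close>
  also have "\<dots> \<le> 4 * (dconst * w) + 4 * (2 * dconst * w)"
  proof -
    have "z\<^sup>2 \<le> 2\<^sup>2" using z l by (intro power_mono) auto
    then show ?thesis using z l dconst(1) w0 by (intro add_mono mult_right_mono) auto
  qed
  also have "\<dots> = 12 * dconst * w" by simp
  finally have "\<bar>h' z\<bar> \<le> 12 * dconst * w" .
  then have "(l - 1) * \<bar>h' z\<bar> \<le> (l - 1) * (12 * dconst * w)" using l1 by (intro mult_left_mono) auto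
  moreover have "\<bar>gdiff l y\<bar> = (l - 1) * \<bar>h' z\<bar>"
  proof -
    have "gdiff l y = - (h l - h 1)" by (simp add: gdiff_def h_def)
    then show ?thesis unfolding z(3) using l1 by (simp add: abs_mult)
  qed
  ultimately show ?thesis by (simp add: w_def mult_ac)
qed

abbreviation phe :: "real \<Rightarrow> R2 \<Rightarrow> real" where "phe \<equiv> phi_eps \<phi>"

lemma kern_phi: "kern \<phi>"
  by (rule kern_decay(1)[OF phi_continuous, of dconst]) (use dconst in auto)

lemma phe_continuous: "\<epsilon> > 0 \<Longrightarrow> continuous_on UNIV (phe \<epsilon>)"
  unfolding phi_eps_def by (intro continuous_intros continuous_on_compose2[OF phi_continuous]) auto

lemma phe_nonneg: "0 \<le> phe \<epsilon> x"
  by (simp add: phi_eps_def nonneg)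

lemma phe_bound: "\<epsilon> > 0 \<Longrightarrow> \<bar>phe \<epsilon> x\<bar> \<le> dconst / \<epsilon>\<^sup>2"
proof -
  assume e: "\<epsilon> > 0"
  have "\<bar>\<phi> y\<bar> \<le> dconst" for y
  proof -
    have "dconst * (1 / (1 + norm y) ^ 5) \<le> dconst * 1"
      using dconst(1) by (intro mult_left_mono inv_pow_le_1) auto
    then show ?thesis using dconst(2)[of y] by simp
  qed
  then show ?thesis unfolding phi_eps_def by (simp add: abs_divide divide_right_mono)
qed

lemma bcf_phe: "\<epsilon> > 0 \<Longrightarrow> bcf (phe \<epsilon>)"
  using phe_continuous phe_bound unfolding bcf_def by blast

lemma phe_diff:
  assumes "0 < \<epsilon>'" "\<epsilon>' \<le> \<epsilon>"
  shows "phe \<epsilon> x - phe \<epsilon>' x = gdiff (\<epsilon> / \<epsilon>') ((1 / \<epsilon>) *\<^sub>R x) / \<epsilon>\<^sup>2"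
proof -
  have "(\<epsilon> / \<epsilon>') *\<^sub>R ((1 / \<epsilon>) *\<^sub>R x) = (1 / \<epsilon>') *\<^sub>R x" using assms by simp
  then show ?thesis using assms by (simp add: phi_eps_def gdiff_def power_divide diff_divide_distrib)
qed

lemma integral_scaled:
  fixes f :: "R2 \<Rightarrow> real"
  assumes [measurable]: "f \<in> borel_measurable borel" and e: "\<epsilon> > 0"
  shows "(\<integral>x. f ((1 / \<epsilon>) *\<^sub>R x) / \<epsilon>\<^sup>2 \<partial>lborel) = (\<integral>x. f x \<partial>lborel)"
  using integral_scale_R2[OF assms(1), of "1 / \<epsilon>"] e by (simp add: power_divide)

lemma phi_measurable[measurable]: "\<phi> \<in> borel_measurable borel"
  using phi_continuous by (rule borel_measurable_continuous_onI)

lemma phe_integrable: "\<epsilon> > 0 \<Longrightarrow> integrable lborel (phe \<epsilon>)"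
  using kern_phi unfolding phi_eps_def[abs_def] kern_def by (intro integrable_divide integrable_scale_R2) auto

lemma phe_integral: "\<epsilon> > 0 \<Longrightarrow> (\<integral>x. phe \<epsilon> x \<partial>lborel) = 1"
  unfolding phi_eps_def by (subst integral_scaled[OF phi_measurable]) (simp_all add: total)

text \<open>Both mollifiers have integral one, so their difference is centered. Scaling by
  \<open>\<epsilon>\<close> preserves \<open>mass\<close> and multiplies \<open>hmom\<close> by
  \<open>sqrt \<epsilon>\<close>; this factor makes the sum over the octaves of
  \<open>\<epsilon>\<close> converge.\<close>

lemma kern_phe_diff:
  assumes e: "0 < \<epsilon>'" "\<epsilon>' \<le> \<epsilon>" "\<epsilon> \<le> 2 * \<epsilon>'" and "\<epsilon> \<le> 1"
  defines "f \<equiv> \<lambda>x. phe \<epsilon> x - phe \<epsilon>' x"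
  defines "K \<equiv> 12 * dconst * (\<epsilon> / \<epsilon>' - 1)"
  shows "kern f" "(\<integral>x. f x \<partial>lborel) = 0" "mass f * hmom f \<le> (K * dmass)\<^sup>2 * sqrt \<epsilon>" "\<bar>f x\<bar> \<le> K / \<epsilon>\<^sup>2"
proof -
  have e0: "\<epsilon> > 0" using e by simp
  define l where "l = \<epsilon> / \<epsilon>'"
  have l: "1 \<le> l" "l \<le> 2" using e by (auto simp: l_def divide_le_eq)
  define g where "g = gdiff l"
  have fg: "f x = g ((1 / \<epsilon>) *\<^sub>R x) / \<epsilon>\<^sup>2" for x
    unfolding f_def g_def l_def by (rule phe_diff) (use e in auto)
  have K0: "0 \<le> K" using l dconst(1) by (simp add: K_def l_def)
  have gb: "\<bar>g x\<bar> \<le> K * (1 / (1 + norm x) ^ 5)" for x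
    unfolding g_def K_def l_def[symmetric] by (rule gdiff_bound[OF l])
  have gc: "continuous_on UNIV g"
    unfolding g_def gdiff_def by (intro continuous_intros continuous_on_compose2[OF phi_continuous]) auto
  note gk = kern_decay[OF gc K0 gb]
  have [measurable]: "g \<in> borel_measurable borel" by (rule kern_measurable[OF gk(1)])
  have gK: "\<bar>g x\<bar> \<le> K" for x
  proof -
    have "K * (1 / (1 + norm x) ^ 5) \<le> K * 1" using K0 by (intro mult_left_mono inv_pow_le_1)
    then show ?thesis using gb[of x] by simp
  qed
  then show fb: "\<bar>f x\<bar> \<le> K / \<epsilon>\<^sup>2" for x
    unfolding fg by (simp add: abs_divide divide_right_mono)
  have fe: "f = (\<lambda>x. g ((1 / \<epsilon>) *\<^sub>R x) / \<epsilon>\<^sup>2)" by (simp add: fg fun_eq_iff)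
  have "continuous_on UNIV f" unfolding f_def by (intro continuous_intros phe_continuous) (use e in auto)
  moreover have "integrable lborel f" unfolding f_def by (intro Bochner_Integration.integrable_diff phe_integrable) (use e in auto)
  moreover have hm: "sqrt (norm x) * f x = sqrt \<epsilon> * ((sqrt (norm ((1 / \<epsilon>) *\<^sub>R x)) * g ((1 / \<epsilon>) *\<^sub>R x)) / \<epsilon>\<^sup>2)" for x
    using e0 unfolding fg by (simp add: real_sqrt_divide)
  moreover have "integrable lborel (\<lambda>x. sqrt \<epsilon> * ((sqrt (norm ((1 / \<epsilon>) *\<^sub>R x)) * g ((1 / \<epsilon>) *\<^sub>R x)) / \<epsilon>\<^sup>2))"
    using gk(1) e0 unfolding kern_def
    by (intro integrable_mult_right integrable_divide integrable_scale_R2[of "\<lambda>x. sqrt (norm x) * g x"]) auto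
  ultimately show "kern f" using fb by (auto simp: kern_def)
  show "(\<integral>x. f x \<partial>lborel) = 0"
    unfolding f_def using e phe_integrable phe_integral by simp
  have "mass f = mass g"
    unfolding mass_def fe using integral_scaled[of "\<lambda>x. \<bar>g x\<bar>" \<epsilon>] e0 by (simp add: abs_divide)
  moreover have "hmom f = sqrt \<epsilon> * hmom g"
  proof -
    have "hmom f = (\<integral>x. sqrt \<epsilon> * ((sqrt (norm ((1 / \<epsilon>) *\<^sub>R x)) * \<bar>g ((1 / \<epsilon>) *\<^sub>R x)\<bar>) / \<epsilon>\<^sup>2) \<partial>lborel)"
      unfolding hmom_def using e0 by (intro Bochner_Integration.integral_cong refl) (simp add: fg real_sqrt_divide abs_divide)
    also have "\<dots> = sqrt \<epsilon> * (\<integral>x. (\<lambda>y. sqrt (norm y) * \<bar>g y\<bar>) ((1 / \<epsilon>) *\<^sub>R x) / \<epsilon>\<^sup>2 \<partial>lborel)"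
      by (rule integral_mult_right_zero)
    also have "(\<integral>x. (\<lambda>y. sqrt (norm y) * \<bar>g y\<bar>) ((1 / \<epsilon>) *\<^sub>R x) / \<epsilon>\<^sup>2 \<partial>lborel) = hmom g"
      unfolding hmom_def by (rule integral_scaled[OF _ e0]) measurable
    finally show ?thesis .
  qed
  moreover have "mass g * hmom g \<le> (K * dmass) * (K * dmass)"
    by (intro mult_mono gk) (use mass_nonneg[of g] hmom_nonneg[of g] gk in \<open>auto intro: order_trans\<close>)
  then have "(mass g * hmom g) * sqrt \<epsilon> \<le> (K * dmass) * (K * dmass) * sqrt \<epsilon>"
    using e0 by (intro mult_right_mono) auto
  ultimately show "mass f * hmom f \<le> (K * dmass)\<^sup>2 * sqrt \<epsilon>"
    by (simp add: power2_eq_square mult_ac)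
qed

end

section \<open>Convergence of the mollified local times\<close>

lemma ctri_zero:
  assumes f: "bcf f" and X: "bm M X" and w: "\<omega> \<in> space M"
  shows "ctri M f 0 X \<omega> = 0"
proof -
  obtain B where B: "0 \<le> B" "\<And>x. \<bar>f x\<bar> \<le> B" using bcf_bounded[OF f] by blast
  have "tri f 0 (\<lambda>s. X s \<omega>) = 0" if "\<omega> \<in> space M" for \<omega>
    using tri_bound[OF B f bm_path_measurable[OF X that], of 0] by simp
  then show ?thesis using w by (simp add: ctri_def cong: Bochner_Integration.integral_cong)
qed

lemma (in prob_space) integral_abs_le:
  fixes Y :: "'a \<Rightarrow> real"
  assumes "Y \<in> borel_measurable M" "\<And>\<omega>. \<omega> \<in> space M \<Longrightarrow> \<bar>Y \<omega>\<bar> \<le> B"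
  shows "\<bar>\<integral>\<omega>. Y \<omega> \<partial>M\<bar> \<le> B"
proof -
  have i: "integrable M Y" by (rule integrable_bounded_measurable[OF assms])
  have "\<bar>\<integral>\<omega>. Y \<omega> \<partial>M\<bar> \<le> (\<integral>\<omega>. \<bar>Y \<omega>\<bar> \<partial>M)" by (rule integral_abs_bound)
  also have "\<dots> \<le> (\<integral>\<omega>. B \<partial>M)" using i by (intro integral_mono_AE) (auto intro!: AE_I2 assms)
  finally show ?thesis by (simp add: prob_space)
qed

lemma ctri_bound:
  assumes B: "0 \<le> B" "\<And>x. \<bar>f x\<bar> \<le> B" and f: "bcf f" and X: "bm M X" and w: "\<omega> \<in> space M" and t: "0 \<le> t"
  shows "\<bar>ctri M f t X \<omega>\<bar> \<le> 2 * B * t\<^sup>2"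
proof -
  interpret prob_space M by (rule bm_prob_space[OF X])
  have "\<bar>tri f t (\<lambda>s. X s \<omega>)\<bar> \<le> B * t\<^sup>2" if "\<omega> \<in> space M" for \<omega>
    by (rule tri_bound[OF B f bm_path_measurable[OF X that] t])
  from this[OF w] integral_abs_le[OF dbl_measurable[OF X f tset_measurable] this]
  show ?thesis unfolding ctri_def by (rule order_trans[OF abs_triangle_ineq4, OF order_trans[OF add_mono]]) simp_all
qed

text \<open>Qualitative only: the constant contains the supremum of the kernel and is not uniform in
  the mollification. Through \<open>ctri_lipschitz\<close> it provides the continuity and
  integrability needed for \<open>chaining\<close>.\<close>

lemma tri_lipschitz:
  assumes B: "0 \<le> B" "\<And>x. \<bar>f x\<bar> \<le> B" and f: "bcf f" and x: "x \<in> borel_measurable borel" and s: "0 \<le> s" "s \<le> t" "t \<le> 1"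
  shows "\<bar>tri f t x - tri f s x\<bar> \<le> 2 * B * (t - s)"
proof -
  define h where "h = t - s"
  have h: "0 \<le> h" "h \<le> 1" "t = s + h" using s by (auto simp: h_def)
  have xs: "(\<lambda>u. x (s + u)) \<in> borel_measurable borel"
    by (rule measurable_compose[OF _ x]) measurable
  have "tri f t x - tri f s x = tri f h (\<lambda>u. x (s + u)) + rect f s (s + h) x"
    using tri_split[OF f x s(1) h(1)] h by simp
  also have "\<bar>\<dots>\<bar> \<le> B * h\<^sup>2 + B * (h * s)"
    using tri_bound[OF B f xs h(1)] rect_bound[OF B f x s(1) h(1)] by linarith
  also have "\<dots> \<le> B * h + B * h"
    using h s B by (intro add_mono mult_left_mono) (auto simp: power2_eq_square mult_left_le)
  finally show ?thesis by (simp add: h_def)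
qed

lemma ctri_lipschitz:
  assumes B: "0 \<le> B" "\<And>x. \<bar>f x\<bar> \<le> B" and f: "bcf f" and X: "bm M X" and w: "\<omega> \<in> space M"
    and s: "0 \<le> s" "s \<le> 1" "0 \<le> t" "t \<le> 1"
  shows "\<bar>ctri M f t X \<omega> - ctri M f s X \<omega>\<bar> \<le> 4 * B * \<bar>t - s\<bar>"
proof -
  interpret prob_space M by (rule bm_prob_space[OF X])
  have main: "\<bar>ctri M f t X \<omega> - ctri M f s X \<omega>\<bar> \<le> 4 * B * (t - s)" if s: "0 \<le> s" "s \<le> t" "t \<le> 1" for s t
  proof -
    note [measurable] = dbl_measurable[OF X f tset_measurable]
    have *: "\<bar>tri f t (\<lambda>s. X s \<omega>) - tri f s (\<lambda>s. X s \<omega>)\<bar> \<le> 2 * B * (t - s)" if "\<omega> \<in> space M" for \<omega>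
      by (rule tri_lipschitz[OF B f bm_path_measurable[OF X that] s])
    have "\<bar>\<integral>\<omega>. tri f t (\<lambda>s. X s \<omega>) - tri f s (\<lambda>s. X s \<omega>) \<partial>M\<bar> \<le> 2 * B * (t - s)"
      by (rule integral_abs_le[OF _ *]) auto
    moreover have "(\<integral>\<omega>. tri f t (\<lambda>s. X s \<omega>) - tri f s (\<lambda>s. X s \<omega>) \<partial>M) = (\<integral>\<omega>. tri f t (\<lambda>s. X s \<omega>) \<partial>M) - (\<integral>\<omega>. tri f s (\<lambda>s. X s \<omega>) \<partial>M)"
      using s by (intro Bochner_Integration.integral_diff integrable_tri[OF X f]) auto
    ultimately show ?thesis using *[OF w] unfolding ctri_def by linarith
  qed
  show ?thesis
    using main[of s t] main[of t s] s by (cases "s \<le> t") (auto simp: abs_minus_commute)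
qed

lemma dbl_diff:
  assumes f: "bcf f" "bcf g" and x: "x \<in> borel_measurable borel" and A: "A \<in> sets borel" "emeasure lborel A < \<infinity>"
  shows "dbl A (\<lambda>z. f z - g z) x = dbl A f x - dbl A g x"
  unfolding dbl_def using dbl_integrable[OF f(1) x A] dbl_integrable[OF f(2) x A]
  by (simp add: right_diff_distrib)

lemma ctri_diff:
  assumes f: "bcf f" "bcf g" and X: "bm M X" and w: "\<omega> \<in> space M" and t: "0 \<le> t"
  shows "ctri M (\<lambda>z. f z - g z) t X \<omega> = ctri M f t X \<omega> - ctri M g t X \<omega>"
proof -
  have d: "tri (\<lambda>z. f z - g z) t (\<lambda>s. X s \<omega>) = tri f t (\<lambda>s. X s \<omega>) - tri g t (\<lambda>s. X s \<omega>)" if "\<omega> \<in> space M" for \<omega>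
    by (rule dbl_diff[OF f bm_path_measurable[OF X that] tset_measurable emeasure_tset_finite])
  have "(\<integral>\<omega>. tri (\<lambda>z. f z - g z) t (\<lambda>s. X s \<omega>) \<partial>M) = (\<integral>\<omega>. tri f t (\<lambda>s. X s \<omega>) - tri g t (\<lambda>s. X s \<omega>) \<partial>M)"
    by (rule Bochner_Integration.integral_cong) (auto simp: d)
  also have "\<dots> = (\<integral>\<omega>. tri f t (\<lambda>s. X s \<omega>) \<partial>M) - (\<integral>\<omega>. tri g t (\<lambda>s. X s \<omega>) \<partial>M)"
    using t by (intro Bochner_Integration.integral_diff integrable_tri[OF X]) (auto intro: f)
  finally show ?thesis unfolding ctri_def d[OF w] by simp
qed

text \<open>First use of \<open>chaining\<close>: in time, for one fixed centered kernel.\<close>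

lemma ctri_sup_bound:
  assumes f: "kern f" and z: "(\<integral>x. f x \<partial>lborel) = 0" and Q: "mass f * hmom f \<le> Q" "0 < Q" and X: "bm M X"
  shows "ubd M (\<lambda>\<omega>. SUP t\<in>{0..1}. ennreal ((ctri M f t X \<omega>)\<^sup>2)) (ennreal (75 * (21000 * Q)))"
proof -
  interpret prob_space M by (rule bm_prob_space[OF X])
  obtain B where B: "0 \<le> B" "\<And>x. \<bar>f x\<bar> \<le> B" using kern_bounded[OF f] by blast
  note bf = kern_bcf[OF f]
  note [measurable] = ctri_measurable[OF X bf]
  define D where "D s t \<omega> = \<bar>ctri M f t X \<omega> - ctri M f s X \<omega>\<bar>" for s t \<omega>
  have "ubd M (\<lambda>\<omega>. SUP t\<in>{0..1}. ennreal ((D 0 t \<omega>)\<^sup>2)) (ennreal (75 * (21000 * Q)))"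
  proof (rule chaining)
    fix s t :: real assume s: "0 \<le> s" "s < t" "t \<le> 1"
    have "integrable M (\<lambda>\<omega>. (ctri M f t X \<omega> - ctri M f s X \<omega>)\<^sup>2)"
    proof (rule integrable_bounded_measurable[of _ "(4 * B * \<bar>t - s\<bar>)\<^sup>2"])
      fix \<omega> assume "\<omega> \<in> space M"
      from ctri_lipschitz[OF B bf X this, of s t] s
      have "\<bar>ctri M f t X \<omega> - ctri M f s X \<omega>\<bar>\<^sup>2 \<le> (4 * B * \<bar>t - s\<bar>)\<^sup>2" by (intro power_mono) auto
      then show "\<bar>(ctri M f t X \<omega> - ctri M f s X \<omega>)\<^sup>2\<bar> \<le> (4 * B * \<bar>t - s\<bar>)\<^sup>2" by simp
    qed measurable
    then have "(\<integral>\<^sup>+\<omega>. ennreal ((ctri M f t X \<omega> - ctri M f s X \<omega>)\<^sup>2) \<partial>M) = ennreal (\<integral>\<omega>. (ctri M f t X \<omega> - ctri M f s X \<omega>)\<^sup>2 \<partial>M)"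
      by (rule nn_integral_eq_integral) auto
    also have "\<dots> \<le> ennreal (21000 * Q * (t - s) powr (11/8))"
      by (intro ennreal_leI ctri_increment[OF f z Q X s])
    finally show "ubd M (\<lambda>\<omega>. ennreal ((D s t \<omega>)\<^sup>2)) (ennreal (21000 * Q * (t - s) powr (11/8)))"
      by (intro ubdI[of "\<lambda>\<omega>. ennreal ((ctri M f t X \<omega> - ctri M f s X \<omega>)\<^sup>2)"]) (auto simp: D_def)
  next
    fix \<omega> u and t :: real assume w: "\<omega> \<in> space M" and u: "u \<longlonglongrightarrow> t" "\<And>j. 0 \<le> u j \<and> u j \<le> 1" and t: "0 \<le> t" "t \<le> 1"
    have "(\<lambda>j. 4 * B * \<bar>t - u j\<bar>) \<longlonglongrightarrow> 4 * B * \<bar>t - t\<bar>" by (intro tendsto_intros u)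
    then have lim: "(\<lambda>j. 4 * B * \<bar>t - u j\<bar>) \<longlonglongrightarrow> 0" by simp
    have le: "D (u j) t \<omega> \<le> 4 * B * \<bar>t - u j\<bar>" for j
      unfolding D_def using u(2)[of j] t by (intro ctri_lipschitz[OF B bf X w]) auto
    have "0 \<le> D (u j) t \<omega>" for j unfolding D_def by simp
    then show "(\<lambda>j. D (u j) t \<omega>) \<longlonglongrightarrow> 0"
      by (intro tendsto_sandwich[OF _ _ tendsto_const lim] always_eventually allI le)
  qed (use Q in \<open>auto simp: D_def\<close>)
  then show ?thesis
    by (rule ubd_mono) (auto simp: D_def ctri_zero[OF bf X])
qed

context mollifier
begin

section \<open>Chaining in the mollification parameter\<close>

definition gam :: "(real \<Rightarrow> 'a \<Rightarrow> R2) \<Rightarrow> real \<Rightarrow> real \<Rightarrow> 'a \<Rightarrow> real" where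
  "gam X \<epsilon> t \<omega> = ctri M (phe \<epsilon>) t X \<omega>"

text \<open>\<open>75 * 21000\<close> comes from chaining in time and \<open>12\<close> from
  \<open>gdiff_bound\<close>; \<open>dmass + 1\<close> stands in for \<open>dmass\<close> so that
  positivity is immediate.\<close>

definition uconst :: real where
  "uconst = 75 * 21000 * (12 * dconst * (dmass + 1))\<^sup>2"

lemma dmass_nonneg: "0 \<le> dmass"
  by (simp add: dmass_def decay_nonneg)

lemma uconst_pos: "0 < uconst"
  using dconst(1) dmass_nonneg by (simp add: uconst_def)

lemma gam_diff_eq:
  assumes X: "bm M X" and w: "\<omega> \<in> space M" and e: "0 < \<epsilon>" "0 < \<epsilon>'" and t: "0 \<le> t"
  shows "gam X \<epsilon> t \<omega> - gam X \<epsilon>' t \<omega> = ctri M (\<lambda>x. phe \<epsilon> x - phe \<epsilon>' x) t X \<omega>"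
  unfolding gam_def using ctri_diff[OF bcf_phe bcf_phe X w t] e by simp

text \<open>The factor is quadratic in the relative difference of the scales, which beats the
  exponent \<open>11/8\<close> demanded by \<open>chaining\<close>; hence the bound can be chained
  again, now in \<open>\<epsilon>\<close>.\<close>

lemma gam_sup_bound:
  assumes X: "bm M X" and e: "0 < \<epsilon>'" "\<epsilon>' < \<epsilon>" "\<epsilon> \<le> 2 * \<epsilon>'" "\<epsilon> \<le> 1"
  shows "ubd M (\<lambda>\<omega>. SUP t\<in>{0..1}. ennreal ((gam X \<epsilon> t \<omega> - gam X \<epsilon>' t \<omega>)\<^sup>2)) (ennreal (uconst * sqrt \<epsilon> * (\<epsilon> / \<epsilon>' - 1)\<^sup>2))"
proof -
  have e': "\<epsilon>' \<le> \<epsilon>" using e by simp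
  define K where "K = 12 * dconst * (\<epsilon> / \<epsilon>' - 1)"
  note k = kern_phe_diff[OF e(1) e' e(3,4)]
  have K: "0 < K" using e dconst(1) by (simp add: K_def)
  define Q where "Q = (K * (dmass + 1))\<^sup>2 * sqrt \<epsilon>"
  have Q: "0 < Q" using K e dmass_nonneg by (simp add: Q_def)
  have "(K * dmass)\<^sup>2 \<le> (K * (dmass + 1))\<^sup>2"
    using K dmass_nonneg by (intro power_mono mult_left_mono) auto
  then have "(K * dmass)\<^sup>2 * sqrt \<epsilon> \<le> Q" unfolding Q_def using e by (intro mult_right_mono) auto
  then have "mass (\<lambda>x. phe \<epsilon> x - phe \<epsilon>' x) * hmom (\<lambda>x. phe \<epsilon> x - phe \<epsilon>' x) \<le> Q"
    using k(3) unfolding K_def by linarith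
  from ctri_sup_bound[OF k(1,2) this Q X] show ?thesis
  proof (rule ubd_mono)
    show "(SUP t\<in>{0..1}. ennreal ((gam X \<epsilon> t \<omega> - gam X \<epsilon>' t \<omega>)\<^sup>2)) \<le> (SUP t\<in>{0..1}. ennreal ((ctri M (\<lambda>x. phe \<epsilon> x - phe \<epsilon>' x) t X \<omega>)\<^sup>2))"
      if w: "\<omega> \<in> space M" for \<omega>
      by (intro SUP_mono' order_eq_refl SUP_cong refl) (use gam_diff_eq[OF X w, of \<epsilon> \<epsilon>'] e in auto)
    have "75 * (21000 * Q) = uconst * sqrt \<epsilon> * (\<epsilon> / \<epsilon>' - 1)\<^sup>2"
      unfolding Q_def K_def uconst_def power_mult_distrib by (simp only: mult_ac)
    then show "ennreal (75 * (21000 * Q)) \<le> ennreal (uconst * sqrt \<epsilon> * (\<epsilon> / \<epsilon>' - 1)\<^sup>2)" by simp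
  qed
qed

definition supd :: "(real \<Rightarrow> 'a \<Rightarrow> R2) \<Rightarrow> real \<Rightarrow> real \<Rightarrow> 'a \<Rightarrow> real" where
  "supd X \<epsilon> \<epsilon>' \<omega> = (SUP t\<in>{0..1}. \<bar>gam X \<epsilon> t \<omega> - gam X \<epsilon>' t \<omega>\<bar>)"

lemma gam_bound:
  assumes X: "bm M X" and w: "\<omega> \<in> space M" and e: "0 < \<epsilon>" and t: "0 \<le> t" "t \<le> 1"
  shows "\<bar>gam X \<epsilon> t \<omega>\<bar> \<le> 2 * (dconst / \<epsilon>\<^sup>2)"
proof -
  have "\<bar>gam X \<epsilon> t \<omega>\<bar> \<le> 2 * (dconst / \<epsilon>\<^sup>2) * t\<^sup>2"
    unfolding gam_def using dconst(1) e by (intro ctri_bound[OF _ phe_bound[OF e] bcf_phe[OF e] X w t(1)]) simp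
  also have "\<dots> \<le> 2 * (dconst / \<epsilon>\<^sup>2) * 1"
    using t dconst(1) by (intro mult_left_mono power_le_one) auto
  finally show ?thesis by simp
qed

lemma supd_bdd:
  assumes X: "bm M X" and w: "\<omega> \<in> space M" and e: "0 < \<epsilon>" "0 < \<epsilon>'"
  shows "bdd_above ((\<lambda>t. \<bar>gam X \<epsilon> t \<omega> - gam X \<epsilon>' t \<omega>\<bar>) ` {0..1})"
proof (rule bdd_aboveI2)
  fix t :: real assume "t \<in> {0..1}"
  then show "\<bar>gam X \<epsilon> t \<omega> - gam X \<epsilon>' t \<omega>\<bar> \<le> 2 * (dconst / \<epsilon>\<^sup>2) + 2 * (dconst / \<epsilon>'\<^sup>2)"
    using gam_bound[OF X w e(1), of t] gam_bound[OF X w e(2), of t] by auto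
qed

lemma supd_upper:
  assumes X: "bm M X" and w: "\<omega> \<in> space M" and e: "0 < \<epsilon>" "0 < \<epsilon>'" and t: "0 \<le> t" "t \<le> 1"
  shows "\<bar>gam X \<epsilon> t \<omega> - gam X \<epsilon>' t \<omega>\<bar> \<le> supd X \<epsilon> \<epsilon>' \<omega>"
  unfolding supd_def by (rule cSUP_upper[OF _ supd_bdd[OF X w e]]) (use t in simp)

lemma supd_least: "(\<And>t. 0 \<le> t \<Longrightarrow> t \<le> 1 \<Longrightarrow> \<bar>gam X \<epsilon> t \<omega> - gam X \<epsilon>' t \<omega>\<bar> \<le> c) \<Longrightarrow> supd X \<epsilon> \<epsilon>' \<omega> \<le> c"
  unfolding supd_def by (rule cSUP_least) auto

lemma supd_nonneg: "bm M X \<Longrightarrow> \<omega> \<in> space M \<Longrightarrow> 0 < \<epsilon> \<Longrightarrow> 0 < \<epsilon>' \<Longrightarrow> 0 \<le> supd X \<epsilon> \<epsilon>' \<omega>"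
  using supd_upper[of X \<omega> \<epsilon> \<epsilon>' 0] by linarith

lemma supd_commute: "supd X \<epsilon> \<epsilon>' \<omega> = supd X \<epsilon>' \<epsilon> \<omega>"
  by (simp add: supd_def abs_minus_commute)

text \<open>Links the real-valued supremum to the extended one delivered by chaining; where the
  latter is infinite there is nothing to show.\<close>

lemma supd_sq_le:
  assumes X: "bm M X" and w: "\<omega> \<in> space M" and e: "0 < \<epsilon>" "0 < \<epsilon>'"
  shows "ennreal ((supd X \<epsilon> \<epsilon>' \<omega>)\<^sup>2) \<le> (SUP t\<in>{0..1}. ennreal ((gam X \<epsilon> t \<omega> - gam X \<epsilon>' t \<omega>)\<^sup>2))" (is "_ \<le> ?S")
proof (cases "?S = \<infinity>")
  case False
  then obtain u where u: "?S = ennreal u" "0 \<le> u" by (cases ?S) auto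
  have "supd X \<epsilon> \<epsilon>' \<omega> \<le> sqrt u"
  proof (rule supd_least)
    fix t :: real assume "0 \<le> t" "t \<le> 1"
    then have "ennreal ((gam X \<epsilon> t \<omega> - gam X \<epsilon>' t \<omega>)\<^sup>2) \<le> ennreal u"
      unfolding u(1)[symmetric] by (intro SUP_upper) auto
    then show "\<bar>gam X \<epsilon> t \<omega> - gam X \<epsilon>' t \<omega>\<bar> \<le> sqrt u" using u(2) by (simp add: real_le_rsqrt)
  qed
  then have "(supd X \<epsilon> \<epsilon>' \<omega>)\<^sup>2 \<le> (sqrt u)\<^sup>2" using supd_nonneg[OF X w e] by (intro power_mono) auto
  then show ?thesis using u by (simp add: ennreal_leI)
next
  case True
  then show ?thesis by (simp only: infinity_ennreal_def top_greatest)
qed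

text \<open>Second use of \<open>chaining\<close>, over the octave from \<open>e0\<close> down to
  \<open>e0 / 2\<close>, parametrised affinely by \<open>u\<close>; the distance is the supremum
  over time. In this parameter the ratio of two scales exceeds one by at most the difference of the
  parameters.\<close>

lemma gam_octave:
  assumes X: "bm M X" and e: "0 < e0" "e0 \<le> 1"
  shows "ubd M (\<lambda>\<omega>. SUP u\<in>{0..1}. ennreal ((supd X e0 (e0 * (1 - u / 2)) \<omega>)\<^sup>2)) (ennreal (75 * (uconst * sqrt e0)))"
proof -
  \<comment> \<open>Clamped so that \<open>ep u\<close> is a legitimate scale for every real
    \<open>u\<close>: the triangle inequality in \<open>chaining\<close> is required without bounds
    on its arguments.\<close>
  define ep where "ep u = e0 * (1 - max 0 (min 1 u) / 2)" for u :: real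
  have ep: "0 < ep u" "ep u \<le> 1" "e0 / 2 \<le> ep u" "ep u \<le> e0" for u
  proof -
    have "e0 * (1/2) \<le> ep u" "ep u \<le> e0 * 1" unfolding ep_def using e by (intro mult_left_mono; auto)+
    then show "0 < ep u" "ep u \<le> 1" "e0 / 2 \<le> ep u" "ep u \<le> e0" using e by auto
  qed
  have epc: "ep u = e0 * (1 - u / 2)" if "0 \<le> u" "u \<le> 1" for u using that by (simp add: ep_def)
  have ratio: "ep u / ep v - 1 \<le> v - u" "ep v < ep u" "ep u \<le> 2 * ep v" if "0 \<le> u" "u < v" "v \<le> 1" for u v
  proof -
    have "ep u - ep v = e0 * (v - u) / 2" using that by (simp add: epc algebra_simps)
    moreover have "e0 * (v - u) / 2 \<le> ep v * (v - u)" using ep(3)[of v] that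
      by (simp add: mult_right_mono[of "e0 / 2" "ep v" "v - u", simplified])
    ultimately show "ep u / ep v - 1 \<le> v - u" using ep(1)[of v] by (simp add: field_simps)
    show "ep v < ep u" using that e by (simp add: epc)
    show "ep u \<le> 2 * ep v" using ep(3)[of v] ep(4)[of u] by simp
  qed
  define D where "D u v \<omega> = supd X (ep u) (ep v) \<omega>" for u v \<omega>
  have "ubd M (\<lambda>\<omega>. SUP u\<in>{0..1}. ennreal ((D 0 u \<omega>)\<^sup>2)) (ennreal (75 * (uconst * sqrt e0)))"
  proof (rule chaining)
    fix s t \<omega> assume w: "\<omega> \<in> space M"
    show "0 \<le> D s t \<omega>" unfolding D_def by (rule supd_nonneg[OF X w ep(1) ep(1)])
    have "D t t \<omega> \<le> 0" unfolding D_def by (rule supd_least) auto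
    then show "D t t \<omega> = 0" using supd_nonneg[OF X w ep(1) ep(1), of t t] unfolding D_def by linarith
    fix r show "D r t \<omega> \<le> D r s \<omega> + D s t \<omega>"
      unfolding D_def
    proof (rule supd_least)
      fix x :: real assume x: "0 \<le> x" "x \<le> 1"
      show "\<bar>gam X (ep r) x \<omega> - gam X (ep t) x \<omega>\<bar> \<le> supd X (ep r) (ep s) \<omega> + supd X (ep s) (ep t) \<omega>"
        using supd_upper[OF X w ep(1) ep(1) x, of r s] supd_upper[OF X w ep(1) ep(1) x, of s t] by linarith
    qed
  next
    fix s t :: real assume s: "0 \<le> s" "s < t" "t \<le> 1"
    have r: "ep t < ep s" "ep s \<le> 2 * ep t" by (rule ratio(2,3)[OF s])+
    have b: "ubd M (\<lambda>\<omega>. SUP x\<in>{0..1}. ennreal ((gam X (ep s) x \<omega> - gam X (ep t) x \<omega>)\<^sup>2)) (ennreal (uconst * sqrt (ep s) * (ep s / ep t - 1)\<^sup>2))"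
      by (rule gam_sup_bound[OF X ep(1) r ep(2)])
    show "ubd M (\<lambda>\<omega>. ennreal ((D s t \<omega>)\<^sup>2)) (ennreal (uconst * sqrt e0 * (t - s) powr (11/8)))"
    proof (rule ubd_mono[OF b])
      show "ennreal ((D s t \<omega>)\<^sup>2) \<le> (SUP x\<in>{0..1}. ennreal ((gam X (ep s) x \<omega> - gam X (ep t) x \<omega>)\<^sup>2))" if "\<omega> \<in> space M" for \<omega>
        unfolding D_def by (rule supd_sq_le[OF X that ep(1) ep(1)])
      have "(ep s / ep t - 1)\<^sup>2 \<le> (t - s)\<^sup>2"
        using ratio(1)[OF s] r(1) ep(1)[of t] by (intro power_mono) auto
      also have "\<dots> = (t - s) powr 2" using s by (simp add: powr_numeral)
      also have "\<dots> \<le> (t - s) powr (11/8)" using s by (intro powr_mono') auto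
      finally have "uconst * sqrt (ep s) * (ep s / ep t - 1)\<^sup>2 \<le> uconst * sqrt e0 * (t - s) powr (11/8)"
        using ep(4)[of s] ep(1)[of s] uconst_pos e by (intro mult_mono) auto
      then show "ennreal (uconst * sqrt (ep s) * (ep s / ep t - 1)\<^sup>2) \<le> ennreal (uconst * sqrt e0 * (t - s) powr (11/8))"
        by (rule ennreal_leI)
    qed
  next
    fix \<omega> u and t :: real assume w: "\<omega> \<in> space M" and u: "u \<longlonglongrightarrow> t" "\<And>j. 0 \<le> u j \<and> u j \<le> 1" and t: "0 \<le> t" "t \<le> 1"
    \<comment> \<open>Continuity in \<open>u\<close> comes from the crude supremum bound, so this
      constant may depend on \<open>e0\<close>.\<close>
    define L where "L = 2 * (12 * dconst / (e0 / 2)\<^sup>2)"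
    have L0: "0 \<le> L" using dconst(1) by (simp add: L_def)
    have lip: "D v v' \<omega> \<le> L * (v' - v)" if v: "0 \<le> v" "v < v'" "v' \<le> 1" for v v'
      unfolding D_def
    proof (rule supd_least)
      fix x :: real assume x: "0 \<le> x" "x \<le> 1"
      have r: "ep v' < ep v" "ep v \<le> 2 * ep v'" by (rule ratio(2,3)[OF v])+
      then have r': "ep v' \<le> ep v" by simp
      note k = kern_phe_diff[OF ep(1) r' r(2) ep(2)]
      define K where "K = 12 * dconst * (ep v / ep v' - 1) / (ep v)\<^sup>2"
      have K0: "0 \<le> K" using r dconst(1) ep(1)[of v'] by (simp add: K_def)
      have "\<bar>gam X (ep v) x \<omega> - gam X (ep v') x \<omega>\<bar> \<le> 2 * K * x\<^sup>2"
        unfolding gam_diff_eq[OF X w ep(1) ep(1) x(1)] K_def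
        by (rule ctri_bound[OF K0[unfolded K_def] k(4) kern_bcf[OF k(1)] X w x(1)])
      also have "\<dots> \<le> 2 * K * 1" using x K0 by (intro mult_left_mono power_le_one) auto
      also have "K \<le> 12 * dconst * (v' - v) / (e0 / 2)\<^sup>2"
        unfolding K_def using ratio(1)[OF v] ep(3)[of v] e dconst(1) v
        by (intro frac_le mult_left_mono power_mono) auto
      finally show "\<bar>gam X (ep v) x \<omega> - gam X (ep v') x \<omega>\<bar> \<le> L * (v' - v)" by (simp add: L_def)
    qed
    have Dle: "D (u j) t \<omega> \<le> L * \<bar>t - u j\<bar>" for j
    proof -
      consider "u j = t" | "u j < t" | "t < u j" by linarith
      then show ?thesis
      proof cases
        case 1
        have "D t t \<omega> \<le> 0" unfolding D_def by (rule supd_least) auto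
        then show ?thesis using 1 by simp
      next
        case 2
        then show ?thesis using lip[of "u j" t] u(2)[of j] t by simp
      next
        case 3
        then show ?thesis using lip[of t "u j"] u(2)[of j] t by (simp add: D_def supd_commute)
      qed
    qed
    have "(\<lambda>j. L * \<bar>t - u j\<bar>) \<longlonglongrightarrow> L * \<bar>t - t\<bar>" by (intro tendsto_intros u)
    then have lim: "(\<lambda>j. L * \<bar>t - u j\<bar>) \<longlonglongrightarrow> 0" by simp
    have "0 \<le> D (u j) t \<omega>" for j unfolding D_def by (rule supd_nonneg[OF X w ep(1) ep(1)])
    then show "(\<lambda>j. D (u j) t \<omega>) \<longlonglongrightarrow> 0"
      by (intro tendsto_sandwich[OF _ _ tendsto_const lim] always_eventually allI Dle)
  qed (use uconst_pos e in auto)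
  then show ?thesis
    by (rule ubd_mono) (auto simp: D_def epc intro!: SUP_mono')
qed

definition cconst :: real where "cconst = 75 * (75 * uconst)"

lemma cconst_pos: "0 < cconst" using uconst_pos by (simp add: cconst_def)

text \<open>Octave \<open>n\<close> contributes \<open>sqrt (1/2) ^ n\<close> in the mean, a decay
  that survives the weights \<open>(8/7) ^ n\<close>. Starting the sum at octave \<open>m\<close>
  instead of \<open>0\<close> gains \<open>(7/8) ^ m\<close>, so a single integrable
  \<open>G\<close> controls all scales and all times.\<close>

lemma gam_uniform_cauchy:
  assumes X: "bm M X"
  obtains G where "G \<in> borel_measurable M" "(\<integral>\<^sup>+\<omega>. G \<omega> \<partial>M) \<le> ennreal cconst"
    "\<And>m \<epsilon> t \<omega>. \<omega> \<in> space M \<Longrightarrow> 0 < \<epsilon> \<Longrightarrow> \<epsilon> \<le> 1 / 2 ^ m \<Longrightarrow> 0 \<le> t \<Longrightarrow> t \<le> 1 \<Longrightarrow>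
       ennreal ((gam X (1 / 2 ^ m) t \<omega> - gam X \<epsilon> t \<omega>)\<^sup>2) \<le> ennreal ((7/8) ^ m) * G \<omega>"
proof -
  define F where "F n \<omega> = (SUP u\<in>{0..1}. ennreal ((supd X (1 / 2 ^ n) ((1 / 2 ^ n) * (1 - u / 2)) \<omega>)\<^sup>2))" for n \<omega>
  have "ubd M (F n) (ennreal (75 * uconst * (sqrt (1/2)) ^ n))" for n
    using gam_octave[OF X, of "1 / 2 ^ n"] unfolding F_def by (simp add: real_sqrt_power[symmetric] real_sqrt_divide power_divide)
  moreover have "sqrt (1/2) \<le> 25/32" by (rule real_le_lsqrt) (auto simp: power2_eq_square)
  ultimately have "ubd M (\<lambda>\<omega>. 8 * (\<Sum>j. ennreal ((8/7) ^ j) * F j \<omega>)) (ennreal (75 * (75 * uconst)))"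
    using uconst_pos by (intro ubd_weighted_sum) auto
  then obtain G where G: "G \<in> borel_measurable M" "\<And>\<omega>. \<omega> \<in> space M \<Longrightarrow> 8 * (\<Sum>j. ennreal ((8/7) ^ j) * F j \<omega>) \<le> G \<omega>"
    "(\<integral>\<^sup>+\<omega>. G \<omega> \<partial>M) \<le> ennreal cconst" unfolding cconst_def by (rule ubdE) blast
  have main: "ennreal ((gam X (1 / 2 ^ m) t \<omega> - gam X \<epsilon> t \<omega>)\<^sup>2) \<le> ennreal ((7/8) ^ m) * G \<omega>"
    if w: "\<omega> \<in> space M" and e: "0 < \<epsilon>" "\<epsilon> \<le> 1 / 2 ^ m" and t: "0 \<le> t" "t \<le> 1" for m \<epsilon> t \<omega>
  proof -
    have single: "ennreal ((gam X (1 / 2 ^ n) t \<omega> - gam X \<delta> t \<omega>)\<^sup>2) \<le> F n \<omega>" if d: "1 / 2 ^ Suc n \<le> \<delta>" "\<delta> \<le> 1 / 2 ^ n" for n \<delta>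
    proof -
      define u where "u = 2 * (1 - \<delta> * 2 ^ n)"
      have d2: "1 / 2 \<le> \<delta> * 2 ^ n" "\<delta> * 2 ^ n \<le> 1" using d by (auto simp: field_simps)
      have u: "0 \<le> u" "u \<le> 1" using d2 by (auto simp: u_def)
      have "(1 / 2 ^ n) * (1 - u / 2) = \<delta>" by (simp add: u_def field_simps)
      then have "ennreal ((supd X (1 / 2 ^ n) \<delta> \<omega>)\<^sup>2) \<le> F n \<omega>"
        unfolding F_def using u by (intro SUP_upper2[of u]) auto
      moreover have "0 < \<delta>" by (rule less_le_trans[OF _ d(1)]) simp
      then have "\<bar>gam X (1 / 2 ^ n) t \<omega> - gam X \<delta> t \<omega>\<bar> \<le> supd X (1 / 2 ^ n) \<delta> \<omega>"
        by (intro supd_upper[OF X w _ _ t]) auto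
      then have "\<bar>gam X (1 / 2 ^ n) t \<omega> - gam X \<delta> t \<omega>\<bar>\<^sup>2 \<le> (supd X (1 / 2 ^ n) \<delta> \<omega>)\<^sup>2" by (intro power_mono) auto
      ultimately show ?thesis by (auto intro: order_trans ennreal_leI)
    qed
    \<comment> \<open>The octave below \<open>1 / 2 ^ m\<close> that contains
      \<open>\<epsilon>\<close>, found as the first dyadic scale not above it.\<close>
    have "\<exists>J. 1 / 2 ^ Suc (m + J) \<le> \<epsilon> \<and> \<epsilon> \<le> 1 / 2 ^ (m + J)"
    proof -
      obtain N where N: "1 / 2 ^ N < \<epsilon>" using real_arch_pow_inv[OF e(1), of "1/2"] by (auto simp: power_divide)
      define n where "n = (LEAST n. 1 / 2 ^ Suc n \<le> \<epsilon>)"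
      have ex: "1 / 2 ^ Suc N \<le> \<epsilon>"
        by (rule order_trans[OF _ less_imp_le[OF N]]) (simp add: divide_left_mono)
      have n1: "1 / 2 ^ Suc n \<le> \<epsilon>" unfolding n_def by (rule LeastI[of "\<lambda>n. 1 / 2 ^ Suc n \<le> \<epsilon>", OF ex])
      have n2: "\<not> 1 / 2 ^ Suc k \<le> \<epsilon>" if "k < n" for k using that unfolding n_def by (rule not_less_Least)
      show ?thesis
      proof (cases "n \<le> m")
        case True
        have "(1::real) / 2 ^ Suc m \<le> 1 / 2 ^ Suc n" using True by (intro divide_left_mono power_increasing) auto
        then show ?thesis using n1 e(2) by (intro exI[of _ 0]) auto
      next
        case False
        then obtain J where J: "n = Suc (m + J)" using less_imp_Suc_add[of m n] by auto
        have "\<epsilon> \<le> 1 / 2 ^ n" using n2[of "m + J"] J by simp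
        then show ?thesis using n1 J by (intro exI[of _ "Suc J"]) auto
      qed
    qed
    then obtain J where J: "1 / 2 ^ Suc (m + J) \<le> \<epsilon>" "\<epsilon> \<le> 1 / 2 ^ (m + J)" by blast
    \<comment> \<open>Full octaves down to level \<open>m + J\<close>, then one partial octave
      ending at \<open>\<epsilon>\<close>; zero afterwards, since the weighted square bound asks for
      an infinite sequence.\<close>
    define x where "x j = (if j < J then gam X (1 / 2 ^ (m + j)) t \<omega> - gam X (1 / 2 ^ Suc (m + j)) t \<omega>
       else if j = J then gam X (1 / 2 ^ (m + J)) t \<omega> - gam X \<epsilon> t \<omega> else 0)" for j
    have sx: "(\<Sum>j\<le>J. x j) = gam X (1 / 2 ^ m) t \<omega> - gam X \<epsilon> t \<omega>"
    proof -
      have "(\<Sum>j<k. gam X (1 / 2 ^ (m + j)) t \<omega> - gam X (1 / 2 ^ Suc (m + j)) t \<omega>) = gam X (1 / 2 ^ m) t \<omega> - gam X (1 / 2 ^ (m + k)) t \<omega>" for k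
        by (induction k) auto
      moreover have "(\<Sum>j\<le>J. x j) = (\<Sum>j<J. x j) + x J" by (simp add: lessThan_Suc_atMost[symmetric])
      moreover have "(\<Sum>j<J. x j) = (\<Sum>j<J. gam X (1 / 2 ^ (m + j)) t \<omega> - gam X (1 / 2 ^ Suc (m + j)) t \<omega>)"
        by (rule sum.cong) (auto simp: x_def)
      ultimately show ?thesis by (simp add: x_def)
    qed
    have xF: "ennreal ((x j)\<^sup>2) \<le> F (m + j) \<omega>" for j
      unfolding x_def using single[of "m + j" "1 / 2 ^ Suc (m + j)"] single[OF J] by (auto simp: divide_left_mono)
    have "ennreal ((gam X (1 / 2 ^ m) t \<omega> - gam X \<epsilon> t \<omega>)\<^sup>2) \<le> 8 * (\<Sum>j. ennreal ((8/7) ^ j) * F (m + j) \<omega>)"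
      unfolding sx[symmetric] by (rule ennreal_sum_square_weighted[OF xF])
    also have "(\<Sum>j. ennreal ((8/7) ^ j) * F (m + j) \<omega>) = ennreal ((7/8) ^ m) * (\<Sum>j. ennreal ((8/7) ^ (j + m)) * F (j + m) \<omega>)"
    proof -
      have "ennreal ((8/7) ^ j) * F (m + j) \<omega> = ennreal ((7/8) ^ m) * (ennreal ((8/7) ^ (j + m)) * F (j + m) \<omega>)" for j
      proof -
        have "(8/7 :: real) ^ j = (7/8) ^ m * (8/7) ^ (j + m)"
          by (simp add: power_add power_mult_distrib[symmetric])
        then show ?thesis by (simp add: ennreal_mult mult.assoc add.commute)
      qed
      then show ?thesis by (simp add: ennreal_suminf_cmult)
    qed
    also have "(\<Sum>j. ennreal ((8/7) ^ (j + m)) * F (j + m) \<omega>) \<le> (\<Sum>j. ennreal ((8/7) ^ j) * F j \<omega>)"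
      by (subst suminf_offset[of "\<lambda>j. ennreal ((8/7) ^ j) * F j \<omega>" m]) (auto intro: summableI)
    finally have "ennreal ((gam X (1 / 2 ^ m) t \<omega> - gam X \<epsilon> t \<omega>)\<^sup>2) \<le> 8 * (ennreal ((7/8) ^ m) * (\<Sum>j. ennreal ((8/7) ^ j) * F j \<omega>))"
      by (meson mult_left_mono order_trans zero_le)
    also have "\<dots> = ennreal ((7/8) ^ m) * (8 * (\<Sum>j. ennreal ((8/7) ^ j) * F j \<omega>))" by (simp add: mult_ac)
    also have "\<dots> \<le> ennreal ((7/8) ^ m) * G \<omega>" by (intro mult_left_mono G(2)[OF w]) auto
    finally show ?thesis .
  qed
  show thesis by (rule that[OF G(1) G(3) main])
qed

end

section \<open>The lower tail of the mollified local times\<close>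

lemma dbl_mono_nonneg: "(\<And>z. 0 \<le> f z) \<Longrightarrow> 0 \<le> dbl A f x"
  unfolding dbl_def by (intro integral_nonneg_AE AE_I2 mult_nonneg_nonneg) auto

lemma tri_ge_blocks:
  assumes f: "bcf f" "\<And>z. 0 \<le> f z" and X: "bm M X" and w: "\<omega> \<in> space M" and h: "0 < h"
  shows "(\<Sum>k<n. h\<^sup>2 * tri (\<lambda>z. f (sqrt h *\<^sub>R z)) 1 (\<lambda>s. resc X (real k * h) h s \<omega>)) \<le> tri f (real n * h) (\<lambda>s. X s \<omega>)"
proof (induction n)
  case 0
  then show ?case by (simp add: dbl_mono_nonneg f)
next
  case (Suc n)
  have "tri f (real n * h + h) (\<lambda>s. X s \<omega>) = tri f (real n * h) (\<lambda>s. X s \<omega>)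
     + h\<^sup>2 * tri (\<lambda>z. f (sqrt h *\<^sub>R z)) 1 (\<lambda>s. resc X (real n * h) h s \<omega>) + rect f (real n * h) (real n * h + h) (\<lambda>s. X s \<omega>)"
    by (rule bm_tri_split[OF f(1) X w _ h]) (use h in simp)
  moreover have "0 \<le> rect f (real n * h) (real n * h + h) (\<lambda>s. X s \<omega>)" by (rule dbl_mono_nonneg[OF f(2)])
  moreover have "real (Suc n) * h = real n * h + h" by (simp add: algebra_simps)
  ultimately show ?case using Suc by simp
qed

section \<open>Means of the mollified local times\<close>

lemma expectation_increment:
  assumes X: "bm M X" and f[measurable]: "f \<in> borel_measurable borel" and s: "0 \<le> u" "u < s"
  shows "(\<integral>\<omega>. f (X s \<omega> - X u \<omega>) \<partial>M) = (\<integral>x. f x * gauss2 (s - u) x \<partial>lborel :: real)"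
proof -
  note [measurable] = bm_measurable[OF X]
  have "(\<integral>\<omega>. f (X s \<omega> - X u \<omega>) \<partial>M) = (\<integral>x. f x \<partial>distr M borel (\<lambda>\<omega>. X s \<omega> - X u \<omega>))"
    by (rule integral_distr[symmetric]) auto
  also have "\<dots> = (\<integral>x. gauss2 (s - u) x * f x \<partial>lborel)"
    unfolding bm_increment_distr[OF X s] by (rule integral_gaussm) (use s in auto)
  finally show ?thesis by (simp add: mult.commute)
qed

text \<open>In the coordinate \<open>r = s - u\<close>, a lag \<open>r\<close> occurs for a set of
  start times of length \<open>t - r\<close>.\<close>

lemma nn_integral_triangle:
  assumes [measurable]: "e \<in> borel_measurable borel"
  shows "(\<integral>\<^sup>+p. indicator (tset t) p * e (fst p - snd p) \<partial>lborel) = (\<integral>\<^sup>+r. indicator {0..t} r * ennreal (t - r) * e r \<partial>lborel)"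
proof -
  have "(\<integral>\<^sup>+p. indicator (tset t) p * e (fst p - snd p) \<partial>lborel) = (\<integral>\<^sup>+s. \<integral>\<^sup>+u. indicator (tset t) (s, u) * e (s - u) \<partial>lborel \<partial>lborel)"
    by (subst nn_integral_R2) auto
  also have "\<dots> = (\<integral>\<^sup>+u. \<integral>\<^sup>+s. indicator (tset t) (s, u) * e (s - u) \<partial>lborel \<partial>lborel)"
  proof (rule lborel_pair.Fubini')
    have "(\<lambda>p. (snd p, fst p)) \<in> borel_measurable (borel :: R2 measure)"
      by (intro borel_measurable_continuous_onI continuous_intros)
    from measurable_compose[OF this, of "\<lambda>p. indicator (tset t) p * e (fst p - snd p)" borel]
    have "(\<lambda>p. indicator (tset t) (snd p, fst p) * e (snd p - fst p)) \<in> borel_measurable (borel :: R2 measure)" by simp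
    then show "(\<lambda>(u, s). indicator (tset t) (s, u) * e (s - u)) \<in> borel_measurable (lborel \<Otimes>\<^sub>M lborel)"
      by (simp add: lborel_prod case_prod_beta)
  qed
  also have "\<dots> = (\<integral>\<^sup>+u. \<integral>\<^sup>+r. indicator (tset t) (u + r, u) * e r \<partial>lborel \<partial>lborel)"
  proof (rule nn_integral_cong)
    fix u :: real
    have [measurable]: "(\<lambda>s. indicator (tset t) (s, u) * e (s - u)) \<in> borel_measurable borel"
    proof -
      have "(\<lambda>s. (s, u)) \<in> borel_measurable (borel :: real measure)" by (intro borel_measurable_continuous_onI continuous_intros)
      from measurable_compose[OF this, of "\<lambda>p. indicator (tset t) p * e (fst p - snd p)" borel]
      show ?thesis by simp
    qed
    show "(\<integral>\<^sup>+s. indicator (tset t) (s, u) * e (s - u) \<partial>lborel) = (\<integral>\<^sup>+r. indicator (tset t) (u + r, u) * e r \<partial>lborel)"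
      using nn_integral_real_affine[of "\<lambda>s. indicator (tset t) (s, u) * e (s - u)" 1 u] by simp
  qed
  also have "\<dots> = (\<integral>\<^sup>+r. \<integral>\<^sup>+u. indicator (tset t) (u + r, u) * e r \<partial>lborel \<partial>lborel)"
  proof (rule lborel_pair.Fubini')
    have "(\<lambda>p. (snd p + fst p, snd p)) \<in> borel_measurable (borel :: R2 measure)"
      by (intro borel_measurable_continuous_onI continuous_intros)
    from measurable_compose[OF this, of "indicator (tset t)" borel]
    have [measurable]: "(\<lambda>p. indicator (tset t) (snd p + fst p, snd p) :: ennreal) \<in> borel_measurable (borel :: R2 measure)" by simp
    have "(\<lambda>p. indicator (tset t) (snd p + fst p, snd p) * e (fst p)) \<in> borel_measurable (borel :: R2 measure)" by measurable
    then show "(\<lambda>(r, u). indicator (tset t) (u + r, u) * e r) \<in> borel_measurable (lborel \<Otimes>\<^sub>M lborel)"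
      by (simp add: lborel_prod case_prod_beta)
  qed
  also have "\<dots> = (\<integral>\<^sup>+r. indicator {0..t} r * ennreal (t - r) * e r \<partial>lborel)"
  proof (rule nn_integral_cong)
    fix r :: real
    have "(\<integral>\<^sup>+u. indicator (tset t) (u + r, u) * e r \<partial>lborel) = (\<integral>\<^sup>+u. (indicator {0..} r * e r) * indicator {0..t - r} u \<partial>lborel)"
      by (intro nn_integral_cong) (auto simp: tset_def indicator_def)
    also have "\<dots> = (indicator {0..} r * e r) * emeasure lborel {0..t - r}"
      by (rule nn_integral_cmult_indicator) simp
    also have "\<dots> = indicator {0..t} r * ennreal (t - r) * e r"
      by (auto simp: indicator_def emeasure_lborel_Icc_eq mult.commute)
    finally show "(\<integral>\<^sup>+u. indicator (tset t) (u + r, u) * e r \<partial>lborel) = indicator {0..t} r * ennreal (t - r) * e r" .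
  qed
  finally show ?thesis .
qed

lemma AE_off_diagonal: "AE p in (lborel :: R2 measure). fst p \<noteq> snd p"
proof -
  have "emeasure lborel {p :: R2. fst p = snd p} = (\<integral>\<^sup>+p. indicator {p :: R2. fst p = snd p} p \<partial>lborel)"
    by (subst nn_integral_indicator) (auto intro!: borel_closed closed_Collect_eq continuous_intros)
  also have "\<dots> = (\<integral>\<^sup>+s. \<integral>\<^sup>+u. indicator {p :: R2. fst p = snd p} (s, u) \<partial>lborel \<partial>lborel)"
    by (rule nn_integral_R2) (auto intro!: borel_measurable_indicator borel_closed closed_Collect_eq continuous_intros)
  also have "\<dots> = (\<integral>\<^sup>+s. \<integral>\<^sup>+u. indicator {s} u \<partial>lborel \<partial>(lborel :: real measure))"
    by (intro nn_integral_cong) (auto simp: indicator_def)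
  also have "\<dots> = 0" by simp
  finally have "{p :: R2. fst p = snd p} \<in> null_sets lborel"
    by (auto simp: null_sets_def intro!: borel_closed closed_Collect_eq continuous_intros)
  then show ?thesis by (rule AE_I') auto
qed

context mollifier
begin

text \<open>Mean of the mollifier at a Brownian increment of duration \<open>r\<close>. Its bound
  \<open>1 / (2 * pi * r)\<close> is the source of the terms \<open>ln n / (2 * pi)\<close> in the
  upper bounds for the tail.\<close>

definition pker :: "real \<Rightarrow> real \<Rightarrow> real" where
  "pker \<epsilon> r = (\<integral>x. phe \<epsilon> x * gauss2 r x \<partial>lborel)"

definition mtri :: "real \<Rightarrow> real \<Rightarrow> real" where
  "mtri \<epsilon> t = (\<integral>r. indicator {0<..t} r * ((t - r) * pker \<epsilon> r) \<partial>lborel)"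

lemma phe_measurable[measurable]: "phe \<epsilon> \<in> borel_measurable borel"
  unfolding phi_eps_def[abs_def] by measurable

lemma pker_measurable[measurable]: "pker \<epsilon> \<in> borel_measurable borel"
  unfolding pker_def by (rule lborel.borel_measurable_lebesgue_integral) measurable

lemma pker_nonneg: "0 < r \<Longrightarrow> 0 \<le> pker \<epsilon> r"
  unfolding pker_def by (intro integral_nonneg_AE AE_I2 mult_nonneg_nonneg phe_nonneg gauss2_nonneg)

lemma pker_le:
  assumes e: "0 < \<epsilon>" and r: "0 < r"
  shows "pker \<epsilon> r \<le> 1 / (2 * pi * r)" "pker \<epsilon> r \<le> dconst / \<epsilon>\<^sup>2"
proof -
  have i: "integrable lborel (\<lambda>x. phe \<epsilon> x * gauss2 r x)"
  proof (rule Bochner_Integration.integrable_bound)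
    show "integrable lborel (\<lambda>x. phe \<epsilon> x * (1 / (2 * pi * r)))" using phe_integrable[OF e] by simp
    show "AE x in lborel. norm (phe \<epsilon> x * gauss2 r x) \<le> norm (phe \<epsilon> x * (1 / (2 * pi * r)))"
      using abs_mult_gauss2_le[OF r] r by (intro AE_I2) (simp add: abs_mult)
  qed measurable
  have "pker \<epsilon> r \<le> (\<integral>x. phe \<epsilon> x * (1 / (2 * pi * r)) \<partial>lborel)"
    unfolding pker_def using phe_integrable[OF e]
    by (intro integral_mono i mult_left_mono gauss2_le r phe_nonneg) simp
  then show "pker \<epsilon> r \<le> 1 / (2 * pi * r)" using phe_integral[OF e] by simp
  have "pker \<epsilon> r \<le> (\<integral>x. (dconst / \<epsilon>\<^sup>2) * gauss2 r x \<partial>lborel)"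
    unfolding pker_def using integrable_gauss2[OF r] phe_bound[OF e] phe_nonneg
    by (intro integral_mono i mult_right_mono gauss2_nonneg r) (auto simp: abs_of_nonneg)
  then show "pker \<epsilon> r \<le> dconst / \<epsilon>\<^sup>2" using integral_gauss2[OF r] by simp
qed

lemma mtri_integrable:
  assumes e: "0 < \<epsilon>" and t: "0 \<le> t"
  shows "integrable lborel (\<lambda>r. indicator {0<..t} r * ((t - r) * pker \<epsilon> r))"
proof (rule Bochner_Integration.integrable_bound)
  show "integrable lborel (\<lambda>r. indicator {0<..t} r * (t * (dconst / \<epsilon>\<^sup>2)))"
    by (intro integrable_mult_left integrable_real_indicator) (use t in auto)
  show "AE r in lborel. norm (indicator {0<..t} r * ((t - r) * pker \<epsilon> r)) \<le> norm (indicator {0<..t} r * (t * (dconst / \<epsilon>\<^sup>2)))"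
  proof (rule AE_I2)
    fix r :: real
    show "norm (indicator {0<..t} r * ((t - r) * pker \<epsilon> r)) \<le> norm (indicator {0<..t} r * (t * (dconst / \<epsilon>\<^sup>2)))"
    proof (cases "0 < r \<and> r \<le> t")
      case True
      then have "(t - r) * pker \<epsilon> r \<le> t * (dconst / \<epsilon>\<^sup>2)"
        using pker_le[OF e, of r] pker_nonneg[of r \<epsilon>] by (intro mult_mono) auto
      then show ?thesis using True pker_nonneg[of r \<epsilon>] dconst(1) by (simp add: indicator_def)
    qed simp
  qed
qed measurable

lemma mean_tri:
  assumes X: "bm M X" and e: "0 < \<epsilon>" and t: "0 \<le> t"
  shows "(\<integral>\<omega>. tri (phe \<epsilon>) t (\<lambda>s. X s \<omega>) \<partial>M) = mtri \<epsilon> t"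
proof -
  interpret prob_space M by (rule bm_prob_space[OF X])
  note bf = bcf_phe[OF e]
  have "(\<integral>\<omega>. 1 * tri (phe \<epsilon>) t (\<lambda>s. X s \<omega>) \<partial>M)
    = (\<integral>p. indicator (tset t) p * (\<integral>\<omega>. 1 * phe \<epsilon> (X (fst p) \<omega> - X (snd p) \<omega>) \<partial>M) \<partial>lborel)"
    by (rule expectation_dbl(1)[OF X bf tset_measurable emeasure_tset_finite, of _ 1]) auto
  also have "\<dots> = (\<integral>p. indicator (tset t) p * (indicator {0<..} (fst p - snd p) * pker \<epsilon> (fst p - snd p)) \<partial>lborel)"
  proof (rule integral_cong_AE)
    show "(\<lambda>p. indicator (tset t) p * (\<integral>\<omega>. 1 * phe \<epsilon> (X (fst p) \<omega> - X (snd p) \<omega>) \<partial>M)) \<in> borel_measurable lborel"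
      using expectation_dbl(2)[OF X bf tset_measurable emeasure_tset_finite, of "\<lambda>_. 1" 1 t] by auto
    show "AE p in lborel. indicator (tset t) p * (\<integral>\<omega>. 1 * phe \<epsilon> (X (fst p) \<omega> - X (snd p) \<omega>) \<partial>M)
       = indicator (tset t) p * (indicator {0<..} (fst p - snd p) * pker \<epsilon> (fst p - snd p))"
      using AE_off_diagonal
    proof eventually_elim
      case (elim p)
      show ?case
      proof (cases "p \<in> tset t")
        case True
        then have "0 \<le> snd p" "snd p < fst p" using elim by (auto simp: tset_def)
        then show ?thesis using expectation_increment[OF X phe_measurable, of "snd p" "fst p" \<epsilon>] by (simp add: pker_def)
      qed simp
    qed
  qed measurable
  also have "\<dots> = enn2real (\<integral>\<^sup>+p. ennreal (indicator (tset t) p * (indicator {0<..} (fst p - snd p) * pker \<epsilon> (fst p - snd p))) \<partial>lborel)"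
    by (rule integral_eq_nn_integral) (auto simp: indicator_def pker_nonneg)
  also have "(\<integral>\<^sup>+p. ennreal (indicator (tset t) p * (indicator {0<..} (fst p - snd p) * pker \<epsilon> (fst p - snd p))) \<partial>lborel)
    = (\<integral>\<^sup>+p. indicator (tset t) p * (\<lambda>r. ennreal (indicator {0<..} r * pker \<epsilon> r)) (fst p - snd p) \<partial>lborel)"
    by (intro nn_integral_cong) (auto simp: indicator_def)
  also have "\<dots> = (\<integral>\<^sup>+r. indicator {0..t} r * ennreal (t - r) * ennreal (indicator {0<..} r * pker \<epsilon> r) \<partial>lborel)"
    by (rule nn_integral_triangle) measurable
  also have "\<dots> = (\<integral>\<^sup>+r. ennreal (indicator {0<..t} r * ((t - r) * pker \<epsilon> r)) \<partial>lborel)"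
    by (intro nn_integral_cong) (auto simp: indicator_def ennreal_mult pker_nonneg)
  also have "enn2real \<dots> = mtri \<epsilon> t"
    unfolding mtri_def by (rule integral_eq_nn_integral[symmetric]) (auto simp: indicator_def pker_nonneg)
  finally show ?thesis by simp
qed

lemma gam_eq: "bm M X \<Longrightarrow> 0 < \<epsilon> \<Longrightarrow> 0 \<le> t \<Longrightarrow> gam X \<epsilon> t \<omega> = tri (phe \<epsilon>) t (\<lambda>s. X s \<omega>) - mtri \<epsilon> t"
  by (simp add: gam_def ctri_def mean_tri)

lemma gam_measurable: "bm M X \<Longrightarrow> 0 < \<epsilon> \<Longrightarrow> gam X \<epsilon> t \<in> borel_measurable M"
  unfolding gam_def[abs_def] by (rule ctri_measurable[OF _ bcf_phe])

section \<open>Brownian scaling of the mollified local time\<close>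

lemma phe_scale:
  assumes "0 < \<epsilon>" "0 < h"
  shows "phe \<epsilon> (sqrt h *\<^sub>R z) = (1 / h) * phe (\<epsilon> / sqrt h) z"
  using assms by (simp add: phi_eps_def power_divide)

lemma dbl_cmult: "dbl A (\<lambda>z. c * f z) x = c * dbl A f x"
  unfolding dbl_def by (simp add: mult.left_commute[of _ c])

lemma tri_phe_rescale:
  assumes X: "bm M X" and w: "\<omega> \<in> space M" and a: "0 \<le> a" and h: "0 < h" and t: "0 \<le> t" and e: "0 < \<epsilon>"
  shows "tri (phe \<epsilon>) (h * t) (\<lambda>s. X (a + s) \<omega>) = h * tri (phe (\<epsilon> / sqrt h)) t (\<lambda>s. resc X a h s \<omega>)"
  using tri_rescale[OF bcf_phe[OF e] X w a h t] h
  unfolding phe_scale[OF e h] dbl_cmult by (simp add: power2_eq_square)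

text \<open>A deterministic identity derived through the path: the rescaled path is again a Brownian
  motion, so its mean is given by the same function at the scale
  \<open>\<epsilon> / sqrt h\<close>.\<close>

lemma mtri_scale:
  assumes X: "bm M X" and h: "0 < h" and t: "0 \<le> t" and e: "0 < \<epsilon>"
  shows "mtri \<epsilon> (h * t) = h * mtri (\<epsilon> / sqrt h) t"
proof -
  have "mtri \<epsilon> (h * t) = (\<integral>\<omega>. tri (phe \<epsilon>) (h * t) (\<lambda>s. X s \<omega>) \<partial>M)"
    using mean_tri[OF X e, of "h * t"] h t by simp
  also have "\<dots> = (\<integral>\<omega>. h * tri (phe (\<epsilon> / sqrt h)) t (\<lambda>s. resc X 0 h s \<omega>) \<partial>M)"
    using tri_phe_rescale[OF X _ _ h t e, of _ 0] by (intro Bochner_Integration.integral_cong) auto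
  also have "\<dots> = h * mtri (\<epsilon> / sqrt h) t"
    using mean_tri[OF bm_resc[OF X _ h] _ t, of 0 "\<epsilon> / sqrt h"] e h by simp
  finally show ?thesis .
qed

lemma gam_rescale:
  assumes X: "bm M X" and w: "\<omega> \<in> space M" and h: "0 < h" and t: "0 \<le> t" and e: "0 < \<epsilon>"
  shows "gam X \<epsilon> (h * t) \<omega> = h * gam (resc X 0 h) (\<epsilon> / sqrt h) t \<omega>"
  using tri_phe_rescale[OF X w _ h t e, of 0] mtri_scale[OF X h t e] h t e X
  by (simp add: gam_eq bm_resc right_diff_distrib)

text \<open>Among the pairs of times in different blocks, a lag \<open>r\<close> has weight
  \<open>(n - 1) * r\<close> for \<open>r \<le> 1 / n\<close> and at most \<open>1\<close> beyond.
  With \<open>pker \<epsilon> r \<le> 1 / (2 * pi * r)\<close> the short lags cost at most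
  \<open>1\<close> and the long ones \<open>ln n\<close>, up to the factor
  \<open>1 / (2 * pi)\<close>.\<close>

lemma mtri_cross:
  assumes e: "0 < \<epsilon>" and n: "0 < n"
  shows "mtri \<epsilon> 1 - real n * mtri \<epsilon> (1 / real n) \<le> (ln (real n) + 1) / (2 * pi)"
proof -
  define h where "h = 1 / real n"
  have h: "0 < h" "h \<le> 1" "real n * h = 1" using n by (auto simp: h_def)
  have 1: "has_bochner_integral lborel (\<lambda>r. 1 / r * indicator {h..1} r) (ln 1 - ln h)"
    by (rule has_bochner_integral_FTC_Icc_real) (use h in \<open>auto intro!: derivative_eq_intros continuous_intros\<close>)
  have i1: "integrable lborel (\<lambda>r. 1 / r * indicator {h..1} r)" and v1: "(\<integral>r. 1 / r * indicator {h..1} r \<partial>lborel) = ln (real n)"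
    using 1 n by (auto simp: has_bochner_integral_iff h_def ln_div)
  have i2: "integrable lborel (\<lambda>r. indicator {0<..h} r * (real n - 1))"
    by (intro integrable_mult_left integrable_real_indicator) (use h in auto)
  have v2: "(\<integral>r. indicator {0<..h} r * (real n - 1) \<partial>lborel) = h * (real n - 1)"
    using h by simp
  note i3 = mtri_integrable[OF e, of 1] mtri_integrable[OF e, of h]
  have "mtri \<epsilon> 1 - real n * mtri \<epsilon> h
    = (\<integral>r. indicator {0<..1} r * ((1 - r) * pker \<epsilon> r) - real n * (indicator {0<..h} r * ((h - r) * pker \<epsilon> r)) \<partial>lborel)"
    unfolding mtri_def using i3 h by simp
  also have "\<dots> \<le> (\<integral>r. (1 / (2 * pi)) * (indicator {0<..h} r * (real n - 1) + 1 / r * indicator {h..1} r) \<partial>lborel)"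
  proof (rule integral_mono)
    show "integrable lborel (\<lambda>r. indicator {0<..1} r * ((1 - r) * pker \<epsilon> r) - real n * (indicator {0<..h} r * ((h - r) * pker \<epsilon> r)))"
      using i3 h by simp
    show "integrable lborel (\<lambda>r. (1 / (2 * pi)) * (indicator {0<..h} r * (real n - 1) + 1 / r * indicator {h..1} r))"
      using i1 i2 by (intro integrable_mult_right Bochner_Integration.integrable_add)
    fix r :: real
    show "indicator {0<..1} r * ((1 - r) * pker \<epsilon> r) - real n * (indicator {0<..h} r * ((h - r) * pker \<epsilon> r))
       \<le> (1 / (2 * pi)) * (indicator {0<..h} r * (real n - 1) + 1 / r * indicator {h..1} r)"
    proof -
      consider "r \<le> 0 \<or> 1 < r" | "0 < r" "r \<le> h" | "h < r" "r \<le> 1" by linarith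
      then show ?thesis
      proof cases
        case 1
        then show ?thesis using h n by (auto simp: indicator_def)
      next
        case 2
        have "(1 - r) * pker \<epsilon> r - real n * ((h - r) * pker \<epsilon> r) = ((real n - 1) * r) * pker \<epsilon> r"
          using h(3) by (simp add: algebra_simps)
        also have "\<dots> \<le> ((real n - 1) * r) * (1 / (2 * pi * r))"
          using 2 n pker_le(1)[OF e 2(1)] by (intro mult_left_mono) auto
        also have "\<dots> = (1 / (2 * pi)) * (real n - 1)" using 2 by simp
        also have "\<dots> \<le> (1 / (2 * pi)) * ((real n - 1) + 1 / r * indicator {h..1} r)"
          using 2 by (intro mult_left_mono) auto
        finally show ?thesis using 2 h by simp
      next
        case 3
        have r: "0 < r" using 3 h by simp
        have "(1 - r) * pker \<epsilon> r \<le> 1 * (1 / (2 * pi * r))"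
          using 3 r pker_le(1)[OF e r] pker_nonneg[OF r] by (intro mult_mono) auto
        then show ?thesis using 3 r by simp
      qed
    qed
  qed
  also have "\<dots> = (1 / (2 * pi)) * (h * (real n - 1) + ln (real n))"
    using i1 i2 v1 v2 by simp
  also have "\<dots> \<le> (1 / (2 * pi)) * (1 + ln (real n))"
    using h by (intro mult_left_mono add_mono) (auto simp: algebra_simps)
  finally show ?thesis by (simp add: h_def add.commute)
qed

section \<open>Decomposition into equal blocks\<close>

definition blk :: "(real \<Rightarrow> 'a \<Rightarrow> R2) \<Rightarrow> nat \<Rightarrow> nat \<Rightarrow> real \<Rightarrow> 'a \<Rightarrow> R2" where
  "blk X n k = resc X (real k * (1 / real n)) (1 / real n)"

lemma bm_blk: "bm M X \<Longrightarrow> 0 < n \<Longrightarrow> bm M (blk X n k)"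
  unfolding blk_def by (rule bm_resc) auto

text \<open>\<open>mtri_scale\<close> matches the means of the blocks with
  \<open>n * mtri \<epsilon> (1 / n)\<close>, so only the mean of the discarded interactions is
  left. The blocks see the mollification \<open>\<epsilon> * sqrt n\<close>, which may be
  large.\<close>

lemma gam_ge_blocks:
  assumes X: "bm M X" and w: "\<omega> \<in> space M" and e: "0 < \<epsilon>" and n: "0 < n"
  shows "(\<Sum>k<n. gam (blk X n k) (\<epsilon> * sqrt (real n)) 1 \<omega>) / real n - (ln (real n) + 1) / (2 * pi) \<le> gam X \<epsilon> 1 \<omega>"
proof -
  define h where "h = 1 / real n"
  have h: "0 < h" "real n * h = 1" "\<epsilon> / sqrt h = \<epsilon> * sqrt (real n)" using n by (auto simp: h_def real_sqrt_divide)
  have e': "0 < \<epsilon> * sqrt (real n)" using e n by simp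
  have "(\<Sum>k<n. h\<^sup>2 * tri (\<lambda>z. phe \<epsilon> (sqrt h *\<^sub>R z)) 1 (\<lambda>s. resc X (real k * h) h s \<omega>)) \<le> tri (phe \<epsilon>) (real n * h) (\<lambda>s. X s \<omega>)"
    by (rule tri_ge_blocks[OF bcf_phe[OF e] phe_nonneg X w h(1)])
  moreover have "h\<^sup>2 * tri (\<lambda>z. phe \<epsilon> (sqrt h *\<^sub>R z)) 1 (\<lambda>s. resc X (real k * h) h s \<omega>)
     = h * (gam (blk X n k) (\<epsilon> * sqrt (real n)) 1 \<omega> + mtri (\<epsilon> * sqrt (real n)) 1)" for k
    unfolding phe_scale[OF e h(1)] dbl_cmult h(3) gam_eq[OF bm_blk[OF X n] e' zero_le_one]
    using h by (simp add: blk_def h_def[symmetric] power2_eq_square)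
  ultimately have "(\<Sum>k<n. h * (gam (blk X n k) (\<epsilon> * sqrt (real n)) 1 \<omega> + mtri (\<epsilon> * sqrt (real n)) 1)) \<le> tri (phe \<epsilon>) 1 (\<lambda>s. X s \<omega>)"
    using h(2) by simp
  moreover have "(\<Sum>k<n. h * (gam (blk X n k) (\<epsilon> * sqrt (real n)) 1 \<omega> + mtri (\<epsilon> * sqrt (real n)) 1))
    = (\<Sum>k<n. gam (blk X n k) (\<epsilon> * sqrt (real n)) 1 \<omega>) / real n + real n * (h * mtri (\<epsilon> * sqrt (real n)) 1)"
    by (simp add: sum_distrib_left[symmetric] sum.distrib h_def add_divide_distrib sum_divide_distrib)
  moreover have "h * mtri (\<epsilon> * sqrt (real n)) 1 = mtri \<epsilon> (1 / real n)"
    using mtri_scale[OF X h(1) _ e, of 1] h by (simp add: h_def)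
  ultimately show ?thesis
    using mtri_cross[OF e n] by (simp add: gam_eq[OF X e])
qed

section \<open>Second moments uniform in the mollification\<close>

definition vconst :: real where "vconst = 8 * dconst\<^sup>2 + 2 * cconst"

lemma vconst_pos: "0 < vconst" using cconst_pos by (simp add: vconst_def add_nonneg_pos)

lemma gam_integrable:
  assumes X: "bm M X" and e: "0 < \<epsilon>" and t: "0 \<le> t" "t \<le> 1"
  shows "integrable M (gam X \<epsilon> t)" "integrable M (\<lambda>\<omega>. (gam X \<epsilon> t \<omega>)\<^sup>2)"
proof -
  interpret prob_space M by (rule bm_prob_space[OF X])
  note [measurable] = gam_measurable[OF X e]
  note b = gam_bound[OF X _ e t]
  show "integrable M (gam X \<epsilon> t)" by (rule integrable_bounded_measurable[OF _ b]) measurable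
  show "integrable M (\<lambda>\<omega>. (gam X \<epsilon> t \<omega>)\<^sup>2)"
  proof (rule integrable_bounded_measurable[of _ "(2 * (dconst / \<epsilon>\<^sup>2))\<^sup>2"])
    show "\<bar>(gam X \<epsilon> t \<omega>)\<^sup>2\<bar> \<le> (2 * (dconst / \<epsilon>\<^sup>2))\<^sup>2" if "\<omega> \<in> space M" for \<omega>
      using power_mono[OF b[OF that], of 2] by simp
  qed measurable
qed

text \<open>Scales up to \<open>1\<close> are compared with scale \<open>1\<close> through
  \<open>G\<close>; for \<open>\<epsilon> > 1\<close> the mollifier itself is bounded. Uniformity
  over all scales is forced by the factor \<open>sqrt n\<close> in the blocks.\<close>

lemma gam_second_moment:
  assumes X: "bm M X" and e: "0 < \<epsilon>"
  shows "(\<integral>\<omega>. (gam X \<epsilon> 1 \<omega>)\<^sup>2 \<partial>M) \<le> vconst"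
proof -
  interpret prob_space M by (rule bm_prob_space[OF X])
  note [measurable] = gam_measurable[OF X e] gam_measurable[OF X zero_less_one]
  obtain G where G[measurable]: "G \<in> borel_measurable M" and GI: "(\<integral>\<^sup>+\<omega>. G \<omega> \<partial>M) \<le> ennreal cconst"
    and GB: "\<And>m \<epsilon> t \<omega>. \<omega> \<in> space M \<Longrightarrow> 0 < \<epsilon> \<Longrightarrow> \<epsilon> \<le> 1 / 2 ^ m \<Longrightarrow> 0 \<le> t \<Longrightarrow> t \<le> 1 \<Longrightarrow>
       ennreal ((gam X (1 / 2 ^ m) t \<omega> - gam X \<epsilon> t \<omega>)\<^sup>2) \<le> ennreal ((7/8) ^ m) * G \<omega>"
    using gam_uniform_cauchy[OF X] by blast
  have "ennreal (\<integral>\<omega>. (gam X \<epsilon> 1 \<omega>)\<^sup>2 \<partial>M) = (\<integral>\<^sup>+\<omega>. ennreal ((gam X \<epsilon> 1 \<omega>)\<^sup>2) \<partial>M)"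
    by (rule nn_integral_eq_integral[symmetric]) (auto intro: gam_integrable[OF X e])
  also have "\<dots> \<le> (\<integral>\<^sup>+\<omega>. ennreal (8 * dconst\<^sup>2) + 2 * G \<omega> \<partial>M)"
  proof (rule nn_integral_mono)
    fix \<omega> assume w: "\<omega> \<in> space M"
    show "ennreal ((gam X \<epsilon> 1 \<omega>)\<^sup>2) \<le> ennreal (8 * dconst\<^sup>2) + 2 * G \<omega>"
    proof (cases "\<epsilon> \<le> 1")
      case True
      have "(gam X \<epsilon> 1 \<omega>)\<^sup>2 \<le> 2 * (gam X 1 1 \<omega>)\<^sup>2 + 2 * (gam X 1 1 \<omega> - gam X \<epsilon> 1 \<omega>)\<^sup>2"
        using zero_le_power2[of "2 * gam X 1 1 \<omega> - gam X \<epsilon> 1 \<omega>"] by (simp add: power2_eq_square algebra_simps)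
      moreover have "\<bar>gam X 1 1 \<omega>\<bar>\<^sup>2 \<le> (2 * dconst)\<^sup>2"
        using gam_bound[OF X w zero_less_one, of 1] by (intro power_mono) auto
      then have "(gam X 1 1 \<omega>)\<^sup>2 \<le> 4 * dconst\<^sup>2" by (simp only: power2_abs power_mult_distrib) simp
      ultimately have "(gam X \<epsilon> 1 \<omega>)\<^sup>2 \<le> 8 * dconst\<^sup>2 + 2 * (gam X 1 1 \<omega> - gam X \<epsilon> 1 \<omega>)\<^sup>2"
        by linarith
      then have "ennreal ((gam X \<epsilon> 1 \<omega>)\<^sup>2) \<le> ennreal (8 * dconst\<^sup>2 + 2 * (gam X 1 1 \<omega> - gam X \<epsilon> 1 \<omega>)\<^sup>2)"
        by (rule ennreal_leI)
      also have "\<dots> = ennreal (8 * dconst\<^sup>2) + 2 * ennreal ((gam X 1 1 \<omega> - gam X \<epsilon> 1 \<omega>)\<^sup>2)"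
        by (subst ennreal_plus) (auto simp: ennreal_mult)
      also have "\<dots> \<le> ennreal (8 * dconst\<^sup>2) + 2 * G \<omega>"
        using GB[OF w e, of 0 1] True by (intro add_mono mult_left_mono) auto
      finally show ?thesis .
    next
      case False
      have "2 * (dconst / \<epsilon>\<^sup>2) \<le> 2 * (dconst / 1)"
        using False dconst(1) by (intro mult_left_mono divide_left_mono) (auto simp: one_le_power)
      then have "\<bar>gam X \<epsilon> 1 \<omega>\<bar>\<^sup>2 \<le> (2 * dconst)\<^sup>2"
        using gam_bound[OF X w e, of 1] by (intro power_mono) auto
      moreover have "(2 * dconst)\<^sup>2 \<le> 8 * dconst\<^sup>2" by (simp add: power_mult_distrib)
      ultimately have "\<bar>gam X \<epsilon> 1 \<omega>\<bar>\<^sup>2 \<le> 8 * dconst\<^sup>2" by (rule order_trans)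
      then have "(gam X \<epsilon> 1 \<omega>)\<^sup>2 \<le> 8 * dconst\<^sup>2" by (simp only: power2_abs)
      then have "ennreal ((gam X \<epsilon> 1 \<omega>)\<^sup>2) \<le> ennreal (8 * dconst\<^sup>2)" by (rule ennreal_leI)
      also have "\<dots> \<le> ennreal (8 * dconst\<^sup>2) + 2 * G \<omega>" by (rule add_increasing2) auto
      finally show ?thesis .
    qed
  qed
  also have "\<dots> = ennreal (8 * dconst\<^sup>2) + 2 * (\<integral>\<^sup>+\<omega>. G \<omega> \<partial>M)"
    by (simp add: nn_integral_add nn_integral_cmult emeasure_space_1)
  also have "\<dots> \<le> ennreal (8 * dconst\<^sup>2) + 2 * ennreal cconst"
    by (intro add_mono mult_left_mono GI) auto
  also have "\<dots> = ennreal vconst"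
    unfolding vconst_def using cconst_pos by (subst ennreal_plus) (auto simp: ennreal_mult)
  finally show ?thesis using vconst_pos by simp
qed

lemma gam_mean:
  assumes X: "bm M X" and e: "0 < \<epsilon>"
  shows "(\<integral>\<omega>. gam X \<epsilon> 1 \<omega> \<partial>M) = 0"
proof -
  interpret prob_space M by (rule bm_prob_space[OF X])
  show ?thesis
    using integrable_tri[OF X bcf_phe[OF e], of 1] mean_tri[OF X e, of 1]
    by (simp add: gam_eq[OF X e] prob_space)
qed

lemma gam_blocks_product:
  assumes X: "bm M X" and e: "0 < \<epsilon>" and n: "0 < n" and g: "\<And>k. k < n \<Longrightarrow> continuous_on UNIV (g k :: real \<Rightarrow> real)"
  shows "(\<integral>\<omega>. (\<Prod>k<n. g k (gam (blk X n k) \<epsilon> 1 \<omega>)) \<partial>M) = (\<Prod>k<n. \<integral>\<omega>. g k (gam (blk X n k) \<epsilon> 1 \<omega>) \<partial>M)"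
proof -
  have "(\<integral>\<omega>. (\<Prod>k<n. (\<lambda>y. g k (y - mtri \<epsilon> 1)) (tri (phe \<epsilon>) 1 (\<lambda>s. resc X (real k * (1 / real n)) (1 / real n) s \<omega>))) \<partial>M)
    = (\<Prod>k<n. \<integral>\<omega>. (\<lambda>y. g k (y - mtri \<epsilon> 1)) (tri (phe \<epsilon>) 1 (\<lambda>s. resc X (real k * (1 / real n)) (1 / real n) s \<omega>)) \<partial>M)"
    using n by (intro indep_blocks[OF X] bcf_phe e continuous_on_compose2[OF g] continuous_intros)
      (auto simp: add_divide_distrib)
  moreover have "gam (blk X n k) \<epsilon> 1 \<omega> = tri (phe \<epsilon>) 1 (\<lambda>s. resc X (real k * (1 / real n)) (1 / real n) s \<omega>) - mtri \<epsilon> 1" for k \<omega>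
    using gam_eq[OF bm_blk[OF X n, of k] e zero_le_one] unfolding blk_def by blast
  ultimately show ?thesis by (simp only:)
qed

lemma gam_blocks_uncorrelated:
  assumes X: "bm M X" and e: "0 < \<epsilon>" and n: "0 < n" and jk: "j < n" "k < n" "j \<noteq> k"
  shows "(\<integral>\<omega>. gam (blk X n j) \<epsilon> 1 \<omega> * gam (blk X n k) \<epsilon> 1 \<omega> \<partial>M) = 0"
proof -
  interpret prob_space M by (rule bm_prob_space[OF X])
  \<comment> \<open>The identity at \<open>j\<close> and \<open>k\<close> and the constant one
    elsewhere, so that the product formula returns the covariance.\<close>
  define g where "g i y = (if i = j \<or> i = k then y else 1)" for i :: nat and y :: real
  have c: "continuous_on UNIV (g i)" for i unfolding g_def by (cases "i = j \<or> i = k") auto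
  have pr: "(\<Prod>i<n. g i (y i)) = y j * y k" for y
  proof -
    have "(\<Prod>i<n. g i (y i)) = (\<Prod>i\<in>{j, k}. g i (y i))"
      using jk by (intro prod.mono_neutral_right) (auto simp: g_def)
    then show ?thesis using jk by (simp add: g_def)
  qed
  have "(\<integral>\<omega>. gam (blk X n j) \<epsilon> 1 \<omega> * gam (blk X n k) \<epsilon> 1 \<omega> \<partial>M) = (\<integral>\<omega>. (\<Prod>i<n. g i (gam (blk X n i) \<epsilon> 1 \<omega>)) \<partial>M)"
    by (simp only: pr)
  also have "\<dots> = (\<Prod>i<n. \<integral>\<omega>. g i (gam (blk X n i) \<epsilon> 1 \<omega>) \<partial>M)"
    by (rule gam_blocks_product[OF X e n c])
  also have "\<dots> = 0"
    using jk gam_mean[OF bm_blk[OF X n] e] by (intro prod_zero) (auto simp: g_def intro!: bexI[of _ j])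
  finally show ?thesis .
qed

lemma gam_blocks_second_moment:
  assumes X: "bm M X" and e: "0 < \<epsilon>" and n: "0 < n"
  shows "(\<integral>\<omega>. (\<Sum>k<n. gam (blk X n k) \<epsilon> 1 \<omega>)\<^sup>2 \<partial>M) \<le> real n * vconst"
    "integrable M (\<lambda>\<omega>. (\<Sum>k<n. gam (blk X n k) \<epsilon> 1 \<omega>)\<^sup>2)"
proof -
  interpret prob_space M by (rule bm_prob_space[OF X])
  define y where "y k = gam (blk X n k) \<epsilon> 1" for k
  have ym[measurable]: "y k \<in> borel_measurable M" for k unfolding y_def by (rule gam_measurable[OF bm_blk[OF X n] e])
  define B where "B = 2 * (dconst / \<epsilon>\<^sup>2)"
  have yB: "\<bar>y k \<omega>\<bar> \<le> B" if "\<omega> \<in> space M" for k \<omega> unfolding y_def B_def by (rule gam_bound[OF bm_blk[OF X n] that e]) auto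
  have i: "integrable M (\<lambda>\<omega>. y j \<omega> * y k \<omega>)" for j k
  proof (rule integrable_bounded_measurable[of _ "B * B"])
    show "\<bar>y j \<omega> * y k \<omega>\<bar> \<le> B * B" if "\<omega> \<in> space M" for \<omega>
      unfolding abs_mult using yB[OF that, of j] yB[OF that, of k] by (intro mult_mono) auto
  qed measurable
  have eq: "(\<Sum>k<n. y k \<omega>)\<^sup>2 = (\<Sum>j<n. \<Sum>k<n. y j \<omega> * y k \<omega>)" for \<omega>
    by (simp add: power2_eq_square sum_product)
  show "integrable M (\<lambda>\<omega>. (\<Sum>k<n. gam (blk X n k) \<epsilon> 1 \<omega>)\<^sup>2)"
    unfolding y_def[symmetric] eq by (intro Bochner_Integration.integrable_sum i)
  have "(\<integral>\<omega>. (\<Sum>k<n. y k \<omega>)\<^sup>2 \<partial>M) = (\<Sum>j<n. \<Sum>k<n. \<integral>\<omega>. y j \<omega> * y k \<omega> \<partial>M)"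
    unfolding eq by (simp add: i)
  also have "\<dots> = (\<Sum>j<n. \<Sum>k<n. if j = k then \<integral>\<omega>. (y j \<omega>)\<^sup>2 \<partial>M else 0)"
    by (intro sum.cong refl) (auto simp: power2_eq_square y_def gam_blocks_uncorrelated[OF X e n])
  also have "\<dots> = (\<Sum>j<n. \<integral>\<omega>. (y j \<omega>)\<^sup>2 \<partial>M)" by (simp add: sum.delta)
  also have "\<dots> \<le> (\<Sum>j<n. vconst)"
    unfolding y_def by (intro sum_mono gam_second_moment bm_blk X n e)
  finally show "(\<integral>\<omega>. (\<Sum>k<n. gam (blk X n k) \<epsilon> 1 \<omega>)\<^sup>2 \<partial>M) \<le> real n * vconst"
    unfolding y_def by simp
qed

text \<open>First half of the bootstrap: the average of \<open>n\<close> uncorrelated blocks has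
  variance at most \<open>vconst / n\<close>, and Chebyshev's inequality gives a tail that decays
  like \<open>exp (- 2 * pi * x)\<close> in the level \<open>x\<close>.\<close>

lemma gam_weak_tail:
  assumes X: "bm M X" and e: "0 < \<epsilon>" and n: "0 < n"
  shows "emeasure M {\<omega>\<in>space M. (ln (real n) + 1) / (2 * pi) + 1 \<le> - gam X \<epsilon> 1 \<omega>} \<le> ennreal (vconst / real n)"
proof -
  interpret prob_space M by (rule bm_prob_space[OF X])
  note [measurable] = gam_measurable[OF X e]
  define e' where "e' = \<epsilon> * sqrt (real n)"
  have e': "0 < e'" using e n by (simp add: e'_def)
  define Z where "Z \<omega> = (\<Sum>k<n. gam (blk X n k) e' 1 \<omega>)" for \<omega>
  note [measurable] = gam_measurable[OF bm_blk[OF X n] e']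
  have [measurable]: "Z \<in> borel_measurable M" unfolding Z_def by measurable
  note z = gam_blocks_second_moment[OF X e' n, folded Z_def]
  have sub: "indicator {\<omega>\<in>space M. (ln (real n) + 1) / (2 * pi) + 1 \<le> - gam X \<epsilon> 1 \<omega>} \<omega> \<le> ennreal ((Z \<omega>)\<^sup>2 / (real n)\<^sup>2)" if w: "\<omega> \<in> space M" for \<omega>
  proof (cases "(ln (real n) + 1) / (2 * pi) + 1 \<le> - gam X \<epsilon> 1 \<omega>")
    case True
    then have "Z \<omega> / real n \<le> -1"
      using gam_ge_blocks[OF X w e n] by (simp add: Z_def e'_def)
    then have "1 \<le> \<bar>Z \<omega> / real n\<bar>" by linarith
    then have "1\<^sup>2 \<le> \<bar>Z \<omega> / real n\<bar>\<^sup>2" by (intro power_mono) auto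
    then have "1 \<le> (Z \<omega>)\<^sup>2 / (real n)\<^sup>2" by (simp add: power_divide)
    then show ?thesis by (auto simp: indicator_def)
  qed (simp add: indicator_def)
  have "emeasure M {\<omega>\<in>space M. (ln (real n) + 1) / (2 * pi) + 1 \<le> - gam X \<epsilon> 1 \<omega>}
     = (\<integral>\<^sup>+\<omega>. indicator {\<omega>\<in>space M. (ln (real n) + 1) / (2 * pi) + 1 \<le> - gam X \<epsilon> 1 \<omega>} \<omega> \<partial>M)"
    by (rule nn_integral_indicator[symmetric]) measurable
  also have "\<dots> \<le> (\<integral>\<^sup>+\<omega>. ennreal ((Z \<omega>)\<^sup>2 / (real n)\<^sup>2) \<partial>M)"
    by (intro nn_integral_mono sub)
  also have "\<dots> = ennreal (\<integral>\<omega>. (Z \<omega>)\<^sup>2 / (real n)\<^sup>2 \<partial>M)"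
    using z(2) by (intro nn_integral_eq_integral) auto
  also have "\<dots> \<le> ennreal (vconst / real n)"
  proof (rule ennreal_leI)
    have "(\<integral>\<omega>. (Z \<omega>)\<^sup>2 / (real n)\<^sup>2 \<partial>M) = (\<integral>\<omega>. (Z \<omega>)\<^sup>2 \<partial>M) / (real n)\<^sup>2" by simp
    also have "\<dots> \<le> (real n * vconst) / (real n)\<^sup>2" by (intro divide_right_mono z) auto
    also have "\<dots> = vconst / real n" using n by (simp add: power2_eq_square)
    finally show "(\<integral>\<omega>. (Z \<omega>)\<^sup>2 / (real n)\<^sup>2 \<partial>M) \<le> vconst / real n" .
  qed
  finally show ?thesis .
qed

section \<open>Exponential moments\<close>

definition econst :: real where "econst = exp 2 + exp (17/8) * (vconst * 3)"

lemma econst_ge1: "1 \<le> econst"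
  using vconst_pos by (simp add: econst_def add_increasing2)

lemma exp_eighth: "exp (1/8 :: real) \<le> 4/3"
proof -
  have "1 + (- (1/8)) \<le> exp (- (1/8) :: real)" by (rule exp_ge_add_one_self)
  then have "7/8 * exp (1/8) \<le> exp (- (1/8)) * exp (1/8 :: real)" by (intro mult_right_mono) auto
  then show ?thesis by (simp add: exp_add[symmetric])
qed

text \<open>The weak tail beats \<open>exp x\<close>. With \<open>n = 2 ^ l\<close> the level
  \<open>l / 8 + 2\<close> is exceeded with probability at most \<open>vconst / 2 ^ l\<close>, while
  the integrand grows by \<open>exp (1/8) \<le> 4/3\<close> from one level to the next; the series
  has ratio \<open>2/3\<close> and sum \<open>3\<close>.\<close>

lemma gam_exp_moment:
  assumes X: "bm M X" and e: "0 < \<epsilon>"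
  shows "(\<integral>\<omega>. exp (- gam X \<epsilon> 1 \<omega>) \<partial>M) \<le> econst"
proof -
  interpret prob_space M by (rule bm_prob_space[OF X])
  note [measurable] = gam_measurable[OF X e]
  define Y where "Y \<omega> = - gam X \<epsilon> 1 \<omega>" for \<omega>
  have [measurable]: "Y \<in> borel_measurable M" unfolding Y_def by measurable
  define b where "b l = real l / 8 + 2" for l :: nat
  define A where "A l = {\<omega>\<in>space M. b l \<le> Y \<omega>}" for l
  have [measurable]: "A l \<in> sets M" for l unfolding A_def by measurable
  have PA: "emeasure M (A l) \<le> ennreal (vconst * (1/2) ^ l)" for l
  proof -
    \<comment> \<open>The growth of the level per doubling of \<open>n\<close> is at most
      \<open>7/10 / 6 < 1/8\<close>, which justifies the spacing of \<open>b\<close>.\<close>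
    have pi1: "1 / (2 * pi) \<le> 1 / 6" using pi_gt3 by (intro divide_left_mono) auto
    have "ln (real (2 ^ l)) = real l * ln 2" by (simp add: ln_realpow)
    also have "\<dots> \<le> real l * (7/10)" using ln2_le_25_over_36 by (intro mult_left_mono) auto
    finally have "(ln (real (2 ^ l)) + 1) * (1 / (2 * pi)) \<le> (real l * (7/10) + 1) * (1 / 6)"
      using pi1 by (intro mult_mono) auto
    also have "\<dots> + 1 \<le> b l" by (simp add: b_def)
    finally have "(ln (real (2 ^ l)) + 1) / (2 * pi) + 1 \<le> b l" by simp
    then have "A l \<subseteq> {\<omega>\<in>space M. (ln (real (2 ^ l)) + 1) / (2 * pi) + 1 \<le> - gam X \<epsilon> 1 \<omega>}"
      by (auto simp: A_def Y_def)
    then have "emeasure M (A l) \<le> ennreal (vconst / real (2 ^ l))"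
      by (intro order_trans[OF emeasure_mono gam_weak_tail[OF X e]]) auto
    then show ?thesis by (simp add: power_divide)
  qed
  have i: "integrable M (\<lambda>\<omega>. exp (Y \<omega>))"
  proof (rule integrable_bounded_measurable[of _ "exp (2 * (dconst / \<epsilon>\<^sup>2))"])
    show "\<bar>exp (Y \<omega>)\<bar> \<le> exp (2 * (dconst / \<epsilon>\<^sup>2))" if "\<omega> \<in> space M" for \<omega>
      using gam_bound[OF X that e, of 1] by (simp add: Y_def)
  qed measurable
  have "ennreal (\<integral>\<omega>. exp (Y \<omega>) \<partial>M) = (\<integral>\<^sup>+\<omega>. ennreal (exp (Y \<omega>)) \<partial>M)"
    by (rule nn_integral_eq_integral[symmetric, OF i]) auto
  also have "\<dots> \<le> (\<integral>\<^sup>+\<omega>. ennreal (exp 2) + (\<Sum>l. ennreal (exp (b (Suc l))) * indicator (A l) \<omega>) \<partial>M)"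
  proof (rule nn_integral_mono)
    fix \<omega> assume w: "\<omega> \<in> space M"
    show "ennreal (exp (Y \<omega>)) \<le> ennreal (exp 2) + (\<Sum>l. ennreal (exp (b (Suc l))) * indicator (A l) \<omega>)"
    proof (cases "Y \<omega> < 2")
      case True
      then show ?thesis by (intro add_increasing2) (auto intro: ennreal_leI)
    next
      case False
      define l where "l = nat \<lfloor>8 * (Y \<omega> - 2)\<rfloor>"
      have "real l = real_of_int \<lfloor>8 * (Y \<omega> - 2)\<rfloor>" using False by (simp add: l_def)
      then have l: "real l \<le> 8 * (Y \<omega> - 2)" "8 * (Y \<omega> - 2) \<le> real l + 1" by linarith+
      have "ennreal (exp (Y \<omega>)) \<le> ennreal (exp (b (Suc l))) * indicator (A l) \<omega>"
      proof -
        have "b l \<le> Y \<omega>" "Y \<omega> \<le> b (Suc l)" using l by (simp_all add: b_def field_simps)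
        then show ?thesis using w by (simp add: A_def)
      qed
      also have "\<dots> \<le> (\<Sum>l. ennreal (exp (b (Suc l))) * indicator (A l) \<omega>)"
      proof -
        define F where "F = (\<lambda>l. ennreal (exp (b (Suc l))) * indicator (A l) \<omega>)"
        have "sum F {l} \<le> suminf F" by (rule sum_le_suminf) auto
        then have "F l \<le> suminf F" by simp
        then show ?thesis unfolding F_def .
      qed
      finally show ?thesis by (rule order_trans) (simp add: add_increasing)
    qed
  qed
  also have "\<dots> = ennreal (exp 2) + (\<Sum>l. ennreal (exp (b (Suc l))) * emeasure M (A l))"
    by (simp add: nn_integral_add nn_integral_suminf nn_integral_cmult emeasure_space_1)
  also have "\<dots> \<le> ennreal (exp 2) + (\<Sum>l. ennreal (exp (17/8) * (vconst * (2/3) ^ l)))"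
  proof (intro add_left_mono suminf_le)
    fix l
    have "exp (b (Suc l)) = exp (17/8) * exp (1/8) ^ l"
      by (simp add: b_def exp_add[symmetric] exp_of_nat_mult[symmetric] add_divide_distrib)
    also have "\<dots> \<le> exp (17/8) * (4/3) ^ l" by (intro mult_left_mono power_mono exp_eighth) auto
    finally have "ennreal (exp (b (Suc l))) * emeasure M (A l) \<le> ennreal (exp (17/8) * (4/3) ^ l) * ennreal (vconst * (1/2) ^ l)"
      by (intro mult_mono ennreal_leI PA) auto
    also have "\<dots> = ennreal (exp (17/8) * (4/3) ^ l * (vconst * (1/2) ^ l))"
      using vconst_pos by (intro ennreal_mult[symmetric]) auto
    also have "exp (17/8) * (4/3) ^ l * (vconst * (1/2) ^ l) = exp (17/8) * (vconst * ((4/3) * (1/2)) ^ l)"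
      by (simp only: power_mult_distrib mult_ac)
    finally show "ennreal (exp (b (Suc l))) * emeasure M (A l) \<le> ennreal (exp (17/8) * (vconst * (2/3) ^ l))" by simp
  qed auto
  also have "(\<Sum>l. ennreal (exp (17/8) * (vconst * (2/3) ^ l))) = ennreal (exp (17/8) * (vconst * 3))"
  proof (rule suminf_ennreal_eq)
    show "(\<lambda>l. exp (17/8) * (vconst * (2/3) ^ l)) sums (exp (17/8) * (vconst * 3))"
      using geometric_sums[of "2/3 :: real"] by (intro sums_mult) simp
  qed (use vconst_pos in auto)
  also have "ennreal (exp 2) + \<dots> = ennreal econst"
    unfolding econst_def using vconst_pos by (subst ennreal_plus) auto
  finally show ?thesis
    unfolding Y_def using econst_ge1 by (subst (asm) ennreal_le_iff) auto
qed

text \<open>\<open>ln econst\<close> is the cost of the exponential moment per block; one unit buys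
  the decay \<open>exp (- n)\<close>, the other covers the summand \<open>1 / (2 * pi)\<close> of
  \<open>gam_ge_blocks\<close>.\<close>

definition kconst :: real where "kconst = ln econst + 2"

text \<open>The blocks of length \<open>1/n\<close> contribute an average of independent variables with a finite exponential
  moment, so that a deviation of order one costs \<open>exp (-n)\<close>; the interactions between the blocks are
  nonnegative and only their mean, about \<open>ln n / (2 pi)\<close>, can be lost.\<close>

lemma gam_tail:
  assumes X: "bm M X" and e: "0 < \<epsilon>" and n: "0 < n"
  shows "emeasure M {\<omega>\<in>space M. ln (real n) / (2 * pi) + kconst \<le> - gam X \<epsilon> 1 \<omega>} \<le> ennreal (exp (- real n))"
proof -
  interpret prob_space M by (rule bm_prob_space[OF X])
  note [measurable] = gam_measurable[OF X e]
  define e' where "e' = \<epsilon> * sqrt (real n)"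
  have e': "0 < e'" using e n by (simp add: e'_def)
  note [measurable] = gam_measurable[OF bm_blk[OF X n] e']
  define A where "A = {\<omega>\<in>space M. ln (real n) / (2 * pi) + kconst \<le> - gam X \<epsilon> 1 \<omega>}"
  have [measurable]: "A \<in> sets M" unfolding A_def by measurable
  define P where "P \<omega> = (\<Prod>k<n. exp (- gam (blk X n k) e' 1 \<omega>))" for \<omega>
  have Pe: "P \<omega> = exp (- (\<Sum>k<n. gam (blk X n k) e' 1 \<omega>))" for \<omega>
    by (simp add: P_def exp_sum[symmetric] sum_negf)
  have [measurable]: "P \<in> borel_measurable M" unfolding P_def by measurable
  define K where "K = ln econst + 1"
  have iP: "integrable M P"
  proof (rule integrable_bounded_measurable[of _ "\<Prod>k<n. exp (2 * (dconst / e'\<^sup>2))"])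
    show "\<bar>P \<omega>\<bar> \<le> (\<Prod>k<n. exp (2 * (dconst / e'\<^sup>2)))" if "\<omega> \<in> space M" for \<omega>
    proof -
      have "exp (- gam (blk X n k) e' 1 \<omega>) \<le> exp (2 * (dconst / e'\<^sup>2))" for k
        using abs_le_D2[OF gam_bound[OF bm_blk[OF X n, of k] that e', of 1]] by simp
      then have "(\<Prod>k<n. exp (- gam (blk X n k) e' 1 \<omega>)) \<le> (\<Prod>k<n. exp (2 * (dconst / e'\<^sup>2)))"
        by (intro prod_mono conjI) auto
      moreover have "0 \<le> (\<Prod>k<n. exp (- gam (blk X n k) e' 1 \<omega>))" by (intro prod_nonneg) simp
      ultimately show ?thesis unfolding P_def by (simp only: abs_of_nonneg)
    qed
  qed measurable
  have "(\<integral>\<omega>. P \<omega> \<partial>M) = (\<Prod>k<n. \<integral>\<omega>. exp (- gam (blk X n k) e' 1 \<omega>) \<partial>M)"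
    unfolding P_def by (rule gam_blocks_product[OF X e' n, where g = "\<lambda>_ y. exp (- y)"]) (intro continuous_intros)
  also have "\<dots> \<le> (\<Prod>k<n. econst)"
    by (intro prod_mono conjI gam_exp_moment bm_blk X n e') simp
  finally have EP: "(\<integral>\<omega>. P \<omega> \<partial>M) \<le> econst ^ n" by simp
  have sub: "indicator A \<omega> \<le> ennreal (exp (- (real n * K)) * P \<omega>)" if w: "\<omega> \<in> space M" for \<omega>
  proof (cases "\<omega> \<in> A")
    case True
    have pi1: "1 / (2 * pi) \<le> 1" using pi_gt3 by simp
    have "(\<Sum>k<n. gam (blk X n k) e' 1 \<omega>) / real n \<le> (ln (real n) + 1) / (2 * pi) - (ln (real n) / (2 * pi) + kconst)"
      using gam_ge_blocks[OF X w e n] True by (simp add: A_def e'_def)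
    also have "\<dots> \<le> - K" using pi1 by (simp add: K_def kconst_def add_divide_distrib)
    finally have "real n * K \<le> - (\<Sum>k<n. gam (blk X n k) e' 1 \<omega>)" using n by (simp add: divide_le_eq mult.commute)
    then have "1 \<le> exp (- (real n * K)) * P \<omega>" unfolding Pe exp_add[symmetric] by simp
    then show ?thesis by (simp add: indicator_def)
  qed simp
  have "emeasure M A = (\<integral>\<^sup>+\<omega>. indicator A \<omega> \<partial>M)" by simp
  also have "\<dots> \<le> (\<integral>\<^sup>+\<omega>. ennreal (exp (- (real n * K)) * P \<omega>) \<partial>M)" by (intro nn_integral_mono sub)
  also have "\<dots> = ennreal (\<integral>\<omega>. exp (- (real n * K)) * P \<omega> \<partial>M)"
    by (rule nn_integral_eq_integral) (use iP in \<open>simp, simp add: Pe\<close>)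
  also have "\<dots> \<le> ennreal (exp (- real n))"
  proof (rule ennreal_leI)
    have "(\<integral>\<omega>. exp (- (real n * K)) * P \<omega> \<partial>M) \<le> exp (- (real n * K)) * econst ^ n"
      using EP by (simp add: mult_left_mono)
    also have "econst ^ n = exp (real n * ln econst)" using econst_ge1 by (simp add: exp_of_nat_mult)
    also have "exp (- (real n * K)) * exp (real n * ln econst) = exp (- real n)"
      unfolding exp_add[symmetric] K_def by (simp add: algebra_simps)
    finally show "(\<integral>\<omega>. exp (- (real n * K)) * P \<omega> \<partial>M) \<le> exp (- real n)" .
  qed
  finally show ?thesis by (simp add: A_def)
qed

section \<open>The renormalized self-intersection local time\<close>

text \<open>By \<open>mean_rect\<close>, the mean interaction between adjacent time intervals of
  lengths \<open>a\<close> and \<open>b\<close>.\<close>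

definition cross :: "real \<Rightarrow> real \<Rightarrow> real \<Rightarrow> real" where
  "cross \<epsilon> a b = mtri \<epsilon> (a + b) - mtri \<epsilon> a - mtri \<epsilon> b"

text \<open>The argument of \<open>mtri_cross\<close> for two unequal intervals: a lag
  \<open>r\<close> carries weight at most \<open>min r k\<close>, where \<open>k\<close> is the
  shorter length.\<close>

lemma cross_le:
  assumes e: "0 < \<epsilon>" and a: "0 < a" and b: "0 < b" and k: "k = min a b"
  shows "cross \<epsilon> a b \<le> k * (1 + ln ((a + b) / k)) / (2 * pi)"
proof -
  have kp: "0 < k" "k \<le> a" "k \<le> b" using a b k by auto
  have 1: "has_bochner_integral lborel (\<lambda>r. k / r * indicator {k..a + b} r) (k * ln (a + b) - k * ln k)"
    by (rule has_bochner_integral_FTC_Icc_real[where F = "\<lambda>r. k * ln r"]) (use kp in \<open>auto intro!: derivative_eq_intros continuous_intros\<close>)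
  have i1: "integrable lborel (\<lambda>r. k / r * indicator {k..a + b} r)"
    and v1: "(\<integral>r. k / r * indicator {k..a + b} r \<partial>lborel) = k * ln ((a + b) / k)"
    using 1 kp a b by (auto simp: has_bochner_integral_iff ln_div right_diff_distrib)
  have i2: "integrable lborel (\<lambda>r. indicator {0<..k} r :: real)"
    by (intro integrable_real_indicator) (use kp in auto)
  have v2: "(\<integral>r. indicator {0<..k} r \<partial>lborel) = k" using kp by simp
  note i3 = mtri_integrable[OF e, of "a + b"] mtri_integrable[OF e, of a] mtri_integrable[OF e, of b]
  have "cross \<epsilon> a b
    = (\<integral>r. indicator {0<..a + b} r * ((a + b - r) * pker \<epsilon> r) - indicator {0<..a} r * ((a - r) * pker \<epsilon> r)
       - indicator {0<..b} r * ((b - r) * pker \<epsilon> r) \<partial>lborel)"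
    unfolding mtri_def cross_def using i3 a b by simp
  also have "\<dots> \<le> (\<integral>r. (1 / (2 * pi)) * (indicator {0<..k} r + k / r * indicator {k..a + b} r) \<partial>lborel)"
  proof (rule integral_mono)
    show "integrable lborel (\<lambda>r. indicator {0<..a + b} r * ((a + b - r) * pker \<epsilon> r) - indicator {0<..a} r * ((a - r) * pker \<epsilon> r)
       - indicator {0<..b} r * ((b - r) * pker \<epsilon> r))"
      using i3 a b by simp
    show "integrable lborel (\<lambda>r. (1 / (2 * pi)) * (indicator {0<..k} r + k / r * indicator {k..a + b} r))"
      using i1 i2 by (intro integrable_mult_right Bochner_Integration.integrable_add)
    fix r :: real
    show "indicator {0<..a + b} r * ((a + b - r) * pker \<epsilon> r) - indicator {0<..a} r * ((a - r) * pker \<epsilon> r)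
       - indicator {0<..b} r * ((b - r) * pker \<epsilon> r) \<le> (1 / (2 * pi)) * (indicator {0<..k} r + k / r * indicator {k..a + b} r)"
    proof (cases "0 < r \<and> r \<le> a + b")
      case False
      then show ?thesis using a b kp by (auto simp: indicator_def)
    next
      case True
      define w where "w = (a + b - r) - indicator {0<..a} r * (a - r) - indicator {0<..b} r * (b - r)"
      have w: "w \<le> min r k" using True a b unfolding w_def k by (auto simp: indicator_def min_def)
      have p: "0 \<le> pker \<epsilon> r" "pker \<epsilon> r \<le> 1 / (2 * pi * r)" using pker_nonneg pker_le(1)[OF e] True by auto
      have "indicator {0<..a + b} r * ((a + b - r) * pker \<epsilon> r) - indicator {0<..a} r * ((a - r) * pker \<epsilon> r)
       - indicator {0<..b} r * ((b - r) * pker \<epsilon> r) = w * pker \<epsilon> r"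
        using True by (simp add: w_def algebra_simps)
      also have "\<dots> \<le> min r k * pker \<epsilon> r" using w p by (intro mult_right_mono)
      also have "\<dots> \<le> min r k * (1 / (2 * pi * r))" using p True kp by (intro mult_left_mono) auto
      also have "\<dots> \<le> (1 / (2 * pi)) * (indicator {0<..k} r + k / r * indicator {k..a + b} r)"
      proof (cases "r \<le> k")
        case r: True
        have "min r k * (1 / (2 * pi * r)) = (1 / (2 * pi)) * 1" using r True by simp
        also have "\<dots> \<le> (1 / (2 * pi)) * (indicator {0<..k} r + k / r * indicator {k..a + b} r)"
          using r True kp by (intro mult_left_mono) (auto simp: indicator_def)
        finally show ?thesis .
      next
        case False
        then show ?thesis using True by (simp add: min_def)
      qed
      finally show ?thesis .
    qed
  qed
  also have "\<dots> = (1 / (2 * pi)) * (k + k * ln ((a + b) / k))"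
    using i1 i2 v1 v2 by simp
  finally show ?thesis by (simp add: algebra_simps add_divide_distrib)
qed

lemma gam_split:
  assumes X: "bm M X" and w: "\<omega> \<in> space M" and a: "0 \<le> a" and h: "0 < h" and u: "0 \<le> u" and e: "0 < \<epsilon>"
  shows "gam X \<epsilon> (a + h * u) \<omega> = gam X \<epsilon> a \<omega> + h * gam (resc X a h) (\<epsilon> / sqrt h) u \<omega>
    + rect (phe \<epsilon>) a (a + h * u) (\<lambda>s. X s \<omega>) - cross \<epsilon> a (h * u)"
proof -
  have hu: "0 \<le> h * u" using h u by simp
  have e': "0 < \<epsilon> / sqrt h" using e h by simp
  have "h * gam (resc X a h) (\<epsilon> / sqrt h) u \<omega> = tri (phe \<epsilon>) (h * u) (\<lambda>s. X (a + s) \<omega>) - mtri \<epsilon> (h * u)"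
    using tri_phe_rescale[OF X w a h u e] mtri_scale[OF X h u e]
    by (simp add: gam_eq[OF bm_resc[OF X a h] e' u] right_diff_distrib)
  then show ?thesis
    using tri_split[OF bcf_phe[OF e] bm_path_measurable[OF X w] a hu] a hu
    by (simp add: gam_eq[OF X e] cross_def)
qed

lemma rect_phe_nonneg: "0 \<le> rect (phe \<epsilon>) a b x"
  by (rule dbl_mono_nonneg[OF phe_nonneg])

lemma mean_rect:
  assumes X: "bm M X" and a: "0 \<le> a" "0 < b" and e: "0 < \<epsilon>"
  shows "(\<integral>\<omega>. rect (phe \<epsilon>) a (a + b) (\<lambda>s. X s \<omega>) \<partial>M) = cross \<epsilon> a b"
    "integrable M (\<lambda>\<omega>. rect (phe \<epsilon>) a (a + b) (\<lambda>s. X s \<omega>))"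
proof -
  interpret prob_space M by (rule bm_prob_space[OF X])
  note bf = bcf_phe[OF e]
  have i: "integrable M (\<lambda>\<omega>. tri (phe \<epsilon>) (a + b) (\<lambda>s. X s \<omega>))" "integrable M (\<lambda>\<omega>. tri (phe \<epsilon>) a (\<lambda>s. X s \<omega>))"
    "integrable M (\<lambda>\<omega>. tri (phe \<epsilon>) b (\<lambda>s. resc X a 1 s \<omega>))"
    using a by (intro integrable_tri X bf bm_resc; simp)+
  have eq: "rect (phe \<epsilon>) a (a + b) (\<lambda>s. X s \<omega>) = tri (phe \<epsilon>) (a + b) (\<lambda>s. X s \<omega>) - tri (phe \<epsilon>) a (\<lambda>s. X s \<omega>) - tri (phe \<epsilon>) b (\<lambda>s. resc X a 1 s \<omega>)"
    if "\<omega> \<in> space M" for \<omega>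
    using tri_split[OF bf bm_path_measurable[OF X that] a(1), of b] tri_shift[OF bf X that a(1), of b] a by simp
  show "integrable M (\<lambda>\<omega>. rect (phe \<epsilon>) a (a + b) (\<lambda>s. X s \<omega>))"
    by (subst Bochner_Integration.integrable_cong[OF refl eq]) (use i in auto)
  have "(\<integral>\<omega>. rect (phe \<epsilon>) a (a + b) (\<lambda>s. X s \<omega>) \<partial>M)
    = (\<integral>\<omega>. tri (phe \<epsilon>) (a + b) (\<lambda>s. X s \<omega>) - tri (phe \<epsilon>) a (\<lambda>s. X s \<omega>) - tri (phe \<epsilon>) b (\<lambda>s. resc X a 1 s \<omega>) \<partial>M)"
    by (rule Bochner_Integration.integral_cong[OF refl eq])
  also have "\<dots> = cross \<epsilon> a b"
    using i a mean_tri[OF X e] mean_tri[OF bm_resc[OF X a(1), of 1] e] by (simp add: cross_def)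
  finally show "(\<integral>\<omega>. rect (phe \<epsilon>) a (a + b) (\<lambda>s. X s \<omega>) \<partial>M) = cross \<epsilon> a b" .
qed

section \<open>The limit and its almost sure existence\<close>

definition isl :: "(real \<Rightarrow> 'a \<Rightarrow> R2) \<Rightarrow> real \<Rightarrow> 'a \<Rightarrow> real" where
  "isl X t \<omega> = Lim (at_right 0) (\<lambda>\<epsilon>. gam X \<epsilon> t \<omega>)"

text \<open>\<open>Lim\<close> has an unspecified value when there is no limit, so existence is kept
  as a separate predicate.\<close>

definition conv :: "(real \<Rightarrow> 'a \<Rightarrow> R2) \<Rightarrow> real \<Rightarrow> 'a \<Rightarrow> bool" where
  "conv X t \<omega> \<longleftrightarrow> ((\<lambda>\<epsilon>. gam X \<epsilon> t \<omega>) \<longlongrightarrow> isl X t \<omega>) (at_right 0)"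

lemma convI: "((\<lambda>\<epsilon>. gam X \<epsilon> t \<omega>) \<longlongrightarrow> l) (at_right 0) \<Longrightarrow> conv X t \<omega> \<and> isl X t \<omega> = l"
  unfolding conv_def isl_def by (auto simp: tendsto_Lim)

text \<open>The dyadic scales form a Cauchy sequence, and the bound for arbitrary
  \<open>\<epsilon>\<close> transfers its limit to the full right neighbourhood of zero.\<close>

lemma uniform_cauchy_imp_conv:
  assumes b: "\<And>m \<epsilon>. 0 < \<epsilon> \<Longrightarrow> \<epsilon> \<le> 1 / 2 ^ m \<Longrightarrow> (gam X (1 / 2 ^ m) t \<omega> - gam X \<epsilon> t \<omega>)\<^sup>2 \<le> (7/8) ^ m * g"
    and g: "0 \<le> g"
  shows "conv X t \<omega>"
proof -
  define r where "r m = sqrt ((7/8) ^ m * g)" for m :: nat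
  have r0: "r \<longlonglongrightarrow> 0"
  proof -
    have "(\<lambda>m. sqrt ((7/8) ^ m * g)) \<longlonglongrightarrow> sqrt (0 * g)"
      by (intro tendsto_intros LIMSEQ_realpow_zero) auto
    then show ?thesis by (simp add: r_def[abs_def])
  qed
  have br: "\<bar>gam X (1 / 2 ^ m) t \<omega> - gam X \<epsilon> t \<omega>\<bar> \<le> r m" if "0 < \<epsilon>" "\<epsilon> \<le> 1 / 2 ^ m" for m \<epsilon>
    unfolding r_def using b[OF that] by (simp add: real_le_rsqrt)
  have "Cauchy (\<lambda>m. gam X (1 / 2 ^ m) t \<omega>)"
  proof (rule metric_CauchyI)
    fix e :: real assume "0 < e"
    then have "\<forall>\<^sub>F m in sequentially. r m < e / 2" using r0 by (intro order_tendstoD) auto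
    then obtain N where N: "r N < e / 2" by (auto simp: eventually_sequentially)
    have "dist (gam X (1 / 2 ^ m) t \<omega>) (gam X (1 / 2 ^ n) t \<omega>) < e" if "N \<le> m" "N \<le> n" for m n
    proof -
      have "(1::real) / 2 ^ m \<le> 1 / 2 ^ N" "(1::real) / 2 ^ n \<le> 1 / 2 ^ N" using that by (auto intro!: divide_left_mono power_increasing)
      then show ?thesis using br[of "1 / 2 ^ m" N] br[of "1 / 2 ^ n" N] N by (simp add: dist_real_def)
    qed
    then show "\<exists>N. \<forall>m\<ge>N. \<forall>n\<ge>N. dist (gam X (1 / 2 ^ m) t \<omega>) (gam X (1 / 2 ^ n) t \<omega>) < e" by blast
  qed
  then obtain l where l: "(\<lambda>m. gam X (1 / 2 ^ m) t \<omega>) \<longlonglongrightarrow> l" by (auto simp: Cauchy_convergent_iff convergent_def)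
  have "((\<lambda>\<epsilon>. gam X \<epsilon> t \<omega>) \<longlongrightarrow> l) (at_right 0)"
  proof (rule tendstoI)
    fix e :: real assume e: "0 < e"
    then have "\<forall>\<^sub>F m in sequentially. r m < e / 2" using r0 by (intro order_tendstoD) auto
    moreover have "\<forall>\<^sub>F m in sequentially. dist (gam X (1 / 2 ^ m) t \<omega>) l < e / 2" using l e by (intro tendstoD) auto
    ultimately obtain N where N: "r N < e / 2" "dist (gam X (1 / 2 ^ N) t \<omega>) l < e / 2"
      using eventually_happens'[OF sequentially_bot eventually_conj] by blast
    have "\<forall>\<^sub>F \<epsilon> in at_right (0::real). 0 < \<epsilon> \<and> \<epsilon> < 1 / 2 ^ N"
      by (intro eventually_conj eventually_at_right_less eventually_at_rightI[of 0 "1 / 2 ^ N"]) auto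
    then show "\<forall>\<^sub>F \<epsilon> in at_right 0. dist (gam X \<epsilon> t \<omega>) l < e"
    proof eventually_elim
      case (elim \<epsilon>)
      then have "\<bar>gam X (1 / 2 ^ N) t \<omega> - gam X \<epsilon> t \<omega>\<bar> \<le> r N" by (intro br) auto
      then show ?case using N unfolding dist_real_def by linarith
    qed
  qed
  then show ?thesis using convI by blast
qed

text \<open>One integrable \<open>S\<close> dominates all times and all scales up to
  \<open>1\<close>, and its finiteness detects convergence. Where it is infinite, the bound on
  \<open>isl\<close> is trivial even without a limit.\<close>

lemma gam_limit:
  assumes X: "bm M X"
  obtains S where "S \<in> borel_measurable M" "(\<integral>\<^sup>+\<omega>. S \<omega> \<partial>M) \<le> ennreal vconst"
    "\<And>\<omega> t. \<omega> \<in> space M \<Longrightarrow> S \<omega> < \<infinity> \<Longrightarrow> 0 \<le> t \<Longrightarrow> t \<le> 1 \<Longrightarrow> conv X t \<omega>"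
    "\<And>\<omega> t \<epsilon>. \<omega> \<in> space M \<Longrightarrow> 0 < \<epsilon> \<Longrightarrow> \<epsilon> \<le> 1 \<Longrightarrow> 0 \<le> t \<Longrightarrow> t \<le> 1 \<Longrightarrow> ennreal ((gam X \<epsilon> t \<omega>)\<^sup>2) \<le> S \<omega>"
    "\<And>\<omega> t. \<omega> \<in> space M \<Longrightarrow> 0 \<le> t \<Longrightarrow> t \<le> 1 \<Longrightarrow> ennreal ((isl X t \<omega>)\<^sup>2) \<le> S \<omega>"
proof -
  interpret prob_space M by (rule bm_prob_space[OF X])
  obtain G where G[measurable]: "G \<in> borel_measurable M" and GI: "(\<integral>\<^sup>+\<omega>. G \<omega> \<partial>M) \<le> ennreal cconst"
    and GB: "\<And>m \<epsilon> t \<omega>. \<omega> \<in> space M \<Longrightarrow> 0 < \<epsilon> \<Longrightarrow> \<epsilon> \<le> 1 / 2 ^ m \<Longrightarrow> 0 \<le> t \<Longrightarrow> t \<le> 1 \<Longrightarrow>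
       ennreal ((gam X (1 / 2 ^ m) t \<omega> - gam X \<epsilon> t \<omega>)\<^sup>2) \<le> ennreal ((7/8) ^ m) * G \<omega>"
    using gam_uniform_cauchy[OF X] by blast
  define S where "S \<omega> = ennreal (8 * dconst\<^sup>2) + 2 * G \<omega>" for \<omega>
  have [measurable]: "S \<in> borel_measurable M" unfolding S_def by measurable
  have SI: "(\<integral>\<^sup>+\<omega>. S \<omega> \<partial>M) \<le> ennreal vconst"
  proof -
    have "(\<integral>\<^sup>+\<omega>. S \<omega> \<partial>M) = ennreal (8 * dconst\<^sup>2) + 2 * (\<integral>\<^sup>+\<omega>. G \<omega> \<partial>M)"
      by (simp add: S_def nn_integral_add nn_integral_cmult emeasure_space_1)
    also have "\<dots> \<le> ennreal (8 * dconst\<^sup>2) + 2 * ennreal cconst"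
      by (intro add_mono mult_left_mono GI) auto
    also have "\<dots> = ennreal vconst"
      unfolding vconst_def using cconst_pos by (subst ennreal_plus) (auto simp: ennreal_mult)
    finally show ?thesis .
  qed
  have cv: "conv X t \<omega>" if w: "\<omega> \<in> space M" and Gf: "G \<omega> < \<infinity>" and t: "0 \<le> t" "t \<le> 1" for \<omega> t
  proof -
    obtain g where g: "G \<omega> = ennreal g" "0 \<le> g" using Gf by (cases "G \<omega>") auto
    show ?thesis
    proof (rule uniform_cauchy_imp_conv[OF _ g(2)])
      fix m and \<epsilon> :: real assume "0 < \<epsilon>" "\<epsilon> \<le> 1 / 2 ^ m"
      from GB[OF w this t] show "(gam X (1 / 2 ^ m) t \<omega> - gam X \<epsilon> t \<omega>)\<^sup>2 \<le> (7/8) ^ m * g"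
        using g by (simp add: ennreal_mult[symmetric])
    qed
  qed
  have SG: "G \<omega> < \<infinity>" if "S \<omega> < \<infinity>" for \<omega>
    using that by (auto simp: S_def ennreal_mult_less_top)
  have gb: "ennreal ((gam X \<epsilon> t \<omega>)\<^sup>2) \<le> S \<omega>" if w: "\<omega> \<in> space M" and e: "0 < \<epsilon>" "\<epsilon> \<le> 1" and t: "0 \<le> t" "t \<le> 1" for \<omega> t \<epsilon>
  proof -
    have "(gam X \<epsilon> t \<omega>)\<^sup>2 \<le> 2 * (gam X 1 t \<omega>)\<^sup>2 + 2 * (gam X 1 t \<omega> - gam X \<epsilon> t \<omega>)\<^sup>2"
      using zero_le_power2[of "2 * gam X 1 t \<omega> - gam X \<epsilon> t \<omega>"] by (simp add: power2_eq_square algebra_simps)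
    moreover have "\<bar>gam X 1 t \<omega>\<bar>\<^sup>2 \<le> (2 * dconst)\<^sup>2"
      using gam_bound[OF X w zero_less_one t] by (intro power_mono) auto
    then have "(gam X 1 t \<omega>)\<^sup>2 \<le> 4 * dconst\<^sup>2" by (simp only: power2_abs power_mult_distrib) simp
    ultimately have "(gam X \<epsilon> t \<omega>)\<^sup>2 \<le> 8 * dconst\<^sup>2 + 2 * (gam X 1 t \<omega> - gam X \<epsilon> t \<omega>)\<^sup>2" by linarith
    then have "ennreal ((gam X \<epsilon> t \<omega>)\<^sup>2) \<le> ennreal (8 * dconst\<^sup>2 + 2 * (gam X 1 t \<omega> - gam X \<epsilon> t \<omega>)\<^sup>2)"
      by (rule ennreal_leI)
    also have "\<dots> = ennreal (8 * dconst\<^sup>2) + 2 * ennreal ((gam X 1 t \<omega> - gam X \<epsilon> t \<omega>)\<^sup>2)"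
      by (subst ennreal_plus) (auto simp: ennreal_mult)
    also have "\<dots> \<le> S \<omega>"
      unfolding S_def using GB[OF w e(1), of 0 t] e t by (intro add_mono mult_left_mono) auto
    finally show ?thesis .
  qed
  have ib: "ennreal ((isl X t \<omega>)\<^sup>2) \<le> S \<omega>" if w: "\<omega> \<in> space M" and t: "0 \<le> t" "t \<le> 1" for \<omega> t
  proof (cases "S \<omega> < \<infinity>")
    case True
    then obtain s where s: "S \<omega> = ennreal s" "0 \<le> s" by (cases "S \<omega>") auto
    have "((\<lambda>\<epsilon>. (gam X \<epsilon> t \<omega>)\<^sup>2) \<longlongrightarrow> (isl X t \<omega>)\<^sup>2) (at_right 0)"
      using cv[OF w SG[OF True] t] unfolding conv_def by (intro tendsto_intros)
    moreover have "\<forall>\<^sub>F \<epsilon> in at_right (0::real). 0 < \<epsilon> \<and> \<epsilon> < 1"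
      by (intro eventually_conj eventually_at_right_less eventually_at_rightI[of 0 1]) auto
    then have "\<forall>\<^sub>F \<epsilon> in at_right 0. (gam X \<epsilon> t \<omega>)\<^sup>2 \<le> s"
      by eventually_elim (use gb[OF w _ _ t] s in force)
    ultimately have "(isl X t \<omega>)\<^sup>2 \<le> s" by (rule tendsto_upperbound) simp
    then show ?thesis using s by (simp add: ennreal_leI)
  next
    case False
    then have "S \<omega> = \<infinity>" by (simp add: not_less top_unique)
    then show ?thesis by simp
  qed
  show thesis
  proof (rule that[of S])
    show "S \<in> borel_measurable M" by measurable
    show "(\<integral>\<^sup>+\<omega>. S \<omega> \<partial>M) \<le> ennreal vconst" by (rule SI)
    show "conv X t \<omega>" if "\<omega> \<in> space M" "S \<omega> < \<infinity>" "0 \<le> t" "t \<le> 1" for \<omega> t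
      by (rule cv[OF that(1) SG[OF that(2)] that(3,4)])
    show "ennreal ((gam X \<epsilon> t \<omega>)\<^sup>2) \<le> S \<omega>" if "\<omega> \<in> space M" "0 < \<epsilon>" "\<epsilon> \<le> 1" "0 \<le> t" "t \<le> 1" for \<omega> t \<epsilon>
      by (rule gb[OF that])
    show "ennreal ((isl X t \<omega>)\<^sup>2) \<le> S \<omega>" if "\<omega> \<in> space M" "0 \<le> t" "t \<le> 1" for \<omega> t
      by (rule ib[OF that])
  qed
qed

lemma filterlim_divide_at_right:
  assumes "0 < (c::real)"
  shows "filterlim (\<lambda>\<epsilon>. \<epsilon> / c) (at_right 0) (at_right 0)"
proof (rule filterlim_at_withinI)
  have "((\<lambda>\<epsilon>. \<epsilon> / c) \<longlongrightarrow> 0 / c) (at_right 0)"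
    by (rule tendsto_divide[OF tendsto_ident_at tendsto_const]) (use assms in simp)
  then show "((\<lambda>\<epsilon>. \<epsilon> / c) \<longlongrightarrow> 0) (at_right 0)" by simp
  show "\<forall>\<^sub>F \<epsilon> in at_right 0. \<epsilon> / c \<in> {0<..} - {0}"
    using eventually_at_right_less[of "0::real"] by eventually_elim (use assms in auto)
qed

text \<open>The change of scale to \<open>\<epsilon> / sqrt h\<close> preserves the filter at zero,
  so scaling becomes exact in the limit.\<close>

lemma conv_rescale:
  assumes X: "bm M X" and w: "\<omega> \<in> space M" and h: "0 < h" and t: "0 \<le> t" and c: "conv (resc X 0 h) t \<omega>"
  shows "conv X (h * t) \<omega> \<and> isl X (h * t) \<omega> = h * isl (resc X 0 h) t \<omega>"
proof (rule convI)
  have "((\<lambda>\<epsilon>. gam (resc X 0 h) (\<epsilon> / sqrt h) t \<omega>) \<longlongrightarrow> isl (resc X 0 h) t \<omega>) (at_right 0)"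
    by (rule filterlim_compose[OF c[unfolded conv_def] filterlim_divide_at_right]) (use h in simp)
  then have "((\<lambda>\<epsilon>. h * gam (resc X 0 h) (\<epsilon> / sqrt h) t \<omega>) \<longlongrightarrow> h * isl (resc X 0 h) t \<omega>) (at_right 0)"
    by (intro tendsto_intros)
  moreover have "\<forall>\<^sub>F \<epsilon> in at_right 0. h * gam (resc X 0 h) (\<epsilon> / sqrt h) t \<omega> = gam X \<epsilon> (h * t) \<omega>"
    using eventually_at_right_less[of "0::real"] by eventually_elim (simp add: gam_rescale[OF X w h t])
  ultimately show "((\<lambda>\<epsilon>. gam X \<epsilon> (h * t) \<omega>) \<longlongrightarrow> h * isl (resc X 0 h) t \<omega>) (at_right 0)"
    by (rule Lim_transform_eventually)
qed

lemma AE_conv_unit: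
  assumes X: "bm M X"
  shows "AE \<omega> in M. \<forall>t. 0 \<le> t \<longrightarrow> t \<le> 1 \<longrightarrow> conv X t \<omega>"
proof -
  obtain S where S: "S \<in> borel_measurable M" "(\<integral>\<^sup>+\<omega>. S \<omega> \<partial>M) \<le> ennreal vconst"
    "\<And>\<omega> t. \<omega> \<in> space M \<Longrightarrow> S \<omega> < \<infinity> \<Longrightarrow> 0 \<le> t \<Longrightarrow> t \<le> 1 \<Longrightarrow> conv X t \<omega>"
    using gam_limit[OF X] by metis
  have "(\<integral>\<^sup>+\<omega>. S \<omega> \<partial>M) \<noteq> \<infinity>" using S(2) by (auto simp: top_unique)
  then have "AE \<omega> in M. S \<omega> \<noteq> \<infinity>" by (rule nn_integral_noteq_infinite[OF S(1)])
  then show ?thesis using AE_space by eventually_elim (use S(3) in \<open>auto simp: top.not_eq_extremum\<close>)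
qed

text \<open>Rescaling by the positive integers moves every time into the unit interval at the cost
  of countably many null sets.\<close>

lemma AE_conv:
  assumes X: "bm M X"
  shows "AE \<omega> in M. \<forall>t\<ge>0. conv X t \<omega>"
proof -
  have "AE \<omega> in M. \<forall>n::nat. \<forall>t. 0 \<le> t \<longrightarrow> t \<le> 1 \<longrightarrow> conv (resc X 0 (real (Suc n))) t \<omega>"
    unfolding AE_all_countable by (intro allI AE_conv_unit bm_resc[OF X]) auto
  then show ?thesis using AE_space
  proof eventually_elim
    case (elim \<omega>)
    show ?case
    proof (intro allI impI)
      fix t :: real assume t: "0 \<le> t"
      define n where "n = nat \<lceil>t\<rceil>"
      have n: "t \<le> real (Suc n)" using t unfolding n_def by linarith
      have "conv (resc X 0 (real (Suc n))) (t / real (Suc n)) \<omega>" using elim(1) t n by auto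
      then have "conv X (real (Suc n) * (t / real (Suc n))) \<omega>"
        using conv_rescale[OF X elim(2), of "real (Suc n)" "t / real (Suc n)"] t by simp
      then show "conv X t \<omega>" by simp
    qed
  qed
qed

text \<open>Only the difference of the interaction and its mean is shown to converge; one-sided
  bounds on the two parts are drawn before the limit is taken.\<close>

lemma conv_block:
  assumes X: "bm M X" and w: "\<omega> \<in> space M" and a: "0 \<le> a" and h: "0 < h" and u: "0 \<le> u"
    and c: "conv X a \<omega>" "conv X (a + h * u) \<omega>" "conv (resc X a h) u \<omega>"
  shows "((\<lambda>\<epsilon>. rect (phe \<epsilon>) a (a + h * u) (\<lambda>s. X s \<omega>) - cross \<epsilon> a (h * u)) \<longlongrightarrow>
     isl X (a + h * u) \<omega> - isl X a \<omega> - h * isl (resc X a h) u \<omega>) (at_right 0)"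
proof -
  have "((\<lambda>\<epsilon>. gam (resc X a h) (\<epsilon> / sqrt h) u \<omega>) \<longlongrightarrow> isl (resc X a h) u \<omega>) (at_right 0)"
    by (rule filterlim_compose[OF c(3)[unfolded conv_def] filterlim_divide_at_right]) (use h in simp)
  then have "((\<lambda>\<epsilon>. gam X \<epsilon> (a + h * u) \<omega> - gam X \<epsilon> a \<omega> - h * gam (resc X a h) (\<epsilon> / sqrt h) u \<omega>) \<longlongrightarrow>
     isl X (a + h * u) \<omega> - isl X a \<omega> - h * isl (resc X a h) u \<omega>) (at_right 0)"
    using c(1,2) unfolding conv_def by (intro tendsto_intros)
  moreover have "\<forall>\<^sub>F \<epsilon> in at_right 0. gam X \<epsilon> (a + h * u) \<omega> - gam X \<epsilon> a \<omega> - h * gam (resc X a h) (\<epsilon> / sqrt h) u \<omega>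
     = rect (phe \<epsilon>) a (a + h * u) (\<lambda>s. X s \<omega>) - cross \<epsilon> a (h * u)"
    using eventually_at_right_less[of "0::real"]
    by eventually_elim (simp add: gam_split[OF X w a h u])
  ultimately show ?thesis by (rule Lim_transform_eventually)
qed

text \<open>Discards the nonnegative interaction and keeps the bound on its mean, which is uniform
  in \<open>\<epsilon>\<close> and so survives the limit.\<close>

lemma isl_ge_blocks:
  assumes X: "bm M X" and w: "\<omega> \<in> space M" and a: "0 < a" and h: "0 < h" and u: "0 < u"
    and c: "conv X a \<omega>" "conv X (a + h * u) \<omega>" "conv (resc X a h) u \<omega>" and k: "k = min a (h * u)"
  shows "isl X a \<omega> + h * isl (resc X a h) u \<omega> - k * (1 + ln ((a + h * u) / k)) / (2 * pi) \<le> isl X (a + h * u) \<omega>"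
proof -
  have "- (k * (1 + ln ((a + h * u) / k)) / (2 * pi)) \<le> isl X (a + h * u) \<omega> - isl X a \<omega> - h * isl (resc X a h) u \<omega>"
  proof (rule tendsto_lowerbound[OF conv_block[OF X w _ h _ c]])
    show "\<forall>\<^sub>F \<epsilon> in at_right 0. - (k * (1 + ln ((a + h * u) / k)) / (2 * pi)) \<le> rect (phe \<epsilon>) a (a + h * u) (\<lambda>s. X s \<omega>) - cross \<epsilon> a (h * u)"
      using eventually_at_right_less[of "0::real"]
    proof eventually_elim
      case (elim \<epsilon>)
      have hu: "0 < h * u" using h u by simp
      show ?case using rect_phe_nonneg[of a "a + h * u" \<epsilon> "\<lambda>s. X s \<omega>"] cross_le[OF elim a hu k] by linarith
    qed
  qed (use a u in auto)
  then show ?thesis by simp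
qed

text \<open>If the limit lies strictly below the level, so do all sufficiently fine dyadic scales.
  The events that this happens from scale \<open>N\<close> on increase with \<open>N\<close>, hence
  their union inherits the uniform tail bound; measurability of \<open>isl\<close> never has to be
  discussed.\<close>

lemma isl_tail:
  assumes X: "bm M X" and n: "0 < n"
  obtains A where "A \<in> sets M" "emeasure M A \<le> ennreal (exp (- real n))"
    "\<And>\<omega>. \<omega> \<in> space M \<Longrightarrow> conv X 1 \<omega> \<Longrightarrow> \<omega> \<notin> A \<Longrightarrow> - (ln (real n) / (2 * pi) + kconst) \<le> isl X 1 \<omega>"
proof -
  interpret prob_space M by (rule bm_prob_space[OF X])
  define c where "c = ln (real n) / (2 * pi) + kconst"
  define B where "B m = {\<omega>\<in>space M. c \<le> - gam X (1 / 2 ^ m) 1 \<omega>}" for m :: nat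
  have [measurable]: "gam X (1 / 2 ^ m) 1 \<in> borel_measurable M" for m by (rule gam_measurable[OF X]) simp
  have [measurable]: "B m \<in> sets M" for m unfolding B_def by measurable
  have PB: "emeasure M (B m) \<le> ennreal (exp (- real n))" for m
    unfolding B_def c_def by (rule gam_tail[OF X _ n]) simp
  define L where "L N = (\<Inter>m\<in>{N..}. B m)" for N
  have L[measurable]: "L N \<in> sets M" for N unfolding L_def by measurable
  have "incseq L" unfolding L_def incseq_def by auto
  then have "emeasure M (\<Union>N. L N) = (SUP N. emeasure M (L N))"
    by (intro SUP_emeasure_incseq[symmetric]) auto
  also have "\<dots> \<le> ennreal (exp (- real n))"
  proof (rule SUP_least)
    fix N
    have "emeasure M (L N) \<le> emeasure M (B N)" by (rule emeasure_mono) (auto simp: L_def)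
    then show "emeasure M (L N) \<le> ennreal (exp (- real n))" using PB[of N] by (rule order_trans)
  qed
  finally have P: "emeasure M (\<Union>N. L N) \<le> ennreal (exp (- real n))" .
  have main: "- c \<le> isl X 1 \<omega>" if w: "\<omega> \<in> space M" and cv: "conv X 1 \<omega>" and nA: "\<omega> \<notin> (\<Union>N. L N)" for \<omega>
  proof (rule ccontr)
    assume "\<not> - c \<le> isl X 1 \<omega>"
    then have lt: "isl X 1 \<omega> < - c" by simp
    have "\<forall>\<^sub>F \<epsilon> in at_right 0. gam X \<epsilon> 1 \<omega> < - c" using cv lt unfolding conv_def by (rule order_tendstoD)
    moreover have "filterlim (\<lambda>m::nat. 1 / 2 ^ m :: real) (at_right 0) sequentially"
    proof (rule filterlim_at_withinI)
      show "(\<lambda>m::nat. 1 / 2 ^ m :: real) \<longlonglongrightarrow> 0" by (rule LIMSEQ_divide_realpow_zero) simp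
      show "\<forall>\<^sub>F m::nat in sequentially. (1 / 2 ^ m :: real) \<in> {0<..} - {0}" by (intro always_eventually allI) simp
    qed
    ultimately have "\<forall>\<^sub>F m in sequentially. gam X (1 / 2 ^ m) 1 \<omega> < - c" by (auto simp: filterlim_iff)
    then obtain N where "\<And>m. N \<le> m \<Longrightarrow> gam X (1 / 2 ^ m) 1 \<omega> < - c" by (auto simp: eventually_sequentially)
    then have "\<omega> \<in> L N" using w by (force simp: L_def B_def)
    then show False using nA by blast
  qed
  show thesis
    by (rule that[of "\<Union>N. L N"]) (measurable, rule P, rule main[unfolded c_def])
qed

end

section \<open>Lower bound on the lower tail by tilting\<close>

lemma gauss2_tilt:
  assumes "r > 0"
  shows "gauss2 r x * exp (\<mu> * fst x - \<mu>\<^sup>2 * r / 2) = gauss2 r (x - (\<mu> * r, 0))"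
proof -
  have "- ((fst x)\<^sup>2 + (snd x)\<^sup>2) / (2 * r) + (\<mu> * fst x - \<mu>\<^sup>2 * r / 2) = - ((fst x - \<mu> * r)\<^sup>2 + (snd x)\<^sup>2) / (2 * r)"
    using assms by (simp add: field_simps power2_eq_square)
  then show ?thesis by (simp add: gauss2_def exp_add[symmetric])
qed

text \<open>The Girsanov density at time \<open>r\<close> for a drift \<open>\<mu>\<close> in the
  first coordinate.\<close>

definition tilt :: "real \<Rightarrow> real \<Rightarrow> R2 \<Rightarrow> real" where
  "tilt \<mu> r x = exp (\<mu> * fst x - \<mu>\<^sup>2 * r / 2)"

lemma tilt_measurable[measurable (raw)]:
  assumes [measurable]: "f \<in> borel_measurable N"
  shows "(\<lambda>w. tilt \<mu> r (f w)) \<in> borel_measurable N"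
  unfolding tilt_def by measurable

lemma nn_integral_tilt:
  assumes r: "r > 0" and [measurable]: "f \<in> borel_measurable borel"
  shows "(\<integral>\<^sup>+x. ennreal (tilt \<mu> r x) * f x \<partial>gaussm r) = (\<integral>\<^sup>+x. ennreal (gauss2 r (x - (\<mu> * r, 0))) * f x \<partial>lborel)"
proof -
  have "(\<integral>\<^sup>+x. ennreal (tilt \<mu> r x) * f x \<partial>gaussm r) = (\<integral>\<^sup>+x. ennreal (gauss2 r x) * (ennreal (tilt \<mu> r x) * f x) \<partial>lborel)"
    by (rule nn_integral_gaussm) measurable
  also have "\<dots> = (\<integral>\<^sup>+x. ennreal (gauss2 r (x - (\<mu> * r, 0))) * f x \<partial>lborel)"
    using gauss2_tilt[OF r, of _ \<mu>]
    by (intro nn_integral_cong) (simp add: tilt_def gauss2_nonneg[OF r] ennreal_mult[symmetric] mult.assoc[symmetric])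
  finally show ?thesis .
qed

lemma nn_integral_tilt_1:
  assumes r: "r > 0"
  shows "(\<integral>\<^sup>+x. ennreal (tilt \<mu> r x) \<partial>gaussm r) = 1"
proof -
  have "(\<integral>\<^sup>+x. ennreal (tilt \<mu> r x) \<partial>gaussm r) = (\<integral>\<^sup>+x. ennreal (tilt \<mu> r x) * 1 \<partial>gaussm r)" by simp
  also have "\<dots> = (\<integral>\<^sup>+x. ennreal (gauss2 r (x + (- (\<mu> * r), 0))) \<partial>lborel)"
    by (subst nn_integral_tilt[OF r]) (auto simp: diff_conv_add_uminus simp del: add_uminus_conv_diff)
  also have "\<dots> = 1" by (subst lborel_nn_integral_shift) (auto simp: nn_integral_gauss2 r)
  finally show ?thesis .
qed

text \<open>The density at time \<open>1\<close> factors over the three increments. The factors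
  outside the chord integrate to one, and the factor over the chord shifts its Gaussian law by
  \<open>\<mu> * (s - u)\<close>.\<close>

lemma bm_tilt_chord:
  assumes X: "bm M X" and s: "0 < u" "u < s" "s < 1" and f[measurable]: "f \<in> borel_measurable borel"
  shows "(\<integral>\<^sup>+\<omega>. ennreal (tilt \<mu> 1 (X 1 \<omega>)) * f (X s \<omega> - X u \<omega>) \<partial>M)
    = (\<integral>\<^sup>+x. ennreal (gauss2 (s - u) (x - (\<mu> * (s - u), 0))) * f x \<partial>lborel)"
proof -
  interpret prob_space M by (rule bm_prob_space[OF X])
  note [measurable] = bm_measurable[OF X]
  define a b c where "a = u" and "b = 1 - s" and "c = s - u"
  have pos: "a > 0" "b > 0" "c > 0" using s by (auto simp: a_def b_def c_def)
  interpret A: prob_space "gaussm a" by (rule prob_space_gaussm[OF pos(1)])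
  interpret B: prob_space "gaussm b" by (rule prob_space_gaussm[OF pos(2)])
  interpret C: prob_space "gaussm c" by (rule prob_space_gaussm[OF pos(3)])
  interpret AB: pair_prob_space "gaussm a" "gaussm b" ..
  interpret CAB: pair_prob_space "gaussm c" "gaussm a \<Otimes>\<^sub>M gaussm b" ..
  define t where "t = (\<lambda>n::nat. [0, u, s, 1] ! n)"
  have ts: "t 0 = 0" "t (Suc 0) = u" "t 1 = u" "t 2 = s" "t (Suc (Suc 0)) = s" "t (Suc 1) = s" "t 3 = 1" "t (Suc 2) = 1"
    by (auto simp: t_def)
  define D where "D = (\<lambda>i \<omega>. X (t (Suc i)) \<omega> - X (t i) \<omega>)"
  have distr: "distr M (borel \<Otimes>\<^sub>M (borel \<Otimes>\<^sub>M borel)) (\<lambda>\<omega>. (D 1 \<omega>, (D 0 \<omega>, D 2 \<omega>)))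
     = gaussm c \<Otimes>\<^sub>M (gaussm a \<Otimes>\<^sub>M gaussm b)"
    using bm_increments3[OF X, of t 1 0 2] s
    by (simp add: D_def ts a_def b_def c_def)
  define F where "F = (\<lambda>(z, (x, y)). (ennreal (tilt \<mu> c z) * f z) * (ennreal (tilt \<mu> a x) * ennreal (tilt \<mu> b y)))"
  have [measurable]: "F \<in> borel_measurable (borel \<Otimes>\<^sub>M (borel \<Otimes>\<^sub>M borel))"
    unfolding F_def by measurable
  have "(\<integral>\<^sup>+\<omega>. ennreal (tilt \<mu> 1 (X 1 \<omega>)) * f (X s \<omega> - X u \<omega>) \<partial>M) = (\<integral>\<^sup>+\<omega>. F (D 1 \<omega>, (D 0 \<omega>, D 2 \<omega>)) \<partial>M)"
  proof (rule nn_integral_cong)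
    fix \<omega> assume w: "\<omega> \<in> space M"
    have "tilt \<mu> 1 (X 1 \<omega>) = tilt \<mu> c (D 1 \<omega>) * (tilt \<mu> a (D 0 \<omega>) * tilt \<mu> b (D 2 \<omega>))"
      using bm_zero[OF X w, of 0] unfolding tilt_def exp_add[symmetric]
      by (simp add: D_def ts a_def b_def c_def algebra_simps diff_divide_distrib add_divide_distrib)
    then show "ennreal (tilt \<mu> 1 (X 1 \<omega>)) * f (X s \<omega> - X u \<omega>) = F (D 1 \<omega>, (D 0 \<omega>, D 2 \<omega>))"
      by (simp add: F_def ennreal_mult tilt_def mult_ac) (simp add: D_def ts)
  qed
  also have "\<dots> = (\<integral>\<^sup>+p. F p \<partial>distr M (borel \<Otimes>\<^sub>M (borel \<Otimes>\<^sub>M borel)) (\<lambda>\<omega>. (D 1 \<omega>, (D 0 \<omega>, D 2 \<omega>))))"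
    by (rule nn_integral_distr[symmetric]) (auto simp: D_def)
  also have "\<dots> = (\<integral>\<^sup>+p. F p \<partial>(gaussm c \<Otimes>\<^sub>M (gaussm a \<Otimes>\<^sub>M gaussm b)))"
    by (simp only: distr)
  also have "\<dots> = (\<integral>\<^sup>+z. \<integral>\<^sup>+q. F (z, q) \<partial>(gaussm a \<Otimes>\<^sub>M gaussm b) \<partial>gaussm c)"
    by (rule AB.P.nn_integral_fst[symmetric]) measurable
  also have "\<dots> = (\<integral>\<^sup>+z. ennreal (tilt \<mu> c z) * f z \<partial>gaussm c)"
  proof (rule nn_integral_cong)
    fix z
    have "(\<integral>\<^sup>+q. F (z, q) \<partial>(gaussm a \<Otimes>\<^sub>M gaussm b)) = (\<integral>\<^sup>+x. \<integral>\<^sup>+y. F (z, (x, y)) \<partial>gaussm b \<partial>gaussm a)"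
      by (rule B.nn_integral_fst[symmetric]) measurable
    also have "\<dots> = ennreal (tilt \<mu> c z) * f z"
      by (simp add: F_def nn_integral_cmult nn_integral_tilt_1 pos)
    finally show "(\<integral>\<^sup>+q. F (z, q) \<partial>(gaussm a \<Otimes>\<^sub>M gaussm b)) = ennreal (tilt \<mu> c z) * f z" .
  qed
  also have "\<dots> = (\<integral>\<^sup>+x. ennreal (gauss2 c (x - (\<mu> * c, 0))) * f x \<partial>lborel)"
    by (rule nn_integral_tilt[OF pos(3)]) measurable
  finally show ?thesis by (simp add: c_def)
qed

lemma bm_tilt_mean:
  assumes X: "bm M X"
  shows "(\<integral>\<^sup>+\<omega>. ennreal (tilt \<mu> 1 (X 1 \<omega>)) \<partial>M) = 1"
proof -
  note [measurable] = bm_measurable[OF X]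
  have "(\<integral>\<^sup>+\<omega>. ennreal (tilt \<mu> 1 (X 1 \<omega>)) \<partial>M) = (\<integral>\<^sup>+\<omega>. ennreal (tilt \<mu> 1 (X 1 \<omega> - X 0 \<omega>)) \<partial>M)"
    by (intro nn_integral_cong) (simp add: bm_zero[OF X])
  also have "\<dots> = (\<integral>\<^sup>+x. ennreal (tilt \<mu> 1 x) \<partial>distr M borel (\<lambda>\<omega>. X 1 \<omega> - X 0 \<omega>))"
    by (rule nn_integral_distr[symmetric]) auto
  also have "\<dots> = 1"
    using bm_increment_distr[OF X, of 0 1] nn_integral_tilt_1[of 1] by simp
  finally show ?thesis .
qed

text \<open>The constant is \<open>6 = (16 - 4) / 2\<close>; the remaining factor is again a density
  of mean one.\<close>

lemma tilt_power4: "(tilt \<mu> 1 x) ^ 4 = exp (6 * \<mu>\<^sup>2) * tilt (4 * \<mu>) 1 x"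
proof -
  have "(tilt \<mu> 1 x) ^ 4 = exp (4 * (\<mu> * fst x - \<mu>\<^sup>2 * 1 / 2))"
    unfolding tilt_def exp_of_nat_mult[symmetric] by simp
  also have "4 * (\<mu> * fst x - \<mu>\<^sup>2 * 1 / 2) = 6 * \<mu>\<^sup>2 + (4 * \<mu> * fst x - (4 * \<mu>)\<^sup>2 * 1 / 2)"
    by (simp add: power_mult_distrib)
  finally show ?thesis by (simp only: exp_add tilt_def)
qed

lemma AE_R2_coordinates: "AE p in (lborel :: R2 measure). fst p \<noteq> c \<and> snd p \<noteq> d"
proof -
  have "{c} \<times> UNIV \<in> null_sets (lborel :: R2 measure)" "UNIV \<times> {d} \<in> null_sets (lborel :: R2 measure)"
    unfolding lborel_prod[symmetric] null_sets_def by (auto simp: lborel.emeasure_pair_measure_Times)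
  then have "({c} \<times> UNIV) \<union> (UNIV \<times> {d}) \<in> null_sets (lborel :: R2 measure)" by (rule null_sets.Un)
  then show ?thesis by (rule AE_I') auto
qed

context mollifier
begin

section \<open>Effect of the drift on the mean\<close>

definition tker :: "real \<Rightarrow> real \<Rightarrow> real \<Rightarrow> real" where
  "tker \<mu> \<epsilon> r = (\<integral>x. phe \<epsilon> x * gauss2 r (x - (\<mu> * r, 0)) \<partial>lborel)"

lemma tker_measurable[measurable]: "tker \<mu> \<epsilon> \<in> borel_measurable borel"
  unfolding tker_def
proof (rule lborel.borel_measurable_lebesgue_integral)
  have [measurable]: "(\<lambda>w :: real \<times> R2. (\<mu> * fst w, 0 :: real)) \<in> borel_measurable (borel \<Otimes>\<^sub>M lborel)"
    by (simp add: borel_prod[symmetric])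
  show "(\<lambda>(r, x). phe \<epsilon> x * gauss2 r (x - (\<mu> * r, 0))) \<in> borel_measurable (borel \<Otimes>\<^sub>M lborel)"
    unfolding case_prod_beta by measurable
qed

lemma tker_integrable:
  assumes e: "0 < \<epsilon>" and r: "0 < r"
  shows "integrable lborel (\<lambda>x. phe \<epsilon> x * gauss2 r (x - w))"
proof (rule Bochner_Integration.integrable_bound)
  show "integrable lborel (\<lambda>x. phe \<epsilon> x * (1 / (2 * pi * r)))" using phe_integrable[OF e] by simp
  show "AE x in lborel. norm (phe \<epsilon> x * gauss2 r (x - w)) \<le> norm (phe \<epsilon> x * (1 / (2 * pi * r)))"
    using abs_mult_gauss2_le[OF r] r by (intro AE_I2) (simp add: abs_mult)
qed measurable

lemma tker_nonneg: "0 < r \<Longrightarrow> 0 \<le> tker \<mu> \<epsilon> r"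
  unfolding tker_def by (intro integral_nonneg_AE AE_I2 mult_nonneg_nonneg phe_nonneg gauss2_nonneg)

text \<open>Measured in units of \<open>sqrt r\<close> the shift is \<open>\<mu> * sqrt r\<close>,
  so the Lipschitz bound leaves only \<open>r powr (- (1/2))\<close>. This is integrable at zero and
  uniform in \<open>\<epsilon>\<close>, and it dominates the passage to the limit in
  \<open>tdef_limit\<close>.\<close>

lemma tker_pker:
  assumes e: "0 < \<epsilon>" and r: "0 < r" and mu: "0 \<le> \<mu>"
  shows "\<bar>tker \<mu> \<epsilon> r - pker \<epsilon> r\<bar> \<le> 2 * \<mu> * r powr (- (1/2))"
proof -
  define w where "w = (\<mu> * r, 0 :: real)"
  have nw: "norm w = \<mu> * r" using mu r by (simp add: w_def norm_Pair)
  have "tker \<mu> \<epsilon> r - pker \<epsilon> r = (\<integral>x. phe \<epsilon> x * (gauss2 r (x - w) - gauss2 r x) \<partial>lborel)"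
    unfolding tker_def pker_def w_def using tker_integrable[OF e r, of "(\<mu> * r, 0)"] tker_integrable[OF e r, of 0]
    by (simp add: right_diff_distrib)
  also have "\<bar>\<dots>\<bar> \<le> (\<integral>x. phe \<epsilon> x * (2 * \<mu> * r powr (- (1/2))) \<partial>lborel)"
  proof (rule order_trans[OF integral_abs_bound], rule integral_mono)
    show "integrable lborel (\<lambda>x. \<bar>phe \<epsilon> x * (gauss2 r (x - w) - gauss2 r x)\<bar>)"
      using tker_integrable[OF e r, of w] tker_integrable[OF e r, of 0] by (simp add: right_diff_distrib)
    show "integrable lborel (\<lambda>x. phe \<epsilon> x * (2 * \<mu> * r powr (- (1/2))))"
      using phe_integrable[OF e] by simp
    fix x
    have "\<bar>gauss2 r (x - w) - gauss2 r x\<bar> = \<bar>gauss2 r (w - x) - gauss2 r x\<bar>"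
      by (subst gauss2_minus_commute) simp
    also have "\<dots> \<le> norm w / sqrt r * gbump r w x" by (rule gauss2_lipschitz[OF r])
    also have "\<dots> \<le> norm w / sqrt r * (10 / (2 * pi * r))"
      using r by (intro mult_left_mono gbump_le) auto
    also have "\<dots> = \<mu> * (10 / (2 * pi)) * (1 / sqrt r)"
      using r by (simp add: nw field_simps)
    also have "\<dots> \<le> \<mu> * 2 * (1 / sqrt r)"
      using pi_gt3 mu r by (intro mult_right_mono mult_left_mono) (auto simp: divide_le_eq)
    also have "1 / sqrt r = r powr (- (1/2))"
      unfolding powr_minus powr_half_sqrt[OF less_imp_le[OF r]] by (rule inverse_eq_divide[symmetric])
    finally have "\<bar>gauss2 r (x - w) - gauss2 r x\<bar> \<le> 2 * \<mu> * r powr (- (1/2))" by (simp add: mult.commute)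
    then show "\<bar>phe \<epsilon> x * (gauss2 r (x - w) - gauss2 r x)\<bar> \<le> phe \<epsilon> x * (2 * \<mu> * r powr (- (1/2)))"
      using phe_nonneg[of \<epsilon> x] by (simp add: abs_mult mult_left_mono)
  qed
  also have "\<dots> = 2 * \<mu> * r powr (- (1/2))" using phe_integral[OF e] by simp
  finally show ?thesis .
qed

lemma integrable_inv_sqrt: "integrable lborel (\<lambda>r::real. indicator {0<..1} r * (c * r powr (- (1/2))))"
proof -
  have "integrable lborel (\<lambda>r::real. indicator {0<..1} r * r powr (- (1/2)))"
  proof (rule integrableI_nonneg)
    have "(\<integral>\<^sup>+r. ennreal (indicator {0<..1} (r::real) * r powr (- (1/2))) \<partial>lborel)
      = (\<integral>\<^sup>+r. indicator {0<..1} r * ennreal (r powr (- (1/2))) \<partial>lborel)"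
      by (intro nn_integral_cong) (auto simp: indicator_def)
    also have "\<dots> < \<infinity>" using nn_integral_powr_0[of "1/2" 1] by simp
    finally show "(\<integral>\<^sup>+r. ennreal (indicator {0<..1} (r::real) * r powr (- (1/2))) \<partial>lborel) < \<infinity>" .
  qed auto
  then have "integrable lborel (\<lambda>r. c * (indicator {0<..1} r * r powr (- (1/2))))" by (rule integrable_mult_right)
  then show ?thesis by (simp add: mult.left_commute)
qed

text \<open>By \<open>gam_tilted\<close>, the mean of the renormalised local time under the tilted
  measure.\<close>

definition tdef :: "real \<Rightarrow> real \<Rightarrow> real" where
  "tdef \<mu> \<epsilon> = (\<integral>r. indicator {0<..1} r * ((1 - r) * (tker \<mu> \<epsilon> r - pker \<epsilon> r)) \<partial>lborel)"

lemma tdef_integrable: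
  assumes e: "0 < \<epsilon>" and mu: "0 \<le> \<mu>"
  shows "\<bar>indicator {0<..1} r * ((1 - r) * (tker \<mu> \<epsilon> r - pker \<epsilon> r))\<bar> \<le> indicator {0<..1} r * (2 * \<mu> * r powr (- (1/2)))"
    "integrable lborel (\<lambda>r. indicator {0<..1} r * ((1 - r) * (tker \<mu> \<epsilon> r - pker \<epsilon> r)))"
proof -
  show *: "\<bar>indicator {0<..1} r * ((1 - r) * (tker \<mu> \<epsilon> r - pker \<epsilon> r))\<bar> \<le> indicator {0<..1} r * (2 * \<mu> * r powr (- (1/2)))" for r
  proof (cases "0 < r \<and> r \<le> 1")
    case True
    have "\<bar>(1 - r) * (tker \<mu> \<epsilon> r - pker \<epsilon> r)\<bar> \<le> 1 * (2 * \<mu> * r powr (- (1/2)))"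
      unfolding abs_mult using True tker_pker[OF e _ mu, of r] by (intro mult_mono) auto
    then show ?thesis using True by simp
  qed simp
  show "integrable lborel (\<lambda>r. indicator {0<..1} r * ((1 - r) * (tker \<mu> \<epsilon> r - pker \<epsilon> r)))"
  proof (rule Bochner_Integration.integrable_bound[OF integrable_inv_sqrt[of "2 * \<mu>"]])
    show "AE r in lborel. norm (indicator {0<..1} r * ((1 - r) * (tker \<mu> \<epsilon> r - pker \<epsilon> r)))
       \<le> norm (indicator {0<..1} r * (2 * \<mu> * r powr (- (1/2))))"
      unfolding real_norm_def by (intro AE_I2 order_trans[OF * abs_ge_self])
  qed measurable
qed

lemma gam_tilted:
  assumes X: "bm M X" and e: "0 < \<epsilon>" and mu: "0 \<le> \<mu>"
  shows "integrable M (\<lambda>\<omega>. tilt \<mu> 1 (X 1 \<omega>) * gam X \<epsilon> 1 \<omega>)"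
    "(\<integral>\<omega>. tilt \<mu> 1 (X 1 \<omega>) * gam X \<epsilon> 1 \<omega> \<partial>M) = tdef \<mu> \<epsilon>"
proof -
  interpret prob_space M by (rule bm_prob_space[OF X])
  interpret P: pair_sigma_finite lborel M ..
  note bf = bcf_phe[OF e]
  note [measurable] = bm_measurable[OF X] dbl_measurable[OF X bf tset_measurable] bm_chord_measurable[OF X bf tset_measurable]
  define Z where "Z \<omega> = tilt \<mu> 1 (X 1 \<omega>)" for \<omega>
  have Z0: "0 \<le> Z \<omega>" for \<omega> by (simp add: Z_def tilt_def)
  have [measurable]: "Z \<in> borel_measurable M" unfolding Z_def by measurable
  have iZ: "integrable M Z" by (rule integrableI_nonneg) (use bm_tilt_mean[OF X, of \<mu>] Z0 in \<open>auto simp: Z_def\<close>)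
  have EZ: "(\<integral>\<omega>. Z \<omega> \<partial>M) = 1"
    using bm_tilt_mean[OF X, of \<mu>] Z0 by (subst integral_eq_nn_integral) (auto simp: Z_def)
  let ?T = "\<lambda>\<omega>. tri (phe \<epsilon>) 1 (\<lambda>s. X s \<omega>)"
  have T0: "0 \<le> ?T \<omega>" for \<omega> by (rule dbl_mono_nonneg[OF phe_nonneg])
  have iZT: "integrable M (\<lambda>\<omega>. Z \<omega> * ?T \<omega>)"
  proof (rule Bochner_Integration.integrable_bound)
    show "integrable M (\<lambda>\<omega>. Z \<omega> * (dconst / \<epsilon>\<^sup>2))" using iZ by simp
    show "AE \<omega> in M. norm (Z \<omega> * ?T \<omega>) \<le> norm (Z \<omega> * (dconst / \<epsilon>\<^sup>2))"
    proof (rule AE_I2)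
      fix \<omega> assume w: "\<omega> \<in> space M"
      have "\<bar>?T \<omega>\<bar> \<le> (dconst / \<epsilon>\<^sup>2) * 1\<^sup>2"
        using dconst(1) by (intro tri_bound[OF _ phe_bound[OF e] bf bm_path_measurable[OF X w]]) auto
      then have "\<bar>?T \<omega>\<bar> \<le> \<bar>dconst / \<epsilon>\<^sup>2\<bar>"
        unfolding power_one mult_1_right by (rule order_trans[OF _ abs_ge_self])
      then show "norm (Z \<omega> * ?T \<omega>) \<le> norm (Z \<omega> * (dconst / \<epsilon>\<^sup>2))"
        unfolding real_norm_def abs_mult by (rule mult_left_mono) simp
    qed
  qed measurable
  have "(\<integral>\<^sup>+\<omega>. ennreal (Z \<omega> * ?T \<omega>) \<partial>M)
    = (\<integral>\<^sup>+\<omega>. \<integral>\<^sup>+p. ennreal (Z \<omega>) * ennreal (indicator (tset 1) p * phe \<epsilon> (X (fst p) \<omega> - X (snd p) \<omega>)) \<partial>lborel \<partial>M)"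
  proof (rule nn_integral_cong)
    fix \<omega> assume w: "\<omega> \<in> space M"
    note i = dbl_integrable[OF bf bm_path_measurable[OF X w] tset_measurable emeasure_tset_finite, of 1]
    have "ennreal (?T \<omega>) = (\<integral>\<^sup>+p. ennreal (indicator (tset 1) p * phe \<epsilon> (X (fst p) \<omega> - X (snd p) \<omega>)) \<partial>lborel)"
      unfolding dbl_def by (rule nn_integral_eq_integral[symmetric, OF i]) (auto simp: phe_nonneg)
    then show "ennreal (Z \<omega> * ?T \<omega>) = (\<integral>\<^sup>+p. ennreal (Z \<omega>) * ennreal (indicator (tset 1) p * phe \<epsilon> (X (fst p) \<omega> - X (snd p) \<omega>)) \<partial>lborel)"
      using i by (subst nn_integral_cmult) (auto simp: ennreal_mult Z0 T0)
  qed
  also have "\<dots> = (\<integral>\<^sup>+p. \<integral>\<^sup>+\<omega>. ennreal (Z \<omega>) * ennreal (indicator (tset 1) p * phe \<epsilon> (X (fst p) \<omega> - X (snd p) \<omega>)) \<partial>M \<partial>lborel)"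
  proof (rule P.Fubini')
    have "(\<lambda>q. ennreal (Z (snd q)) * ennreal (case q of (p, \<omega>) \<Rightarrow> indicator (tset 1) p * phe \<epsilon> (X (fst p) \<omega> - X (snd p) \<omega>))) \<in> borel_measurable (lborel \<Otimes>\<^sub>M M)"
      by measurable
    then show "(\<lambda>(p, \<omega>). ennreal (Z \<omega>) * ennreal (indicator (tset 1) p * phe \<epsilon> (X (fst p) \<omega> - X (snd p) \<omega>))) \<in> borel_measurable (lborel \<Otimes>\<^sub>M M)"
      by (simp add: case_prod_beta)
  qed
  also have "\<dots> = (\<integral>\<^sup>+p. indicator (tset 1) p * (\<lambda>r. ennreal (indicator {0<..} r * tker \<mu> \<epsilon> r)) (fst p - snd p) \<partial>lborel)"
  proof (rule nn_integral_cong_AE)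
    show "AE p in lborel. (\<integral>\<^sup>+\<omega>. ennreal (Z \<omega>) * ennreal (indicator (tset 1) p * phe \<epsilon> (X (fst p) \<omega> - X (snd p) \<omega>)) \<partial>M)
      = indicator (tset 1) p * (\<lambda>r. ennreal (indicator {0<..} r * tker \<mu> \<epsilon> r)) (fst p - snd p)"
      \<comment> \<open>Off the diagonal and the sides \<open>fst p = 1\<close> and
        \<open>snd p = 0\<close> all three increments have positive length, as
        \<open>bm_tilt_chord\<close> requires.\<close>
      using AE_off_diagonal AE_R2_coordinates[of 1 0]
    proof eventually_elim
      case (elim p)
      show ?case
      proof (cases "p \<in> tset 1")
        case True
        then have s: "0 < snd p" "snd p < fst p" "fst p < 1" using elim by (auto simp: tset_def less_le)
        have r: "0 < fst p - snd p" using s by simp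
        have "(\<integral>\<^sup>+\<omega>. ennreal (Z \<omega>) * ennreal (phe \<epsilon> (X (fst p) \<omega> - X (snd p) \<omega>)) \<partial>M)
          = (\<integral>\<^sup>+x. ennreal (gauss2 (fst p - snd p) (x - (\<mu> * (fst p - snd p), 0))) * ennreal (phe \<epsilon> x) \<partial>lborel)"
          unfolding Z_def by (rule bm_tilt_chord[OF X s, of "\<lambda>x. ennreal (phe \<epsilon> x)"]) measurable
        also have "\<dots> = (\<integral>\<^sup>+x. ennreal (phe \<epsilon> x * gauss2 (fst p - snd p) (x - (\<mu> * (fst p - snd p), 0))) \<partial>lborel)"
          by (intro nn_integral_cong) (simp add: ennreal_mult phe_nonneg gauss2_nonneg[OF r] mult.commute)
        also have "\<dots> = ennreal (tker \<mu> \<epsilon> (fst p - snd p))"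
          unfolding tker_def by (rule nn_integral_eq_integral[OF tker_integrable[OF e r]]) (simp add: phe_nonneg gauss2_nonneg[OF r])
        finally show ?thesis using True r by simp
      qed simp
    qed
  qed
  also have "\<dots> = (\<integral>\<^sup>+r. indicator {0..1} r * ennreal (1 - r) * ennreal (indicator {0<..} r * tker \<mu> \<epsilon> r) \<partial>lborel)"
    by (rule nn_integral_triangle) measurable
  also have "\<dots> = (\<integral>\<^sup>+r. ennreal (indicator {0<..1} r * ((1 - r) * tker \<mu> \<epsilon> r)) \<partial>lborel)"
    by (intro nn_integral_cong) (auto simp: indicator_def ennreal_mult tker_nonneg)
  finally have E: "(\<integral>\<omega>. Z \<omega> * ?T \<omega> \<partial>M) = (\<integral>r. indicator {0<..1} r * ((1 - r) * tker \<mu> \<epsilon> r) \<partial>lborel)"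
    by (subst integral_eq_nn_integral, simp, simp add: Z0 T0, subst integral_eq_nn_integral) (auto simp: indicator_def tker_nonneg)
  have i1: "integrable lborel (\<lambda>r. indicator {0<..1} r * ((1 - r) * pker \<epsilon> r))"
    using mtri_integrable[OF e, of 1] by simp
  have i2: "integrable lborel (\<lambda>r. indicator {0<..1} r * ((1 - r) * tker \<mu> \<epsilon> r))"
    using Bochner_Integration.integrable_add[OF tdef_integrable(2)[OF e mu] i1] by (simp add: algebra_simps)
  have g: "tilt \<mu> 1 (X 1 \<omega>) * gam X \<epsilon> 1 \<omega> = Z \<omega> * ?T \<omega> - Z \<omega> * mtri \<epsilon> 1" for \<omega>
    by (simp add: gam_eq[OF X e] Z_def right_diff_distrib)
  show "integrable M (\<lambda>\<omega>. tilt \<mu> 1 (X 1 \<omega>) * gam X \<epsilon> 1 \<omega>)"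
    unfolding g using iZT iZ by simp
  have "(\<integral>\<omega>. tilt \<mu> 1 (X 1 \<omega>) * gam X \<epsilon> 1 \<omega> \<partial>M) = (\<integral>\<omega>. Z \<omega> * ?T \<omega> \<partial>M) - mtri \<epsilon> 1"
    unfolding g using iZT iZ EZ by simp
  also have "\<dots> = tdef \<mu> \<epsilon>"
    unfolding E mtri_def tdef_def right_diff_distrib using i1 i2 by simp
  finally show "(\<integral>\<omega>. tilt \<mu> 1 (X 1 \<omega>) * gam X \<epsilon> 1 \<omega> \<partial>M) = tdef \<mu> \<epsilon>" .
qed

text \<open>The mollifiers are an approximate identity; after rescaling, boundedness and continuity
  of the density allow dominated convergence.\<close>

lemma tker_limit:
  assumes r: "0 < r" and e: "\<And>i. 0 < \<epsilon> i" "\<epsilon> \<longlonglongrightarrow> 0"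
  shows "(\<lambda>i. \<integral>x. phe (\<epsilon> i) x * gauss2 r (x - w) \<partial>lborel) \<longlonglongrightarrow> gauss2 r w"
proof -
  have sc: "(\<integral>x. phe (\<epsilon> i) x * gauss2 r (x - w) \<partial>lborel) = (\<integral>y. \<phi> y * gauss2 r (\<epsilon> i *\<^sub>R y - w) \<partial>lborel)" for i
    using integral_scaled[of "\<lambda>y. \<phi> y * gauss2 r (\<epsilon> i *\<^sub>R y - w)" "\<epsilon> i"] e(1)[of i]
    by (simp add: phi_eps_def)
  have "(\<lambda>i. \<integral>y. \<phi> y * gauss2 r (\<epsilon> i *\<^sub>R y - w) \<partial>lborel) \<longlonglongrightarrow> (\<integral>y. \<phi> y * gauss2 r (0 *\<^sub>R y - w) \<partial>lborel)"
  proof (rule integral_dominated_convergence)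
    show "integrable lborel (\<lambda>y. \<phi> y * (1 / (2 * pi * r)))" using kern_phi by (simp add: kern_def)
    show "AE y in lborel. (\<lambda>i. \<phi> y * gauss2 r (\<epsilon> i *\<^sub>R y - w)) \<longlonglongrightarrow> \<phi> y * gauss2 r (0 *\<^sub>R y - w)"
    proof (rule AE_I2)
      fix y :: R2
      have "isCont (gauss2 r) z" for z
        using continuous_gauss2[OF continuous_on_id, of UNIV r] unfolding continuous_on_eq_continuous_at[OF open_UNIV] id_def by blast
      then show "(\<lambda>i. \<phi> y * gauss2 r (\<epsilon> i *\<^sub>R y - w)) \<longlonglongrightarrow> \<phi> y * gauss2 r (0 *\<^sub>R y - w)"
        by (intro tendsto_mult tendsto_const isCont_tendsto_compose[where g = "gauss2 r"] tendsto_diff tendsto_scaleR e)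
    qed
    show "AE y in lborel. norm (\<phi> y * gauss2 r (\<epsilon> i *\<^sub>R y - w)) \<le> \<phi> y * (1 / (2 * pi * r))" for i
      using abs_mult_gauss2_le[OF r] nonneg by (intro AE_I2) (metis abs_of_nonneg real_norm_def)
  qed measurable
  also have "(\<integral>y. \<phi> y * gauss2 r (0 *\<^sub>R y - w) \<partial>lborel) = gauss2 r w" using total by (simp add: gauss2_uminus)
  finally show ?thesis by (simp add: sc)
qed

text \<open>In the limit the integrand is
  \<open>(1 - r) * (exp (- n * r / 2) - 1) / (2 * pi * r)\<close>. It is nonpositive and close to
  \<open>- 1 / (2 * pi * r)\<close> for lags well above \<open>1 / n\<close> and well below
  \<open>1\<close>, which produces \<open>- ln n / (2 * pi)\<close>.\<close>

lemma tdef_limit: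
  assumes n: "0 < n" and e: "\<And>i. 0 < \<epsilon> i" "\<epsilon> \<longlonglongrightarrow> 0"
  shows "\<exists>L. (\<lambda>i. tdef (sqrt (real n)) (\<epsilon> i)) \<longlonglongrightarrow> L \<and> L \<le> - ln (real n) / (2 * pi) + 1"
proof -
  define \<mu> where "\<mu> = sqrt (real n)"
  have mu: "0 \<le> \<mu>" "\<mu>\<^sup>2 = real n" by (auto simp: \<mu>_def)
  define l where "l r = indicator {0<..1} r * ((1 - r) * (gauss2 r (\<mu> * r, 0) - gauss2 r 0))" for r
  have [measurable]: "l \<in> borel_measurable borel"
  proof -
    have [measurable]: "(\<lambda>r. (\<mu> * r, 0 :: real)) \<in> borel_measurable (borel :: real measure)"
      by (intro borel_measurable_continuous_onI continuous_intros)
    show ?thesis unfolding l_def by measurable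
  qed
  have lim: "(\<lambda>i. tdef \<mu> (\<epsilon> i)) \<longlonglongrightarrow> (\<integral>r. l r \<partial>lborel)" and il: "integrable lborel l"
  proof -
    have a: "AE r in lborel. (\<lambda>i. indicator {0<..1} r * ((1 - r) * (tker \<mu> (\<epsilon> i) r - pker (\<epsilon> i) r))) \<longlonglongrightarrow> l r"
    proof (rule AE_I2)
      fix r :: real
      show "(\<lambda>i. indicator {0<..1} r * ((1 - r) * (tker \<mu> (\<epsilon> i) r - pker (\<epsilon> i) r))) \<longlonglongrightarrow> l r"
      proof (cases "0 < r")
        case True
        have "(\<lambda>i. tker \<mu> (\<epsilon> i) r) \<longlonglongrightarrow> gauss2 r (\<mu> * r, 0)"
          unfolding tker_def by (rule tker_limit[OF True e])
        moreover have "(\<lambda>i. pker (\<epsilon> i) r) \<longlonglongrightarrow> gauss2 r 0"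
          unfolding pker_def using tker_limit[OF True e, of 0] by simp
        ultimately show ?thesis unfolding l_def by (intro tendsto_intros)
      qed (simp add: l_def)
    qed
    have b: "AE r in lborel. norm (indicator {0<..1} r * ((1 - r) * (tker \<mu> (\<epsilon> i) r - pker (\<epsilon> i) r))) \<le> indicator {0<..1} r * (2 * \<mu> * r powr (- (1/2)))" for i
      using tdef_integrable(1)[OF e(1) mu(1)] by (intro AE_I2) (simp only: real_norm_def)
    note dc = _ _ integrable_inv_sqrt[of "2 * \<mu>"] a b
    show "(\<lambda>i. tdef \<mu> (\<epsilon> i)) \<longlonglongrightarrow> (\<integral>r. l r \<partial>lborel)"
      unfolding tdef_def by (rule integral_dominated_convergence[OF dc]) measurable
    show "integrable lborel l"
      by (rule integrable_dominated_convergence[OF dc]) measurable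
  qed
  define k where "k = 1 / real n"
  have k: "0 < k" "k \<le> 1" "real n * k = 1" using n by (auto simp: k_def)
  \<comment> \<open>Lags below \<open>k = 1 / n\<close> will be dropped as nonpositive; above,
    \<open>exp (- n * r / 2) / r\<close> is replaced by \<open>n * exp (- n * r / 2)\<close>, which
    has an explicit primitive.\<close>
  have 1: "has_bochner_integral lborel (\<lambda>r. (- (1 / r) + 1 + real n * exp (- (real n * r / 2))) * indicator {k..1} r)
     ((\<lambda>r. - ln r + r - 2 * exp (- (real n * r / 2))) 1 - (\<lambda>r. - ln r + r - 2 * exp (- (real n * r / 2))) k)"
    by (rule has_bochner_integral_FTC_Icc_real[where F = "\<lambda>r. - ln r + r - 2 * exp (- (real n * r / 2))"])
      (use k in \<open>auto intro!: derivative_eq_intros continuous_intros simp: field_simps\<close>)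
  define V where "V = (\<lambda>r. - ln r + r - 2 * exp (- (real n * r / 2))) 1 - (\<lambda>r. - ln r + r - 2 * exp (- (real n * r / 2))) k"
  have V: "V \<le> - ln (real n) + 3"
  proof -
    have "ln k = - ln (real n)" using n by (simp add: k_def ln_div)
    moreover have "exp (- (real n * k / 2)) \<le> (1::real)" using k by simp
    moreover have "0 \<le> exp (- (real n * 1 / 2))" by simp
    ultimately show ?thesis using k(1) unfolding V_def ln_one by linarith
  qed
  have "(\<integral>r. l r \<partial>lborel) \<le> (\<integral>r. (1 / (2 * pi)) * ((- (1 / r) + 1 + real n * exp (- (real n * r / 2))) * indicator {k..1} r) \<partial>lborel)"
  proof (rule integral_mono[OF il])
    show "integrable lborel (\<lambda>r. (1 / (2 * pi)) * ((- (1 / r) + 1 + real n * exp (- (real n * r / 2))) * indicator {k..1} r))"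
      using 1 by (intro integrable_mult_right) (auto simp: has_bochner_integral_iff)
    fix r :: real
    show "l r \<le> (1 / (2 * pi)) * ((- (1 / r) + 1 + real n * exp (- (real n * r / 2))) * indicator {k..1} r)"
    proof (cases "0 < r \<and> r \<le> 1")
      case False
      then show ?thesis using k by (auto simp: l_def indicator_def)
    next
      case True
      define E where "E = exp (- (real n * r / 2))"
      have E: "0 < E" "E \<le> 1" using True by (auto simp: E_def)
      have "(\<mu> * r)\<^sup>2 / (2 * r) = real n * r / 2" using True mu by (simp add: power_mult_distrib power2_eq_square)
      then have "gauss2 r (\<mu> * r, 0) = E / (2 * pi * r)"
        unfolding gauss2_def E_def by (simp only: fst_conv snd_conv power_zero_numeral add_0_right minus_divide_left[symmetric])
      then have "gauss2 r (\<mu> * r, 0) - gauss2 r 0 = (1 / (2 * pi)) * ((E - 1) / r)"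
        by (simp add: gauss2_def diff_divide_distrib mult.commute)
      then have l: "l r = (1 / (2 * pi)) * ((1 - r) * ((E - 1) / r))" using True by (simp add: l_def)
      show ?thesis
      proof (cases "r < k")
        case r: True
        have "(1 - r) * ((E - 1) / r) \<le> 0" using True E by (intro mult_nonneg_nonpos divide_nonpos_pos) auto
        then have "(1 / (2 * pi)) * ((1 - r) * ((E - 1) / r)) \<le> 0" by (rule mult_nonneg_nonpos[rotated]) simp
        moreover have "indicator {k..1} r = (0::real)" using r by simp
        ultimately show ?thesis unfolding l by (simp only: mult_zero_right)
      next
        case False
        have "(1 - r) * ((E - 1) / r) = - (1 / r) + 1 + E / r - E" using True by (simp add: field_simps)
        also have "\<dots> \<le> - (1 / r) + 1 + real n * E"
        proof -
          have "1 / r \<le> real n" using False True k(1) n by (simp add: k_def field_simps)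
          then have "E * (1 / r) \<le> E * real n" using E by (intro mult_left_mono) auto
          then show ?thesis using E by (simp add: mult.commute)
        qed
        finally have "(1 / (2 * pi)) * ((1 - r) * ((E - 1) / r)) \<le> (1 / (2 * pi)) * (- (1 / r) + 1 + real n * E)"
          by (rule mult_left_mono) simp
        moreover have "indicator {k..1} r = (1::real)" using False True by simp
        ultimately show ?thesis unfolding l E_def[symmetric] by (simp only: mult_1_right)
      qed
    qed
  qed
  also have "\<dots> = (1 / (2 * pi)) * V" using 1 by (simp add: has_bochner_integral_iff V_def)
  also have "\<dots> \<le> (1 / (2 * pi)) * (- ln (real n) + 3)" using V by (intro mult_left_mono) auto
  also have "\<dots> \<le> - ln (real n) / (2 * pi) + 1"
  proof -
    have "3 / (2 * pi) \<le> 1" using pi_gt3 by simp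
    then show ?thesis by (simp add: add_divide_distrib diff_divide_distrib)
  qed
  finally have "(\<integral>r. l r \<partial>lborel) \<le> - ln (real n) / (2 * pi) + 1" .
  moreover have "(\<lambda>i. tdef (sqrt (real n)) (\<epsilon> i)) \<longlonglongrightarrow> (\<integral>r. l r \<partial>lborel)"
    using lim by (simp only: \<mu>_def)
  ultimately show ?thesis by (intro exI[of _ "\<integral>r. l r \<partial>lborel"] conjI)
qed

section \<open>From the tilted mean to a probability\<close>

lemma mult_le_weighted_squares: "0 < c \<Longrightarrow> x * y \<le> x\<^sup>2 / (4 * c) + c * y\<^sup>2" for x y c :: real
proof -
  assume c: "0 < c"
  have "0 \<le> (x - 2 * c * y)\<^sup>2 / (4 * c)" using c by simp
  also have "\<dots> = x\<^sup>2 / (4 * c) + c * y\<^sup>2 - x * y"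
    using c by (simp add: power2_eq_square field_simps)
  finally show ?thesis by simp
qed

text \<open>\<open>10 = 6 + 4\<close> adds the exponent of the fourth moment of the density and that
  of \<open>n ^ 4 \<le> exp (4 * n)\<close>; the logarithm collects the constant of the second
  moment.\<close>

definition lconst :: real where "lconst = 10 + ln (2 * (32 + 2 * vconst)\<^sup>2)"

text \<open>Under the Girsanov change of measure given by \<open>tilt\<close> the path acquires a drift of size \<open>sqrt n\<close>,
  which lowers the mean of the renormalized local time to \<open>- ln n / (2 pi)\<close>, at the price of a density with
  moments of order \<open>exp (O(n))\<close>.\<close>

lemma gam_lower_at:
  assumes X: "bm M X" and e: "0 < \<epsilon>" and n: "0 < n" and t: "tdef (sqrt (real n)) \<epsilon> \<le> - ln (real n) / (2 * pi) + 2"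
  shows "exp (- (lconst * real n)) \<le> measure M {\<omega>\<in>space M. gam X \<epsilon> 1 \<omega> \<le> - ln (real n) / (2 * pi) + 3}"
proof -
  interpret prob_space M by (rule bm_prob_space[OF X])
  note [measurable] = bm_measurable[OF X] gam_measurable[OF X e]
  define \<mu> where "\<mu> = sqrt (real n)"
  have mu: "0 \<le> \<mu>" "\<mu>\<^sup>2 = real n" by (auto simp: \<mu>_def)
  define Z where "Z \<omega> = tilt \<mu> 1 (X 1 \<omega>)" for \<omega>
  have Z0: "0 \<le> Z \<omega>" for \<omega> by (simp add: Z_def tilt_def)
  have [measurable]: "Z \<in> borel_measurable M" unfolding Z_def by measurable
  have tm: "integrable M (\<lambda>\<omega>. tilt \<nu> 1 (X 1 \<omega>))" "(\<integral>\<omega>. tilt \<nu> 1 (X 1 \<omega>) \<partial>M) = 1" for \<nu>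
  proof -
    show "integrable M (\<lambda>\<omega>. tilt \<nu> 1 (X 1 \<omega>))"
      by (rule integrableI_nonneg) (use bm_tilt_mean[OF X, of \<nu>] in \<open>auto simp: tilt_def\<close>)
    show "(\<integral>\<omega>. tilt \<nu> 1 (X 1 \<omega>) \<partial>M) = 1"
      using bm_tilt_mean[OF X, of \<nu>] by (subst integral_eq_nn_integral) (auto simp: tilt_def)
  qed
  have i4: "integrable M (\<lambda>\<omega>. (Z \<omega>) ^ 4)" and E4: "(\<integral>\<omega>. (Z \<omega>) ^ 4 \<partial>M) = exp (6 * real n)"
    unfolding Z_def tilt_power4 using tm[of "4 * \<mu>"] mu by auto
  define c where "c = - ln (real n) / (2 * pi) + 3"
  define A where "A = {\<omega>\<in>space M. gam X \<epsilon> 1 \<omega> \<le> c}"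
  have [measurable]: "A \<in> sets M" unfolding A_def by measurable
  \<comment> \<open>A bound for the second moment of \<open>c - gam X \<epsilon> 1\<close>, used
    below as the weight of the first splitting.\<close>
  define v where "v = (32 + 2 * vconst) * (real n)\<^sup>2"
  have n1: "1 \<le> real n" using n by simp
  have v0: "32 \<le> v" using vconst_pos n1 one_le_power[OF n1, of 2] mult_mono[of 32 "32 + 2 * vconst" 1 "(real n)\<^sup>2"] by (simp add: v_def)
  have c: "c\<^sup>2 \<le> 16 * (real n)\<^sup>2"
  proof -
    have "ln (real n) \<le> real n" using n1 ln_le_minus_one[of "real n"] by simp
    moreover have "0 \<le> ln (real n)" using n1 by simp
    moreover have "ln (real n) / (2 * pi) \<le> ln (real n)" using pi_gt3 calculation(2) by (simp add: divide_le_eq mult_le_cancel_left1)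
    moreover have "0 \<le> ln (real n) / (2 * pi)" using calculation(2) by simp
    ultimately have "\<bar>c\<bar> \<le> 4 * real n" using n1 unfolding c_def minus_divide_left[symmetric] by linarith
    then have "\<bar>c\<bar>\<^sup>2 \<le> (4 * real n)\<^sup>2" by (intro power_mono) auto
    then show ?thesis by (simp add: power_mult_distrib)
  qed
  note gi = gam_integrable[OF X e zero_le_one order_refl]
  have iV: "integrable M (\<lambda>\<omega>. (c - gam X \<epsilon> 1 \<omega>)\<^sup>2)"
    using gi by (simp add: power2_diff)
  have EV: "(\<integral>\<omega>. (c - gam X \<epsilon> 1 \<omega>)\<^sup>2 \<partial>M) \<le> v"
  proof -
    have "(\<integral>\<omega>. (c - gam X \<epsilon> 1 \<omega>)\<^sup>2 \<partial>M) = c\<^sup>2 + (\<integral>\<omega>. (gam X \<epsilon> 1 \<omega>)\<^sup>2 \<partial>M)"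
      using gi gam_mean[OF X e] by (simp add: power2_diff prob_space)
    also have "\<dots> \<le> 16 * (real n)\<^sup>2 + vconst * (real n)\<^sup>2"
      using c gam_second_moment[OF X e] mult_left_mono[OF one_le_power[OF n1, of 2], of vconst] vconst_pos
      by linarith
    also have "\<dots> \<le> v" using vconst_pos unfolding v_def by (simp add: distrib_right)
    finally show ?thesis .
  qed
  define q where "q = exp (6 * real n)"
  have q0: "0 < q" by (simp add: q_def)
  \<comment> \<open>Two weighted Young inequalities split the product into the squared deviation,
    the fourth power of the density and the indicator of \<open>A\<close>; off \<open>A\<close> the
    left side is nonpositive. With the weights \<open>v\<close> and \<open>q\<close> the first two
    parts integrate to at most \<open>1/4\<close> each, while the left side integrates to at least
    \<open>1\<close>, so the indicator must carry \<open>1/2\<close>.\<close>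
  have pt: "Z \<omega> * (c - gam X \<epsilon> 1 \<omega>) \<le> (c - gam X \<epsilon> 1 \<omega>)\<^sup>2 / (4 * v) + (Z \<omega>) ^ 4 / (4 * q) + v\<^sup>2 * q * indicator A \<omega>"
    if w: "\<omega> \<in> space M" for \<omega>
  proof (cases "\<omega> \<in> A")
    case True
    define y where "y = c - gam X \<epsilon> 1 \<omega>"
    define z where "z = Z \<omega>"
    have 1: "y * z \<le> y\<^sup>2 / (4 * v) + v * z\<^sup>2" by (rule mult_le_weighted_squares) (use v0 in simp)
    have "z\<^sup>2 * v \<le> (z\<^sup>2)\<^sup>2 / (4 * q) + q * v\<^sup>2" by (rule mult_le_weighted_squares[OF q0])
    moreover have "(z\<^sup>2)\<^sup>2 = z ^ 4" by (simp only: power_mult[symmetric]) simp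
    ultimately have "z * y \<le> y\<^sup>2 / (4 * v) + z ^ 4 / (4 * q) + v\<^sup>2 * q"
      using 1 by (simp only: mult.commute[of z] mult.commute[of "z\<^sup>2"] mult.commute[of q])
    moreover have "indicator A \<omega> = (1::real)" using True by simp
    ultimately show ?thesis by (simp only: y_def z_def mult_1_right)
  next
    case False
    then have "c - gam X \<epsilon> 1 \<omega> \<le> 0" using w by (simp add: A_def)
    then have "Z \<omega> * (c - gam X \<epsilon> 1 \<omega>) \<le> 0" by (rule mult_nonneg_nonpos[OF Z0])
    moreover have "0 \<le> (c - gam X \<epsilon> 1 \<omega>)\<^sup>2 / (4 * v)" "0 \<le> (Z \<omega>) ^ 4 / (4 * q)" "0 \<le> v\<^sup>2 * q * indicator A \<omega>"
      using v0 q0 by simp_all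
    ultimately show ?thesis by linarith
  qed
  note iZg = gam_tilted[OF X e mu(1), folded Z_def]
  have "1 \<le> c - tdef \<mu> \<epsilon>" using t by (simp add: c_def \<mu>_def)
  also have "\<dots> = (\<integral>\<omega>. Z \<omega> * (c - gam X \<epsilon> 1 \<omega>) \<partial>M)"
    using iZg tm[of \<mu>, folded Z_def] by (simp add: right_diff_distrib)
  also have "\<dots> \<le> (\<integral>\<omega>. (c - gam X \<epsilon> 1 \<omega>)\<^sup>2 / (4 * v) + (Z \<omega>) ^ 4 / (4 * q) + v\<^sup>2 * q * indicator A \<omega> \<partial>M)"
  proof (rule integral_mono_AE)
    show "integrable M (\<lambda>\<omega>. Z \<omega> * (c - gam X \<epsilon> 1 \<omega>))"
      using iZg tm[of \<mu>, folded Z_def] by (simp add: right_diff_distrib)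
    show "integrable M (\<lambda>\<omega>. (c - gam X \<epsilon> 1 \<omega>)\<^sup>2 / (4 * v) + (Z \<omega>) ^ 4 / (4 * q) + v\<^sup>2 * q * indicator A \<omega>)"
    proof -
      have "integrable M (\<lambda>\<omega>. indicator A \<omega> :: real)" by (rule integrable_real_indicator) (auto simp: emeasure_eq_measure)
      then show ?thesis using iV i4 by simp
    qed
    show "AE \<omega> in M. Z \<omega> * (c - gam X \<epsilon> 1 \<omega>) \<le> (c - gam X \<epsilon> 1 \<omega>)\<^sup>2 / (4 * v) + (Z \<omega>) ^ 4 / (4 * q) + v\<^sup>2 * q * indicator A \<omega>"
      by (rule AE_I2, rule pt)
  qed
  also have "\<dots> = (\<integral>\<omega>. (c - gam X \<epsilon> 1 \<omega>)\<^sup>2 \<partial>M) / (4 * v) + (\<integral>\<omega>. (Z \<omega>) ^ 4 \<partial>M) / (4 * q) + v\<^sup>2 * q * measure M A"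
  proof -
    have iA: "integrable M (\<lambda>\<omega>. indicator A \<omega> :: real)" by (rule integrable_real_indicator) (auto simp: emeasure_eq_measure)
    have "(\<integral>\<omega>. indicator A \<omega> \<partial>M) = measure M A" by simp
    then show ?thesis using iV i4 iA
      by (simp only: Bochner_Integration.integral_add Bochner_Integration.integrable_add integrable_divide
        integrable_mult_right integral_divide_zero integral_mult_right_zero simp_thms)
  qed
  also have "\<dots> \<le> v / (4 * v) + q / (4 * q) + v\<^sup>2 * q * measure M A"
    unfolding E4 q_def using EV v0 by (intro add_mono divide_right_mono order_refl) simp_all
  also have "\<dots> = 1/2 + v\<^sup>2 * q * measure M A" using v0 q0 by simp
  finally have "1 / 2 \<le> v\<^sup>2 * q * measure M A" by simp
  then have P: "1 / (2 * (v\<^sup>2 * q)) \<le> measure M A"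
    using v0 q0 by (simp add: divide_le_eq mult.commute)
  have "2 * (v\<^sup>2 * q) \<le> exp (lconst * real n)"
  proof -
    have "real n \<le> exp (real n)" using exp_ge_add_one_self[of "real n"] by linarith
    then have "real n ^ 4 \<le> exp (real n) ^ 4" by (rule power_mono) simp
    also have "\<dots> = exp (4 * real n)" using exp_of_nat_mult[of 4 "real n"] by simp
    finally have n4: "real n ^ 4 \<le> exp (4 * real n)" .
    define K where "K = 2 * (32 + 2 * vconst)\<^sup>2"
    have K1: "1 \<le> K"
      using power_mono[of 32 "32 + 2 * vconst" 2] vconst_pos by (simp add: K_def)
    have "2 * (v\<^sup>2 * q) = K * (real n ^ 4 * q)"
      by (simp add: v_def K_def power_mult_distrib)
    also have "\<dots> \<le> K * (exp (4 * real n) * q)" using n4 K1 q0 by (intro mult_left_mono mult_right_mono) auto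
    also have "\<dots> = exp (ln K) * exp (10 * real n)" using K1 by (simp add: q_def exp_add[symmetric])
    also have "\<dots> \<le> exp (ln K * real n) * exp (10 * real n)"
    proof -
      have "ln K * 1 \<le> ln K * real n" using K1 by (intro mult_left_mono n1) simp
      then show ?thesis by simp
    qed
    also have "\<dots> = exp (lconst * real n)"
      unfolding lconst_def K_def[symmetric] exp_add[symmetric] distrib_right by (simp only: add.commute)
    finally show ?thesis .
  qed
  then have "1 / exp (lconst * real n) \<le> 1 / (2 * (v\<^sup>2 * q))" using v0 q0 by (intro divide_left_mono) simp_all
  also note P
  finally show ?thesis unfolding A_def c_def exp_minus inverse_eq_divide .
qed

end

section \<open>The law of the iterated logarithm\<close>

lemma planar_BM_extend:
  assumes X: "planar_BM M X"
  shows "bm M (\<lambda>t \<omega>. if t < 0 then 0 else X t \<omega>)"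
proof -
  interpret prob_space M using X by (simp add: planar_BM_def)
  let ?Y = "\<lambda>t \<omega>. if t < 0 then 0 else X t \<omega>"
  have "planar_BM M ?Y" unfolding planar_BM_def
  proof (intro conjI allI impI ballI)
    show "prob_space M" by (rule prob_space_axioms)
    show "?Y t \<in> borel_measurable M" if "0 \<le> t" for t
      using that X by (simp add: planar_BM_def)
    show "?Y 0 \<omega> = 0" if "\<omega> \<in> space M" for \<omega> using that X by (simp add: planar_BM_def)
    show "continuous_on {0..} (\<lambda>t. ?Y t \<omega>)" if "\<omega> \<in> space M" for \<omega>
    proof -
      have "continuous_on {0..} (\<lambda>t. X t \<omega>)" using that X by (simp add: planar_BM_def)
      then show ?thesis by (rule continuous_on_eq) simp
    qed
    show "indep_vars (\<lambda>_. borel) (\<lambda>i \<omega>. ?Y (ts ! Suc i) \<omega> - ?Y (ts ! i) \<omega>) {..<length ts - 1}"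
      if ts: "sorted_wrt (<) ts \<and> (\<forall>t\<in>set ts. 0 \<le> t)" for ts
    proof -
      have i: "indep_vars (\<lambda>_. borel) (\<lambda>i \<omega>. X (ts ! Suc i) \<omega> - X (ts ! i) \<omega>) {..<length ts - 1}"
        using ts X by (simp add: planar_BM_def)
      have "(\<lambda>\<omega>. ?Y (ts ! Suc i) \<omega> - ?Y (ts ! i) \<omega>) = (\<lambda>\<omega>. X (ts ! Suc i) \<omega> - X (ts ! i) \<omega>)"
        if "i \<in> {..<length ts - 1}" for i
      proof -
        have "ts ! Suc i \<in> set ts" "ts ! i \<in> set ts" using that by (simp_all add: less_diff_conv)
        then have "\<not> ts ! Suc i < 0" "\<not> ts ! i < 0" using ts by (simp_all add: not_less)
        then show ?thesis by simp
      qed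
      then show ?thesis using i by (subst indep_vars_cong[OF refl _ refl]) simp_all
    qed
    show "distributed M lborel (\<lambda>\<omega>. ?Y t \<omega> - ?Y s \<omega>) (\<lambda>x. ennreal (gauss2 (t - s) x))"
      if "0 \<le> s \<and> s < t" for s t
      using that X by (simp add: planar_BM_def)
  qed
  then show ?thesis by (simp add: bm_def)
qed

text \<open>The deterministic part: additive errors \<open>C\<close> and \<open>D\<close> next to
  \<open>ln (ln (ln t)) / (2 * pi)\<close> disappear after division, whatever their values, so no
  effort is made to keep them small.\<close>

lemma Liminf_eq_lnlnln:
  fixes f :: "real \<Rightarrow> real"
  assumes lo: "\<forall>\<^sub>F t in at_top. - (t * (ln (ln (ln t)) / (2 * pi) + C)) \<le> f t"
    and up: "\<exists>\<^sub>F k in sequentially. f (T k) \<le> - (T k * (ln (ln (ln (T k))) / (2 * pi) - D))"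
    and T: "filterlim T at_top sequentially"
  shows "Liminf at_top (\<lambda>t. ereal (f t / (t * ln (ln (ln t))))) = ereal (- 1 / (2 * pi))"
proof (rule antisym)
  have quot: "- (t * (l / (2 * pi) + K)) / (t * l) = - 1 / (2 * pi) - K / l" if "t \<noteq> 0" "l \<noteq> 0" for t l K :: real
    using that by (simp add: field_simps)
  have big: "\<forall>\<^sub>F t :: real in at_top. 0 < t * ln (ln (ln t))" by real_asymp
  show "ereal (- 1 / (2 * pi)) \<le> Liminf at_top (\<lambda>t. ereal (f t / (t * ln (ln (ln t)))))"
    unfolding le_Liminf_iff
  proof (intro allI impI)
    fix y assume "y < ereal (- 1 / (2 * pi))"
    then obtain z where z: "y < ereal z" "z < - 1 / (2 * pi)" using ereal_dense2 by fastforce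
    have "((\<lambda>t. - 1 / (2 * pi) - C / ln (ln (ln t))) \<longlongrightarrow> - 1 / (2 * pi)) at_top" by real_asymp
    then have "\<forall>\<^sub>F t in at_top. z < - 1 / (2 * pi) - C / ln (ln (ln t))" using z(2) by (rule order_tendstoD)
    then have "\<forall>\<^sub>F t in at_top. ereal z < ereal (f t / (t * ln (ln (ln t))))"
      using lo big
    proof eventually_elim
      case (elim t)
      have t: "t \<noteq> 0" "ln (ln (ln t)) \<noteq> 0" using elim(3) by auto
      have "z < - (t * (ln (ln (ln t)) / (2 * pi) + C)) / (t * ln (ln (ln t)))"
        unfolding quot[OF t] by (rule elim(1))
      also have "\<dots> \<le> f t / (t * ln (ln (ln t)))" using elim(2,3) by (intro divide_right_mono) simp_all
      finally show ?case by simp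
    qed
    then show "\<forall>\<^sub>F t in at_top. y < ereal (f t / (t * ln (ln (ln t))))"
      by eventually_elim (rule less_trans[OF z(1)])
  qed
  show "Liminf at_top (\<lambda>t. ereal (f t / (t * ln (ln (ln t))))) \<le> ereal (- 1 / (2 * pi))"
  proof (rule ccontr)
    assume "\<not> ?thesis"
    then have "ereal (- 1 / (2 * pi)) < Liminf at_top (\<lambda>t. ereal (f t / (t * ln (ln (ln t)))))" by simp
    then obtain z where z: "- 1 / (2 * pi) < z" "ereal z < Liminf at_top (\<lambda>t. ereal (f t / (t * ln (ln (ln t)))))"
      using ereal_dense2 by fastforce
    have "((\<lambda>t. - 1 / (2 * pi) + D / ln (ln (ln t))) \<longlongrightarrow> - 1 / (2 * pi)) at_top" by real_asymp
    then have "\<forall>\<^sub>F t in at_top. - 1 / (2 * pi) + D / ln (ln (ln t)) < z" using z(1) by (rule order_tendstoD)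
    with less_LiminfD[OF z(2)] big
    have "\<forall>\<^sub>F t in at_top. \<not> f t \<le> - (t * (ln (ln (ln t)) / (2 * pi) - D))"
    proof eventually_elim
      case (elim t)
      show ?case
      proof
        assume *: "f t \<le> - (t * (ln (ln (ln t)) / (2 * pi) - D))"
        have t: "t \<noteq> 0" "ln (ln (ln t)) \<noteq> 0" using elim(2) by auto
        have "f t / (t * ln (ln (ln t))) \<le> - (t * (ln (ln (ln t)) / (2 * pi) - D)) / (t * ln (ln (ln t)))"
          using * elim(2) by (intro divide_right_mono) simp_all
        also have "\<dots> = - 1 / (2 * pi) + D / ln (ln (ln t))" using quot[OF t, of "- D"] by simp
        finally show False using elim(1,3) by simp
      qed
    qed
    then have "\<forall>\<^sub>F k in sequentially. \<not> f (T k) \<le> - (T k * (ln (ln (ln (T k))) / (2 * pi) - D))"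
      by (rule eventually_compose_filterlim[OF _ T])
    then show False using up by (simp add: frequently_def)
  qed
qed

section \<open>Identification with the given definition\<close>

lemma (in mollifier) sil_eps_eq_tri:
  assumes X: "bm M Y" and XY: "\<And>s. 0 \<le> s \<Longrightarrow> X s \<omega> = Y s \<omega>" and w: "\<omega> \<in> space M" and e: "0 < \<epsilon>"
  shows "sil_eps X \<phi> \<epsilon> t \<omega> = tri (phe \<epsilon>) t (\<lambda>s. Y s \<omega>)"
proof -
  let ?F = "\<lambda>p. indicator (tset t) p * phe \<epsilon> (Y (fst p) \<omega> - Y (snd p) \<omega>)"
  have "integrable (lborel \<Otimes>\<^sub>M lborel) ?F"
    unfolding lborel_prod by (rule dbl_integrable[OF bcf_phe[OF e] bm_path_measurable[OF X w] tset_measurable emeasure_tset_finite])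
  then have "tri (phe \<epsilon>) t (\<lambda>s. Y s \<omega>) = (\<integral>s. \<integral>u. ?F (s, u) \<partial>lborel \<partial>lborel)"
    unfolding dbl_def lborel_prod[symmetric] by (rule lborel_pair.integral_fst'[symmetric])
  also have "\<dots> = sil_eps X \<phi> \<epsilon> t \<omega>"
    unfolding sil_eps_def integral_mult_right_zero[symmetric]
    by (intro Bochner_Integration.integral_cong refl) (auto simp: indicator_def tset_def XY)
  finally show ?thesis ..
qed

lemma (in mollifier) beta_eq_isl:
  assumes X: "planar_BM M X" and w: "\<omega> \<in> space M" and t: "0 \<le> t"
  shows "beta M X \<phi> t \<omega> = isl (\<lambda>t \<omega>. if t < 0 then 0 else X t \<omega>) t \<omega>"
proof -
  let ?Y = "\<lambda>t \<omega>. if t < 0 then 0 else X t \<omega>"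
  note Y = planar_BM_extend[OF X]
  have s: "sil_eps X \<phi> \<epsilon> t \<omega>' = tri (phe \<epsilon>) t (\<lambda>s. ?Y s \<omega>')" if "0 < \<epsilon>" "\<omega>' \<in> space M" for \<epsilon> \<omega>'
    using that by (intro sil_eps_eq_tri[OF Y]) simp_all
  have "sil_eps X \<phi> \<epsilon> t \<omega> - integral\<^sup>L M (sil_eps X \<phi> \<epsilon> t) = gam ?Y \<epsilon> t \<omega>" if e: "0 < \<epsilon>" for \<epsilon>
    unfolding gam_def ctri_def s[OF e w] by (simp only: Bochner_Integration.integral_cong[OF refl s[OF e]])
  then have "\<forall>\<^sub>F \<epsilon> in at_right 0. sil_eps X \<phi> \<epsilon> t \<omega> - integral\<^sup>L M (sil_eps X \<phi> \<epsilon> t) = gam ?Y \<epsilon> t \<omega>"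
    using eventually_at_right_less[of "0::real"] by (auto elim: eventually_mono)
  \<comment> \<open>\<open>Lim\<close> depends only on which values are limits, so eventual equality
    of the two functions is enough and convergence is not at stake here.\<close>
  from tendsto_cong[OF this] show ?thesis
    unfolding beta_def isl_def Topological_Spaces.Lim_def by simp
qed

section \<open>Grid estimates and the first Borel-Cantelli lemma\<close>

lemma root4_step:
  assumes "1 \<le> j"
  shows "root 4 (real (Suc j)) - root 4 (real j) \<le> 1" "0 < root 4 (real (Suc j)) - root 4 (real j)"
    "(root 4 (real (Suc j)) - root 4 (real j)) * root 4 (real j) ^ 3 \<le> 1"
proof -
  define x y where "x = root 4 (real j)" and "y = root 4 (real (Suc j))"
  have x: "1 \<le> x" using assms by (simp add: x_def)
  have y: "x < y" by (simp add: x_def y_def)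
  have e: "x ^ 4 = real j" "y ^ 4 = real j + 1" by (simp_all add: x_def y_def)
  \<comment> \<open>The aim is \<open>(y - x) * x ^ 3 \<le> y ^ 4 - x ^ 4 = 1\<close>.\<close>
  have "(y - x) * x ^ 3 = x ^ 3 * y - x ^ 4" by (simp add: algebra_simps power_numeral_reduce)
  also have "x ^ 3 * y \<le> y ^ 3 * y" using x y by (intro mult_right_mono power_mono) simp_all
  also have "y ^ 3 * y - x ^ 4 = 1" using e by (simp add: power_numeral_reduce)
  finally have 3: "(y - x) * x ^ 3 \<le> 1" by simp
  have "(y - x) * 1 \<le> (y - x) * x ^ 3" using x y by (intro mult_left_mono) (simp_all add: one_le_power)
  with 3 have "y - x \<le> 1" by simp
  then show "root 4 (real (Suc j)) - root 4 (real j) \<le> 1" "0 < root 4 (real (Suc j)) - root 4 (real j)"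
    "(root 4 (real (Suc j)) - root 4 (real j)) * root 4 (real j) ^ 3 \<le> 1"
    using 3 y by (simp_all add: x_def y_def)
qed

lemma summable_root4: "summable (\<lambda>j. c / (root 4 (real j) ^ 3)\<^sup>2)"
proof -
  have "c / (root 4 (real j) ^ 3)\<^sup>2 = c * real j powr (- (3 / 2))" for j :: nat
  proof (cases "j = 0")
    case False
    then have j: "0 < real j" by simp
    have "(root 4 (real j) ^ 3)\<^sup>2 = root 4 (real j) ^ 6" by (simp only: power_mult[symmetric]) simp
    also have "\<dots> = (real j powr (1 / 4)) ^ 6" using j by (simp add: root_powr_inverse)
    also have "\<dots> = real j powr (3 / 2)" using powr_power[of "real j" "1 / 4" 6] j by simp
    finally have "(root 4 (real j) ^ 3)\<^sup>2 = real j powr (3 / 2)" .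
    then show ?thesis by (simp only: powr_minus divide_inverse)
  qed simp
  moreover have "summable (\<lambda>j. real j powr (- (3 / 2)))" by (simp add: summable_real_powr_iff)
  ultimately show ?thesis by (simp add: summable_mult)
qed

lemma (in prob_space) borel_cantelli_bound:
  assumes A: "\<And>j::nat. A j \<in> events" "\<And>j. emeasure M (A j) \<le> ennreal (b j)" and b: "\<And>j. 0 \<le> b j" "summable b"
  shows "AE \<omega> in M. \<forall>\<^sub>F j in sequentially. \<omega> \<notin> A j"
proof -
  have "AE \<omega> in M. \<forall>\<^sub>F j in sequentially. \<omega> \<in> space M - A j"
  proof (rule borel_cantelli_AE1)
    show "summable (\<lambda>j. measure M (A j))"
    proof (rule summable_comparison_test'[OF b(2), of 0])
      show "norm (measure M (A j)) \<le> b j" for j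
        using A(2)[of j] b(1)[of j] by (simp add: emeasure_eq_measure)
    qed
  qed (use A in \<open>simp_all add: emeasure_eq_measure\<close>)
  then show ?thesis by eventually_elim (auto elim: eventually_mono)
qed

lemma nn_integral_Markov_set:
  assumes S: "S \<in> borel_measurable M" "(\<integral>\<^sup>+\<omega>. S \<omega> \<partial>M) \<le> ennreal v" and v: "0 \<le> v" and l: "0 < l"
  shows "{\<omega>\<in>space M. ennreal l \<le> S \<omega>} \<in> sets M" "emeasure M {\<omega>\<in>space M. ennreal l \<le> S \<omega>} \<le> ennreal (v / l)"
proof -
  note [measurable] = S(1)
  show m: "{\<omega>\<in>space M. ennreal l \<le> S \<omega>} \<in> sets M" by measurable
  have "{\<omega>\<in>space M. ennreal l \<le> S \<omega>} = {\<omega>\<in>space M. 1 \<le> ennreal (1 / l) * S \<omega>}"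
  proof -
    have "ennreal l \<le> x \<longleftrightarrow> 1 \<le> ennreal (1 / l) * x" for x
    proof -
      have 1: "ennreal (1 / l) * ennreal l = 1" "ennreal l * ennreal (1 / l) = 1"
        using l by (simp_all flip: ennreal_mult ennreal_1)
      show ?thesis
      proof
        assume "ennreal l \<le> x"
        then have "ennreal (1 / l) * ennreal l \<le> ennreal (1 / l) * x" by (rule mult_left_mono) simp
        then show "1 \<le> ennreal (1 / l) * x" unfolding 1 .
      next
        assume "1 \<le> ennreal (1 / l) * x"
        then have "ennreal l * 1 \<le> ennreal l * (ennreal (1 / l) * x)" by (rule mult_left_mono) simp
        then show "ennreal l \<le> x" unfolding mult.assoc[symmetric] 1 by simp
      qed
    qed
    then show ?thesis by auto
  qed
  then have "emeasure M {\<omega>\<in>space M. ennreal l \<le> S \<omega>} = emeasure M {\<omega>\<in>space M. 1 \<le> ennreal (1 / l) * S \<omega>}" by simp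
  also have "\<dots> \<le> ennreal (1 / l) * (\<integral>\<^sup>+\<omega>. S \<omega> * indicator (space M) \<omega> \<partial>M)"
    by (rule nn_integral_Markov_inequality) measurable
  also have "(\<integral>\<^sup>+\<omega>. S \<omega> * indicator (space M) \<omega> \<partial>M) = (\<integral>\<^sup>+\<omega>. S \<omega> \<partial>M)"
    by (intro nn_integral_cong) simp
  also have "ennreal (1 / l) * \<dots> \<le> ennreal (1 / l) * ennreal v" by (rule mult_left_mono[OF S(2)]) simp
  also have "\<dots> = ennreal (v / l)" using v l by (simp add: ennreal_mult[symmetric])
  finally show "emeasure M {\<omega>\<in>space M. ennreal l \<le> S \<omega>} \<le> ennreal (v / l)" .
qed

context mollifier
begin

text \<open>A single exceptional set serves all times of the unit interval, since the variable
  \<open>S\<close> of \<open>gam_limit\<close> dominates the whole path.\<close>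

lemma isl_second_moment_tail:
  assumes X: "bm M X" and l: "0 < l"
  obtains A where "A \<in> sets M" "emeasure M A \<le> ennreal (vconst / l\<^sup>2)"
    "\<And>\<omega> t. \<omega> \<in> space M \<Longrightarrow> \<omega> \<notin> A \<Longrightarrow> 0 \<le> t \<Longrightarrow> t \<le> 1 \<Longrightarrow> \<bar>isl X t \<omega>\<bar> \<le> l"
proof -
  obtain S where S: "S \<in> borel_measurable M" "(\<integral>\<^sup>+\<omega>. S \<omega> \<partial>M) \<le> ennreal vconst"
    and b: "\<And>\<omega> t. \<omega> \<in> space M \<Longrightarrow> 0 \<le> t \<Longrightarrow> t \<le> 1 \<Longrightarrow> ennreal ((isl X t \<omega>)\<^sup>2) \<le> S \<omega>"
    using gam_limit[OF X] by metis
  have l2: "0 < l\<^sup>2" using l by simp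
  show ?thesis
  proof (rule that[OF nn_integral_Markov_set[OF S less_imp_le[OF vconst_pos] l2]])
    fix \<omega> t assume *: "\<omega> \<in> space M" "\<omega> \<notin> {\<omega>\<in>space M. ennreal (l\<^sup>2) \<le> S \<omega>}" "0 \<le> t" "t \<le> (1::real)"
    then have "S \<omega> < ennreal (l\<^sup>2)" by simp
    with b[OF *(1,3,4)] have "ennreal ((isl X t \<omega>)\<^sup>2) < ennreal (l\<^sup>2)" by (rule le_less_trans)
    then have "(isl X t \<omega>)\<^sup>2 < l\<^sup>2" by (subst (asm) ennreal_less_iff) simp_all
    then show "\<bar>isl X t \<omega>\<bar> \<le> l" using l abs_le_square_iff[of "isl X t \<omega>" l] by simp
  qed
qed

text \<open>Along the grid \<open>exp (j powr (1/4))\<close> the relative gaps are of order \<open>j powr (- (3/4))\<close>, which is square summable: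
  the oscillation within a cell is then \<open>O(t)\<close> by Chebyshev's inequality alone.  On the other hand
  \<open>ln (ln (ln t))\<close> at the grid points differs from \<open>ln (ln j)\<close> only by a constant.\<close>

lemma isl_lower:
  assumes X: "bm M X"
  shows "AE \<omega> in M. \<forall>\<^sub>F t in at_top. - (t * (ln (ln (ln t)) / (2 * pi) + (ln 9 + \<bar>kconst\<bar> + 4))) \<le> isl X t \<omega>"
proof -
  interpret prob_space M by (rule bm_prob_space[OF X])
  define s where "s j = root 4 (real j)" for j
  define T where "T j = exp (s j)" for j
  define h where "h j = T (Suc j) - T j" for j
  \<comment> \<open>About \<open>2 * ln j\<close> blocks: \<open>exp (- n j)\<close> is then at most
    \<open>1 / j\<^sup>2\<close>, hence summable, while \<open>ln (n j)\<close> is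
    \<open>ln (ln j)\<close> up to a constant.\<close>
  define n where "n j = Suc (nat \<lceil>2 * ln (real j)\<rceil>)" for j
  have T0: "0 < T j" for j by (simp add: T_def)
  have h0: "0 < h j" for j by (simp add: h_def T_def s_def)
  have n0: "0 < n j" for j by (simp add: n_def)
  have bT: "bm M (resc X 0 (T j))" and bh: "bm M (resc X (T j) (h j))" for j
    using T0[of j] h0[of j] by (intro bm_resc[OF X]; simp)+
  have "\<exists>A. A \<in> sets M \<and> emeasure M A \<le> ennreal (exp (- real (n j))) \<and>
      (\<forall>\<omega>\<in>space M. conv (resc X 0 (T j)) 1 \<omega> \<longrightarrow> \<omega> \<notin> A \<longrightarrow> - (ln (real (n j)) / (2 * pi) + kconst) \<le> isl (resc X 0 (T j)) 1 \<omega>)" for j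
    using isl_tail[OF bT[of j] n0[of j]] by metis
  then obtain A where A: "\<And>j. A j \<in> sets M" "\<And>j. emeasure M (A j) \<le> ennreal (exp (- real (n j)))"
    "\<And>j \<omega>. \<omega> \<in> space M \<Longrightarrow> conv (resc X 0 (T j)) 1 \<omega> \<Longrightarrow> \<omega> \<notin> A j \<Longrightarrow> - (ln (real (n j)) / (2 * pi) + kconst) \<le> isl (resc X 0 (T j)) 1 \<omega>"
    by metis
  \<comment> \<open>The index is shifted by one so that the threshold \<open>s (Suc j) ^ 3\<close>
    is positive; for the cell with index \<open>0\<close> it would be zero.\<close>
  have "\<exists>B. B \<in> sets M \<and> emeasure M B \<le> ennreal (vconst / (s (Suc j) ^ 3)\<^sup>2) \<and>
      (\<forall>\<omega> t. \<omega> \<in> space M \<longrightarrow> \<omega> \<notin> B \<longrightarrow> 0 \<le> t \<longrightarrow> t \<le> 1 \<longrightarrow> \<bar>isl (resc X (T (Suc j)) (h (Suc j))) t \<omega>\<bar> \<le> s (Suc j) ^ 3)" for j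
  proof -
    have "0 < s (Suc j) ^ 3" by (simp add: s_def)
    from isl_second_moment_tail[OF bh[of "Suc j"] this] show ?thesis by metis
  qed
  then obtain B where B: "\<And>j. B j \<in> sets M" "\<And>j. emeasure M (B j) \<le> ennreal (vconst / (s (Suc j) ^ 3)\<^sup>2)"
    "\<And>j \<omega> t. \<omega> \<in> space M \<Longrightarrow> \<omega> \<notin> B j \<Longrightarrow> 0 \<le> t \<Longrightarrow> t \<le> 1 \<Longrightarrow> \<bar>isl (resc X (T (Suc j)) (h (Suc j))) t \<omega>\<bar> \<le> s (Suc j) ^ 3"
    by metis
  have AE_A: "AE \<omega> in M. \<forall>\<^sub>F j in sequentially. \<omega> \<notin> A j"
  proof (rule borel_cantelli_bound[OF A(1,2)])
    show "summable (\<lambda>j. exp (- real (n j)))"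
    proof (rule summable_comparison_test'[of "\<lambda>j. 1 / real j ^ 2" 1])
      show "summable (\<lambda>j. 1 / real j ^ 2)" using inverse_power_summable[of 2, where 'a = real] by (simp add: divide_inverse)
      fix j :: nat assume j: "1 \<le> j"
      have "2 * ln (real j) \<le> real (n j)" unfolding n_def by linarith
      then have "exp (- real (n j)) \<le> exp (- (2 * ln (real j)))" by simp
      also have "\<dots> = 1 / real j ^ 2" using j by (simp add: exp_minus exp_double divide_inverse)
      finally show "norm (exp (- real (n j))) \<le> 1 / real j ^ 2" by simp
    qed
  qed simp
  have AE_B: "AE \<omega> in M. \<forall>\<^sub>F j in sequentially. \<omega> \<notin> B j"
  proof (rule borel_cantelli_bound[OF B(1,2)])
    show "summable (\<lambda>j. vconst / (s (Suc j) ^ 3)\<^sup>2)"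
      using summable_root4[of vconst] unfolding s_def by (subst summable_Suc_iff)
  qed (use vconst_pos in simp)
  have bracket: "\<exists>j. J \<le> j \<and> 1 \<le> j \<and> T j \<le> t \<and> t < T (Suc j)" if t: "exp (real J + 1) \<le> t" for J t
  proof -
    have t0: "0 < t" using t by (rule less_le_trans[rotated]) simp
    have l: "real J + 1 \<le> ln t" using t t0 by (simp add: ln_ge_iff)
    \<comment> \<open>The grid points are \<open>exp (root 4 j)\<close>, so the cell of
      \<open>t\<close> is the integer part of \<open>ln t ^ 4\<close>.\<close>
    define j where "j = nat \<lfloor>ln t ^ 4\<rfloor>"
    have j: "real j \<le> ln t ^ 4" "ln t ^ 4 < real (Suc j)" unfolding j_def by (simp, linarith)
    have "s j \<le> root 4 (ln t ^ 4)" unfolding s_def using j(1) by simp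
    then have 1: "s j \<le> ln t" using l by (simp add: real_root_power_cancel)
    have "root 4 (ln t ^ 4) < s (Suc j)" unfolding s_def using j(2) by (intro real_root_less_mono) simp_all
    then have 2: "ln t < s (Suc j)" using l by (simp add: real_root_power_cancel)
    have "(real J + 1) ^ 1 \<le> (real J + 1) ^ 4" by (rule power_increasing) simp_all
    also have "\<dots> \<le> ln t ^ 4" using l by (rule power_mono) simp
    also note j(2)
    finally have "J \<le> j" "1 \<le> j" by simp_all
    moreover have "T j \<le> exp (ln t)" "exp (ln t) < T (Suc j)" unfolding T_def using 1 2 by (simp_all only: exp_le_cancel_iff exp_less_cancel_iff)
    ultimately show ?thesis using t0 by auto
  qed
  have size: "\<exists>J. \<forall>j\<ge>J. ln (real (n j)) \<le> ln 9 + ln (ln (ln (T j))) \<and> 0 < ln (ln (T j))"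
  proof -
    have lT: "ln (ln (T j)) = ln (real j) / 4" if "1 \<le> j" for j
      using that by (simp add: T_def s_def ln_root)
    \<comment> \<open>Since \<open>ln (ln (T j)) = ln j / 4\<close>, the number of blocks is
      eventually at most \<open>9\<close> times this quantity; here \<open>ln 9\<close>
      originates.\<close>
    have ev: "\<forall>\<^sub>F j in sequentially. 2 * ln (real j) + 2 \<le> 9 * (ln (real j) / 4) \<and> 0 < ln (real j) / 4 \<and> 1 \<le> j"
      by (intro eventually_conj eventually_ge_at_top) real_asymp+
    then have "\<forall>\<^sub>F j in sequentially. ln (real (n j)) \<le> ln 9 + ln (ln (ln (T j))) \<and> 0 < ln (ln (T j))"
    proof eventually_elim
      case (elim j)
      have "real (n j) \<le> 2 * ln (real j) + 2" unfolding n_def using elim by linarith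
      also have "\<dots> \<le> 9 * (ln (real j) / 4)" using elim by simp
      finally have "ln (real (n j)) \<le> ln (9 * (ln (real j) / 4))" using n0[of j] by (simp add: ln_le_cancel_iff)
      also have "\<dots> = ln 9 + ln (ln (real j) / 4)" by (rule ln_mult_pos) (use elim in simp_all)
      finally have F: "ln (real (n j)) \<le> ln 9 + ln (ln (real j) / 4)" .
      have L: "ln (ln (T j)) = ln (real j) / 4" using elim by (intro lT) simp
      show ?case unfolding L using F elim by (intro conjI) simp_all
    qed
    then show ?thesis by (simp only: eventually_sequentially)
  qed
  then obtain J0 where J0: "\<And>j. J0 \<le> j \<Longrightarrow> ln (real (n j)) \<le> ln 9 + ln (ln (ln (T j)))" "\<And>j. J0 \<le> j \<Longrightarrow> 0 < ln (ln (T j))" by blast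
  have AEc: "AE \<omega> in M. \<forall>j. (\<forall>t\<ge>0. conv (resc X 0 (T j)) t \<omega>) \<and> (\<forall>t\<ge>0. conv (resc X (T j) (h j)) t \<omega>)"
    unfolding AE_all_countable AE_conj_iff by (intro allI conjI AE_conv bT bh)
  show ?thesis
    using AE_A AE_B AE_conv[OF X] AEc AE_space
  proof eventually_elim
    case (elim \<omega>)
    obtain J1 where J1: "\<And>j. J1 \<le> j \<Longrightarrow> \<omega> \<notin> A j" using elim(1) unfolding eventually_sequentially by blast
    obtain J2 where J2: "\<And>j. J2 \<le> j \<Longrightarrow> \<omega> \<notin> B j" using elim(2) unfolding eventually_sequentially by blast
    define J where "J = J0 + J1 + Suc J2"
    show ?case unfolding eventually_at_top_linorder
    proof (intro exI allI impI)
      fix t assume "exp (real J + 1) \<le> t"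
      then obtain j where j: "J \<le> j" "1 \<le> j" "T j \<le> t" "t < T (Suc j)" using bracket by blast
      obtain i where i: "j = Suc i" using j(2) by (cases j) simp_all
      have nA: "\<omega> \<notin> A j" and nB: "\<omega> \<notin> B i" using j(1) i by (auto intro!: J1 J2 simp: J_def)
      have jJ0: "J0 \<le> j" using j(1) by (simp add: J_def)
      have t0: "0 < t" using T0[of j] j(3) by linarith
      define c where "c = ln (real (n j)) / (2 * pi) + \<bar>kconst\<bar>"
      have n1: "0 \<le> ln (real (n j))" using n0[of j] by simp
      have c0: "0 \<le> c" using n1 by (simp add: c_def)
      have "- c \<le> - (ln (real (n j)) / (2 * pi) + kconst)" unfolding c_def by linarith
      also have "\<dots> \<le> isl (resc X 0 (T j)) 1 \<omega>" by (rule A(3)) (use elim nA in simp_all)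
      finally have "- c \<le> isl (resc X 0 (T j)) 1 \<omega>" .
      then have "T j * (- c) \<le> T j * isl (resc X 0 (T j)) 1 \<omega>" using T0[of j] by (intro mult_left_mono) simp_all
      also have "\<dots> = isl X (T j) \<omega>"
        using conv_rescale[OF X elim(5) T0[of j], of 1] elim(4) by simp
      finally have 1: "T j * (- c) \<le> isl X (T j) \<omega>" .
      have "isl X (T j) \<omega> - 3 * t \<le> isl X t \<omega>"
      proof (cases "t = T j")
        case True
        then show ?thesis using t0 by simp
      next
        case False
        define u where "u = (t - T j) / h j"
        have u: "0 < u" "u \<le> 1" using False j(3,4) h0[of j] by (simp_all add: u_def h_def)
        have tu: "T j + h j * u = t" using h0[of j] by (simp add: u_def)
        define k where "k = min (T j) (h j * u)"
        have k0: "0 < k" using T0[of j] h0[of j] u by (simp add: k_def)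
        have "isl X (T j) \<omega> + h j * isl (resc X (T j) (h j)) u \<omega> - k * (1 + ln ((T j + h j * u) / k)) / (2 * pi) \<le> isl X (T j + h j * u) \<omega>"
          by (rule isl_ge_blocks[OF X elim(5) T0 h0 u(1) _ _ _ k_def]) (use elim(3,4) T0[of j] u t0 tu in \<open>simp_all add: less_imp_le\<close>)
        \<comment> \<open>Follows from \<open>ln x \<le> x - 1\<close> at \<open>x = t / k\<close>:
          the mean interaction is of order \<open>t\<close> even without using that the cell is
          short.\<close>
        moreover have "k * (1 + ln ((T j + h j * u) / k)) / (2 * pi) \<le> t"
        proof -
          have "ln (t / k) \<le> t / k - 1" using t0 k0 by (intro ln_le_minus_one) simp
          then have "k * (1 + ln (t / k)) \<le> k * (t / k)" using k0 by (intro mult_left_mono) simp_all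
          also have "\<dots> = t" using k0 by simp
          finally have "k * (1 + ln (t / k)) / (2 * pi) \<le> t / (2 * pi)" by (intro divide_right_mono) simp_all
          also have "\<dots> \<le> t / 1" using t0 pi_gt3 by (intro divide_left_mono) simp_all
          finally show ?thesis by (simp add: tu)
        qed
        \<comment> \<open>The cell has length at most \<open>2 * T j * d\<close> with
          \<open>d * s j ^ 3 \<le> 1\<close>, which compensates the threshold \<open>s j ^ 3\<close>
          allowed for the oscillation.\<close>
        moreover have "- (2 * t) \<le> h j * isl (resc X (T j) (h j)) u \<omega>"
        proof -
          define d where "d = s (Suc j) - s j"
          have d: "d \<le> 1" "0 < d" "d * s j ^ 3 \<le> 1" unfolding d_def s_def using root4_step[OF j(2)] by blast+
          have "exp d \<le> 1 + d + d\<^sup>2" using d by (intro exp_bound) simp_all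
          also have "\<dots> \<le> 1 + 2 * d" using d by (simp add: power2_eq_square mult_le_cancel_left1)
          finally have "exp d - 1 \<le> 2 * d" by simp
          moreover have "h j = T j * (exp d - 1)" by (simp add: h_def T_def d_def exp_diff right_diff_distrib)
          ultimately have "h j \<le> T j * (2 * d)" using T0[of j] by (simp add: mult_left_mono)
          then have "h j * s j ^ 3 \<le> T j * (2 * d) * s j ^ 3" by (rule mult_right_mono) (simp add: s_def)
          also have "\<dots> = (2 * T j) * (d * s j ^ 3)" by simp
          also have "\<dots> \<le> (2 * T j) * 1" using d T0[of j] by (intro mult_left_mono) simp_all
          finally have b: "h j * s j ^ 3 \<le> 2 * t" using j(3) by simp
          have "- (s j ^ 3) \<le> isl (resc X (T j) (h j)) u \<omega>"
            using B(3)[OF elim(5) nB, of u] u unfolding i by simp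
          then have "h j * (- (s j ^ 3)) \<le> h j * isl (resc X (T j) (h j)) u \<omega>" using h0[of j] by (intro mult_left_mono) simp_all
          then show ?thesis using b by simp
        qed
        ultimately show ?thesis unfolding tu by linarith
      qed
      moreover have "t * (- c) \<le> T j * (- c)" using c0 j(3) by (simp add: mult_right_mono)
      moreover have "t * c \<le> t * (ln (ln (ln t)) / (2 * pi) + (ln 9 + \<bar>kconst\<bar>))"
      proof (rule mult_left_mono)
        have "ln (ln (ln (T j))) \<le> ln (ln (ln t))"
        proof -
          have p: "0 < ln (ln (T j))" by (rule J0(2)[OF jJ0])
          have q: "0 < ln (T j)" unfolding T_def s_def using j(2) by simp
          have "ln (T j) \<le> ln t" using T0[of j] j(3) by simp
          then have "ln (ln (T j)) \<le> ln (ln t)" using q by simp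
          then show ?thesis using p by simp
        qed
        then have "ln (real (n j)) \<le> ln 9 + ln (ln (ln t))" using J0(1)[OF jJ0] by linarith
        then have "ln (real (n j)) / (2 * pi) \<le> (ln 9 + ln (ln (ln t))) / (2 * pi)" by (rule divide_right_mono) simp
        also have "\<dots> = ln 9 / (2 * pi) + ln (ln (ln t)) / (2 * pi)" by (rule add_divide_distrib)
        also have "ln 9 / (2 * pi) \<le> ln 9 / (1::real)" using pi_gt3 by (intro divide_left_mono) simp_all
        finally show "c \<le> ln (ln (ln t)) / (2 * pi) + (ln 9 + \<bar>kconst\<bar>)" unfolding c_def by simp
      qed (use t0 in simp)
      ultimately have "- (t * (ln (ln (ln t)) / (2 * pi) + (ln 9 + \<bar>kconst\<bar>))) - 3 * t \<le> isl X t \<omega>"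
        using 1 by simp
      then show "- (t * (ln (ln (ln t)) / (2 * pi) + (ln 9 + \<bar>kconst\<bar> + 4))) \<le> isl X t \<omega>"
        using t0 by (simp add: algebra_simps)
    qed
  qed
qed

end

section \<open>Infinitely many low values\<close>

lemma filterlim_half_powers: "filterlim (\<lambda>m. 1 / 2 ^ m :: real) (at_right 0) sequentially"
  unfolding filterlim_at
proof
  show "(\<lambda>m. 1 / 2 ^ m :: real) \<longlonglongrightarrow> 0"
    using LIMSEQ_realpow_zero[of "1/2 :: real"] by (simp add: power_one_over)
qed simp

lemma sum_unbounded_of_not_summable:
  fixes q :: "nat \<Rightarrow> real"
  assumes "\<And>k. 0 \<le> q k" "\<not> summable q"
  shows "\<exists>N. x < (\<Sum>i<N. q (K + i))"
proof (rule ccontr)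
  assume "\<not> ?thesis"
  then have "summable (\<lambda>i. q (K + i))" using assms(1) by (intro summableI_nonneg_bounded[where x = x]) (simp_all add: not_less)
  then have "summable (\<lambda>i. q (i + K))" by (simp add: add.commute)
  then show False using assms(2) by (simp only: summable_iff_shift)
qed

context mollifier
begin

lemma conv_half_powers: "conv X t \<omega> \<Longrightarrow> (\<lambda>m. gam X (1 / 2 ^ m) t \<omega>) \<longlonglongrightarrow> isl X t \<omega>"
  unfolding conv_def by (rule filterlim_compose[OF _ filterlim_half_powers])

text \<open>The analogue of \<open>gam_blocks_product\<close> for blocks of unequal lengths, as
  needed for rapidly growing times.\<close>

lemma gam_resc_product:
  assumes X: "bm M X" and e: "0 < \<epsilon>" and h: "\<And>k. k < n \<Longrightarrow> 0 < h k"
    and a: "\<And>k. k < n \<Longrightarrow> 0 \<le> a k" "0 \<le> a 0" "\<And>k. k < n \<Longrightarrow> a (Suc k) = a k + h k"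
    and g: "\<And>k. k < n \<Longrightarrow> continuous_on UNIV (g k :: real \<Rightarrow> real)"
  shows "(\<integral>\<omega>. (\<Prod>k<n. g k (gam (resc X (a k) (h k)) \<epsilon> 1 \<omega>)) \<partial>M) = (\<Prod>k<n. \<integral>\<omega>. g k (gam (resc X (a k) (h k)) \<epsilon> 1 \<omega>) \<partial>M)"
proof -
  have eq: "g k (gam (resc X (a k) (h k)) \<epsilon> 1 \<omega>) = (\<lambda>y. g k (y - mtri \<epsilon> 1)) (tri (phe \<epsilon>) 1 (\<lambda>s. resc X (a k) (h k) s \<omega>))"
    if "k < n" for k \<omega>
    by (simp only: gam_eq[OF bm_resc[OF X a(1)[OF that] h[OF that]] e zero_le_one])
  have "(\<integral>\<omega>. (\<Prod>k<n. g k (gam (resc X (a k) (h k)) \<epsilon> 1 \<omega>)) \<partial>M)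
    = (\<integral>\<omega>. (\<Prod>k<n. (\<lambda>y. g k (y - mtri \<epsilon> 1)) (tri (phe \<epsilon>) 1 (\<lambda>s. resc X (a k) (h k) s \<omega>))) \<partial>M)"
    by (intro Bochner_Integration.integral_cong prod.cong refl eq) simp
  also have "\<dots> = (\<Prod>k<n. \<integral>\<omega>. (\<lambda>y. g k (y - mtri \<epsilon> 1)) (tri (phe \<epsilon>) 1 (\<lambda>s. resc X (a k) (h k) s \<omega>)) \<partial>M)"
    by (intro indep_blocks[OF X] bcf_phe e h a continuous_on_compose2[OF g] continuous_intros) simp_all
  also have "\<dots> = (\<Prod>k<n. \<integral>\<omega>. g k (gam (resc X (a k) (h k)) \<epsilon> 1 \<omega>) \<partial>M)"
    by (intro prod.cong Bochner_Integration.integral_cong refl eq[symmetric]) simp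
  finally show ?thesis .
qed

text \<open>The second Borel-Cantelli lemma for events that are independent only at the mollified level:  indicators are
  replaced by continuous clamps \<open>g k\<close>, whose product has the expected size for small mollification, and Fatou's
  lemma removes the mollification.\<close>

lemma AE_frequently_low:
  assumes X: "bm M X" and h: "\<And>k. 0 < h k" and a: "\<And>k. 0 \<le> a k" "\<And>k. a (Suc k) = a k + h k"
    and q: "\<And>k. 0 \<le> q k" "\<not> summable q"
    and p: "\<And>k. \<forall>\<^sub>F m in sequentially. q k \<le> measure M {\<omega>\<in>space M. gam (resc X (a k) (h k)) (1 / 2 ^ m) 1 \<omega> \<le> c k}"
  shows "AE \<omega> in M. \<exists>\<^sub>F k in sequentially. isl (resc X (a k) (h k)) 1 \<omega> \<le> c k + 1"
proof -
  interpret prob_space M by (rule bm_prob_space[OF X])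
  define Y where "Y k = resc X (a k) (h k)" for k
  have bY: "bm M (Y k)" for k unfolding Y_def by (rule bm_resc[OF X a(1) h])
  have [measurable]: "gam (Y k) (1 / 2 ^ m) 1 \<in> borel_measurable M" for k m by (rule gam_measurable[OF bY]) simp
  \<comment> \<open>Zero up to \<open>c k\<close> and one from \<open>c k + 1\<close> on; the unit
    ramp is the price of continuity and reappears as \<open>c k + 1\<close> in the
    conclusion.\<close>
  define g where "g k y = max 0 (min 1 (y - c k))" for k y
  have g: "0 \<le> g k y" "g k y \<le> 1" for k y by (simp_all add: g_def)
  have gc: "continuous_on UNIV (g k)" for k unfolding g_def by (intro continuous_intros)
  have gm[measurable]: "g k \<in> borel_measurable borel" for k by (rule borel_measurable_continuous_onI[OF gc])
  define F where "F K N \<omega> = liminf (\<lambda>m. ennreal (\<Prod>i<N. g (K + i) (gam (Y (K + i)) (1 / 2 ^ m) 1 \<omega>)))" for K N \<omega>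
  have [measurable]: "F K N \<in> borel_measurable M" for K N unfolding F_def by measurable
  \<comment> \<open>The clamp vanishes on the low event, so its mean is at most
    \<open>1 - q k \<le> exp (- q k)\<close>, and products turn into exponentials of partial
    sums.\<close>
  have E1: "(\<integral>\<omega>. g k (gam (Y k) (1 / 2 ^ m) 1 \<omega>) \<partial>M) \<le> exp (- q k)"
    if "q k \<le> measure M {\<omega>\<in>space M. gam (Y k) (1 / 2 ^ m) 1 \<omega> \<le> c k}" for k m
  proof -
    let ?A = "{\<omega>\<in>space M. gam (Y k) (1 / 2 ^ m) 1 \<omega> \<le> c k}"
    have i1: "integrable M (\<lambda>\<omega>. indicator ?A \<omega> :: real)" by (rule integrable_real_indicator) (simp_all add: emeasure_eq_measure)
    have "(\<integral>\<omega>. g k (gam (Y k) (1 / 2 ^ m) 1 \<omega>) \<partial>M) \<le> (\<integral>\<omega>. 1 - indicator ?A \<omega> \<partial>M)"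
    proof (rule integral_mono)
      show "integrable M (\<lambda>\<omega>. g k (gam (Y k) (1 / 2 ^ m) 1 \<omega>))"
        by (rule integrable_const_bound[where B = 1]) (use g in simp_all)
      show "integrable M (\<lambda>\<omega>. 1 - indicator ?A \<omega> :: real)" using i1 by simp
      show "g k (gam (Y k) (1 / 2 ^ m) 1 \<omega>) \<le> 1 - indicator ?A \<omega>" if "\<omega> \<in> space M" for \<omega>
        using that by (simp add: g_def indicator_def)
    qed
    also have "\<dots> = 1 - measure M ?A" using i1 by (simp add: prob_space)
    also have "\<dots> \<le> 1 - q k" using that by simp
    also have "\<dots> \<le> exp (- q k)" using exp_ge_add_one_self[of "- q k"] by simp
    finally show ?thesis .
  qed
  have I: "(\<integral>\<^sup>+\<omega>. F K N \<omega> \<partial>M) \<le> ennreal (exp (- (\<Sum>i<N. q (K + i))))" for K N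
  proof -
    have "(\<integral>\<^sup>+\<omega>. F K N \<omega> \<partial>M) \<le> liminf (\<lambda>m. \<integral>\<^sup>+\<omega>. ennreal (\<Prod>i<N. g (K + i) (gam (Y (K + i)) (1 / 2 ^ m) 1 \<omega>)) \<partial>M)"
      unfolding F_def by (rule nn_integral_liminf) measurable
    also have "\<dots> \<le> liminf (\<lambda>m::nat. ennreal (exp (- (\<Sum>i<N. q (K + i)))))"
    proof (rule Liminf_mono)
      have "\<forall>\<^sub>F m in sequentially. \<forall>i\<in>{..<N}. q (K + i) \<le> measure M {\<omega>\<in>space M. gam (Y (K + i)) (1 / 2 ^ m) 1 \<omega> \<le> c (K + i)}"
        unfolding Y_def using p by (intro eventually_ball_finite) simp_all
      then show "\<forall>\<^sub>F m in sequentially. (\<integral>\<^sup>+\<omega>. ennreal (\<Prod>i<N. g (K + i) (gam (Y (K + i)) (1 / 2 ^ m) 1 \<omega>)) \<partial>M)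
        \<le> ennreal (exp (- (\<Sum>i<N. q (K + i))))"
      proof eventually_elim
        case (elim m)
        have pb: "0 \<le> (\<Prod>i<N. g (K + i) (gam (Y (K + i)) (1 / 2 ^ m) 1 \<omega>))" "(\<Prod>i<N. g (K + i) (gam (Y (K + i)) (1 / 2 ^ m) 1 \<omega>)) \<le> 1" for \<omega>
          by (simp_all add: prod_nonneg prod_le_1 g)
        have "(\<integral>\<^sup>+\<omega>. ennreal (\<Prod>i<N. g (K + i) (gam (Y (K + i)) (1 / 2 ^ m) 1 \<omega>)) \<partial>M)
          = ennreal (\<integral>\<omega>. (\<Prod>i<N. g (K + i) (gam (Y (K + i)) (1 / 2 ^ m) 1 \<omega>)) \<partial>M)"
          by (intro nn_integral_eq_integral integrable_const_bound[where B = 1]) (use pb in simp_all)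
        also have "(\<integral>\<omega>. (\<Prod>i<N. g (K + i) (gam (Y (K + i)) (1 / 2 ^ m) 1 \<omega>)) \<partial>M)
          = (\<Prod>i<N. \<integral>\<omega>. g (K + i) (gam (Y (K + i)) (1 / 2 ^ m) 1 \<omega>) \<partial>M)"
          unfolding Y_def by (rule gam_resc_product[OF X, of _ N "\<lambda>i. h (K + i)" "\<lambda>i. a (K + i)"]) (use h a gc in simp_all)
        also have "\<dots> \<le> (\<Prod>i<N. exp (- q (K + i)))"
          using elim by (intro prod_mono conjI integral_nonneg_AE AE_I2 g E1) simp_all
        also have "\<dots> = exp (- (\<Sum>i<N. q (K + i)))" by (simp add: exp_sum[symmetric] sum_negf)
        finally show ?case by (simp add: ennreal_leI)
      qed
    qed
    finally show ?thesis by (simp add: Liminf_const)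
  qed
  \<comment> \<open>The integral of this infimum vanishes because the partial sums of
    \<open>q\<close> diverge, whereas a path whose limits stay above \<open>c k + 1\<close> from
    block \<open>K\<close> on gives it the value one.\<close>
  define G where "G K \<omega> = (INF N. F K N \<omega>)" for K \<omega>
  have [measurable]: "G K \<in> borel_measurable M" for K unfolding G_def by measurable
  have "AE \<omega> in M. G K \<omega> = 0" for K
  proof -
    have "(\<integral>\<^sup>+\<omega>. G K \<omega> \<partial>M) \<le> 0"
    proof (rule ennreal_le_epsilon)
      fix e :: real assume e: "0 < e"
      obtain N where "- ln e < (\<Sum>i<N. q (K + i))" using sum_unbounded_of_not_summable[OF q] by blast
      then have "- (\<Sum>i<N. q (K + i)) < ln e" by simp
      then have "exp (- (\<Sum>i<N. q (K + i))) \<le> exp (ln e)" by (simp del: exp_ln)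
      then have N: "exp (- (\<Sum>i<N. q (K + i))) \<le> e" using e by simp
      have "(\<integral>\<^sup>+\<omega>. G K \<omega> \<partial>M) \<le> (\<integral>\<^sup>+\<omega>. F K N \<omega> \<partial>M)"
        unfolding G_def by (intro nn_integral_mono INF_lower) simp
      also note I
      also have "ennreal (exp (- (\<Sum>i<N. q (K + i)))) \<le> 0 + ennreal e" using N by (simp add: ennreal_leI)
      finally show "(\<integral>\<^sup>+\<omega>. G K \<omega> \<partial>M) \<le> 0 + ennreal e" .
    qed
    then show ?thesis by (subst (asm) le_zero_eq, subst (asm) nn_integral_0_iff_AE) simp_all
  qed
  then have "AE \<omega> in M. \<forall>K. G K \<omega> = 0" by (simp add: AE_all_countable)
  moreover have "AE \<omega> in M. \<forall>k. \<forall>t\<ge>0. conv (Y k) t \<omega>" unfolding AE_all_countable by (intro allI AE_conv bY)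
  ultimately show ?thesis
  proof eventually_elim
    case (elim \<omega>)
    show ?case
    proof (rule ccontr)
      assume "\<not> ?case"
      then have "\<forall>\<^sub>F k in sequentially. c k + 1 < isl (Y k) 1 \<omega>" by (simp add: not_frequently not_le Y_def)
      then obtain K where K: "\<And>k. K \<le> k \<Longrightarrow> c k + 1 < isl (Y k) 1 \<omega>" unfolding eventually_sequentially by blast
      have "F K N \<omega> = 1" for N
      proof -
        have "\<forall>\<^sub>F m in sequentially. \<forall>i\<in>{..<N}. c (K + i) + 1 < gam (Y (K + i)) (1 / 2 ^ m) 1 \<omega>"
        proof (rule eventually_ball_finite)
          show "\<forall>i\<in>{..<N}. \<forall>\<^sub>F m in sequentially. c (K + i) + 1 < gam (Y (K + i)) (1 / 2 ^ m) 1 \<omega>"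
            using elim(2) by (auto intro!: order_tendstoD(1)[OF conv_half_powers] K)
        qed simp
        then have "\<forall>\<^sub>F m in sequentially. ennreal (\<Prod>i<N. g (K + i) (gam (Y (K + i)) (1 / 2 ^ m) 1 \<omega>)) = 1"
        proof eventually_elim
          case (elim m)
          have "(\<Prod>i<N. g (K + i) (gam (Y (K + i)) (1 / 2 ^ m) 1 \<omega>)) = (\<Prod>i<N. 1)"
          proof (rule prod.cong[OF refl])
            fix i assume "i \<in> {..<N}"
            then have "c (K + i) + 1 < gam (Y (K + i)) (1 / 2 ^ m) 1 \<omega>" using elim by blast
            then show "g (K + i) (gam (Y (K + i)) (1 / 2 ^ m) 1 \<omega>) = 1" unfolding g_def by linarith
          qed
          then show ?case by simp
        qed
        then have "F K N \<omega> = liminf (\<lambda>m::nat. 1)" unfolding F_def by (rule Liminf_eq)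
        then show ?thesis by (simp add: Liminf_const)
      qed
      then have "G K \<omega> = 1" by (simp add: G_def)
      then show False using elim(1) by simp
    qed
  qed
qed

text \<open>In this direction the interaction itself must be bounded from above. Its mean is bounded
  uniformly in \<open>\<epsilon>\<close>; Fatou's lemma along dyadic scales and Markov's inequality
  turn this into one event for the limit. The subtracted mean is nonnegative and is simply
  dropped.\<close>

lemma isl_le_block:
  assumes X: "bm M X" and a: "0 < a" "a \<le> h" and l: "0 < l"
  obtains A where "A \<in> sets M" "emeasure M A \<le> ennreal (a * (1 + ln ((a + h) / a)) / (2 * pi) / l)"
    "\<And>\<omega>. \<omega> \<in> space M \<Longrightarrow> conv X a \<omega> \<Longrightarrow> conv X (a + h) \<omega> \<Longrightarrow> conv (resc X a h) 1 \<omega> \<Longrightarrow> \<omega> \<notin> A \<Longrightarrow>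
      isl X (a + h) \<omega> \<le> isl X a \<omega> + h * isl (resc X a h) 1 \<omega> + l"
proof -
  interpret prob_space M by (rule bm_prob_space[OF X])
  define v where "v = a * (1 + ln ((a + h) / a)) / (2 * pi)"
  have h: "0 < h" using a by simp
  have v0: "0 \<le> v" using a h by (simp add: v_def)
  define r where "r \<epsilon> \<omega> = rect (phe \<epsilon>) a (a + h) (\<lambda>s. X s \<omega>)" for \<epsilon> \<omega>
  have r0: "0 \<le> r \<epsilon> \<omega>" for \<epsilon> \<omega> unfolding r_def by (rule rect_phe_nonneg)
  have ir: "integrable M (r \<epsilon>)" "(\<integral>\<omega>. r \<epsilon> \<omega> \<partial>M) = cross \<epsilon> a h" if "0 < \<epsilon>" for \<epsilon>
    unfolding r_def using mean_rect[OF X less_imp_le[OF a(1)] h that] by simp_all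
  have cv: "cross \<epsilon> a h \<le> v" if "0 < \<epsilon>" for \<epsilon>
    unfolding v_def by (rule cross_le[OF that a(1) h]) (use a in simp)
  have c0: "0 \<le> cross \<epsilon> a h" if "0 < \<epsilon>" for \<epsilon>
    unfolding ir(2)[OF that, symmetric] by (intro integral_nonneg_AE AE_I2 r0)
  define L where "L \<omega> = liminf (\<lambda>m. ennreal (r (1 / 2 ^ m) \<omega>))" for \<omega>
  have [measurable]: "r (1 / 2 ^ m) \<in> borel_measurable M" for m :: nat using ir(1)[of "1 / 2 ^ m"] by simp
  have L: "L \<in> borel_measurable M" unfolding L_def by measurable
  have "(\<integral>\<^sup>+\<omega>. L \<omega> \<partial>M) \<le> liminf (\<lambda>m. \<integral>\<^sup>+\<omega>. ennreal (r (1 / 2 ^ m) \<omega>) \<partial>M)"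
    unfolding L_def by (rule nn_integral_liminf) measurable
  also have "\<dots> = liminf (\<lambda>m. ennreal (cross (1 / 2 ^ m) a h))"
    using ir r0 by (simp add: nn_integral_eq_integral)
  also have "\<dots> \<le> liminf (\<lambda>m::nat. ennreal v)"
    by (intro Liminf_mono always_eventually allI ennreal_leI cv) simp
  finally have LI: "(\<integral>\<^sup>+\<omega>. L \<omega> \<partial>M) \<le> ennreal v" by (simp add: Liminf_const)
  show ?thesis
  proof (rule that[OF nn_integral_Markov_set[OF L LI v0 l, unfolded v_def]])
    fix \<omega> assume w: "\<omega> \<in> space M" and c: "conv X a \<omega>" "conv X (a + h) \<omega>" "conv (resc X a h) 1 \<omega>"
      and "\<omega> \<notin> {\<omega>\<in>space M. ennreal l \<le> L \<omega>}"
    then have nl: "\<not> ennreal l \<le> L \<omega>" by simp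
    show "isl X (a + h) \<omega> \<le> isl X a \<omega> + h * isl (resc X a h) 1 \<omega> + l"
    proof (rule ccontr)
      assume "\<not> ?thesis"
      then have "l < isl X (a + h * 1) \<omega> - isl X a \<omega> - h * isl (resc X a h) 1 \<omega>" by simp
      moreover have "((\<lambda>m. r (1 / 2 ^ m) \<omega> - cross (1 / 2 ^ m) a h) \<longlongrightarrow>
          isl X (a + h * 1) \<omega> - isl X a \<omega> - h * isl (resc X a h) 1 \<omega>) sequentially"
        using filterlim_compose[OF conv_block[OF X w less_imp_le[OF a(1)] h zero_le_one] filterlim_half_powers] c
        by (simp add: r_def)
      ultimately have "\<forall>\<^sub>F m in sequentially. l < r (1 / 2 ^ m) \<omega> - cross (1 / 2 ^ m) a h"
        by (intro order_tendstoD(1))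
      then have "\<forall>\<^sub>F m in sequentially. ennreal l \<le> ennreal (r (1 / 2 ^ m) \<omega>)"
      proof eventually_elim
        case (elim m)
        have "0 \<le> cross (1 / 2 ^ m) a h" by (rule c0) simp
        then show ?case using elim by (intro ennreal_leI) simp
      qed
      then have "ennreal l \<le> L \<omega>" unfolding L_def by (rule Liminf_bounded)
      then show False using nl by contradiction
    qed
  qed
qed

lemma lconst_ge: "10 \<le> lconst"
proof -
  have "(32::real)\<^sup>2 \<le> (32 + 2 * vconst)\<^sup>2" using vconst_pos by (intro power_mono) simp_all
  then have "0 \<le> ln (2 * (32 + 2 * vconst)\<^sup>2)" by simp
  then show ?thesis by (simp only: lconst_def)
qed

text \<open>By \<open>tdef_limit\<close> the hypothesis of \<open>gam_lower_at\<close> holds at all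
  sufficiently fine dyadic scales, with one unit of slack; a further unit is lost in
  \<open>AE_frequently_low\<close>.\<close>

lemma AE_resc_frequently_low:
  assumes X: "bm M X" and h: "\<And>k. 0 < h k" and a: "\<And>k. 0 \<le> a k" "\<And>k. a (Suc k) = a k + h k"
    and n: "\<And>k. 0 < n k" "\<not> summable (\<lambda>k. exp (- (lconst * real (n k))))"
  shows "AE \<omega> in M. \<exists>\<^sub>F k in sequentially. isl (resc X (a k) (h k)) 1 \<omega> \<le> - ln (real (n k)) / (2 * pi) + 4"
proof -
  have "AE \<omega> in M. \<exists>\<^sub>F k in sequentially. isl (resc X (a k) (h k)) 1 \<omega> \<le> (- ln (real (n k)) / (2 * pi) + 3) + 1"
  proof (rule AE_frequently_low[where h = h and a = a and q = "\<lambda>k. exp (- (lconst * real (n k)))", OF X h a _ n(2)])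
    fix k
    have pos: "0 < (1 / 2 ^ m :: real)" for m :: nat by simp
    have z: "(\<lambda>m. 1 / 2 ^ m :: real) \<longlonglongrightarrow> 0"
      using filterlim_half_powers by (simp add: filterlim_at)
    obtain L where L: "(\<lambda>m. tdef (sqrt (real (n k))) (1 / 2 ^ m)) \<longlonglongrightarrow> L" "L \<le> - ln (real (n k)) / (2 * pi) + 1"
      using tdef_limit[OF n(1) pos z] by blast
    have "\<forall>\<^sub>F m in sequentially. tdef (sqrt (real (n k))) (1 / 2 ^ m) < - ln (real (n k)) / (2 * pi) + 2"
      by (rule order_tendstoD(2)[OF L(1)]) (use L(2) in simp)
    then show "\<forall>\<^sub>F m in sequentially. exp (- (lconst * real (n k)))
        \<le> measure M {\<omega>\<in>space M. gam (resc X (a k) (h k)) (1 / 2 ^ m) 1 \<omega> \<le> - ln (real (n k)) / (2 * pi) + 3}"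
      by eventually_elim (intro gam_lower_at bm_resc[OF X a(1) h] n(1) pos less_imp_le)
  qed simp
  then show ?thesis by (simp add: add.assoc)
qed

text \<open>The times \<open>exp (k\<^sup>2)\<close> grow so fast that the path before a block and its interaction with the block contribute
  only \<open>O(t)\<close>.\<close>

lemma isl_upper:
  assumes X: "bm M X"
  shows "AE \<omega> in M. \<exists>\<^sub>F k in sequentially. isl X (exp ((real (Suc k))\<^sup>2)) \<omega>
    \<le> - (exp ((real (Suc k))\<^sup>2) * (ln (ln (ln (exp ((real (Suc k))\<^sup>2)))) / (2 * pi) - (ln (4 * lconst) / (2 * pi) + 7)))"
proof -
  interpret prob_space M by (rule bm_prob_space[OF X])
  define a where "a k = exp ((real k)\<^sup>2)" for k
  define h where "h k = a (Suc k) - a k" for k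
  \<comment> \<open>About \<open>ln k / lconst\<close> blocks: the lower bound
    \<open>exp (- (lconst * n k))\<close> is then eventually at least \<open>1 / Suc k\<close>, so
    its sum diverges.\<close>
  define n where "n k = max 1 (nat \<lfloor>ln (real (Suc k)) / lconst\<rfloor>)" for k
  have a0: "0 < a k" for k by (simp add: a_def)
  have ratio: "a (Suc k) = a k * exp (2 * real k + 1)" for k
    unfolding a_def exp_add[symmetric] by (simp add: power2_eq_square algebra_simps)
  have e1: "(2::real) \<le> exp (2 * real k + 1)" for k
    using exp_ge_add_one_self[of "2 * real k + 1"] by linarith
  have ah: "a k \<le> h k" for k
    using mult_left_mono[OF e1[of k] less_imp_le[OF a0[of k]]] unfolding h_def ratio by simp
  have h0: "0 < h k" for k using ah[of k] a0[of k] by linarith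
  have aS: "a (Suc k) = a k + h k" for k by (simp add: h_def)
  have n0: "0 < n k" for k by (simp add: n_def)
  have l0: "0 < lconst" using lconst_ge by simp
  have ev_ln: "\<forall>\<^sub>F k in sequentially. x \<le> ln (real (Suc k))" for x
  proof -
    have "filterlim (\<lambda>k. ln (real (Suc k))) at_top sequentially" by real_asymp
    then show ?thesis unfolding filterlim_at_top by blast
  qed
  have ns: "\<not> summable (\<lambda>k. exp (- (lconst * real (n k))))"
  proof
    assume s: "summable (\<lambda>k. exp (- (lconst * real (n k))))"
    have "\<forall>\<^sub>F k in sequentially. norm (real (Suc k) powr - 1) \<le> exp (- (lconst * real (n k)))"
      using ev_ln[of lconst]
    proof eventually_elim
      case (elim k)
      have "1 \<le> ln (real (Suc k)) / lconst" using elim l0 by simp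
      then have "real (n k) \<le> ln (real (Suc k)) / lconst" unfolding n_def by linarith
      then have "lconst * real (n k) \<le> ln (real (Suc k))" using l0 by (simp add: field_simps)
      then have "exp (- ln (real (Suc k))) \<le> exp (- (lconst * real (n k)))" by (simp only: exp_le_cancel_iff neg_le_iff_le)
      then show ?case by (simp add: powr_def)
    qed
    from summable_comparison_test_ev[OF this s] have "summable (\<lambda>k. real (Suc k) powr - 1)" .
    then have "summable (\<lambda>k. real k powr - 1)" by (subst (asm) summable_Suc_iff)
    then show False unfolding summable_real_powr_iff by simp
  qed
  have AE_low: "AE \<omega> in M. \<exists>\<^sub>F k in sequentially. isl (resc X (a k) (h k)) 1 \<omega> \<le> - ln (real (n k)) / (2 * pi) + 4"
    by (rule AE_resc_frequently_low[where h = h and a = a and n = n, OF X h0 less_imp_le[OF a0] aS n0 ns])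
  have geo: "summable (\<lambda>k. c * exp (- real k))" for c
  proof -
    have "exp (- real k) = exp (- 1) ^ k" for k by (simp add: exp_of_nat_mult[symmetric])
    then show ?thesis by (simp add: summable_geometric summable_mult)
  qed
  have "\<exists>A. A \<in> sets M \<and> emeasure M A \<le> ennreal (1 * exp (- real k)) \<and>
    (\<forall>\<omega>\<in>space M. (\<forall>t\<ge>0. conv X t \<omega>) \<longrightarrow> conv (resc X (a k) (h k)) 1 \<omega> \<longrightarrow> \<omega> \<notin> A \<longrightarrow>
      isl X (a (Suc k)) \<omega> \<le> isl X (a k) \<omega> + h k * isl (resc X (a k) (h k)) 1 \<omega> + a (Suc k))" for k
  proof -
    define v where "v = a k * (1 + ln ((a k + h k) / a k)) / (2 * pi) / a (Suc k)"
    obtain A where A: "A \<in> sets M" "emeasure M A \<le> ennreal v"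
      "\<And>\<omega>. \<omega> \<in> space M \<Longrightarrow> conv X (a k) \<omega> \<Longrightarrow> conv X (a k + h k) \<omega> \<Longrightarrow> conv (resc X (a k) (h k)) 1 \<omega> \<Longrightarrow> \<omega> \<notin> A \<Longrightarrow>
        isl X (a k + h k) \<omega> \<le> isl X (a k) \<omega> + h k * isl (resc X (a k) (h k)) 1 \<omega> + a (Suc k)"
      using isl_le_block[OF X a0[of k] ah[of k] a0[of "Suc k"]] unfolding v_def by metis
    have "(a k + h k) / a k = exp (2 * real k + 1)" unfolding aS[symmetric] ratio using a0[of k] by simp
    \<comment> \<open>Relative to \<open>a (Suc k)\<close> the mean interaction is
      \<open>(k + 1) / pi * exp (- (2 * k + 1))\<close>, which is summable.\<close>
    then have "v = (a k * (2 * real k + 2)) / (2 * pi) / (a k * exp (2 * real k + 1))" unfolding v_def ratio by simp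
    also have "\<dots> = (real k + 1) / pi * exp (- (2 * real k + 1))"
      using a0[of k] by (simp only: exp_minus) (simp add: field_simps)
    also have "\<dots> \<le> exp (real k) * exp (- (2 * real k + 1))"
    proof (rule mult_right_mono)
      have "(real k + 1) / pi \<le> (real k + 1) / 1" using pi_gt3 by (intro divide_left_mono) simp_all
      also have "\<dots> \<le> exp (real k)" unfolding div_by_1 using exp_ge_add_one_self[of "real k"] by linarith
      finally show "(real k + 1) / pi \<le> exp (real k)" .
    qed simp
    also have "\<dots> \<le> exp (- real k)" unfolding exp_add[symmetric] by simp
    finally have v: "v \<le> 1 * exp (- real k)" by simp
    have m: "emeasure M A \<le> ennreal (1 * exp (- real k))" by (rule order_trans[OF A(2) ennreal_leI[OF v]])
    show ?thesis
    proof (intro exI[of _ A] conjI A(1) m ballI impI)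
      fix \<omega> assume *: "\<omega> \<in> space M" "\<forall>t\<ge>0. conv X t \<omega>" "conv (resc X (a k) (h k)) 1 \<omega>" "\<omega> \<notin> A"
      show "isl X (a (Suc k)) \<omega> \<le> isl X (a k) \<omega> + h k * isl (resc X (a k) (h k)) 1 \<omega> + a (Suc k)"
        using A(3)[OF *(1) _ _ *(3,4)] *(2) a0[of k] h0[of k] aS[of k] by simp
    qed
  qed
  then obtain A where A: "\<And>k. A k \<in> sets M" "\<And>k. emeasure M (A k) \<le> ennreal (1 * exp (- real k))"
    "\<And>k \<omega>. \<omega> \<in> space M \<Longrightarrow> \<forall>t\<ge>0. conv X t \<omega> \<Longrightarrow> conv (resc X (a k) (h k)) 1 \<omega> \<Longrightarrow> \<omega> \<notin> A k \<Longrightarrow>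
      isl X (a (Suc k)) \<omega> \<le> isl X (a k) \<omega> + h k * isl (resc X (a k) (h k)) 1 \<omega> + a (Suc k)" by metis
  \<comment> \<open>Since \<open>a k * exp (2 * real k + 1) = a (Suc k)\<close>, this threshold lets
    the whole past contribute at most \<open>a (Suc k)\<close>.\<close>
  have "\<exists>B. B \<in> sets M \<and> emeasure M B \<le> ennreal (vconst * exp (- real k)) \<and>
    (\<forall>\<omega>\<in>space M. \<omega> \<notin> B \<longrightarrow> \<bar>isl (resc X 0 (a k)) 1 \<omega>\<bar> \<le> exp (2 * real k + 1))" for k
  proof -
    obtain B where B: "B \<in> sets M" "emeasure M B \<le> ennreal (vconst / (exp (2 * real k + 1))\<^sup>2)"
      "\<And>\<omega> t. \<omega> \<in> space M \<Longrightarrow> \<omega> \<notin> B \<Longrightarrow> 0 \<le> t \<Longrightarrow> t \<le> 1 \<Longrightarrow> \<bar>isl (resc X 0 (a k)) t \<omega>\<bar> \<le> exp (2 * real k + 1)"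
      using isl_second_moment_tail[OF bm_resc[OF X order_refl a0[of k]] exp_gt_zero[of "2 * real k + 1"]] by metis
    have "vconst / (exp (2 * real k + 1))\<^sup>2 = vconst * exp (- (2 * (2 * real k + 1)))"
      by (simp only: exp_minus exp_double divide_inverse)
    also have "\<dots> \<le> vconst * exp (- real k)" using vconst_pos by (intro mult_left_mono) simp_all
    finally show ?thesis using B by (intro exI[of _ B]) (auto intro: order_trans ennreal_leI)
  qed
  then obtain B where B: "\<And>k. B k \<in> sets M" "\<And>k. emeasure M (B k) \<le> ennreal (vconst * exp (- real k))"
    "\<And>k \<omega>. \<omega> \<in> space M \<Longrightarrow> \<omega> \<notin> B k \<Longrightarrow> \<bar>isl (resc X 0 (a k)) 1 \<omega>\<bar> \<le> exp (2 * real k + 1)" by metis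
  have AE_A: "AE \<omega> in M. \<forall>\<^sub>F k in sequentially. \<omega> \<notin> A k" by (rule borel_cantelli_bound[OF A(1,2) _ geo]) simp
  have AE_B: "AE \<omega> in M. \<forall>\<^sub>F k in sequentially. \<omega> \<notin> B k" by (rule borel_cantelli_bound[OF B(1,2) _ geo]) (use vconst_pos in simp)
  have AEc: "AE \<omega> in M. \<forall>k. (\<forall>t\<ge>0. conv (resc X 0 (a k)) t \<omega>) \<and> (\<forall>t\<ge>0. conv (resc X (a k) (h k)) t \<omega>)"
    unfolding AE_all_countable AE_conj_iff by (intro allI conjI AE_conv bm_resc[OF X] a0 h0 order_refl less_imp_le[OF a0])
  have size: "\<forall>\<^sub>F k in sequentially. ln (ln (ln (a (Suc k)))) - ln (4 * lconst) \<le> ln (real (n k)) \<and> ln (real (n k)) \<le> exp (2 * real k + 1)"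
    using ev_ln[of "2 * lconst"]
  proof eventually_elim
    case (elim k)
    have lp: "0 < ln (real (Suc k))" using elim l0 by linarith
    \<comment> \<open>Rounding down in \<open>n k\<close> costs at most a factor \<open>2\<close>,
      and \<open>ln (ln (a (Suc k))) = 2 * ln (Suc k)\<close> costs another; together they give the
      constant \<open>4 * lconst\<close>.\<close>
    have "ln (real (Suc k)) / (2 * lconst) \<le> ln (real (Suc k)) / lconst - 1"
      using elim l0 by (simp add: field_simps)
    also have "\<dots> \<le> real (n k)" unfolding n_def by linarith
    finally have "ln (ln (real (Suc k)) / (2 * lconst)) \<le> ln (real (n k))" using lp l0 n0[of k] by (subst ln_le_cancel_iff) simp_all
    moreover have "ln (ln (real (Suc k)) / (2 * lconst)) = ln (ln (real (Suc k))) - ln (2 * lconst)"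
      using lp l0 by (simp only: ln_divide_pos)
    moreover have "ln (ln (ln (a (Suc k)))) = ln 2 + ln (ln (real (Suc k)))"
    proof -
      have "ln (ln (a (Suc k))) = 2 * ln (real (Suc k))" unfolding a_def by (simp add: ln_realpow)
      then show ?thesis using lp by (simp only:) (rule ln_mult_pos, simp_all)
    qed
    moreover have "ln (4 * lconst) = ln 2 + ln (2 * lconst)" using ln_mult_pos[of 2 "2 * lconst"] l0 by simp
    moreover have "ln (real (n k)) \<le> exp (2 * real k + 1)"
    proof -
      have "ln (real (Suc k)) / lconst \<le> ln (real (Suc k)) / 1" using lconst_ge lp by (intro divide_left_mono) simp_all
      also have "\<dots> \<le> real (Suc k)" using ln_le_minus_one[of "real (Suc k)"] by simp
      finally have "real (n k) \<le> real (Suc k)" unfolding n_def by linarith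
      moreover have "ln (real (n k)) \<le> real (n k)" using ln_le_minus_one[of "real (n k)"] n0[of k] by simp
      ultimately show ?thesis using exp_ge_add_one_self[of "2 * real k + 1"] by simp
    qed
    ultimately show ?case by linarith
  qed
  show ?thesis
    using AE_low AE_A AE_B AE_conv[OF X] AEc AE_space
  proof eventually_elim
    case (elim \<omega>)
    note w = elim(6) and cX = elim(4) and cR = elim(5)
    show ?case
    proof (rule frequently_rev_mp[OF elim(1)])
      show "\<forall>\<^sub>F k in sequentially. isl (resc X (a k) (h k)) 1 \<omega> \<le> - ln (real (n k)) / (2 * pi) + 4 \<longrightarrow>
        isl X (exp ((real (Suc k))\<^sup>2)) \<omega> \<le> - (exp ((real (Suc k))\<^sup>2) * (ln (ln (ln (exp ((real (Suc k))\<^sup>2)))) / (2 * pi) - (ln (4 * lconst) / (2 * pi) + 7)))"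
        unfolding a_def[symmetric] using elim(2,3) size
      proof eventually_elim
        case (elim k)
        show ?case
        proof
          assume low: "isl (resc X (a k) (h k)) 1 \<omega> \<le> - ln (real (n k)) / (2 * pi) + 4"
          define b where "b = a (Suc k)"
          define l where "l = ln (real (n k)) / (2 * pi)"
          have b0: "0 < b" unfolding b_def by (rule a0)
          have n1: "0 \<le> ln (real (n k))" using n0[of k] by simp
          have l1: "0 \<le> l" "l \<le> exp (2 * real k + 1)"
          proof -
            show "0 \<le> l" using n1 by (simp add: l_def)
            have "l \<le> ln (real (n k)) / 1" unfolding l_def using n1 pi_gt3 by (intro divide_left_mono) simp_all
            then show "l \<le> exp (2 * real k + 1)" using elim(3) by simp
          qed
          have 1: "isl X b \<omega> \<le> isl X (a k) \<omega> + h k * isl (resc X (a k) (h k)) 1 \<omega> + b"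
            unfolding b_def using w cX elim(1) cR by (intro A(3)) simp_all
          have "isl X (a k) \<omega> = a k * isl (resc X 0 (a k)) 1 \<omega>"
            using conv_rescale[OF X w a0[of k], of 1] cR by simp
          also have "\<dots> \<le> a k * exp (2 * real k + 1)"
            using B(3)[OF w elim(2)] a0[of k] by (intro mult_left_mono) simp_all
          finally have 2: "isl X (a k) \<omega> \<le> b" by (simp add: b_def ratio)
          have "h k * isl (resc X (a k) (h k)) 1 \<omega> \<le> h k * (- l + 4)"
            using low h0[of k] by (intro mult_left_mono) (simp_all add: l_def)
          also have "\<dots> = - (b * l) + a k * l + h k * 4" unfolding h_def b_def by (simp add: algebra_simps)
          also have "a k * l \<le> a k * exp (2 * real k + 1)" using l1 a0[of k] by (intro mult_left_mono) simp_all
          also have "\<dots> = b" by (simp add: b_def ratio)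
          also have "h k * 4 \<le> b * 4" using a0[of k] by (simp add: h_def b_def)
          finally have 3: "h k * isl (resc X (a k) (h k)) 1 \<omega> \<le> - (b * l) + b + b * 4" by simp
          have "(ln (ln (ln b)) - ln (4 * lconst)) / (2 * pi) \<le> l"
            unfolding l_def b_def using elim(3) by (intro divide_right_mono) simp_all
          then have "b * (ln (ln (ln b)) / (2 * pi) - ln (4 * lconst) / (2 * pi)) \<le> b * l"
            using b0 by (intro mult_left_mono) (simp_all add: diff_divide_distrib)
          \<comment> \<open>The \<open>7\<close> counts one \<open>b\<close> for the interaction,
            one for the past, one for \<open>a k * l \<le> b\<close>, and four from the constant in
            the block estimate.\<close>
          then have "b * (ln (ln (ln b)) / (2 * pi) - (ln (4 * lconst) / (2 * pi) + 7)) \<le> b * l - 7 * b"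
            by (simp add: algebra_simps)
          then show "isl X (a (Suc k)) \<omega> \<le> - (a (Suc k) * (ln (ln (ln (a (Suc k)))) / (2 * pi) - (ln (4 * lconst) / (2 * pi) + 7)))"
            unfolding b_def[symmetric] using 1 2 3 by linarith
        qed
      qed
    qed
  qed
qed

end

theorem theorem1p5:
  fixes M :: "'a measure" and X :: "real \<Rightarrow> 'a \<Rightarrow> real \<times> real" and \<phi> :: "real \<times> real \<Rightarrow> real"
  assumes "planar_BM M X"
    and "schwartz_R2 \<phi>" and "\<forall>x. \<phi> x \<ge> 0" and "integral\<^sup>L lborel \<phi> = 1"
  shows "AE \<omega> in M. Liminf at_top
           (\<lambda>t. ereal (beta M X \<phi> t \<omega> / (t * ln (ln (ln t))))) = ereal (- 1 / (2 * pi))"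
proof -
  interpret mollifier \<phi> M by unfold_locales (rule assms(2) assms(3)[rule_format] assms(4))+
  let ?Y = "\<lambda>t \<omega>. if t < 0 then 0 else X t \<omega>"
  note Y = planar_BM_extend[OF assms(1)]
  show ?thesis using isl_lower[OF Y] isl_upper[OF Y] AE_space
  proof eventually_elim
    case (elim \<omega>)
    have b: "beta M X \<phi> t \<omega> = isl ?Y t \<omega>" if "0 \<le> t" for t
      by (rule beta_eq_isl[OF assms(1) elim(3) that])
    have T: "filterlim (\<lambda>k. exp ((real (Suc k))\<^sup>2)) at_top sequentially" by real_asymp
    have "Liminf at_top (\<lambda>t. ereal (beta M X \<phi> t \<omega> / (t * ln (ln (ln t)))))
        = Liminf at_top (\<lambda>t. ereal (isl ?Y t \<omega> / (t * ln (ln (ln t)))))"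
    proof (rule Liminf_eq)
      show "\<forall>\<^sub>F t in at_top. ereal (beta M X \<phi> t \<omega> / (t * ln (ln (ln t)))) = ereal (isl ?Y t \<omega> / (t * ln (ln (ln t))))"
        using eventually_ge_at_top[of 0] by eventually_elim (simp only: b)
    qed
    also have "\<dots> = ereal (- 1 / (2 * pi))"
      by (rule Liminf_eq_lnlnln[OF elim(1,2) T])
    finally show ?case .
  qed
qed

end
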